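(* Let $\xi_0\in\mathbf Z^d$, $\varrho\in L^2(\mathbf T^d)$ and $\alpha_h=1/h$. Then there exist sequences $(u_h)$ and $(v_h)$ in $L^2(\mathbf T^d)$ (indexed by a sequence of values $h\to0^+$) whose semiclassical measure is, for both, $$\mu_0(x,\xi)=|\varrho(x)|^2dx\,\delta_{\xi_0}(\xi),$$ i.e. $\lim_{h\to0^+}(\mathrm{op}_h(a)u_h|u_h)=\lim_{h\to0^+}(\mathrm{op}_h(a)v_h|v_h)=\int_{\mathbf T^d}a(x,\xi_0)|\varrho(x)|^2dx$ for every $a\in C_c^\infty(T^*\mathbf T^d)$, but such that, for every $\varphi\in L^1(\mathbf R)$ and every $a\in C_c^\infty(T^*\mathbf T^d)$, $$\lim_{h\to0^+}\int_{\mathbf R}\varphi(t)(\mathrm{op}_h(a)e^{it\Delta/2}u_h|e^{it\Delta/2}u_h)\,dt=\int_{\mathbf R}\varphi(t)\int_{T^*\mathbf T^d}a(x,\xi)\,\mu_{(u_h)}(t,dx,d\xi)\,dt,$$ $$\lim_{h\to0^+}\int_{\mathbf R}\varphi(t)(\mathrm{op}_h(a)e^{it\Delta/2}v_h|e^{it\Delta/2}v_h)\,dt=\int_{\mathbf R}\varphi(t)\int_{T^*\mathbf T^d}a(x,\xi)\,\mu_{(v_h)}(t,dx,d\xi)\,dt,$$ where $$\mu_{(u_h)}(t,x,\xi)=\left\langle|e^{it\Delta/2}\varrho|^2\right\rangle(x)\,dx\,\delta_{\xi_0}(\xi),$$ $$\mu_{(v_h)}(t,x,\xi)=\frac{1}{(2\pi)^d}\left(\int_{\mathbf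 T^d}|\varrho(y)|^2dy\right)dx\,\delta_{\xi_0}(\xi).$$
   Context: $\mathbf T^d=\mathbf R^d/(2\pi\mathbf Z)^d$ is the flat torus, $T^*\mathbf T^d$ is identified with $\mathbf T^d\times\mathbf R^d$, $\Delta$ is the Laplacian on $\mathbf T^d$, and $(\cdot|\cdot)$ is the inner product of $L^2(\mathbf T^d)$. The general time-scaled propagator $e^{i\alpha_hht\Delta/2}$ equals $e^{it\Delta/2}$ for $\alpha_h=1/h$. $\langle\cdot\rangle$ denotes the average along the geodesic flow $\phi_s(x,\xi)=(x+s\xi,\xi)$; for a function $f$ of $x$ alone, evaluated at $\xi=\xi_0$, it is $$\langle f\rangle(x)=\lim_{T\to\infty}\frac1T\int_0^Tf(x+s\xi_0)\,ds.$$ Quantization. For $a\in C_c^\infty(\mathbf R^d\times\mathbf R^d)$ and $h>0$, the Weyl quantization is $$\mathrm{op}_h(a)u(x)=\int_{\mathbf R^d}\int_{\mathbf R^d}a\left(\tfrac{x+y}{2},h\xi\right)u(y)e^{i(x-y)\cdot\xi}\,dy\,\frac{d\xi}{(2\pi)^d}.$$ On $M=\mathbf T^d$: if $\kappa:U\subset\mathbf R^d\to V\subset M$ is a coordinate patch, $\tilde\kappa:T^*U\to T^*V$ the induced canonical diffeomorphism, and $a\in C_c^\infty(T^*M)$ is supported in $T^*M|_V$, then $\mathrm{op}_h(a)$ is defined by $(\mathrm{op}_h(a)u)\circ\kappa=(\theta\circ\kappa)\,\mathrm{op}_h(a\circ\tilde\kappa)\big((\theta u)\circ\kappa\big)$,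 where $\theta\in C_c^\infty(V)$ equals $1$ on the projection of $\operatorname{supp}a$ to $M$. For general $a\in C_c^\infty(T^*M)$ one decomposes $a$ with a partition of unity; different choices change $\mathrm{op}_h(a)$ by an operator whose $L^2(M)$-norm tends to $0$ as $h\to0^+$. *)

theory Defs
  imports "HOL-Probability.Probability"
begin

text \<open>
  Functions on the torus \<open>R^d / (2 pi Z)^d\<close> are represented by functions on \<open>R^d\<close> that are
  \<open>2 pi\<close>-periodic in each coordinate, subsets of the torus by their periodic preimages in \<open>R^d\<close>,
  and integrals over the torus by integrals over the half-open cell \<open>[0, 2 pi)^d\<close>.
\<close>

definition int_vecs :: "(real ^ 'd) set" where
  "int_vecs = {k. \<forall>i. k $ i \<in> \<int>}"

definition torus_eq :: "real ^ 'd \<Rightarrow> real ^ 'd \<Rightarrow> bool" where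
  "torus_eq x y \<longleftrightarrow> (\<exists>k\<in>int_vecs. y = x + (2 * pi) *\<^sub>R k)"

definition torus_periodic :: "(real ^ 'd \<Rightarrow> 'b) \<Rightarrow> bool" where
  "torus_periodic f \<longleftrightarrow> (\<forall>x y. torus_eq x y \<longrightarrow> f x = f y)"

definition torus_cell :: "(real ^ 'd) set" where
  "torus_cell = {x. \<forall>i. 0 \<le> x $ i \<and> x $ i < 2 * pi}"

abbreviation torus_measure :: "(real ^ 'd) measure" where
  "torus_measure \<equiv> lebesgue_on torus_cell"

text \<open>Elements of \<open>L^2\<close> are given by representatives; everything below is insensitive to
  changing a representative on a null set.\<close>

definition torus_L2 :: "(real ^ 'd::finite \<Rightarrow> complex) set" where
  "torus_L2 = {u. torus_periodic u \<and> u \<in> borel_measurable lebesgue \<and>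
                  integrable torus_measure (\<lambda>x. (norm (u x))\<^sup>2)}"

definition torus_inner :: "(real ^ 'd::finite \<Rightarrow> complex) \<Rightarrow> (real ^ 'd \<Rightarrow> complex) \<Rightarrow> complex" where
  "torus_inner u v = (LINT x|torus_measure. u x * cnj (v x))"

definition fourier_coeff :: "(real ^ 'd::finite \<Rightarrow> complex) \<Rightarrow> real ^ 'd \<Rightarrow> complex" where
  "fourier_coeff u k =
     (LINT x|torus_measure. u x * cis (- (k \<bullet> x))) / (2 * pi) ^ CARD('d)"

text \<open>The propagator \<open>exp (i t Laplacian / 2)\<close>, by the spectral decomposition of the Laplacian: the
  exponential with frequency \<open>k\<close> has eigenvalue \<open>- |k|^2\<close>. By Riesz-Fischer and the completeness
  of the exponentials, the conditions on \<open>w\<close> determine exactly one class in \<open>L^2\<close>.\<close>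

definition propagator :: "real \<Rightarrow> (real ^ 'd::finite \<Rightarrow> complex) \<Rightarrow> real ^ 'd \<Rightarrow> complex" where
  "propagator t u = (SOME w. w \<in> torus_L2 \<and>
     (\<forall>k\<in>int_vecs. fourier_coeff w k = cis (- (t * (norm k)\<^sup>2 / 2)) * fourier_coeff u k))"

definition flow_average :: "real ^ 'd::finite \<Rightarrow> (real ^ 'd \<Rightarrow> real) \<Rightarrow> real ^ 'd \<Rightarrow> real" where
  "flow_average \<xi> f x =
     Lim at_top (\<lambda>T. (LINT s|lebesgue_on {0..T}. f (x + s *\<^sub>R \<xi>)) / T)"

primrec Ck_on ::
  "nat \<Rightarrow> 'a::real_normed_vector set \<Rightarrow> ('a \<Rightarrow> 'b::real_normed_vector) \<Rightarrow> bool" where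
  "Ck_on 0 S f \<longleftrightarrow> continuous_on S f"
| "Ck_on (Suc n) S f \<longleftrightarrow> (\<forall>x\<in>S. f differentiable (at x)) \<and>
     (\<forall>v. Ck_on n S (\<lambda>x. frechet_derivative f (at x) v))"

text \<open>Only used for open \<open>S\<close>.\<close>

definition smooth_on ::
  "'a::real_normed_vector set \<Rightarrow> ('a \<Rightarrow> 'b::real_normed_vector) \<Rightarrow> bool" where
  "smooth_on S f \<longleftrightarrow> (\<forall>n. Ck_on n S f)"

text \<open>Compactly supported smooth symbols on the cotangent bundle of the torus.\<close>

definition torus_symbols :: "((real ^ 'd::finite) \<times> (real ^ 'd) \<Rightarrow> complex) set" where
  "torus_symbols = {a. smooth_on UNIV a \<and>
     (\<forall>\<xi>. torus_periodic (\<lambda>x. a (x, \<xi>))) \<and>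
     (\<exists>R. \<forall>x \<xi>. a (x, \<xi>) \<noteq> 0 \<longrightarrow> norm \<xi> \<le> R)}"

definition weyl_op :: "real \<Rightarrow> ((real ^ 'd::finite) \<times> (real ^ 'd) \<Rightarrow> complex) \<Rightarrow>
    (real ^ 'd \<Rightarrow> complex) \<Rightarrow> real ^ 'd \<Rightarrow> complex" where
  "weyl_op h a u x =
     (LINT \<xi>|lebesgue. LINT y|lebesgue.
        a ((1 / 2) *\<^sub>R (x + y), h *\<^sub>R \<xi>) * u y * cis ((x - y) \<bullet> \<xi>)) / (2 * pi) ^ CARD('d)"

text \<open>A coordinate patch \<open>U \<rightarrow> V\<close> of the torus is represented by a map \<open>\<kappa>\<close> choosing for each
  point of \<open>U\<close> an arbitrary preimage in \<open>R^d\<close> of its image in the torus. Such a \<open>\<kappa>\<close> need not be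
  continuous, and there need not be a continuous choice on all of \<open>U\<close>, so derivatives are those of
  local lifts. They do not depend on the lift, because two lifts differ locally by a constant.\<close>

definition chart_jacobian :: "(real ^ 'd::finite \<Rightarrow> real ^ 'd) \<Rightarrow> real ^ 'd \<Rightarrow> real ^ 'd ^ 'd" where
  "chart_jacobian \<kappa> X = (THE A. \<exists>W l. open W \<and> X \<in> W \<and> (\<forall>Y\<in>W. torus_eq (\<kappa> Y) (l Y)) \<and>
     (l has_derivative (\<lambda>v. A *v v)) (at X))"

text \<open>An injective smooth map with invertible differential is a diffeomorphism onto its image,
  which is open.\<close>

definition torus_chart :: "(real ^ 'd::finite) set \<Rightarrow> (real ^ 'd \<Rightarrow> real ^ 'd) \<Rightarrow> bool" where
  "torus_chart U \<kappa> \<longleftrightarrow> open U \<and>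
     (\<forall>X\<in>U. \<exists>W l. open W \<and> X \<in> W \<and> W \<subseteq> U \<and> smooth_on W l \<and> (\<forall>Y\<in>W. torus_eq (\<kappa> Y) (l Y))) \<and>
     (\<forall>X\<in>U. \<forall>Y\<in>U. torus_eq (\<kappa> X) (\<kappa> Y) \<longrightarrow> X = Y) \<and>
     (\<forall>X\<in>U. invertible (chart_jacobian \<kappa> X))"

definition chart_image :: "(real ^ 'd) set \<Rightarrow> (real ^ 'd \<Rightarrow> real ^ 'd) \<Rightarrow> (real ^ 'd) set" where
  "chart_image U \<kappa> = {x. \<exists>X\<in>U. torus_eq (\<kappa> X) x}"

definition chart_inv :: "(real ^ 'd) set \<Rightarrow> (real ^ 'd \<Rightarrow> real ^ 'd) \<Rightarrow> real ^ 'd \<Rightarrow> real ^ 'd" where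
  "chart_inv U \<kappa> x = (THE X. X \<in> U \<and> torus_eq (\<kappa> X) x)"

text \<open>The canonical diffeomorphism of cotangent bundles: covectors are transported by the inverse
  transpose of the differential.\<close>

definition cotangent_lift ::
  "(real ^ 'd::finite \<Rightarrow> real ^ 'd) \<Rightarrow> (real ^ 'd) \<times> (real ^ 'd) \<Rightarrow> (real ^ 'd) \<times> (real ^ 'd)" where
  "cotangent_lift \<kappa> = (\<lambda>(X, \<Xi>). (\<kappa> X, matrix_inv (transpose (chart_jacobian \<kappa> X)) *v \<Xi>))"

text \<open>Functions on \<open>U\<close>, on its cotangent bundle and on the image of the patch are extended by zero.\<close>

definition chart_op :: "(real ^ 'd::finite) set \<Rightarrow> (real ^ 'd \<Rightarrow> real ^ 'd) \<Rightarrow> (real ^ 'd \<Rightarrow> complex) \<Rightarrow>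
    real \<Rightarrow> ((real ^ 'd) \<times> (real ^ 'd) \<Rightarrow> complex) \<Rightarrow> (real ^ 'd \<Rightarrow> complex) \<Rightarrow> real ^ 'd \<Rightarrow> complex" where
  "chart_op U \<kappa> \<theta> h a u x =
     (if x \<in> chart_image U \<kappa>
      then \<theta> x * weyl_op h (\<lambda>p. if fst p \<in> U then a (cotangent_lift \<kappa> p) else 0)
                           (\<lambda>Y. if Y \<in> U then \<theta> (\<kappa> Y) * u (\<kappa> Y) else 0) (chart_inv U \<kappa> x)
      else 0)"

text \<open>\<open>torus_quantization a Op\<close> says that \<open>Op h\<close> is a quantization of \<open>a\<close> obtained from some finite
  family of patches \<open>\<kappa> j\<close>, a subordinate partition of unity \<open>\<psi> j\<close>, and cutoffs \<open>\<theta> j\<close> supported in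
  the patches and equal to 1 on the projection of the support of \<open>\<psi> j * a\<close>. The support conditions
  are conditions on closures of periodic sets, as closed subsets of the torus are compact.\<close>

definition torus_quantization :: "((real ^ 'd::finite) \<times> (real ^ 'd) \<Rightarrow> complex) \<Rightarrow>
    (real \<Rightarrow> (real ^ 'd \<Rightarrow> complex) \<Rightarrow> real ^ 'd \<Rightarrow> complex) \<Rightarrow> bool" where
  "torus_quantization a Op \<longleftrightarrow>
     (\<exists>(N::nat) U \<kappa> (\<psi> :: nat \<Rightarrow> real ^ 'd \<Rightarrow> real) (\<theta> :: nat \<Rightarrow> real ^ 'd \<Rightarrow> complex).
        (\<forall>j<N. torus_chart (U j) (\<kappa> j) \<and>
           smooth_on UNIV (\<psi> j) \<and> torus_periodic (\<psi> j) \<and> (\<forall>x. 0 \<le> \<psi> j x) \<and>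
           closure {x. \<psi> j x \<noteq> 0} \<subseteq> chart_image (U j) (\<kappa> j) \<and>
           smooth_on UNIV (\<theta> j) \<and> torus_periodic (\<theta> j) \<and>
           closure {x. \<theta> j x \<noteq> 0} \<subseteq> chart_image (U j) (\<kappa> j) \<and>
           (\<forall>x \<in> fst ` closure {p. \<psi> j (fst p) * a p \<noteq> 0}. \<theta> j x = 1)) \<and>
        (\<forall>x. (\<Sum>j<N. \<psi> j x) = 1) \<and>
        Op = (\<lambda>h u x. \<Sum>j<N. chart_op (U j) (\<kappa> j) (\<theta> j) h (\<lambda>p. \<psi> j (fst p) * a p) u x))"

text \<open>The measure \<open>f(x) dx \<delta>_\<xi>\<close>, on the cell times \<open>R^d\<close>.\<close>

definition dx_dirac :: "(real ^ 'd::finite \<Rightarrow> real) \<Rightarrow> real ^ 'd \<Rightarrow> ((real ^ 'd) \<times> (real ^ 'd)) measure" where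
  "dx_dirac f \<xi> = density torus_measure (\<lambda>x. ennreal (f x)) \<Otimes>\<^sub>M return borel \<xi>"

text \<open>Since quantizations of the same symbol differ by an operator of norm \<open>o(1)\<close>, the limits are
  required for all of them.\<close>

definition semiclassical_measure :: "(nat \<Rightarrow> real) \<Rightarrow> (nat \<Rightarrow> real ^ 'd::finite \<Rightarrow> complex) \<Rightarrow>
    ((real ^ 'd) \<times> (real ^ 'd)) measure \<Rightarrow> bool" where
  "semiclassical_measure h u \<mu> \<longleftrightarrow>
     (\<forall>a\<in>torus_symbols. \<forall>Op. torus_quantization a Op \<longrightarrow>
        (\<lambda>n. torus_inner (Op (h n) (u n)) (u n)) \<longlonglongrightarrow> (LINT p|\<mu>. a p))"

definition evolved_semiclassical_measure :: "(nat \<Rightarrow> real) \<Rightarrow> (nat \<Rightarrow> real ^ 'd::finite \<Rightarrow> complex) \<Rightarrow>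
    (real \<Rightarrow> ((real ^ 'd) \<times> (real ^ 'd)) measure) \<Rightarrow> bool" where
  "evolved_semiclassical_measure h u \<mu> \<longleftrightarrow>
     (\<forall>\<phi> :: real \<Rightarrow> complex. integrable lebesgue \<phi> \<longrightarrow>
       (\<forall>a\<in>torus_symbols. \<forall>Op. torus_quantization a Op \<longrightarrow>
         (\<lambda>n. LINT t|lebesgue.
            \<phi> t * torus_inner (Op (h n) (propagator t (u n))) (propagator t (u n)))
         \<longlonglongrightarrow> (LINT t|lebesgue. \<phi> t * (LINT p|\<mu> t. a p))))"

end

(*
  Write e_k for the exponential with frequency k and take u_h = e_eta rho with integer vectors eta
  such that h eta -> xi_0. Quantizations are bounded on L^2 uniformly in h (Schur's test in each
  patch), and (op_h(a) e_(eta+k) | e_(eta+l)) tends to the integral of a(x, xi_0) e_(k-l). Expanding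
  rho in its Fourier series, everything reduces to finitely many pairs (k, l), and the evolution
  multiplies the pair (k, l) by the phase of frequency (|k|^2 - |l|^2)/2 + (k - l).eta. By the
  Riemann-Lebesgue lemma only the pairs for which (k - l).eta stays bounded contribute. For
  eta = xi_0/h these are the pairs with (k - l).xi_0 = 0, which is the average along the flow.
  For v_h the frequency eta is perturbed by (N, N^2, ..., N^d) with N^(d+1) = 1/h; then
  |(k - l).eta| tends to infinity unless k = l, so only the mean over the torus survives.
*)

theory Submission imports Defs begin

text \<open>All quantizations of a symbol are treated at once, so the charts are arbitrary and the
  limit covector has to survive the change of coordinates. In a patch with lift l the modulation
  contributes the phase (h eta) . ((l(X - h z) - l(X)) / h), which tends to - xi . (J z) = - z .
  (J^T xi). Fourier inversion then evaluates the pulled back symbol at (X, J^T xi), and the inverse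
  transpose in \<open>cotangent_lift\<close> turns this into a(x, xi). Both limits are written as
  multiplication by a bounded function \<open>b\<close> made from a(., xi): its mean along orbits,
  or over the torus. Averaging the symbol instead of |exp(i t Laplacian / 2) rho|^2 keeps the
  averaged function bounded; the averaged density returns only at the end, by duality. With 1/h =
  N^(d+1) the vector xi_0/h is integral, and the exponent d + 1 exceeds all exponents in (N, ...,
  N^d), so that h times the perturbation tends to 0 although its entries have pairwise different
  orders of growth.\<close>

section \<open>Change of variables over an arbitrary finite index type\<close>

typedef 'a wo = "UNIV :: 'a set" by simp

lemma UNIV_wo: "(UNIV :: 'a wo set) = range Abs_wo"
  by (metis Rep_wo_inverse surj_def)

instance wo :: (finite) finite
  by standard (simp add: UNIV_wo)

text \<open>Any enumeration will do: a determinant does not change when rows and columns are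
  permuted simultaneously.\<close>

definition wo_index :: "'a::finite \<Rightarrow> nat" where
  "wo_index = (SOME f. inj f)"

lemma inj_wo_index: "inj (wo_index :: 'a::finite \<Rightarrow> nat)"
proof -
  obtain f :: "'a \<Rightarrow> nat" where "inj f"
    using finite_imp_inj_to_nat_seg[OF finite[of "UNIV :: 'a set"]] by metis
  then show ?thesis unfolding wo_index_def by (rule someI[where P = inj])
qed

instantiation wo :: (finite) wellorder
begin

definition less_eq_wo :: "'a wo \<Rightarrow> 'a wo \<Rightarrow> bool" where
  "less_eq_wo x y \<longleftrightarrow> wo_index (Rep_wo x) \<le> wo_index (Rep_wo y)"

definition less_wo :: "'a wo \<Rightarrow> 'a wo \<Rightarrow> bool" where
  "less_wo x y \<longleftrightarrow> wo_index (Rep_wo x) < wo_index (Rep_wo y)"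

instance
proof
  fix P :: "'a wo \<Rightarrow> bool" and a
  assume *: "\<And>x. (\<And>y. y < x \<Longrightarrow> P y) \<Longrightarrow> P x"
  show "P a"
    by (induction a rule: measure_induct_rule[of "\<lambda>x. wo_index (Rep_wo x)"])
      (use * in \<open>auto simp: less_wo_def\<close>)
qed (auto simp: less_eq_wo_def less_wo_def Rep_wo_inject dest: injD[OF inj_wo_index])

end

definition to_wo :: "real ^ 'd \<Rightarrow> real ^ 'd wo" where
  "to_wo x = (\<chi> i. x $ Rep_wo i)"

definition of_wo :: "real ^ 'd wo \<Rightarrow> real ^ 'd" where
  "of_wo x = (\<chi> i. x $ Abs_wo i)"

lemma of_to_wo [simp]: "of_wo (to_wo x) = x"
  by (simp add: of_wo_def to_wo_def Abs_wo_inverse vec_eq_iff)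

lemma to_of_wo [simp]: "to_wo (of_wo x) = x"
  by (simp add: of_wo_def to_wo_def Rep_wo_inverse vec_eq_iff)

lemma linear_to_wo: "linear to_wo" and linear_of_wo: "linear of_wo"
  by (auto intro!: linearI simp: to_wo_def of_wo_def vec_eq_iff)

lemma bounded_linear_to_wo: "bounded_linear (to_wo :: real ^ 'd::finite \<Rightarrow> _)"
  and bounded_linear_of_wo: "bounded_linear (of_wo :: _ \<Rightarrow> real ^ 'd::finite)"
  using linear_to_wo linear_of_wo linear_conv_bounded_linear by blast+

lemma continuous_on_wo [continuous_intros]:
  "continuous_on S f \<Longrightarrow> continuous_on S (\<lambda>x. to_wo (f x :: real ^ 'd::finite))"
  "continuous_on S g \<Longrightarrow> continuous_on S (\<lambda>x. of_wo (g x) :: real ^ 'd::finite)"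
  by (auto intro: bounded_linear.continuous_on[OF bounded_linear_to_wo] bounded_linear.continuous_on[OF bounded_linear_of_wo])

lemma measurable_wo [measurable]:
  "to_wo \<in> borel \<rightarrow>\<^sub>M borel" "(of_wo :: _ \<Rightarrow> real ^ 'd::finite) \<in> borel \<rightarrow>\<^sub>M borel"
  by (auto intro!: borel_measurable_continuous_onI continuous_intros)

lemma image_to_wo: "to_wo ` S = of_wo -` S"
  by (auto simp: image_iff) (metis to_of_wo)

lemma prod_Basis_vec:
  "(\<Prod>b\<in>(Basis :: (real ^ 'n::finite) set). f b) = (\<Prod>i\<in>UNIV. f (axis i 1))"
proof -
  have B: "(Basis :: (real ^ 'n) set) = (\<lambda>i. axis i 1) ` UNIV"
    by (auto simp: Basis_vec_def)
  have "inj (\<lambda>i :: 'n. axis i (1::real))"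
    by (auto simp: inj_on_def axis_eq_axis)
  then show ?thesis unfolding B by (subst prod.reindex) auto
qed

text \<open>Relabelling the coordinates only permutes the factors in the volume of a box, and boxes
  determine Lebesgue measure.\<close>

lemma distr_to_wo: "distr lborel borel (to_wo :: real ^ 'd::finite \<Rightarrow> _) = lborel"
proof (rule lborel_eqI[symmetric])
  fix l u :: "real ^ 'd wo" assume le: "\<And>b. b \<in> Basis \<Longrightarrow> l \<bullet> b \<le> u \<bullet> b"
  have le': "l $ i \<le> u $ i" for i
    using le[of "axis i 1"] by (auto simp: inner_axis Basis_vec_def)
  have "to_wo -` box l u = box (of_wo l) (of_wo u :: real ^ 'd)"
    by (auto simp: mem_box_cart to_wo_def of_wo_def) (metis Abs_wo_inverse UNIV_I Rep_wo_inverse)+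
  then have "emeasure (distr lborel borel to_wo) (box l u) = emeasure lborel (box (of_wo l) (of_wo u :: real ^ 'd))"
    by (subst emeasure_distr) auto
  also have "\<dots> = ennreal (\<Prod>b\<in>Basis. (of_wo u - of_wo l :: real ^ 'd) \<bullet> b)"
    by (rule emeasure_lborel_box) (use le' in \<open>auto simp: Basis_vec_def inner_axis of_wo_def\<close>)
  also have "(\<Prod>b\<in>Basis. (of_wo u - of_wo l :: real ^ 'd) \<bullet> b) = (\<Prod>i\<in>UNIV. (u - l) $ Abs_wo i)"
    by (simp add: prod_Basis_vec inner_axis of_wo_def)
  also have "\<dots> = (\<Prod>i\<in>UNIV. (u - l) $ i)"
    unfolding UNIV_wo by (subst prod.reindex) (auto simp: inj_on_def Abs_wo_inject)
  also have "\<dots> = (\<Prod>b\<in>Basis. (u - l) \<bullet> b)"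
    by (simp add: prod_Basis_vec inner_axis)
  finally show "emeasure (distr lborel borel to_wo) (box l u) = (\<Prod>b\<in>Basis. (u - l) \<bullet> b)" .
qed simp

text \<open>On Borel sets this is \<open>distr_to_wo\<close>. A Lebesgue set is a Borel main part
  together with a subset of a Borel null set, and the two pieces are transported separately.\<close>

lemma emeasure_lebesgue_to_wo:
  assumes "S \<in> sets lebesgue"
  shows "emeasure lebesgue (to_wo ` S :: (real ^ 'd::finite wo) set) = emeasure lebesgue S"
proof -
  have lb: "emeasure lborel (to_wo ` B) = emeasure lborel B \<and> to_wo ` B \<in> sets borel"
    if "B \<in> sets borel" for B :: "(real ^ 'd) set"
  proof -
    have "to_wo ` B = of_wo -` B \<inter> space borel" by (simp add: image_to_wo)
    also have "\<dots> \<in> sets borel" using that by measurable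
    finally have m: "to_wo ` B \<in> sets borel" .
    have "emeasure lborel (to_wo ` B) = emeasure (distr lborel borel (to_wo :: real ^ 'd \<Rightarrow> _)) (to_wo ` B)"
      by (simp add: distr_to_wo)
    also have "\<dots> = emeasure lborel (to_wo -` to_wo ` B :: (real^'d) set)"
      using m by (subst emeasure_distr) auto
    also have "to_wo -` to_wo ` B = B"
      by (auto simp: image_to_wo)
    finally show ?thesis using m by simp
  qed
  obtain N' where N': "N' \<in> null_sets lborel" "null_part lborel S \<subseteq> N'"
    using null_part[OF assms] by blast
  have eq: "S = main_part lborel S \<union> null_part lborel S"
    using main_part_null_part_Un[OF assms] by simp
  have mp: "main_part lborel S \<in> sets borel"
    using main_part_sets[OF assms] by simp
  have nn: "to_wo ` null_part lborel S \<in> null_sets lebesgue"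
  proof (rule null_sets_completion_subset)
    have "to_wo ` N' \<in> null_sets lborel"
      using lb[of N'] null_setsD1[OF N'(1)] null_setsD2[OF N'(1)] by (intro null_setsI) auto
    then show "to_wo ` N' \<in> null_sets lebesgue" by (rule null_sets_completionI)
  qed (use N' in blast)
  have "emeasure lebesgue (to_wo ` S) = emeasure lebesgue (to_wo ` main_part lborel S \<union> to_wo ` null_part lborel S)"
    by (subst eq) (simp add: image_Un)
  also have "\<dots> = emeasure lebesgue (to_wo ` main_part lborel S)"
    using nn lb[OF mp] by (intro emeasure_Un_null_set) auto
  also have "\<dots> = emeasure lborel (main_part lborel S)"
    using lb[OF mp] by simp
  also have "\<dots> = emeasure lebesgue S"
    using emeasure_completion[OF assms] by simp
  finally show ?thesis .
qed

text \<open>The determinant is taken on the well-ordered copy of the index type, since the change of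
  variables theorem is only available there.\<close>

definition abs_jac :: "(real ^ 'd::finite \<Rightarrow> real ^ 'd) \<Rightarrow> real" where
  "abs_jac L = \<bar>det (matrix (\<lambda>x. to_wo (L (of_wo x))))\<bar>"

text \<open>The area formula for injective maps, obtained by conjugation with \<open>to_wo\<close>.
  Derivatives are taken within \<open>E\<close>, so that it applies to Borel pieces of an open set,
  and values in [0, oo] spare any finiteness assumption when pieces are summed.\<close>

lemma nn_integral_abs_jac:
  fixes g :: "real ^ 'd::finite \<Rightarrow> real ^ 'd"
  assumes E: "E \<in> sets borel" and der: "\<And>x. x \<in> E \<Longrightarrow> (g has_derivative g' x) (at x within E)"
    and inj: "inj_on g E"
  shows "g ` E \<in> sets lebesgue"
    and "(\<integral>\<^sup>+x. ennreal (abs_jac (g' x)) * indicator E x \<partial>lborel) = emeasure lebesgue (g ` E)"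
    and "(\<lambda>x. abs_jac (g' x)) \<in> borel_measurable (lebesgue_on E)"
proof -
  show gE: "g ` E \<in> sets lebesgue"
    by (rule differentiable_image_in_sets_lebesgue)
       (use E der in \<open>auto simp: differentiable_on_def differentiable_def\<close>)
  define E' where "E' = to_wo ` E"
  define G where "G x = to_wo (g (of_wo x))" for x
  define G' where "G' x = (\<lambda>y. to_wo (g' (of_wo x) (of_wo y)))" for x
  have E'b: "E' \<in> sets borel"
  proof -
    have "E' = of_wo -` E \<inter> space borel" by (simp add: image_to_wo E'_def)
    also have "\<dots> \<in> sets borel" using E by measurable
    finally show ?thesis .
  qed
  then have E': "E' \<in> sets lebesgue" by simp
  have derG: "(G has_derivative G' x) (at x within E')" if "x \<in> E'" for x
  proof -
    have 1: "(of_wo has_derivative of_wo) (at x within E')"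
      by (rule bounded_linear.has_derivative[OF bounded_linear_of_wo has_derivative_ident])
    have 2: "(g has_derivative g' (of_wo x)) (at (of_wo x) within of_wo ` E')"
      using der[of "of_wo x"] that unfolding E'_def image_to_wo
      by (metis E'_def image_to_wo der has_derivative_subset image_vimage_subset vimage_eq)
    have 3: "((g \<circ> of_wo) has_derivative (g' (of_wo x) \<circ> of_wo)) (at x within E')"
      by (rule diff_chain_within[OF 1 2])
    have "((\<lambda>x. to_wo ((g \<circ> of_wo) x)) has_derivative (\<lambda>y. to_wo ((g' (of_wo x) \<circ> of_wo) y))) (at x within E')"
      by (rule bounded_linear.has_derivative[OF bounded_linear_to_wo 3])
    then show ?thesis unfolding G_def G'_def by simp
  qed
  have injG: "inj_on G E'"
    using inj by (auto simp: inj_on_def G_def E'_def) (metis of_to_wo)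
  have im: "G ` E' = to_wo ` (g ` E)"
    by (simp add: G_def E'_def image_image)
  have J: "abs_jac (g' (of_wo x)) = \<bar>det (matrix (G' x))\<bar>" for x
    by (simp add: abs_jac_def G'_def)
  have meas: "(\<lambda>x. \<bar>det (matrix (G' x))\<bar>) \<in> borel_measurable (lebesgue_on E')"
    using borel_measurable_det_Jacobian[OF E' derG] by simp
  have mwo: "to_wo \<in> lebesgue_on E \<rightarrow>\<^sub>M lebesgue_on E'"
  proof (rule measurable_restrict_space3)
    show "to_wo \<in> lebesgue \<rightarrow>\<^sub>M (lebesgue :: (real ^ 'd wo) measure)"
    proof (rule measurableI)
      fix A :: "(real ^ 'd wo) set" assume A: "A \<in> sets lebesgue"
      have eq: "A = main_part lborel A \<union> null_part lborel A"
        using main_part_null_part_Un[OF A] by simp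
      obtain N' where N': "N' \<in> null_sets lborel" "null_part lborel A \<subseteq> N'"
        using null_part[OF A] by blast
      have "to_wo -` main_part lborel A \<inter> space borel \<in> sets borel"
        using main_part_sets[OF A] by measurable
      then have 1: "to_wo -` main_part lborel A \<in> sets lebesgue" by simp
      have "to_wo -` N' \<inter> space borel \<in> sets borel"
        using N' by (intro measurable_sets[OF measurable_wo(1)]) auto
      moreover have "emeasure (lborel :: (real^'d) measure) (to_wo -` N') = emeasure (distr lborel borel (to_wo :: real ^ 'd \<Rightarrow> _)) N'"
        using N' by (subst emeasure_distr) auto
      ultimately have "to_wo -` N' \<in> null_sets lborel"
        using N' by (auto simp: distr_to_wo null_sets_def)
      then have 2: "to_wo -` null_part lborel A \<in> null_sets lebesgue"
        by (rule null_sets_completion_subset[OF vimage_mono[OF N'(2)] null_sets_completionI])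
      have "to_wo -` A = to_wo -` main_part lborel A \<union> to_wo -` null_part lborel A"
        using eq by blast
      also have "\<dots> \<in> sets lebesgue" using 1 null_setsD2[OF 2] by (rule sets.Un)
      finally show "to_wo -` A \<inter> space lebesgue \<in> sets lebesgue" by simp
    qed simp
  qed (auto simp: E'_def)
  show "(\<lambda>x. abs_jac (g' x)) \<in> borel_measurable (lebesgue_on E)"
    using measurable_compose[OF mwo meas] unfolding J[symmetric] by simp
  \<comment> \<open>A Borel representative is needed because \<open>distr_to_wo\<close> is about
    \<open>lborel\<close>, whereas the Jacobian is only known to be Lebesgue measurable.\<close>
  obtain F where F: "F \<in> borel_measurable lborel"
      "AE x in lborel. ennreal \<bar>det (matrix (G' x))\<bar> * indicator E' x = F x"
  proof -
    have "(\<lambda>x. ennreal \<bar>det (matrix (G' x))\<bar> * indicator E' x) \<in> borel_measurable lebesgue"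
    proof -
      have "(\<lambda>x. indicat_real E' x * \<bar>det (matrix (G' x))\<bar>) \<in> borel_measurable lebesgue"
        using meas E' by (subst (asm) borel_measurable_restrict_space_iff) auto
      then have "(\<lambda>x. ennreal (indicat_real E' x * \<bar>det (matrix (G' x))\<bar>)) \<in> borel_measurable lebesgue"
        by measurable
      then show ?thesis
        by (rule measurable_cong[THEN iffD1, rotated]) (simp add: indicator_def)
    qed
    from completion_ex_borel_measurable[OF this] show ?thesis using that by auto
  qed
  have ind: "indicator E x = (indicator E' (to_wo x) :: ennreal)" for x
    by (auto simp: E'_def image_to_wo indicator_def)
  have "(\<integral>\<^sup>+x. ennreal (abs_jac (g' x)) * indicator E x \<partial>lborel) = (\<integral>\<^sup>+x. F (to_wo x) \<partial>lborel)"
  proof (rule nn_integral_cong_AE)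
    have "AE x in distr lborel borel (to_wo :: real ^ 'd \<Rightarrow> _). ennreal \<bar>det (matrix (G' x))\<bar> * indicator E' x = F x"
      unfolding distr_to_wo using F(2) .
    then have "AE x in lborel. ennreal \<bar>det (matrix (G' (to_wo x)))\<bar> * indicator E' (to_wo x :: real ^ 'd wo) = F (to_wo x)"
      by (rule AE_distrD[rotated]) simp
    then show "AE x in lborel. ennreal (abs_jac (g' x)) * indicator E x = F (to_wo x)"
      by (simp add: ind J[symmetric])
  qed
  also have "\<dots> = (\<integral>\<^sup>+x. F x \<partial>distr lborel borel to_wo)"
    using F by (subst nn_integral_distr) auto
  also have "\<dots> = (\<integral>\<^sup>+x. F x \<partial>lborel)"
    by (simp add: distr_to_wo)
  also have "\<dots> = (\<integral>\<^sup>+x. ennreal \<bar>det (matrix (G' x))\<bar> * indicator E' x \<partial>lborel)"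
    using F by (intro nn_integral_cong_AE) auto
  \<comment> \<open>If the image has finite measure, this is the classical formula. Otherwise both
    sides are infinite, since an integrable Jacobian would force the image to have finite
    measure.\<close>
  also have "\<dots> = emeasure lebesgue (G ` E')"
  proof (cases "G ` E' \<in> lmeasurable")
    case True
    then have "((\<lambda>x. \<bar>det (matrix (G' x))\<bar>) has_integral measure lebesgue (G ` E')) E'"
      using has_measure_differentiable_image[OF E' derG injG] by blast
    then have "(\<integral>\<^sup>+x. ennreal \<bar>det (matrix (G' x))\<bar> * indicator E' x \<partial>lborel) = ennreal (measure lebesgue (G ` E'))"
      by (intro nn_integral_has_integral_lebesgue') auto
    then show ?thesis using fmeasurableD2[OF True] by (metis emeasure_eq_ennreal_measure infinity_ennreal_def)
  next
    case False
    have GE: "G ` E' \<in> sets lebesgue"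
      by (rule differentiable_image_in_sets_lebesgue)
         (use E' derG in \<open>auto simp: differentiable_on_def differentiable_def\<close>)
    with False have "emeasure lebesgue (G ` E') = \<infinity>"
      by (auto simp: fmeasurable_def less_top[symmetric])
    moreover have "(\<integral>\<^sup>+x. ennreal \<bar>det (matrix (G' x))\<bar> * indicator E' x \<partial>lborel) = \<infinity>"
    proof (rule ccontr)
      assume "(\<integral>\<^sup>+x. ennreal \<bar>det (matrix (G' x))\<bar> * indicator E' x \<partial>lborel) \<noteq> \<infinity>"
      then have "(\<integral>\<^sup>+x. ennreal \<bar>det (matrix (G' x))\<bar> \<partial>lebesgue_on E') < \<infinity>"
        using E' by (simp add: nn_integral_restrict_space nn_integral_completion less_top[symmetric])
      then have "integrable (lebesgue_on E') (\<lambda>x. \<bar>det (matrix (G' x))\<bar>)"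
        using meas by (intro integrableI_nonneg) auto
      then have "(\<lambda>x. \<bar>det (matrix (G' x))\<bar>) integrable_on E'"
        using E' by (simp add: integrable_on_lebesgue_on)
      then show False using False measurable_differentiable_image_eq[OF E' derG injG] by blast
    qed
    ultimately show ?thesis by simp
  qed
  also have "\<dots> = emeasure lebesgue (g ` E)"
    unfolding im by (rule emeasure_lebesgue_to_wo[OF gE])
  finally show "(\<integral>\<^sup>+x. ennreal (abs_jac (g' x)) * indicator E x \<partial>lborel) = emeasure lebesgue (g ` E)" .
qed

subsection \<open>The torus\<close>

definition torus_red :: "real ^ 'd \<Rightarrow> real ^ 'd" where
  "torus_red x = (\<chi> i. x $ i - 2 * pi * of_int \<lfloor>x $ i / (2 * pi)\<rfloor>)"

lemma int_vecs_simps [simp]: "0 \<in> int_vecs"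
  "k \<in> int_vecs \<Longrightarrow> l \<in> int_vecs \<Longrightarrow> k + l \<in> int_vecs"
  "k \<in> int_vecs \<Longrightarrow> l \<in> int_vecs \<Longrightarrow> k - l \<in> int_vecs"
  "k \<in> int_vecs \<Longrightarrow> - k \<in> int_vecs"
  "k \<in> int_vecs \<Longrightarrow> r \<in> \<int> \<Longrightarrow> r *\<^sub>R k \<in> int_vecs"
  by (auto simp: int_vecs_def)

lemma countable_int_vecs: "countable (int_vecs :: (real ^ 'd::finite) set)"
proof -
  have "int_vecs \<subseteq> range (\<lambda>f :: 'd \<Rightarrow> int. (\<chi> i. of_int (f i)) :: real ^ 'd)"
  proof
    fix k :: "real ^ 'd" assume "k \<in> int_vecs"
    then have "k = (\<chi> i. of_int \<lfloor>k $ i\<rfloor>)"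
      by (auto simp: int_vecs_def vec_eq_iff elim!: Ints_cases)
    then show "k \<in> range (\<lambda>f :: 'd \<Rightarrow> int. (\<chi> i. of_int (f i)) :: real ^ 'd)"
      by (rule range_eqI[of _ _ "\<lambda>i. \<lfloor>k $ i\<rfloor>"])
  qed
  then show ?thesis by (rule countable_subset) simp
qed

lemma inner_int_vecs: "k \<in> int_vecs \<Longrightarrow> l \<in> int_vecs \<Longrightarrow> k \<bullet> (l :: real ^ 'd::finite) \<in> \<int>"
  by (auto simp: int_vecs_def inner_vec_def intro!: Ints_sum Ints_mult)

lemma torus_eq_refl [simp]: "torus_eq x x"
  unfolding torus_eq_def by (rule bexI[of _ 0]) auto

lemma torus_eq_sym: "torus_eq x y \<Longrightarrow> torus_eq y x"
  unfolding torus_eq_def by (metis add_diff_cancel_right' diff_conv_add_uminus int_vecs_simps(4) scaleR_minus_right)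

lemma torus_eq_trans: "torus_eq x y \<Longrightarrow> torus_eq y z \<Longrightarrow> torus_eq x z"
  unfolding torus_eq_def by (metis (no_types, opaque_lifting) add.assoc int_vecs_simps(2) scaleR_add_right)

lemma torus_eq_shift: "k \<in> int_vecs \<Longrightarrow> torus_eq x (x - (2 * pi) *\<^sub>R k)"
  unfolding torus_eq_def by (rule bexI[of _ "- k"]) auto

lemma torus_eq_add: "torus_eq x y \<Longrightarrow> torus_eq (x + s) (y + s)"
  unfolding torus_eq_def by (auto simp: algebra_simps)

lemma torus_eq_red: "torus_eq x (torus_red x)"
  unfolding torus_eq_def
  by (rule bexI[of _ "\<chi> i. - of_int \<lfloor>x $ i / (2 * pi)\<rfloor>"]) (auto simp: torus_red_def int_vecs_def vec_eq_iff)

lemma torus_red_in_cell: "torus_red x \<in> torus_cell"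
proof -
  have "0 \<le> t - 2 * pi * of_int \<lfloor>t / (2 * pi)\<rfloor> \<and> t - 2 * pi * of_int \<lfloor>t / (2 * pi)\<rfloor> < 2 * pi" for t :: real
  proof -
    have "of_int \<lfloor>t / (2 * pi)\<rfloor> \<le> t / (2 * pi)" "t / (2 * pi) < of_int \<lfloor>t / (2 * pi)\<rfloor> + 1"
      by linarith+
    then have "of_int \<lfloor>t / (2 * pi)\<rfloor> * (2 * pi) \<le> t" "t < (of_int \<lfloor>t / (2 * pi)\<rfloor> + 1) * (2 * pi)"
      using pos_le_divide_eq[of "2 * pi" "of_int \<lfloor>t / (2 * pi)\<rfloor>" t] pos_divide_less_eq[of "2 * pi" t "of_int \<lfloor>t / (2 * pi)\<rfloor> + 1"] pi_gt_zero by auto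
    then show ?thesis by (simp add: algebra_simps)
  qed
  then show ?thesis by (simp add: torus_cell_def torus_red_def)
qed

lemma torus_eq_cell_unique:
  assumes "x \<in> torus_cell" "y \<in> torus_cell" "torus_eq x y"
  shows "x = y"
proof -
  obtain k where k: "k \<in> int_vecs" "y = x + (2 * pi) *\<^sub>R k" using assms by (auto simp: torus_eq_def)
  have "k $ i = 0" for i
  proof -
    obtain m :: int where m: "k $ i = of_int m" using k by (auto simp: int_vecs_def elim: Ints_cases)
    have "\<bar>y $ i - x $ i\<bar> < 2 * pi" using assms by (auto simp: torus_cell_def abs_less_iff) (smt (verit))+
    then have "\<bar>of_int m\<bar> * (2 * pi) < 1 * (2 * pi)" using k m by (simp add: abs_mult)
    then have "\<bar>of_int m :: real\<bar> < 1" using mult_less_cancel_right_pos[of "2 * pi"] by (metis pi_gt_zero zero_less_mult_iff zero_less_numeral)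
    then show ?thesis using m by simp
  qed
  then show ?thesis using k by (simp add: vec_eq_iff)
qed

lemma torus_red_cell: "x \<in> torus_cell \<Longrightarrow> torus_red x = x"
  using torus_eq_cell_unique[OF _ torus_red_in_cell torus_eq_red] by metis

lemma torus_red_cong: "torus_eq x y \<Longrightarrow> torus_red x = torus_red y"
  by (meson torus_eq_cell_unique torus_eq_red torus_eq_sym torus_eq_trans torus_red_in_cell)

lemma torus_red_measurable [measurable]: "torus_red \<in> borel \<rightarrow>\<^sub>M (borel :: (real ^ 'd::finite) measure)"
proof -
  have "(\<lambda>x :: real ^ 'd. torus_red x \<bullet> b) \<in> borel_measurable borel" if "b \<in> Basis" for b
    using that by (auto simp: Basis_vec_def inner_axis torus_red_def)
  then show ?thesis by (subst borel_measurable_euclidean_space) auto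
qed

lemma torus_cell_measurable [measurable, simp]: "(torus_cell :: (real ^ 'd::finite) set) \<in> sets borel"
proof -
  have "(torus_cell :: (real ^ 'd) set) = (\<Inter>i. {x. 0 \<le> x $ i} \<inter> {x. x $ i < 2 * pi})"
    by (auto simp: torus_cell_def)
  also have "\<dots> \<in> sets borel"
    by (intro sets.finite_INT) auto
  finally show ?thesis .
qed

lemma torus_periodicD: "torus_periodic f \<Longrightarrow> torus_eq x y \<Longrightarrow> f x = f y"
  by (auto simp: torus_periodic_def)

lemma torus_periodic_red: "torus_periodic f \<Longrightarrow> f (torus_red x) = f x"
  using torus_periodicD torus_eq_red by metis

section \<open>Substitution along coordinate patches of the torus\<close>

text \<open>Each piece \<open>E i\<close> carries a differentiable lift \<open>g i\<close>. Cutting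
  it further by the lattice vector that brings the lift back to the cell gives countably many Borel
  pieces on which the reduced map is \<open>g i\<close> minus a constant. The area formula holds on
  each of them, and countable additivity collects the results.\<close>

lemma torus_change_of_variables_sets:
  fixes \<kappa> :: "real ^ 'd::finite \<Rightarrow> real ^ 'd" and E :: "nat \<Rightarrow> (real ^ 'd) set"
  assumes E: "\<And>i. E i \<in> sets borel" and disj: "disjoint_family E"
    and der: "\<And>i x. x \<in> E i \<Longrightarrow> (g i has_derivative g' x) (at x within E i)"
    and lift: "\<And>i x. x \<in> E i \<Longrightarrow> torus_eq (\<kappa> x) (g i x)"
    and inj: "\<And>x y. x \<in> (\<Union>i. E i) \<Longrightarrow> y \<in> (\<Union>i. E i) \<Longrightarrow> torus_eq (\<kappa> x) (\<kappa> y) \<Longrightarrow> x = y"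
    and A: "A \<in> sets borel"
  defines "V \<equiv> {x. \<exists>X\<in>(\<Union>i. E i). torus_eq (\<kappa> X) x}"
  shows "(\<lambda>x. ennreal (abs_jac (g' x)) * indicator (\<Union>i. E i) x) \<in> borel_measurable lebesgue"
    and "{x \<in> (\<Union>i. E i). torus_red (\<kappa> x) \<in> A} \<in> sets borel"
    and "A \<inter> torus_cell \<inter> V \<in> sets lebesgue"
    and "(\<integral>\<^sup>+x. ennreal (abs_jac (g' x)) * indicator (\<Union>i. E i) x * indicator {x \<in> (\<Union>i. E i). torus_red (\<kappa> x) \<in> A} x \<partial>lebesgue)
      = emeasure lebesgue (A \<inter> torus_cell \<inter> V)"
proof -
  let ?U = "\<Union>i. E i"
  let ?D = "\<lambda>x. ennreal (abs_jac (g' x)) * indicator ?U x"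
  have cont: "continuous_on (E i) (g i)" for i
    using der has_derivative_continuous continuous_on_eq_continuous_within by blast
  define P where "P = (\<lambda>(i, k). {x \<in> E i. g i x - (2 * pi) *\<^sub>R k \<in> torus_cell \<inter> A})"
  define I where "I = (UNIV :: nat set) \<times> (int_vecs :: (real ^ 'd) set)"
  define G where "G = (\<lambda>(i, k) x. g i x - (2 * pi) *\<^sub>R k)"
  have cI: "countable I" unfolding I_def using countable_int_vecs by auto
  have Pb: "P p \<in> sets borel" for p
  proof (cases p)
    case (Pair i k)
    have "(\<lambda>x. g i x - (2 * pi) *\<^sub>R k) \<in> restrict_space borel (E i) \<rightarrow>\<^sub>M borel"
      by (intro borel_measurable_continuous_on_restrict continuous_intros cont)
    from measurable_sets[OF this, of "torus_cell \<inter> A"] 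
    have "(\<lambda>x. g i x - (2 * pi) *\<^sub>R k) -` (torus_cell \<inter> A) \<inter> E i \<in> sets (restrict_space borel (E i))"
      using A by (simp add: space_restrict_space)
    then have "(\<lambda>x. g i x - (2 * pi) *\<^sub>R k) -` (torus_cell \<inter> A) \<inter> E i \<in> sets borel"
      using E by (subst (asm) sets_restrict_space_iff) auto
    also have "(\<lambda>x. g i x - (2 * pi) *\<^sub>R k) -` (torus_cell \<inter> A) \<inter> E i = P p"
      unfolding P_def Pair by auto
    finally show ?thesis .
  qed
  have red: "torus_red (\<kappa> x) = G (i, k) x" if "(i, k) \<in> I" "x \<in> P (i, k)" for i k x
  proof -
    have "torus_eq (\<kappa> x) (g i x - (2 * pi) *\<^sub>R k)"
      using that lift torus_eq_shift torus_eq_trans unfolding P_def I_def by blast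
    then have "torus_red (\<kappa> x) = torus_red (g i x - (2 * pi) *\<^sub>R k)" by (rule torus_red_cong)
    then show ?thesis using that unfolding P_def G_def by (simp add: torus_red_cell)
  qed
  have PU: "(\<Union>p\<in>I. P p) = {x \<in> ?U. torus_red (\<kappa> x) \<in> A}"
  proof (intro equalityI subsetI)
    fix x assume "x \<in> (\<Union>p\<in>I. P p)"
    then obtain i k where *: "(i, k) \<in> I" "x \<in> P (i, k)" by auto
    then show "x \<in> {x \<in> ?U. torus_red (\<kappa> x) \<in> A}"
      using red[OF *] unfolding P_def G_def by auto
  next
    fix x assume x: "x \<in> {x \<in> ?U. torus_red (\<kappa> x) \<in> A}"
    then obtain i where i: "x \<in> E i" by auto
    have "torus_eq (g i x) (torus_red (\<kappa> x))"
      using lift[OF i] torus_eq_red torus_eq_sym torus_eq_trans by blast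
    from torus_eq_sym[OF this] obtain k where k: "k \<in> int_vecs" "g i x = torus_red (\<kappa> x) + (2 * pi) *\<^sub>R k"
      unfolding torus_eq_def by blast
    then have "x \<in> P (i, k)" using x i torus_red_in_cell by (simp add: P_def)
    then show "x \<in> (\<Union>p\<in>I. P p)" using k unfolding I_def by blast
  qed
  show UA: "{x \<in> ?U. torus_red (\<kappa> x) \<in> A} \<in> sets borel"
    unfolding PU[symmetric] using Pb cI by (intro sets.countable_UN') auto
  have Pdisj: "disjoint_family_on P I"
  proof (unfold disjoint_family_on_def, intro ballI impI)
    fix p q assume pq: "p \<in> I" "q \<in> I" "p \<noteq> q"
    show "P p \<inter> P q = {}"
    proof (rule ccontr)
      assume "P p \<inter> P q \<noteq> {}"
      then obtain x where x: "x \<in> P p" "x \<in> P q" by blast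
      obtain i k j l where p: "p = (i, k)" and q: "q = (j, l)" by (meson surj_pair)
      have "i = j" using x disj unfolding P_def p q disjoint_family_on_def by auto
      moreover have "G (i, k) x = G (j, l) x"
        using red[of i k x] red[of j l x] x pq unfolding p q by simp
      ultimately show False using pq p q unfolding G_def by simp
    qed
  qed
  have Dm: "(\<lambda>x. ennreal (abs_jac (g' x)) * indicator (E i) x) \<in> borel_measurable lebesgue" if "inj_on (g i) (E i)" for i
  proof -
    have "(\<lambda>x. abs_jac (g' x)) \<in> borel_measurable (lebesgue_on (E i))"
      by (rule nn_integral_abs_jac(3)[OF E der that])
    then have "(\<lambda>x. ennreal (abs_jac (g' x))) \<in> borel_measurable (lebesgue_on (E i))" by measurable
    then show ?thesis using E by (subst (asm) borel_measurable_restrict_space_iff_ennreal) auto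
  qed
  have ginj: "inj_on (g i) (E i)" for i
  proof (rule inj_onI)
    fix x y assume xy: "x \<in> E i" "y \<in> E i" "g i x = g i y"
    have "torus_eq (\<kappa> x) (g i y)" using lift[OF xy(1)] xy(3) by simp
    then have "torus_eq (\<kappa> x) (\<kappa> y)" using torus_eq_sym[OF lift[OF xy(2)]] by (rule torus_eq_trans)
    then show "x = y" using xy(1,2) by (intro inj) blast+
  qed
  show Dmeas: "?D \<in> borel_measurable lebesgue"
  proof -
    have "?D x = (\<Sum>i. ennreal (abs_jac (g' x)) * indicator (E i) x)" for x
      using suminf_indicator[OF disj, of x] by (simp add: ennreal_suminf_cmult)
    then have "?D = (\<lambda>x. \<Sum>i. ennreal (abs_jac (g' x)) * indicator (E i) x)" by (rule ext)
    then show ?thesis by (simp only:) (intro borel_measurable_suminf_order Dm[OF ginj])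
  qed
  have Ginj: "inj_on (G p) (P p)" for p
    using ginj unfolding G_def P_def by (cases p) (auto simp: inj_on_def)
  have Gder: "(G p has_derivative g' x) (at x within P p)" if "x \<in> P p" for p x
  proof (cases p)
    case (Pair i k)
    have "(g i has_derivative g' x) (at x within P p)"
      using that by (intro has_derivative_subset[OF der[of x i]]) (auto simp: P_def Pair)
    then show ?thesis unfolding G_def Pair by (auto intro!: derivative_eq_intros)
  qed
  have Gsets: "G p ` P p \<in> sets lebesgue" for p
    by (rule nn_integral_abs_jac(1)[OF Pb Gder Ginj])
  have GU: "(\<Union>p\<in>I. G p ` P p) = A \<inter> torus_cell \<inter> V"
  proof (intro equalityI subsetI)
    fix y assume "y \<in> (\<Union>p\<in>I. G p ` P p)"
    then obtain i k x where *: "(i, k) \<in> I" "x \<in> P (i, k)" "y = G (i, k) x" by auto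
    then have "y = torus_red (\<kappa> x)" using red by simp
    then show "y \<in> A \<inter> torus_cell \<inter> V"
      using * PU torus_red_in_cell torus_eq_red unfolding V_def by blast
  next
    fix y assume y: "y \<in> A \<inter> torus_cell \<inter> V"
    then obtain x where x: "x \<in> ?U" "torus_eq (\<kappa> x) y" unfolding V_def by blast
    have r: "torus_red (\<kappa> x) = y" using torus_red_cong[OF x(2)] torus_red_cell[of y] y by simp
    then have "x \<in> (\<Union>p\<in>I. P p)" unfolding PU using x y by auto
    then obtain i k where ik: "(i, k) \<in> I" "x \<in> P (i, k)" by auto
    have "y = G (i, k) x" using red[OF ik] r by simp
    then show "y \<in> (\<Union>p\<in>I. G p ` P p)" by (intro UN_I[OF ik(1)] image_eqI[OF _ ik(2)])
  qed
  \<comment> \<open>Here injectivity of \<open>\<kappa>\<close> modulo the lattice enters: a common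
    image point makes two parameters torus-equivalent, hence equal, and the pieces \<open>P\<close>
    are disjoint.\<close>
  have Gdisj: "disjoint_family_on (\<lambda>p. G p ` P p) I"
  proof (unfold disjoint_family_on_def, intro ballI impI)
    fix p q assume pq: "p \<in> I" "q \<in> I" "p \<noteq> q"
    show "G p ` P p \<inter> G q ` P q = {}"
    proof (rule ccontr)
      assume "G p ` P p \<inter> G q ` P q \<noteq> {}"
      then obtain x y where xy: "x \<in> P p" "y \<in> P q" "G p x = G q y" by blast
      have redp: "torus_red (\<kappa> z) = G r z" if "r \<in> I" "z \<in> P r" for r z
        using red[of "fst r" "snd r" z] that by simp
      have "torus_red (\<kappa> x) = torus_red (\<kappa> y)"
        using redp[OF pq(1) xy(1)] redp[OF pq(2) xy(2)] xy(3) by simp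
      then have "torus_eq (\<kappa> x) (\<kappa> y)"
        using torus_eq_trans[OF torus_eq_red[of "\<kappa> x"]] torus_eq_sym[OF torus_eq_red[of "\<kappa> y"]] by simp
      moreover have "x \<in> ?U" "y \<in> ?U" using xy pq PU by blast+
      ultimately have "x = y" using inj by blast
      then show False using xy Pdisj pq unfolding disjoint_family_on_def by blast
    qed
  qed
  show "A \<inter> torus_cell \<inter> V \<in> sets lebesgue"
    unfolding GU[symmetric] using Gsets cI by (intro sets.countable_UN') auto
  have "(\<integral>\<^sup>+x. ?D x * indicator {x \<in> ?U. torus_red (\<kappa> x) \<in> A} x \<partial>lebesgue) = emeasure (density lebesgue ?D) (\<Union>p\<in>I. P p)"
    using Dmeas UA unfolding PU by (subst emeasure_density) auto
  also have "\<dots> = (\<integral>\<^sup>+p. emeasure (density lebesgue ?D) (P p) \<partial>count_space I)"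
    using Pb cI Pdisj by (intro emeasure_UN_countable) auto
  also have "\<dots> = (\<integral>\<^sup>+p. emeasure lebesgue (G p ` P p) \<partial>count_space I)"
  proof (rule nn_integral_cong)
    fix p
    have "emeasure (density lebesgue ?D) (P p) = (\<integral>\<^sup>+x. ?D x * indicator (P p) x \<partial>lborel)"
      using Dmeas Pb by (subst emeasure_density) (auto simp: nn_integral_completion)
    also have "\<dots> = (\<integral>\<^sup>+x. ennreal (abs_jac (g' x)) * indicator (P p) x \<partial>lborel)"
      by (rule nn_integral_cong) (auto simp: P_def indicator_def split: prod.splits)
    also have "\<dots> = emeasure lebesgue (G p ` P p)"
      by (rule nn_integral_abs_jac(2)[OF Pb Gder Ginj])
    finally show "emeasure (density lebesgue ?D) (P p) = emeasure lebesgue (G p ` P p)" .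
  qed
  also have "\<dots> = emeasure lebesgue (\<Union>p\<in>I. G p ` P p)"
    using Gsets cI Gdisj by (intro emeasure_UN_countable[symmetric]) auto
  finally show "(\<integral>\<^sup>+x. ?D x * indicator {x \<in> ?U. torus_red (\<kappa> x) \<in> A} x \<partial>lebesgue) = emeasure lebesgue (A \<inter> torus_cell \<inter> V)"
    unfolding GU .
qed

lemma sets_torus_measure: "A \<in> sets torus_measure \<longleftrightarrow> A \<in> sets lebesgue \<and> A \<subseteq> (torus_cell :: (real ^ 'd::finite) set)"
  by (subst sets_restrict_space_iff) auto

text \<open>Passes from Borel to Lebesgue sets. Since a Lebesgue set is a Borel set up to a null
  part, the missing point is that null sets have null preimages.\<close>

lemma torus_change_of_variables:
  fixes \<kappa> :: "real ^ 'd::finite \<Rightarrow> real ^ 'd" and E :: "nat \<Rightarrow> (real ^ 'd) set"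
  assumes E: "\<And>i. E i \<in> sets borel" and disj: "disjoint_family E" and U: "U = (\<Union>i. E i)"
    and der: "\<And>i x. x \<in> E i \<Longrightarrow> (g i has_derivative g' x) (at x within E i)"
    and lift: "\<And>i x. x \<in> E i \<Longrightarrow> torus_eq (\<kappa> x) (g i x)"
    and inj: "\<And>x y. x \<in> U \<Longrightarrow> y \<in> U \<Longrightarrow> torus_eq (\<kappa> x) (\<kappa> y) \<Longrightarrow> x = y"
    and pos: "\<And>x. x \<in> U \<Longrightarrow> abs_jac (g' x) > 0"
  defines "V \<equiv> {x. \<exists>X\<in>U. torus_eq (\<kappa> X) x}"
  shows "V \<inter> torus_cell \<in> sets lebesgue"
    and "(\<lambda>x. abs_jac (g' x)) \<in> borel_measurable (lebesgue_on U)"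
    and "(\<lambda>x. torus_red (\<kappa> x)) \<in> lebesgue_on U \<rightarrow>\<^sub>M torus_measure"
    and "distr (density (lebesgue_on U) (\<lambda>x. ennreal (abs_jac (g' x)))) torus_measure (\<lambda>x. torus_red (\<kappa> x))
      = density torus_measure (indicator V)"
proof -
  let ?D = "\<lambda>x. ennreal (abs_jac (g' x)) * indicator U x"
  define m where "m A = {x \<in> U. torus_red (\<kappa> x) \<in> A}" for A
  note R = torus_change_of_variables_sets[where E = E and g = g and g' = g' and \<kappa> = \<kappa>, folded U]
  have Dm: "?D \<in> borel_measurable lebesgue"
    by (rule R(1)[where A = "{}"]) (rule E disj der lift inj sets.empty_sets | assumption)+
  have cov2: "m A \<in> sets borel" and cov3: "A \<inter> torus_cell \<inter> V \<in> sets lebesgue"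
    and cov4: "(\<integral>\<^sup>+x. ?D x * indicator (m A) x \<partial>lebesgue) = emeasure lebesgue (A \<inter> torus_cell \<inter> V)"
    if A: "A \<in> sets borel" for A
    unfolding m_def V_def
    by ((rule R(2) R(3) R(4), (rule E disj der lift inj A | assumption)+)+)
  have Ub: "U \<in> sets borel" unfolding U using E by blast
  show Vc: "V \<inter> torus_cell \<in> sets lebesgue" using cov3[of UNIV] by (simp add: Int_commute)
  \<comment> \<open>The weighted measure of the preimage is the measure of a null set; as the weight
    is positive on all of \<open>U\<close>, the preimage itself is null.\<close>
  have null: "m N \<in> null_sets lebesgue" if "N \<in> null_sets lborel" for N
  proof -
    have N: "N \<in> sets borel" using that by auto
    have "N \<inter> torus_cell \<inter> V \<in> null_sets lebesgue"
      by (rule null_sets_completion_subset[OF _ null_sets_completionI[OF that]]) auto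
    then have "(\<integral>\<^sup>+x. ?D x * indicator (m N) x \<partial>lebesgue) = 0"
      using cov4[OF N] by auto
    moreover have mN: "m N \<in> sets lebesgue" using cov2[OF N] by auto
    ultimately have "AE x in lebesgue. ?D x * indicator (m N) x = 0"
      using Dm by (subst (asm) nn_integral_0_iff_AE) auto
    then have "AE x in lebesgue. x \<notin> m N"
      by eventually_elim (use pos in \<open>force simp: m_def indicator_def ennreal_eq_0_iff not_le[symmetric] split: if_splits\<close>)
    then show ?thesis using mN by (simp add: AE_iff_null_sets)
  qed
  have key: "m A \<in> sets lebesgue \<and> (\<integral>\<^sup>+x. ?D x * indicator (m A) x \<partial>lebesgue) = emeasure lebesgue (A \<inter> (V \<inter> torus_cell))"
    if A: "A \<in> sets lebesgue" for A
  proof -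
    let ?B = "main_part lborel A" and ?N = "null_part lborel A"
    have eq: "A = ?B \<union> ?N" using main_part_null_part_Un[OF A] by simp
    have B: "?B \<in> sets borel" using main_part_sets[OF A] by simp
    obtain N' where N': "N' \<in> null_sets lborel" "?N \<subseteq> N'" using null_part[OF A] by blast
    have mA: "m A = m ?B \<union> m ?N" using eq unfolding m_def by blast
    have "m ?N \<subseteq> m N'" using N' by (auto simp: m_def)
    then have mN: "m ?N \<in> null_sets lebesgue" using null_sets_completion_subset[OF _ null[OF N'(1)]] by blast
    have mB: "m ?B \<in> sets lebesgue" using cov2[OF B] by auto
    have 1: "m A \<in> sets lebesgue" unfolding mA using mB null_setsD2[OF mN] by blast
    have "(\<integral>\<^sup>+x. ?D x * indicator (m A) x \<partial>lebesgue) = (\<integral>\<^sup>+x. ?D x * indicator (m ?B) x \<partial>lebesgue)"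
    proof (rule nn_integral_cong_AE)
      show "AE x in lebesgue. ?D x * indicator (m A) x = ?D x * indicator (m ?B) x"
        using AE_not_in[OF mN] by eventually_elim (auto simp: mA indicator_def)
    qed
    also have "\<dots> = emeasure lebesgue (?B \<inter> (V \<inter> torus_cell))"
      using cov4[OF B] by (simp add: Int_ac)
    also have "\<dots> = emeasure lebesgue ((?B \<inter> (V \<inter> torus_cell)) \<union> (?N \<inter> (V \<inter> torus_cell)))"
    proof (rule emeasure_Un_null_set[symmetric])
      show "?B \<inter> (V \<inter> torus_cell) \<in> sets lebesgue" using B Vc by auto
      have "?N \<inter> (V \<inter> torus_cell) \<subseteq> N'" using N' by blast
      then show "?N \<inter> (V \<inter> torus_cell) \<in> null_sets lebesgue"
        using null_sets_completion_subset[OF _ null_sets_completionI[OF N'(1)]] by blast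
    qed
    also have "(?B \<inter> (V \<inter> torus_cell)) \<union> (?N \<inter> (V \<inter> torus_cell)) = A \<inter> (V \<inter> torus_cell)"
      using eq by blast
    finally show ?thesis using 1 by blast
  qed
  have cellL: "torus_cell \<in> sets lebesgue" by simp
  have UL: "U \<in> sets lebesgue" using Ub by simp
  have "(\<lambda>x. ennreal (abs_jac (g' x))) \<in> borel_measurable (lebesgue_on U)"
    using Dm UL by (subst borel_measurable_restrict_space_iff_ennreal) auto
  then have "(\<lambda>x. enn2real (ennreal (abs_jac (g' x)))) \<in> borel_measurable (lebesgue_on U)" by measurable
  moreover have "abs_jac L \<ge> 0" for L :: "real ^ 'd \<Rightarrow> real ^ 'd" by (simp add: abs_jac_def)
  ultimately show Dm': "(\<lambda>x. abs_jac (g' x)) \<in> borel_measurable (lebesgue_on U)" by simp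
  show meas: "(\<lambda>x. torus_red (\<kappa> x)) \<in> lebesgue_on U \<rightarrow>\<^sub>M torus_measure"
  proof (rule measurableI)
    fix A :: "(real ^ 'd) set" assume "A \<in> sets torus_measure"
    then have A: "A \<in> sets lebesgue" by (simp add: sets_torus_measure)
    have "(\<lambda>x. torus_red (\<kappa> x)) -` A \<inter> U = m A" by (auto simp: m_def)
    moreover have "m A \<subseteq> U" by (auto simp: m_def)
    ultimately show "(\<lambda>x. torus_red (\<kappa> x)) -` A \<inter> space (lebesgue_on U) \<in> sets (lebesgue_on U)"
      using key[OF A] UL by (simp add: sets_restrict_space_iff)
  qed (simp add: torus_red_in_cell)
  show "distr (density (lebesgue_on U) (\<lambda>x. ennreal (abs_jac (g' x)))) torus_measure (\<lambda>x. torus_red (\<kappa> x))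
      = density torus_measure (indicator V)" (is "?M1 = ?M2")
  proof (rule measure_eqI)
    fix A assume "A \<in> sets ?M1"
    then have A': "A \<in> sets torus_measure" by simp
    then have A: "A \<in> sets lebesgue" "A \<subseteq> torus_cell" by (auto simp: sets_torus_measure)
    have mU: "m A \<inter> U = m A" by (auto simp: m_def)
    have mA: "m A \<in> sets (lebesgue_on U)"
      using key[OF A(1)] UL by (auto simp: sets_restrict_space_iff m_def)
    have "emeasure ?M1 A = emeasure (density (lebesgue_on U) (\<lambda>x. ennreal (abs_jac (g' x)))) (m A)"
      using meas A' by (subst emeasure_distr) (auto simp: m_def intro!: arg_cong2[where f = emeasure])
    also have "\<dots> = (\<integral>\<^sup>+x. ennreal (abs_jac (g' x)) * indicator (m A) x \<partial>lebesgue_on U)"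
      using mA Dm' by (subst emeasure_density) auto
    also have "\<dots> = (\<integral>\<^sup>+x. ?D x * indicator (m A) x \<partial>lebesgue)"
      using UL by (subst nn_integral_restrict_space) (auto intro!: nn_integral_cong simp: indicator_def)
    also have "\<dots> = emeasure lebesgue (A \<inter> (V \<inter> torus_cell))" using key[OF A(1)] by blast
    also have "\<dots> = emeasure torus_measure (A \<inter> (V \<inter> torus_cell))"
      using Vc cellL by (subst emeasure_restrict_space) auto
    also have "A \<inter> (V \<inter> torus_cell) = (V \<inter> torus_cell) \<inter> A" by auto
    also have "emeasure torus_measure ((V \<inter> torus_cell) \<inter> A) = emeasure (density torus_measure (indicator (V \<inter> torus_cell))) A"
      using Vc A' by (subst emeasure_restricted) (auto simp: sets_torus_measure)
    also have "density torus_measure (indicator (V \<inter> torus_cell)) = density torus_measure (indicator V)"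
    proof -
      have i: "(\<lambda>x. indicator (V \<inter> torus_cell) x) \<in> borel_measurable torus_measure"
        using Vc by (intro borel_measurable_indicator) (simp add: sets_torus_measure)
      have "(\<lambda>x. indicator V x :: ennreal) \<in> borel_measurable torus_measure"
        by (rule measurable_cong[THEN iffD1, OF _ i]) (auto simp: indicator_def space_restrict_space)
      then show ?thesis using i by (intro density_cong AE_I2) (simp_all add: space_restrict_space indicator_inter_arith)
    qed
    finally show "emeasure ?M1 A = emeasure ?M2 A" .
  qed simp
qed

text \<open>Exactly what integration asks of a patch: reduction modulo the lattice carries D(x) dx
  on \<open>U\<close> to dx on \<open>V\<close>. Coordinate patches and translations of the cell are
  both instances, and share the substitution rules below.\<close>

definition torus_param :: "(real ^ 'd::finite) set \<Rightarrow> (real ^ 'd \<Rightarrow> real ^ 'd) \<Rightarrow> (real ^ 'd \<Rightarrow> real) \<Rightarrow> (real ^ 'd) set \<Rightarrow> bool" where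
  "torus_param U \<kappa> D V \<longleftrightarrow> U \<in> sets lebesgue \<and> (\<forall>x\<in>U. D x > 0) \<and> D \<in> borel_measurable (lebesgue_on U) \<and>
     V \<inter> torus_cell \<in> sets lebesgue \<and> (\<lambda>x. torus_red (\<kappa> x)) \<in> lebesgue_on U \<rightarrow>\<^sub>M torus_measure \<and>
     distr (density (lebesgue_on U) (\<lambda>x. ennreal (D x))) torus_measure (\<lambda>x. torus_red (\<kappa> x))
       = density torus_measure (indicator V)"

lemma torus_paramI:
  fixes \<kappa> :: "real ^ 'd::finite \<Rightarrow> real ^ 'd" and E :: "nat \<Rightarrow> (real ^ 'd) set"
  assumes E: "\<And>i. E i \<in> sets borel" and disj: "disjoint_family E" and U: "U = (\<Union>i. E i)"
    and der: "\<And>i x. x \<in> E i \<Longrightarrow> (g i has_derivative g' x) (at x within E i)"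
    and lift: "\<And>i x. x \<in> E i \<Longrightarrow> torus_eq (\<kappa> x) (g i x)"
    and inj: "\<And>x y. x \<in> U \<Longrightarrow> y \<in> U \<Longrightarrow> torus_eq (\<kappa> x) (\<kappa> y) \<Longrightarrow> x = y"
    and pos: "\<And>x. x \<in> U \<Longrightarrow> abs_jac (g' x) > 0"
  shows "torus_param U \<kappa> (\<lambda>x. abs_jac (g' x)) {x. \<exists>X\<in>U. torus_eq (\<kappa> X) x}"
proof -
  note R = torus_change_of_variables[where E = E and U = U and g = g and g' = g' and \<kappa> = \<kappa>]
  have "U \<in> sets lebesgue" unfolding U using E by auto
  moreover have "{x. \<exists>X\<in>U. torus_eq (\<kappa> X) x} \<inter> torus_cell \<in> sets lebesgue"
    by (rule R(1)) (rule E disj U der lift inj pos | assumption)+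
  moreover have "(\<lambda>x. abs_jac (g' x)) \<in> borel_measurable (lebesgue_on U)"
    by (rule R(2)) (rule E disj U der lift inj pos | assumption)+
  moreover have "(\<lambda>x. torus_red (\<kappa> x)) \<in> lebesgue_on U \<rightarrow>\<^sub>M torus_measure"
    by (rule R(3)) (rule E disj U der lift inj pos | assumption)+
  moreover have "distr (density (lebesgue_on U) (\<lambda>x. ennreal (abs_jac (g' x)))) torus_measure (\<lambda>x. torus_red (\<kappa> x))
      = density torus_measure (indicator {x. \<exists>X\<in>U. torus_eq (\<kappa> X) x})"
    by (rule R(4)) (rule E disj U der lift inj pos | assumption)+
  ultimately show ?thesis using pos unfolding torus_param_def by blast
qed

lemma torus_param_measurable:
  assumes p: "torus_param U \<kappa> D V" and f: "f \<in> borel_measurable torus_measure" "torus_periodic f"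
  shows "(\<lambda>x. f (\<kappa> x)) \<in> borel_measurable (lebesgue_on U)"
  using measurable_compose[of "\<lambda>x. torus_red (\<kappa> x)" "lebesgue_on U" torus_measure f borel] p f
  by (simp add: torus_param_def torus_periodic_red)

lemma torus_param_indicator:
  assumes p: "torus_param U \<kappa> D V"
  shows "(indicator V :: _ \<Rightarrow> real) \<in> borel_measurable torus_measure"
proof -
  have i: "(\<lambda>x. indicator (V \<inter> torus_cell) x) \<in> borel_measurable torus_measure"
    using p by (intro borel_measurable_indicator) (simp add: sets_torus_measure torus_param_def)
  show "(\<lambda>x. indicator V x :: real) \<in> borel_measurable torus_measure"
    by (rule measurable_cong[THEN iffD1, OF _ i]) (auto simp: indicator_def space_restrict_space)
qed

lemma torus_param_integral:
  fixes f :: "real ^ 'd::finite \<Rightarrow> 'b::{banach, second_countable_topology}"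
  assumes p: "torus_param U \<kappa> D V" and f: "f \<in> borel_measurable torus_measure" "torus_periodic f"
  shows "integrable torus_measure (\<lambda>x. indicator V x *\<^sub>R f x) \<longleftrightarrow> integrable (lebesgue_on U) (\<lambda>x. D x *\<^sub>R f (\<kappa> x))"
    and "(LINT x|torus_measure. indicator V x *\<^sub>R f x) = (LINT x|lebesgue_on U. D x *\<^sub>R f (\<kappa> x))"
proof -
  have m: "(\<lambda>x. f (\<kappa> x)) \<in> borel_measurable (lebesgue_on U)"
    by (rule torus_param_measurable[OF p f])
  have D: "D \<in> borel_measurable (lebesgue_on U)" "AE x in lebesgue_on U. 0 \<le> D x"
    using p by (auto simp: torus_param_def intro!: AE_I2 less_imp_le)
  have r: "(\<lambda>x. torus_red (\<kappa> x)) \<in> density (lebesgue_on U) (\<lambda>x. ennreal (D x)) \<rightarrow>\<^sub>M torus_measure"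
    using p by (simp add: torus_param_def)
  let ?M = "distr (density (lebesgue_on U) (\<lambda>x. ennreal (D x))) torus_measure (\<lambda>x. torus_red (\<kappa> x))"
  have eq: "?M = density torus_measure (\<lambda>x. ennreal (indicator V x))"
    using p by (simp add: torus_param_def ennreal_indicator)
  have "integrable torus_measure (\<lambda>x. indicator V x *\<^sub>R f x) \<longleftrightarrow> integrable (density torus_measure (\<lambda>x. ennreal (indicator V x))) f"
    using f torus_param_indicator[OF p] by (intro integrable_density[symmetric]) auto
  also have "\<dots> \<longleftrightarrow> integrable ?M f" by (simp add: eq)
  also have "\<dots> \<longleftrightarrow> integrable (density (lebesgue_on U) (\<lambda>x. ennreal (D x))) (\<lambda>x. f (torus_red (\<kappa> x)))"
    using r f by (intro integrable_distr_eq) auto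
  also have "\<dots> \<longleftrightarrow> integrable (lebesgue_on U) (\<lambda>x. D x *\<^sub>R f (\<kappa> x))"
    using f m D by (subst integrable_density) (auto simp: torus_periodic_red)
  finally show "integrable torus_measure (\<lambda>x. indicator V x *\<^sub>R f x) \<longleftrightarrow> integrable (lebesgue_on U) (\<lambda>x. D x *\<^sub>R f (\<kappa> x))" .
  have "(LINT x|torus_measure. indicator V x *\<^sub>R f x) = integral\<^sup>L (density torus_measure (\<lambda>x. ennreal (indicator V x))) f"
    using f torus_param_indicator[OF p] by (intro integral_density[symmetric]) auto
  also have "\<dots> = integral\<^sup>L ?M f" by (simp add: eq)
  also have "\<dots> = integral\<^sup>L (density (lebesgue_on U) (\<lambda>x. ennreal (D x))) (\<lambda>x. f (torus_red (\<kappa> x)))"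
    using r f by (intro integral_distr) auto
  also have "\<dots> = (LINT x|lebesgue_on U. D x *\<^sub>R f (\<kappa> x))"
    using f m D by (subst integral_density) (auto simp: torus_periodic_red)
  finally show "(LINT x|torus_measure. indicator V x *\<^sub>R f x) = (LINT x|lebesgue_on U. D x *\<^sub>R f (\<kappa> x))" .
qed

lemma torus_param_nn_integral:
  assumes p: "torus_param U \<kappa> D V" and f: "f \<in> borel_measurable torus_measure" "torus_periodic f"
  shows "(\<integral>\<^sup>+x. indicator V x * f x \<partial>torus_measure) = (\<integral>\<^sup>+x. ennreal (D x) * f (\<kappa> x) \<partial>lebesgue_on U)"
proof -
  have m: "(\<lambda>x. f (\<kappa> x)) \<in> borel_measurable (lebesgue_on U)"
    by (rule torus_param_measurable[OF p f])
  have D: "D \<in> borel_measurable (lebesgue_on U)"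
    using p by (auto simp: torus_param_def)
  have r: "(\<lambda>x. torus_red (\<kappa> x)) \<in> density (lebesgue_on U) (\<lambda>x. ennreal (D x)) \<rightarrow>\<^sub>M torus_measure"
    using p by (simp add: torus_param_def)
  let ?M = "distr (density (lebesgue_on U) (\<lambda>x. ennreal (D x))) torus_measure (\<lambda>x. torus_red (\<kappa> x))"
  have eq: "?M = density torus_measure (\<lambda>x. ennreal (indicator V x))"
    using p by (simp add: torus_param_def ennreal_indicator)
  have "(\<integral>\<^sup>+x. indicator V x * f x \<partial>torus_measure) = integral\<^sup>N (density torus_measure (\<lambda>x. ennreal (indicator V x))) f"
    using f measurable_compose[OF torus_param_indicator[OF p] measurable_ennreal]
    by (subst nn_integral_density) (simp_all add: ennreal_indicator)
  also have "\<dots> = integral\<^sup>N ?M f" by (simp add: eq)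
  also have "\<dots> = integral\<^sup>N (density (lebesgue_on U) (\<lambda>x. ennreal (D x))) (\<lambda>x. f (torus_red (\<kappa> x)))"
    using r f by (intro nn_integral_distr) auto
  also have "\<dots> = (\<integral>\<^sup>+x. ennreal (D x) * f (\<kappa> x) \<partial>lebesgue_on U)"
    using f m D by (subst nn_integral_density) (auto simp: torus_periodic_red)
  finally show ?thesis .
qed

lemma abs_jac_id: "abs_jac (\<lambda>x. x) = 1"
  by (simp add: abs_jac_def matrix_id)

text \<open>Every translate of the cell is again a fundamental domain, so the image is the whole
  torus and the substitution rule becomes translation invariance of torus integrals.\<close>

lemma torus_param_translation: "torus_param torus_cell (\<lambda>x. x + s) (\<lambda>x. 1) (UNIV :: (real ^ 'd::finite) set)"
proof -
  define E where "E = (\<lambda>i :: nat. if i = 0 then torus_cell else ({} :: (real ^ 'd) set))"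
  have "\<exists>X\<in>torus_cell. torus_eq (X + s) x" for x :: "real ^ 'd"
    by (rule bexI[of _ "torus_red (x - s)"])
      (use torus_eq_add[OF torus_eq_sym[OF torus_eq_red[of "x - s"]], of s] torus_red_in_cell in auto)
  then have V: "{x. \<exists>X\<in>torus_cell. torus_eq (X + s) x} = (UNIV :: (real ^ 'd) set)" by blast
  have U: "(torus_cell :: (real ^ 'd) set) = (\<Union>i. E i)" by (auto simp: E_def split: if_splits)
  have inj: "x = y" if "x \<in> torus_cell" "y \<in> torus_cell" "torus_eq (x + s) (y + s)" for x y :: "real ^ 'd"
    using torus_eq_cell_unique[OF that(1,2)] torus_eq_add[OF that(3), of "- s"] by simp
  note R = torus_paramI[where E = E and U = torus_cell and \<kappa> = "\<lambda>x. x + s" and g = "\<lambda>i x. x + s" and g' = "\<lambda>x y. y"]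
  have "torus_param torus_cell (\<lambda>x. x + s) (\<lambda>x. abs_jac (\<lambda>y :: real ^ 'd. y)) {x :: real ^ 'd. \<exists>X\<in>torus_cell. torus_eq (X + s) x}"
  proof (rule R)
    show "torus_cell = (\<Union>i. E i)" by (rule U)
    show "x = y" if "x \<in> torus_cell" "y \<in> torus_cell" "torus_eq (x + s) (y + s)" for x y by (rule inj[OF that])
  qed (auto simp: E_def disjoint_family_on_def abs_jac_id intro!: derivative_eq_intros)
  then show ?thesis by (simp only: V abs_jac_id)
qed

subsection \<open>Square-integrable functions on the torus\<close>

lemma torus_param_translation_integral:
  fixes f :: "real ^ 'd::finite \<Rightarrow> 'b::{banach, second_countable_topology}"
  assumes f: "f \<in> borel_measurable torus_measure" "torus_periodic f"
  shows "(LINT x|torus_measure. f (x + s)) = (LINT x|torus_measure. f x)"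
    and "integrable torus_measure (\<lambda>x. f (x + s)) \<longleftrightarrow> integrable torus_measure f"
  using torus_param_integral[OF torus_param_translation[of s] f] by simp_all

definition texp :: "real ^ 'd::finite \<Rightarrow> real ^ 'd \<Rightarrow> complex" where
  "texp k x = cis (k \<bullet> x)"

lemma texp_periodic: "k \<in> int_vecs \<Longrightarrow> torus_periodic (texp k)"
  by (auto simp: torus_periodic_def torus_eq_def texp_def inner_add_right cis_mult[symmetric] cis_multiple_2pi inner_int_vecs)

lemma texp_add: "texp (k + l) x = texp k x * texp l x"
  and texp_diff: "texp (k - l) x = texp k x * cnj (texp l x)"
  and texp_translate: "texp k (x + y) = texp k x * texp k y"
  and texp_0 [simp]: "texp 0 x = 1"
  and norm_texp [simp]: "norm (texp k x) = 1"
  by (simp_all add: texp_def inner_simps cis_mult cis_cnj)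

lemma continuous_texp [continuous_intros]: "continuous_on S f \<Longrightarrow> continuous_on S (\<lambda>x. texp k (f x))"
  unfolding texp_def by (intro continuous_intros)

lemma texp_measurable [measurable]: "texp k \<in> borel_measurable lebesgue" "texp k \<in> borel_measurable borel"
  by (auto intro!: measurable_completion borel_measurable_continuous_onI continuous_intros)

lemma torus_measurableI: "f \<in> borel_measurable lebesgue \<Longrightarrow> f \<in> borel_measurable torus_measure"
  by (rule measurable_restrict_space1)

text \<open>The half-open cell lies between an open and a closed box of equal volume.\<close>

lemma emeasure_torus: "emeasure torus_measure (torus_cell :: (real ^ 'd::finite) set) = ennreal ((2 * pi) ^ CARD('d))"
proof -
  let ?v = "\<chi> i. 2 * pi :: real ^ 'd"
  have p: "(\<Prod>b\<in>Basis. ?v \<bullet> b) = (2 * pi) ^ CARD('d)"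
    by (simp add: prod_Basis_vec inner_axis)
  have le: "0 \<bullet> b \<le> ?v \<bullet> b" if "b \<in> Basis" for b
    using that by (auto simp: Basis_vec_def inner_axis)
  have "emeasure lborel (torus_cell :: (real ^ 'd) set) \<le> emeasure lborel (cbox 0 ?v)"
    by (intro emeasure_mono) (auto simp: torus_cell_def mem_box_cart less_imp_le)
  also have "\<dots> = ennreal ((2 * pi) ^ CARD('d))"
    using le p by (subst emeasure_lborel_cbox) auto
  finally have 1: "emeasure lborel (torus_cell :: (real ^ 'd) set) \<le> ennreal ((2 * pi) ^ CARD('d))" .
  have "ennreal ((2 * pi) ^ CARD('d)) = emeasure lborel (box 0 ?v)"
    using le p by (subst emeasure_lborel_box) auto
  also have "\<dots> \<le> emeasure lborel (torus_cell :: (real ^ 'd) set)"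
    by (intro emeasure_mono) (auto simp: torus_cell_def mem_box_cart less_imp_le)
  finally show ?thesis using 1 by (simp add: emeasure_restrict_space)
qed

lemma finite_measure_torus: "finite_measure (torus_measure :: (real ^ 'd::finite) measure)"
  by (rule finite_measureI) (use emeasure_torus[where 'd = 'd] in simp)

lemma measure_torus: "measure torus_measure (torus_cell :: (real ^ 'd::finite) set) = (2 * pi) ^ CARD('d)"
  using emeasure_torus[where 'd = 'd] by (simp add: measure_def)

lemma torus_integrable_const [simp]: "integrable (torus_measure :: (real ^ 'd::finite) measure) (\<lambda>x. c :: 'b::{banach, second_countable_topology})"
  by (rule finite_measure.integrable_const[OF finite_measure_torus])

lemma torus_integrable_bounded:
  fixes f :: "real ^ 'd::finite \<Rightarrow> 'b::{banach, second_countable_topology}"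
  assumes "f \<in> borel_measurable torus_measure" "\<And>x. norm (f x) \<le> B"
  shows "integrable torus_measure f"
  by (rule finite_measure.integrable_const_bound[OF finite_measure_torus, of _ B]) (use assms in auto)

lemma torus_L2_periodic: "u \<in> torus_L2 \<Longrightarrow> torus_periodic u"
  and torus_L2_measurable_lebesgue: "u \<in> torus_L2 \<Longrightarrow> u \<in> borel_measurable lebesgue"
  and torus_L2_measurable: "u \<in> torus_L2 \<Longrightarrow> u \<in> borel_measurable torus_measure"
  and torus_L2_integrable: "u \<in> torus_L2 \<Longrightarrow> integrable torus_measure (\<lambda>x. (norm (u x))\<^sup>2)"
  by (auto simp: torus_L2_def intro: torus_measurableI)

lemma torus_periodic_comp: "torus_periodic f \<Longrightarrow> torus_periodic (\<lambda>x. h (f x))"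
  unfolding torus_periodic_def by metis

lemma torus_periodic_comp2: "torus_periodic f \<Longrightarrow> torus_periodic g \<Longrightarrow> torus_periodic (\<lambda>x. h (f x) (g x))"
  unfolding torus_periodic_def by metis

lemma torus_L2_add:
  assumes "u \<in> torus_L2" "v \<in> torus_L2" shows "(\<lambda>x. u x + v x) \<in> torus_L2"
proof -
  have "(norm (a + b))\<^sup>2 \<le> 2 * (norm a)\<^sup>2 + 2 * (norm b)\<^sup>2" for a b :: complex
  proof -
    have "(norm (a + b))\<^sup>2 \<le> (norm a + norm b)\<^sup>2" by (intro power_mono norm_triangle_ineq) auto
    also have "\<dots> \<le> 2 * (norm a)\<^sup>2 + 2 * (norm b)\<^sup>2"
      using zero_le_power2[of "norm a - norm b"] by (simp add: power2_eq_square algebra_simps)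
    finally show ?thesis .
  qed
  note le = this
  note [measurable] = torus_L2_measurable[OF assms(1)] torus_L2_measurable[OF assms(2)]
  have "integrable torus_measure (\<lambda>x. 2 * (norm (u x))\<^sup>2 + 2 * (norm (v x))\<^sup>2)"
    using torus_L2_integrable[OF assms(1)] torus_L2_integrable[OF assms(2)]
    by (intro Bochner_Integration.integrable_add integrable_mult_right)
  then have "integrable torus_measure (\<lambda>x. (norm (u x + v x))\<^sup>2)"
    by (rule Bochner_Integration.integrable_bound) (use le in \<open>auto intro!: AE_I2\<close>)
  moreover have "(\<lambda>x. u x + v x) \<in> borel_measurable lebesgue"
    using assms by (intro borel_measurable_add torus_L2_measurable_lebesgue)
  ultimately show ?thesis
    using torus_periodic_comp2[OF torus_L2_periodic[OF assms(1)] torus_L2_periodic[OF assms(2)], of "(+)"]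
    by (simp add: torus_L2_def)
qed

lemma torus_L2_scale:
  assumes "u \<in> torus_L2" shows "(\<lambda>x. c * u x) \<in> torus_L2"
  using assms torus_periodic_comp[of u "\<lambda>z. c * z"] by (simp add: torus_L2_def norm_mult power_mult_distrib borel_measurable_times)

lemma torus_L2_bounded:
  assumes "u \<in> borel_measurable lebesgue" "torus_periodic u" "\<And>x. norm (u x) \<le> B"
  shows "u \<in> torus_L2"
proof -
  have "integrable torus_measure (\<lambda>x. (norm (u x))\<^sup>2)"
    using assms(3) torus_measurableI[OF assms(1)] by (intro torus_integrable_bounded[of _ "B\<^sup>2"]) (simp_all add: power_mono)
  then show ?thesis using assms by (simp add: torus_L2_def)
qed

lemma torus_L2_mult_bounded:
  assumes u: "u \<in> torus_L2" and b: "b \<in> borel_measurable lebesgue" "torus_periodic b" "\<And>x. norm (b x) \<le> B"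
  shows "(\<lambda>x. b x * u x) \<in> torus_L2"
proof -
  note [measurable] = torus_L2_measurable[OF u] torus_measurableI[OF b(1)]
  have "integrable torus_measure (\<lambda>x. B\<^sup>2 * (norm (u x))\<^sup>2)"
    using torus_L2_integrable[OF u] by (rule integrable_mult_right)
  then have "integrable torus_measure (\<lambda>x. (norm (b x * u x))\<^sup>2)"
    by (rule Bochner_Integration.integrable_bound)
      (use b(3) in \<open>auto intro!: AE_I2 mult_right_mono power_mono simp: norm_mult power_mult_distrib\<close>)
  moreover have "(\<lambda>x. b x * u x) \<in> borel_measurable lebesgue"
    by (intro borel_measurable_times b(1) torus_L2_measurable_lebesgue[OF u])
  ultimately show ?thesis
    using torus_periodic_comp2[OF b(2) torus_L2_periodic[OF u], of "(*)"]
    by (simp add: torus_L2_def)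
qed

lemma torus_L2_diff: "u \<in> torus_L2 \<Longrightarrow> v \<in> torus_L2 \<Longrightarrow> (\<lambda>x. u x - v x) \<in> torus_L2"
  using torus_L2_add[OF _ torus_L2_scale[of v "-1"], of u] by simp

lemma torus_L2_zero: "(\<lambda>x. 0) \<in> torus_L2"
  by (rule torus_L2_bounded[of _ 0]) (auto simp: torus_periodic_def)

lemma torus_L2_sum: "finite F \<Longrightarrow> (\<And>k. k \<in> F \<Longrightarrow> u k \<in> torus_L2) \<Longrightarrow> (\<lambda>x. \<Sum>k\<in>F. u k x) \<in> torus_L2"
  by (induction F rule: finite_induct) (auto intro: torus_L2_add torus_L2_zero)

lemma texp_L2: "k \<in> int_vecs \<Longrightarrow> texp k \<in> torus_L2"
  by (rule torus_L2_bounded[of _ 1]) (auto simp: texp_periodic)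

section \<open>Seminorm, bounded sesquilinear forms and Fourier coefficients\<close>

text \<open>A seminorm on representatives, taken without the factor (2 pi)^-d; this is the origin of
  the powers of 2 pi in the identities for Fourier coefficients.\<close>

definition tnorm :: "(real ^ 'd::finite \<Rightarrow> complex) \<Rightarrow> real" where
  "tnorm u = sqrt (LINT x|torus_measure. (norm (u x))\<^sup>2)"

lemma tnorm_nonneg [simp]: "tnorm u \<ge> 0"
  by (simp add: tnorm_def)

lemma tnorm_power2: "(tnorm u)\<^sup>2 = (LINT x|torus_measure. (norm (u x))\<^sup>2)"
  by (simp add: tnorm_def)

lemma tnorm_scale: "tnorm (\<lambda>x. c * u x) = norm c * tnorm u"
  by (simp add: tnorm_def norm_mult power_mult_distrib real_sqrt_mult)

text \<open>The right-hand side is smallest at t = sqrt B / sqrt A. Adding a small \<open>d\<close>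
  to both roots keeps this choice meaningful when one of them vanishes. The lemma converts weighted
  arithmetic-geometric bounds into products, for Cauchy-Schwarz and again for Schur's test.\<close>

lemma le_sqrt_mult:
  fixes x A B :: real
  assumes "A \<ge> 0" "B \<ge> 0" "\<And>t. t > 0 \<Longrightarrow> x \<le> (t * A + B / t) / 2"
  shows "x \<le> sqrt A * sqrt B"
proof (rule field_le_epsilon)
  fix e :: real assume e: "e > 0"
  define a where "a = sqrt A" define b where "b = sqrt B"
  have ab: "A = a\<^sup>2" "B = b\<^sup>2" "a \<ge> 0" "b \<ge> 0" using assms by (auto simp: a_def b_def)
  define d where "d = e / (a + b + 1)"
  have d: "d > 0" "d * (a + b) \<le> e" using e ab by (auto simp: d_def field_simps)
  have p: "a + d > 0" "b + d > 0" using d ab by auto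
  have "x \<le> ((b + d) / (a + d) * A + B / ((b + d) / (a + d))) / 2" using p by (intro assms) auto
  also have "\<dots> = ((b + d) * (a\<^sup>2 / (a + d)) + (a + d) * (b\<^sup>2 / (b + d))) / 2" using ab by simp
  also have "\<dots> \<le> ((b + d) * a + (a + d) * b) / 2"
  proof -
    have "a\<^sup>2 / (a + d) \<le> a" "b\<^sup>2 / (b + d) \<le> b" using p d ab by (simp_all add: field_simps power2_eq_square)
    then show ?thesis using p by (intro divide_right_mono add_mono mult_left_mono) auto
  qed
  also have "\<dots> = a * b + d * (a + b) / 2" by (simp add: field_simps)
  also have "\<dots> \<le> a * b + e" using d e by simp
  finally show "x \<le> sqrt A * sqrt B + e" by (simp add: a_def b_def)
qed

lemma torus_L2_mult_integrable:
  assumes "u \<in> torus_L2" "v \<in> torus_L2"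
  shows "integrable torus_measure (\<lambda>x. norm (u x) * norm (v x))"
    and "integrable torus_measure (\<lambda>x. u x * cnj (v x))"
proof -
  have le: "norm (a * b) \<le> (norm a)\<^sup>2 + (norm b)\<^sup>2" for a b :: complex
  proof -
    have "0 \<le> norm a * norm b" by simp
    moreover have "2 * (norm a * norm b) \<le> (norm a)\<^sup>2 + (norm b)\<^sup>2"
      using zero_le_power2[of "norm a - norm b"] by (simp add: power2_eq_square algebra_simps)
    ultimately show ?thesis unfolding norm_mult by linarith
  qed
  have i: "integrable torus_measure (\<lambda>x. (norm (u x))\<^sup>2 + (norm (v x))\<^sup>2)"
    using assms by (intro Bochner_Integration.integrable_add torus_L2_integrable)
  note m = torus_L2_measurable[OF assms(1)] torus_L2_measurable[OF assms(2)]
  have cm: "(\<lambda>x. cnj (v x)) \<in> borel_measurable torus_measure"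
    by (rule borel_measurable_continuous_on[OF _ m(2)]) (intro continuous_intros)
  show "integrable torus_measure (\<lambda>x. norm (u x) * norm (v x))"
    by (rule Bochner_Integration.integrable_bound[OF i]) (use m le in \<open>auto intro!: AE_I2 simp: norm_mult\<close>)
  show "integrable torus_measure (\<lambda>x. u x * cnj (v x))"
    by (rule Bochner_Integration.integrable_bound[OF i]) (use m cm le in \<open>auto intro!: AE_I2 simp: norm_mult\<close>)
qed

lemma torus_Cauchy_Schwarz:
  assumes "u \<in> torus_L2" "v \<in> torus_L2"
  shows "(LINT x|torus_measure. norm (u x) * norm (v x)) \<le> tnorm u * tnorm v"
  unfolding tnorm_def
proof (rule le_sqrt_mult)
  fix t :: real assume t: "t > 0"
  have le: "a * b \<le> (t * a\<^sup>2 + b\<^sup>2 / t) / 2" for a b :: real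
    using t zero_le_power2[of "t * a - b"] by (simp add: field_simps power2_eq_square)
  have "(LINT x|torus_measure. norm (u x) * norm (v x)) \<le> (LINT x|torus_measure. (t * (norm (u x))\<^sup>2 + (norm (v x))\<^sup>2 / t) / 2)"
    by (intro integral_mono torus_L2_mult_integrable(1) integrable_divide_zero Bochner_Integration.integrable_add
          integrable_mult_right torus_L2_integrable assms le)
  also have "\<dots> = (t * (LINT x|torus_measure. (norm (u x))\<^sup>2) + (LINT x|torus_measure. (norm (v x))\<^sup>2) / t) / 2"
    using assms by (simp add: torus_L2_integrable)
  finally show "(LINT x|torus_measure. norm (u x) * norm (v x)) \<le> (t * (LINT x|torus_measure. (norm (u x))\<^sup>2) + (LINT x|torus_measure. (norm (v x))\<^sup>2) / t) / 2" .
qed auto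

lemma torus_inner_bound:
  assumes "u \<in> torus_L2" "v \<in> torus_L2"
  shows "norm (torus_inner u v) \<le> tnorm u * tnorm v"
proof -
  have "norm (torus_inner u v) \<le> (LINT x|torus_measure. norm (u x * cnj (v x)))"
    unfolding torus_inner_def by (rule integral_norm_bound)
  then show ?thesis using torus_Cauchy_Schwarz[OF assms] by (simp add: norm_mult)
qed

text \<open>Quantizations enter the limit argument only as the forms (op_h(a) u | v), with one
  constant \<open>C\<close> for all h. The multiplication forms that appear in the limit are of the
  same kind.\<close>

definition torus_form :: "real \<Rightarrow> ((real ^ 'd::finite \<Rightarrow> complex) \<Rightarrow> (real ^ 'd \<Rightarrow> complex) \<Rightarrow> complex) \<Rightarrow> bool" where
  "torus_form C B \<longleftrightarrow> C \<ge> 0 \<and>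
     (\<forall>u\<in>torus_L2. \<forall>v\<in>torus_L2. \<forall>w\<in>torus_L2. B (\<lambda>x. u x + v x) w = B u w + B v w \<and> B w (\<lambda>x. u x + v x) = B w u + B w v) \<and>
     (\<forall>u\<in>torus_L2. \<forall>v\<in>torus_L2. \<forall>c. B (\<lambda>x. c * u x) v = c * B u v \<and> B u (\<lambda>x. c * v x) = cnj c * B u v) \<and>
     (\<forall>u\<in>torus_L2. \<forall>v\<in>torus_L2. norm (B u v) \<le> C * tnorm u * tnorm v)"

lemma torus_form_add:
  assumes "torus_form C B" "u \<in> torus_L2" "v \<in> torus_L2" "w \<in> torus_L2"
  shows "B (\<lambda>x. u x + v x) w = B u w + B v w" "B w (\<lambda>x. u x + v x) = B w u + B w v"
  using assms unfolding torus_form_def by blast+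

lemma torus_form_scale:
  assumes "torus_form C B" "u \<in> torus_L2" "v \<in> torus_L2"
  shows "B (\<lambda>x. c * u x) v = c * B u v" "B u (\<lambda>x. c * v x) = cnj c * B u v"
  using assms unfolding torus_form_def by blast+

lemma torus_form_bound:
  assumes "torus_form C B" "u \<in> torus_L2" "v \<in> torus_L2"
  shows "norm (B u v) \<le> C * tnorm u * tnorm v" "C \<ge> 0"
  using assms unfolding torus_form_def by blast+

lemma torus_form_diff:
  assumes "torus_form C B" "u \<in> torus_L2" "v \<in> torus_L2" "w \<in> torus_L2"
  shows "B (\<lambda>x. u x - v x) w = B u w - B v w" "B w (\<lambda>x. u x - v x) = B w u - B w v"
  using torus_form_add[OF assms(1,2) torus_L2_scale[OF assms(3)] assms(4), of "-1"]
    torus_form_scale[OF assms(1) assms(3,4), of "-1"] torus_form_scale[OF assms(1) assms(4,3), of "-1"] by simp_all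

lemma torus_form_sum:
  assumes B: "torus_form C B" and F: "finite F" and u: "\<And>k. k \<in> F \<Longrightarrow> u k \<in> torus_L2" and v: "v \<in> torus_L2"
  shows "B (\<lambda>x. \<Sum>k\<in>F. c k * u k x) v = (\<Sum>k\<in>F. c k * B (u k) v)"
    and "B v (\<lambda>x. \<Sum>k\<in>F. c k * u k x) = (\<Sum>k\<in>F. cnj (c k) * B v (u k))"
proof -
  have z: "B (\<lambda>x. 0) v = 0" "B v (\<lambda>x. 0) = 0"
    using torus_form_scale[OF B torus_L2_zero v, of 0] torus_form_scale[OF B v torus_L2_zero, of 0] by simp_all
  have "B (\<lambda>x. \<Sum>k\<in>F. c k * u k x) v = (\<Sum>k\<in>F. c k * B (u k) v) \<and> B v (\<lambda>x. \<Sum>k\<in>F. c k * u k x) = (\<Sum>k\<in>F. cnj (c k) * B v (u k))"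
    using F u
  proof (induction F rule: finite_induct)
    case empty then show ?case using z by simp
  next
    case (insert k F)
    have 1: "(\<lambda>x. c k * u k x) \<in> torus_L2" using insert by (intro torus_L2_scale) auto
    have 2: "(\<lambda>x. \<Sum>k\<in>F. c k * u k x) \<in> torus_L2" using insert by (intro torus_L2_sum torus_L2_scale) auto
    have uk: "u k \<in> torus_L2" using insert by auto
    show ?case using insert torus_form_add[OF B 1 2 v] torus_form_scale[OF B uk v] torus_form_scale[OF B v uk] by simp
  qed
  then show "B (\<lambda>x. \<Sum>k\<in>F. c k * u k x) v = (\<Sum>k\<in>F. c k * B (u k) v)"
    and "B v (\<lambda>x. \<Sum>k\<in>F. c k * u k x) = (\<Sum>k\<in>F. cnj (c k) * B v (u k))" by auto
qed

text \<open>With \<open>b\<close> = 1 this is the inner product; with \<open>b\<close> an averaged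
  symbol it is the limit of the quantized forms, so that approximants and limit obey the same
  truncation estimates.\<close>

lemma torus_form_inner_bounded:
  fixes b :: "real ^ 'd::finite \<Rightarrow> complex"
  assumes b: "b \<in> borel_measurable lebesgue" "torus_periodic b" "\<And>x. norm (b x) \<le> K"
  shows "torus_form K (\<lambda>u v. LINT x|torus_measure. b x * (u x * cnj (v x)))"
proof -
  have K: "K \<ge> 0" using b(3)[of 0] norm_ge_zero order_trans by blast
  have i: "integrable torus_measure (\<lambda>x. b x * (u x * cnj (v x)))" if "u \<in> torus_L2" "v \<in> torus_L2" for u v
    using torus_L2_mult_integrable(2)[OF torus_L2_mult_bounded[OF that(1) b] that(2)] by (simp add: mult.assoc)
  have bd: "norm (LINT x|torus_measure. b x * (u x * cnj (v x))) \<le> K * tnorm u * tnorm v" if "u \<in> torus_L2" "v \<in> torus_L2" for u v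
  proof -
    have "norm (LINT x|torus_measure. b x * (u x * cnj (v x))) \<le> (LINT x|torus_measure. norm (b x * (u x * cnj (v x))))"
      by (rule integral_norm_bound)
    also have "\<dots> \<le> (LINT x|torus_measure. K * (norm (u x) * norm (v x)))"
      using that b(3) by (intro integral_mono integrable_norm i integrable_mult_right torus_L2_mult_integrable(1))
        (auto simp: norm_mult intro!: mult_right_mono)
    also have "\<dots> \<le> K * (tnorm u * tnorm v)" using torus_Cauchy_Schwarz[OF that] K by (simp add: mult_left_mono)
    finally show ?thesis by (simp add: mult.assoc)
  qed
  have "(LINT x|torus_measure. b x * ((u x + v x) * cnj (w x))) = (LINT x|torus_measure. b x * (u x * cnj (w x))) + (LINT x|torus_measure. b x * (v x * cnj (w x)))"
    "(LINT x|torus_measure. b x * (w x * cnj (u x + v x))) = (LINT x|torus_measure. b x * (w x * cnj (u x))) + (LINT x|torus_measure. b x * (w x * cnj (v x)))"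
    if "u \<in> torus_L2" "v \<in> torus_L2" "w \<in> torus_L2" for u v w
    using Bochner_Integration.integral_add[OF i[OF that(1,3)] i[OF that(2,3)]] Bochner_Integration.integral_add[OF i[OF that(3,1)] i[OF that(3,2)]]
    by (simp_all add: algebra_simps)
  moreover have "(LINT x|torus_measure. b x * ((c * u x) * cnj (v x))) = c * (LINT x|torus_measure. b x * (u x * cnj (v x)))"
    "(LINT x|torus_measure. b x * (u x * cnj (c * v x))) = cnj c * (LINT x|torus_measure. b x * (u x * cnj (v x)))"
    if "u \<in> torus_L2" "v \<in> torus_L2" for u v c
    using integral_mult_right_zero[of torus_measure c "\<lambda>x. b x * (u x * cnj (v x))"] integral_mult_right_zero[of torus_measure "cnj c" "\<lambda>x. b x * (u x * cnj (v x))"]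
    by (simp_all add: mult_ac)
  ultimately show ?thesis unfolding torus_form_def using K bd by blast
qed

lemma torus_form_inner: "torus_form 1 torus_inner"
  using torus_form_inner_bounded[of "\<lambda>x. 1" 1] by (simp add: torus_inner_def[abs_def] torus_periodic_def)

lemma tnorm_inner: "torus_inner u u = of_real ((tnorm u)\<^sup>2)"
  unfolding torus_inner_def tnorm_power2
  by (subst integral_complex_of_real[symmetric]) (simp only: complex_norm_square)

lemma torus_inner_cnj: "torus_inner v u = cnj (torus_inner u v)"
  unfolding torus_inner_def by (subst Bochner_Integration.integral_cnj[symmetric]) (simp add: mult.commute)

lemma torus_integral_texp:
  assumes k: "k \<in> int_vecs" "k \<noteq> (0 :: real ^ 'd::finite)"
  shows "(LINT x|torus_measure. texp k x) = 0"
proof -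
  \<comment> \<open>Half a wavelength in direction \<open>k\<close>: translation by
    \<open>?s\<close> multiplies \<open>texp k\<close> by cis pi = -1, so the integral equals its
    own negative.\<close>
  let ?s = "(pi / (norm k)\<^sup>2) *\<^sub>R k"
  have s: "texp k ?s = -1" using k by (simp add: texp_def dot_square_norm)
  have "(LINT x|torus_measure. texp k x) = (LINT x|torus_measure. texp k (x + ?s))"
    using k by (intro torus_param_translation_integral(1)[symmetric] texp_periodic torus_measurableI) auto
  also have "\<dots> = - (LINT x|torus_measure. texp k x)"
    by (simp only: texp_translate s) simp
  finally show ?thesis by simp
qed

lemma torus_inner_texp:
  assumes "k \<in> int_vecs" "l \<in> (int_vecs :: (real ^ 'd::finite) set)"
  shows "torus_inner (texp k) (texp l) = (if k = l then (2 * pi) ^ CARD('d) else 0)"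
  using torus_integral_texp[of "k - l"] assms measure_torus[where 'd = 'd]
  by (auto simp: torus_inner_def texp_diff[symmetric] scaleR_conv_of_real)

lemma fourier_coeff_inner:
  "fourier_coeff (u :: real ^ 'd::finite \<Rightarrow> complex) k = torus_inner u (texp k) / (2 * pi) ^ CARD('d)"
  by (simp add: fourier_coeff_def torus_inner_def texp_def cis_cnj)

definition trig :: "(real ^ 'd::finite) set \<Rightarrow> (real ^ 'd \<Rightarrow> complex) \<Rightarrow> real ^ 'd \<Rightarrow> complex" where
  "trig F c x = (\<Sum>k\<in>F. c k * texp k x)"

lemma trig_L2: "finite F \<Longrightarrow> F \<subseteq> int_vecs \<Longrightarrow> trig F c \<in> torus_L2"
  unfolding trig_def[abs_def] by (intro torus_L2_sum torus_L2_scale texp_L2) auto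

lemma torus_form_trig:
  assumes B: "torus_form C B" and F: "finite F" "F \<subseteq> int_vecs" and v: "v \<in> torus_L2"
  shows "B (trig F c) v = (\<Sum>k\<in>F. c k * B (texp k) v)"
    and "B v (trig F c) = (\<Sum>k\<in>F. cnj (c k) * B v (texp k))"
  unfolding trig_def[abs_def] using F by (auto intro!: torus_form_sum[OF B _ _ v] texp_L2)

lemma torus_form_trig2:
  assumes B: "torus_form C B" and F: "finite F" "F \<subseteq> int_vecs"
  shows "B (trig F c) (trig F c) = (\<Sum>k\<in>F. \<Sum>l\<in>F. c k * cnj (c l) * B (texp k) (texp l))"
proof -
  have "B (trig F c) (trig F c) = (\<Sum>k\<in>F. c k * B (texp k) (trig F c))"
    by (rule torus_form_trig(1)[OF B F trig_L2[OF F]])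
  also have "\<dots> = (\<Sum>k\<in>F. \<Sum>l\<in>F. c k * cnj (c l) * B (texp k) (texp l))"
  proof (rule sum.cong[OF refl])
    fix k assume "k \<in> F"
    then have "texp k \<in> torus_L2" using F texp_L2 by auto
    then show "c k * B (texp k) (trig F c) = (\<Sum>l\<in>F. c k * cnj (c l) * B (texp k) (texp l))"
      by (subst torus_form_trig(2)[OF B F]) (simp_all add: sum_distrib_left mult.assoc)
  qed
  finally show ?thesis .
qed

lemma fourier_coeff_trig:
  assumes F: "finite F" "F \<subseteq> int_vecs" and l: "l \<in> int_vecs"
  shows "fourier_coeff (trig F c) l = (if l \<in> F then c l else (0 :: complex))"
proof -
  have "torus_inner (trig F c) (texp l) = (\<Sum>k\<in>F. c k * torus_inner (texp k) (texp l))"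
    by (rule torus_form_trig(1)[OF torus_form_inner F texp_L2[OF l]])
  also have "\<dots> = (\<Sum>k\<in>F. if k = l then c k * (2 * pi) ^ CARD('a) else 0)"
    by (rule sum.cong) (use F l in \<open>auto simp: torus_inner_texp subset_iff\<close>)
  also have "\<dots> = (if l \<in> F then c l * (2 * pi) ^ CARD('a) else 0)"
    using F by (simp add: sum.delta')
  finally show ?thesis by (simp add: fourier_coeff_inner)
qed

text \<open>Completing the square in the coefficients. Only the last sum depends on
  \<open>c\<close>, which yields both Bessel's inequality and the best approximation property of
  Fourier sums.\<close>

lemma tnorm_trig_diff:
  fixes u :: "real ^ 'd::finite \<Rightarrow> complex"
  assumes u: "u \<in> torus_L2" and F: "finite F" "F \<subseteq> int_vecs"
  shows "(tnorm (\<lambda>x. u x - trig F c x))\<^sup>2 = (tnorm u)\<^sup>2 - (2 * pi) ^ CARD('d) * (\<Sum>k\<in>F. (norm (fourier_coeff u k))\<^sup>2)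
    + (2 * pi) ^ CARD('d) * (\<Sum>k\<in>F. (norm (fourier_coeff u k - c k))\<^sup>2)"
proof -
  let ?P = "(2 * pi) ^ CARD('d) :: complex"
  note d = torus_form_diff[OF torus_form_inner]
  note P = trig_L2[OF F, of c]
  have 1: "torus_inner u (trig F c) = ?P * (\<Sum>k\<in>F. fourier_coeff u k * cnj (c k))"
    by (subst torus_form_trig(2)[OF torus_form_inner F u]) (simp add: sum_distrib_left fourier_coeff_inner field_simps)
  have 2: "torus_inner (trig F c) u = ?P * (\<Sum>k\<in>F. c k * cnj (fourier_coeff u k))"
    by (subst torus_inner_cnj) (simp add: 1 mult.commute)
  have 3: "torus_inner (trig F c) (trig F c) = ?P * (\<Sum>k\<in>F. c k * cnj (c k))"
    unfolding torus_form_trig(1)[OF torus_form_inner F P] sum_distrib_left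
  proof (rule sum.cong[OF refl])
    fix k assume k: "k \<in> F"
    have "torus_inner (texp k) (trig F c) = cnj (torus_inner (trig F c) (texp k))" by (rule torus_inner_cnj)
    also have "torus_inner (trig F c) (texp k) = fourier_coeff (trig F c) k * ?P" by (simp add: fourier_coeff_inner)
    also have "\<dots> = c k * ?P" using k F fourier_coeff_trig[OF F, of k c] by auto
    finally show "c k * torus_inner (texp k) (trig F c) = ?P * (c k * cnj (c k))" by simp
  qed
  have "complex_of_real ((tnorm (\<lambda>x. u x - trig F c x))\<^sup>2) = torus_inner (\<lambda>x. u x - trig F c x) (\<lambda>x. u x - trig F c x)"
    by (simp add: tnorm_inner)
  also have "\<dots> = torus_inner u u - torus_inner u (trig F c) - (torus_inner (trig F c) u - torus_inner (trig F c) (trig F c))"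
    by (simp add: d[OF u P torus_L2_diff[OF u P]] d[OF u P u] d[OF u P P])
  also have "\<dots> = torus_inner u u - ?P * (\<Sum>k\<in>F. fourier_coeff u k * cnj (fourier_coeff u k)) + ?P * (\<Sum>k\<in>F. (fourier_coeff u k - c k) * cnj (fourier_coeff u k - c k))"
    unfolding 1 2 3 by (simp add: algebra_simps sum.distrib sum_subtractf)
  also have "\<dots> = complex_of_real ((tnorm u)\<^sup>2 - (2 * pi) ^ CARD('d) * (\<Sum>k\<in>F. (norm (fourier_coeff u k))\<^sup>2)
    + (2 * pi) ^ CARD('d) * (\<Sum>k\<in>F. (norm (fourier_coeff u k - c k))\<^sup>2))"
    by (simp only: tnorm_inner complex_norm_square[symmetric]) simp
  finally show ?thesis by (simp only: of_real_eq_iff)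
qed

subsection \<open>Completeness of the exponentials\<close>

lemma tnorm_triangle:
  assumes "u \<in> torus_L2" "v \<in> torus_L2"
  shows "tnorm (\<lambda>x. u x + v x) \<le> tnorm u + tnorm v"
proof -
  note a = torus_form_add[OF torus_form_inner] and uv = torus_L2_add[OF assms]
  have "complex_of_real ((tnorm (\<lambda>x. u x + v x))\<^sup>2) = torus_inner u u + torus_inner u v + (torus_inner v u + torus_inner v v)"
    unfolding tnorm_inner[symmetric] a(1)[OF assms uv] a(2)[OF assms assms(1)] a(2)[OF assms assms(2)] by (rule refl)
  then have "(tnorm (\<lambda>x. u x + v x))\<^sup>2 = Re (torus_inner u u + torus_inner u v + (torus_inner v u + torus_inner v v))"
    by (metis Re_complex_of_real)
  also have "\<dots> = (tnorm u)\<^sup>2 + (tnorm v)\<^sup>2 + 2 * Re (torus_inner u v)"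
    by (simp add: tnorm_inner torus_inner_cnj[of v u] del: of_real_power)
  also have "\<dots> \<le> (tnorm u)\<^sup>2 + (tnorm v)\<^sup>2 + 2 * (tnorm u * tnorm v)"
    using order_trans[OF complex_Re_le_cmod torus_inner_bound[OF assms]] by simp
  also have "\<dots> = (tnorm u + tnorm v)\<^sup>2" by (simp add: power2_eq_square algebra_simps)
  finally show ?thesis by (rule power2_le_imp_le) simp
qed

lemma tnorm_triangle_diff:
  assumes "u \<in> torus_L2" "v \<in> torus_L2" "w \<in> torus_L2"
  shows "tnorm (\<lambda>x. u x - w x) \<le> tnorm (\<lambda>x. u x - v x) + tnorm (\<lambda>x. v x - w x)"
  using tnorm_triangle[OF torus_L2_diff[OF assms(1,2)] torus_L2_diff[OF assms(2,3)]] by simp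

lemma tnorm_le_bound:
  fixes u :: "real ^ 'd::finite \<Rightarrow> complex"
  assumes "u \<in> torus_L2" "\<And>x. norm (u x) \<le> e"
  shows "tnorm u \<le> e * sqrt ((2 * pi) ^ CARD('d))"
proof -
  have e: "e \<ge> 0" using assms(2)[of 0] norm_ge_zero order_trans by blast
  have "(LINT x|torus_measure. (norm (u x))\<^sup>2) \<le> (LINT x|(torus_measure :: (real ^ 'd) measure). e\<^sup>2)"
    by (rule integral_mono) (use assms torus_L2_integrable[OF assms(1)] in \<open>auto intro!: power_mono\<close>)
  also have "\<dots> = e\<^sup>2 * (2 * pi) ^ CARD('d)" using measure_torus[where 'd = 'd] by simp
  finally have "tnorm u \<le> sqrt (e\<^sup>2 * (2 * pi) ^ CARD('d))" unfolding tnorm_def by (rule real_sqrt_le_mono)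
  also have "\<dots> = e * sqrt ((2 * pi) ^ CARD('d))" using e by (simp only: real_sqrt_mult real_sqrt_abs abs_of_nonneg)
  finally show ?thesis .
qed

text \<open>Membership in the L^2 closure of the trigonometric polynomials; \<open>tdense_L2\<close>
  shows that this is no restriction.\<close>

definition tdense :: "(real ^ 'd::finite \<Rightarrow> complex) \<Rightarrow> bool" where
  "tdense u \<longleftrightarrow> u \<in> torus_L2 \<and> (\<forall>e>0. \<exists>F c. finite F \<and> F \<subseteq> int_vecs \<and> tnorm (\<lambda>x. u x - trig F c x) < e)"

lemma tdense_limit:
  assumes u: "u \<in> torus_L2" and e: "\<And>e. e > 0 \<Longrightarrow> \<exists>v. tdense v \<and> tnorm (\<lambda>x. u x - v x) < e"
  shows "tdense u"
  unfolding tdense_def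
proof (intro conjI allI impI)
  fix e :: real assume e0: "e > 0"
  obtain v where v: "tdense v" "tnorm (\<lambda>x. u x - v x) < e / 2" using e[of "e / 2"] e0 by auto
  obtain F c where F: "finite F" "F \<subseteq> int_vecs" "tnorm (\<lambda>x. v x - trig F c x) < e / 2"
    using v(1) e0 unfolding tdense_def by (meson half_gt_zero)
  have vL: "v \<in> torus_L2" using v by (simp add: tdense_def)
  have "tnorm (\<lambda>x. u x - trig F c x) < e"
    using tnorm_triangle_diff[OF u vL trig_L2[OF F(1,2), of c]] v(2) F(3) by linarith
  then show "\<exists>F c. finite F \<and> F \<subseteq> int_vecs \<and> tnorm (\<lambda>x. u x - trig F c x) < e" using F by blast
qed (rule u)

text \<open>Dominated convergence for the squared distance, followed by closedness of the
  closure.\<close>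

lemma tdense_sequence:
  assumes u: "u \<in> torus_L2" and f: "\<And>n. tdense (f n)"
    and lim: "AE x in torus_measure. (\<lambda>n. f n x) \<longlonglongrightarrow> u x"
    and w: "integrable torus_measure w" "\<And>n. AE x in torus_measure. (norm (u x - f n x))\<^sup>2 \<le> w x"
  shows "tdense u"
proof (rule tdense_limit[OF u])
  fix e :: real assume e: "e > 0"
  have fL: "f n \<in> torus_L2" for n using f by (simp add: tdense_def)
  have m: "(\<lambda>x. (norm (u x - f n x))\<^sup>2) \<in> borel_measurable torus_measure" for n
    using torus_L2_measurable[OF u] torus_L2_measurable[OF fL[of n]] by measurable
  have "(\<lambda>n. LINT x|torus_measure. (norm (u x - f n x))\<^sup>2) \<longlonglongrightarrow> (LINT x|(torus_measure :: (real ^ 'a) measure). 0)"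
  proof (rule integral_dominated_convergence[OF _ m w(1)])
    show "AE x in torus_measure. (\<lambda>n. (norm (u x - f n x))\<^sup>2) \<longlonglongrightarrow> 0"
      using lim
    proof eventually_elim
      case (elim x)
      have "(\<lambda>n. (norm (u x - f n x))\<^sup>2) \<longlonglongrightarrow> (norm (u x - u x))\<^sup>2" by (intro tendsto_intros elim)
      then show ?case by simp
    qed
    show "AE x in torus_measure. norm ((norm (u x - f n x))\<^sup>2) \<le> w x" for n using w(2)[of n] by simp
  qed simp
  then have "eventually (\<lambda>n. (LINT x|torus_measure. (norm (u x - f n x))\<^sup>2) < e\<^sup>2) sequentially"
    using e by (intro order_tendstoD) auto
  then obtain n where "(LINT x|torus_measure. (norm (u x - f n x))\<^sup>2) < e\<^sup>2" by (auto simp: eventually_sequentially)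
  then have "tnorm (\<lambda>x. u x - f n x) < sqrt (e\<^sup>2)" unfolding tnorm_def by (rule real_sqrt_less_mono)
  then show "\<exists>v. tdense v \<and> tnorm (\<lambda>x. u x - v x) < e" using f e by auto
qed

definition is_trig :: "(real ^ 'd::finite \<Rightarrow> complex) \<Rightarrow> bool" where
  "is_trig f \<longleftrightarrow> (\<exists>F c. finite F \<and> F \<subseteq> int_vecs \<and> f = trig F c)"

lemma is_trig_texp: "k \<in> int_vecs \<Longrightarrow> is_trig (\<lambda>x. a * texp k x)"
  unfolding is_trig_def by (intro exI[of _ "{k}"] exI[of _ "\<lambda>_. a"]) (auto simp: trig_def)

lemma is_trig_add: assumes "is_trig f" "is_trig g" shows "is_trig (\<lambda>x. f x + g x)"
proof -
  obtain F c G d where *: "finite F" "F \<subseteq> int_vecs" "f = trig F c" "finite G" "G \<subseteq> int_vecs" "g = trig G d"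
    using assms unfolding is_trig_def by blast
  have 1: "trig F c x = (\<Sum>k\<in>F \<union> G. (if k \<in> F then c k else 0) * texp k x)" for x
    unfolding trig_def using * by (intro sum.mono_neutral_cong_left) auto
  have 2: "trig G d x = (\<Sum>k\<in>F \<union> G. (if k \<in> G then d k else 0) * texp k x)" for x
    unfolding trig_def using * by (intro sum.mono_neutral_cong_left) auto
  have "(\<lambda>x. f x + g x) = trig (F \<union> G) (\<lambda>k. (if k \<in> F then c k else 0) + (if k \<in> G then d k else 0))"
    unfolding *(3,6)
  proof (rule ext)
    fix x show "trig F c x + trig G d x = trig (F \<union> G) (\<lambda>k. (if k \<in> F then c k else 0) + (if k \<in> G then d k else 0)) x"
      unfolding trig_def[of "F \<union> G"] distrib_right sum.distrib by (simp only: 1[symmetric] 2[symmetric])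
  qed
  moreover have "finite (F \<union> G)" "F \<union> G \<subseteq> int_vecs" using * by auto
  ultimately show ?thesis unfolding is_trig_def by blast
qed

lemma is_trig_zero: "is_trig (\<lambda>x. 0)"
  using is_trig_texp[of 0 0] by simp

lemma is_trig_sum: "finite A \<Longrightarrow> (\<And>a. a \<in> A \<Longrightarrow> is_trig (f a)) \<Longrightarrow> is_trig (\<lambda>x. \<Sum>a\<in>A. f a x)"
  by (induction A rule: finite_induct) (auto intro: is_trig_zero is_trig_add)

lemma is_trig_mult: assumes "is_trig f" "is_trig g" shows "is_trig (\<lambda>x. f x * g x)"
proof -
  obtain F c G d where *: "finite F" "F \<subseteq> int_vecs" "f = trig F c" "finite G" "G \<subseteq> int_vecs" "g = trig G d"
    using assms unfolding is_trig_def by blast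
  have "(\<lambda>x. f x * g x) = (\<lambda>x. \<Sum>k\<in>F. \<Sum>l\<in>G. (c k * d l) * texp (k + l) x)"
    unfolding *(3,6) trig_def sum_product texp_add by (intro ext sum.cong refl) simp
  moreover have "is_trig (\<lambda>x. \<Sum>k\<in>F. \<Sum>l\<in>G. (c k * d l) * texp (k + l) x)"
    using * by (intro is_trig_sum is_trig_texp int_vecs_simps) auto
  ultimately show ?thesis by simp
qed

lemma tdense_trig: "is_trig f \<Longrightarrow> tdense f"
proof -
  assume "is_trig f"
  then obtain F c where F: "finite F" "F \<subseteq> int_vecs" "f = trig F c" unfolding is_trig_def by blast
  moreover have "tnorm (\<lambda>x. f x - trig F c x) = 0" by (simp add: F(3) tnorm_def)
  ultimately show "tdense f" unfolding tdense_def using trig_L2[OF F(1,2)] by metis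
qed

lemma tdense_add: assumes "tdense u" "tdense v" shows "tdense (\<lambda>x. u x + v x)"
proof -
  have L: "u \<in> torus_L2" "v \<in> torus_L2" using assms by (auto simp: tdense_def)
  show ?thesis
  proof (rule tdense_limit[OF torus_L2_add[OF L]])
    fix e :: real assume e: "e > 0"
    obtain F c where F: "finite F" "F \<subseteq> int_vecs" "tnorm (\<lambda>x. u x - trig F c x) < e / 2"
      using assms(1) e unfolding tdense_def by (meson half_gt_zero)
    obtain G d where G: "finite G" "G \<subseteq> int_vecs" "tnorm (\<lambda>x. v x - trig G d x) < e / 2"
      using assms(2) e unfolding tdense_def by (meson half_gt_zero)
    have "is_trig (trig F c)" "is_trig (trig G d)" using F G unfolding is_trig_def by auto
    then have "tdense (\<lambda>x. trig F c x + trig G d x)" by (intro tdense_trig is_trig_add)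
    moreover have "tnorm (\<lambda>x. (u x - trig F c x) + (v x - trig G d x)) < e"
      using tnorm_triangle[OF torus_L2_diff[OF L(1) trig_L2[OF F(1,2), of c]] torus_L2_diff[OF L(2) trig_L2[OF G(1,2), of d]]] F(3) G(3)
      by linarith
    ultimately show "\<exists>w. tdense w \<and> tnorm (\<lambda>x. u x + v x - w x) < e"
      by (intro exI[of _ "\<lambda>x. trig F c x + trig G d x"]) (simp add: algebra_simps)
  qed
qed

lemma tdense_scale: assumes "tdense u" shows "tdense (\<lambda>x. a * u x)"
proof -
  have L: "u \<in> torus_L2" using assms by (auto simp: tdense_def)
  show ?thesis
  proof (rule tdense_limit[OF torus_L2_scale[OF L]])
    fix e :: real assume e: "e > 0"
    define e' where "e' = e / (norm a + 1)"
    have a1: "norm a + 1 > 0" using norm_ge_zero[of a] by linarith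
    then have e': "e' > 0" "norm a * e' < e" using e by (auto simp: e'_def field_simps)
    obtain F c where F: "finite F" "F \<subseteq> int_vecs" "tnorm (\<lambda>x. u x - trig F c x) < e'"
      using assms e'(1) unfolding tdense_def by blast
    have "is_trig (\<lambda>x. (a * texp 0 x) * trig F c x)"
    proof (rule is_trig_mult[OF is_trig_texp[OF int_vecs_simps(1)]])
      show "is_trig (trig F c)" using F(1,2) unfolding is_trig_def by blast
    qed
    then have "tdense (\<lambda>x. a * trig F c x)" using tdense_trig by simp
    moreover have "tnorm (\<lambda>x. a * (u x - trig F c x)) \<le> norm a * e'"
      unfolding tnorm_scale using F(3) by (intro mult_left_mono) auto
    ultimately show "\<exists>w. tdense w \<and> tnorm (\<lambda>x. a * u x - w x) < e"
      using e'(2) by (intro exI[of _ "\<lambda>x. a * trig F c x"]) (auto simp: algebra_simps)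
  qed
qed

lemma tdense_sum: "finite A \<Longrightarrow> (\<And>a. a \<in> A \<Longrightarrow> tdense (f a)) \<Longrightarrow> tdense (\<lambda>x. \<Sum>a\<in>A. f a x)"
  by (induction A rule: finite_induct) (auto intro: tdense_add tdense_trig is_trig_zero)

text \<open>The torus embedded in \<open>C^d\<close>, where the Stone-Weierstrass theorem applies.\<close>

definition torus_embed :: "real ^ 'd::finite \<Rightarrow> complex ^ 'd" where
  "torus_embed x = (\<chi> i. cis (x $ i))"

lemma axis_int_vecs: "axis i 1 \<in> int_vecs"
  by (auto simp: int_vecs_def axis_def)

lemma torus_embed_component: "torus_embed x $ i = texp (axis i 1) x"
  by (simp add: torus_embed_def texp_def inner_axis inner_commute)

lemma torus_embed_periodic: "torus_periodic torus_embed"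
  using torus_periodicD[OF texp_periodic[OF axis_int_vecs]]
  by (auto simp: torus_periodic_def vec_eq_iff torus_embed_component)

lemma continuous_torus_embed: "continuous_on UNIV torus_embed"
  unfolding torus_embed_def by (intro continuous_intros)

lemma torus_embed_measurable [measurable]: "torus_embed \<in> borel \<rightarrow>\<^sub>M borel"
  by (rule borel_measurable_continuous_onI[OF continuous_torus_embed])

lemma torus_embed_L2:
  assumes "f \<in> borel_measurable borel" "\<And>z. norm (f z) \<le> K"
  shows "(\<lambda>x. f (torus_embed x)) \<in> torus_L2"
proof (rule torus_L2_bounded)
  have "(\<lambda>x. f (torus_embed x)) \<in> borel_measurable lborel" using assms(1) by measurable
  then show "(\<lambda>x. f (torus_embed x)) \<in> borel_measurable lebesgue" by (rule measurable_completion)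
qed (use assms torus_periodic_comp[OF torus_embed_periodic] in auto)

text \<open>The coordinates of \<open>torus_embed x\<close> have cosines and sines as real and
  imaginary parts, hence are combinations of \<open>texp (axis i 1)\<close> and
  \<open>texp (- axis i 1)\<close>; products of exponentials are exponentials again.\<close>

lemma is_trig_polynomial:
  "real_polynomial_function p \<Longrightarrow> is_trig (\<lambda>x. of_real (p (torus_embed x)))"
proof (induction p rule: real_polynomial_function.induct)
  case (linear f)
  have b: "is_trig (\<lambda>x. of_real (torus_embed x \<bullet> b))" if bB: "b \<in> Basis" for b :: "complex ^ 'a"
  proof -
    obtain i w where w: "b = axis i w" "w \<in> Basis" using bB unfolding Basis_vec_def by blast
    have c: "complex_of_real (cos t) = 1/2 * cis t + 1/2 * cis (- t)" "complex_of_real (sin t) = - \<i>/2 * cis t + \<i>/2 * cis (- t)" for t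
      by (auto simp: complex_eq_iff)
    have m: "cis (- (x $ i)) = texp (- axis i 1) x" "cis (x $ i) = texp (axis i 1) x" for x
      by (simp_all add: texp_def inner_axis inner_commute)
    have "of_real (torus_embed x \<bullet> b) = (if w = 1 then of_real (cos (x $ i)) else complex_of_real (sin (x $ i)))" for x
      using w by (auto simp: inner_axis torus_embed_def Basis_complex_def inner_complex_def complex_eq_iff)
    then have e: "of_real (torus_embed x \<bullet> b) = (if w = 1 then 1/2 * texp (axis i 1) x + 1/2 * texp (- axis i 1) x
        else - \<i>/2 * texp (axis i 1) x + \<i>/2 * texp (- axis i 1) x)" for x
      by (simp only: c m)
    note t = is_trig_add[OF is_trig_texp[OF axis_int_vecs[of i]] is_trig_texp[OF int_vecs_simps(4)[OF axis_int_vecs[of i]]]]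
    show ?thesis using t[of "1/2" "1/2"] t[of "- \<i>/2" "\<i>/2"] unfolding e by (cases "w = 1") simp_all
  qed
  have "f (torus_embed x) = (\<Sum>b\<in>Basis. (torus_embed x \<bullet> b) * f b)" for x
    using Linear_Algebra.linear_componentwise[OF bounded_linear.linear[OF linear], of "torus_embed x" 1] by simp
  moreover have "is_trig (\<lambda>x. \<Sum>b\<in>Basis. of_real (torus_embed x \<bullet> b) * (of_real (f b) * texp 0 x))"
    by (intro is_trig_sum is_trig_mult b is_trig_texp) auto
  ultimately show ?case by simp
next
  case (const c) then show ?case using is_trig_texp[of 0 "of_real c"] by simp
qed (simp_all add: is_trig_add is_trig_mult)

lemma tdense_continuous:
  fixes g :: "complex ^ 'd::finite \<Rightarrow> real"
  assumes g: "continuous_on UNIV g" and bd: "\<And>z. \<bar>g z\<bar> \<le> K"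
  shows "tdense (\<lambda>x. of_real (g (torus_embed x)))"
proof (rule tdense_limit)
  have gm: "g \<in> borel_measurable borel" by (rule borel_measurable_continuous_onI[OF g])
  then show gL: "(\<lambda>x. of_real (g (torus_embed x))) \<in> torus_L2"
    by (intro torus_embed_L2[of "\<lambda>z. of_real (g z)" K]) (use bd in auto)
  fix e :: real assume e: "e > 0"
  define P where "P = sqrt ((2 * pi) ^ CARD('d))"
  have P: "P \<ge> 0" by (simp add: P_def)
  define e' where "e' = e / (P + 1)"
  have e': "e' > 0" "e' * P < e" using e P by (auto simp: e'_def field_simps)
  \<comment> \<open>A compact ball that contains the embedded torus: every coordinate has modulus 1,
    and the norm is at most the sum of the CARD('d) moduli.\<close>
  let ?S = "cball 0 (real CARD('d)) :: (complex ^ 'd) set"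
  have S: "torus_embed x \<in> ?S" for x
  proof -
    have "norm (torus_embed x) \<le> (\<Sum>i\<in>UNIV. norm (torus_embed x $ i))"
      unfolding norm_vec_def by (rule L2_set_le_sum) simp
    then show ?thesis by (simp add: torus_embed_component)
  qed
  obtain p where p: "real_polynomial_function p" "\<And>z. z \<in> ?S \<Longrightarrow> norm (g z - p z) < e'"
    using Stone_Weierstrass_real_polynomial_function[of ?S g e'] continuous_on_subset[OF g] e' by (metis compact_cball real_norm_def subset_UNIV)
  have t: "is_trig (\<lambda>x. of_real (p (torus_embed x)))" by (rule is_trig_polynomial[OF p(1)])
  then have d: "tdense (\<lambda>x. of_real (p (torus_embed x)))" by (rule tdense_trig)
  then have pL: "(\<lambda>x. of_real (p (torus_embed x))) \<in> torus_L2" by (simp add: tdense_def)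
  have "norm (complex_of_real (g (torus_embed x)) - of_real (p (torus_embed x))) \<le> e'" for x
    using p(2)[OF S[of x]] by (simp add: norm_of_real flip: of_real_diff)
  then have "tnorm (\<lambda>x. of_real (g (torus_embed x)) - of_real (p (torus_embed x))) \<le> e' * P"
    unfolding P_def by (intro tnorm_le_bound torus_L2_diff gL pL)
  then show "\<exists>v. tdense v \<and> tnorm (\<lambda>x. of_real (g (torus_embed x)) - v x) < e"
    using d e'(2) by (intro exI[of _ "\<lambda>x. of_real (p (torus_embed x))"]) auto
qed

text \<open>Dynkin's induction from the open sets, which are stable under intersection. The
  indicator of an open set is the limit of the continuous functions min 1 (n dist(z, complement));
  complements and disjoint unions are handled by linearity and dominated convergence.\<close>

lemma tdense_indicator:
  fixes A :: "(complex ^ 'd::finite) set"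
  assumes "A \<in> sets borel"
  shows "tdense (\<lambda>x. of_real (indicator A (torus_embed x)))"
proof -
  have iL: "(\<lambda>x. complex_of_real (indicator A (torus_embed x))) \<in> torus_L2" if "A \<in> sets borel" for A :: "(complex ^ 'd) set"
    using that by (intro torus_embed_L2[of "\<lambda>z. of_real (indicator A z)" 1]) (auto simp: indicator_def)
  have 1: "tdense (\<lambda>x :: real ^ 'd. 1)" using tdense_trig[OF is_trig_texp[of "0 :: real ^ 'd" 1]] by simp
  have "Int_stable {S :: (complex ^ 'd) set. open S}" "{S :: (complex ^ 'd) set. open S} \<subseteq> Pow UNIV"
    by (auto simp: Int_stable_def)
  moreover have "A \<in> sigma_sets UNIV {S. open S}" using assms by (simp add: borel_def)
  ultimately show ?thesis
  proof (induction rule: sigma_sets_induct_disjoint)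
    case empty show ?case by (simp add: tdense_trig[OF is_trig_zero])
  next
    case (compl A)
    have "tdense (\<lambda>x. 1 + (-1) * complex_of_real (indicator A (torus_embed x)))"
      by (intro tdense_add 1 tdense_scale compl)
    moreover have "complex_of_real (indicator (UNIV - A) z) = 1 + (-1) * of_real (indicator A z)" for z
      by (auto simp: indicator_def)
    ultimately show ?case by (simp only:)
  next
    case (union A)
    have Ab: "A i \<in> sets borel" for i using union by (auto simp: borel_def)
    show ?case
    proof (rule tdense_sequence[where w = "\<lambda>x. 1" and f = "\<lambda>n x. of_real (indicator (\<Union>i<n. A i) (torus_embed x))"])
      show "(\<lambda>x. complex_of_real (indicator (\<Union>i. A i) (torus_embed x))) \<in> torus_L2"
        using Ab by (intro iL) auto
      have ind: "indicator (\<Union>i<n. A i) z = (\<Sum>i<n. indicator (A i) z :: real)" for n z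
        by (rule indicator_UN_disjoint) (use union in \<open>auto simp: disjoint_family_on_def\<close>)
      show "tdense (\<lambda>x. of_real (indicator (\<Union>i<n. A i) (torus_embed x)))" for n
        unfolding ind of_real_sum by (intro tdense_sum union) auto
      show "AE x in torus_measure. (\<lambda>n. complex_of_real (indicator (\<Union>i<n. A i) (torus_embed x))) \<longlonglongrightarrow> of_real (indicator (\<Union>i. A i) (torus_embed x))"
        by (intro AE_I2 tendsto_of_real LIMSEQ_indicator_UN)
    qed (auto simp: indicator_def)
  next
    case (basic A)
    then have op: "open A" by simp
    show ?case
    \<comment> \<open>The whole space is set apart because \<open>infdist\<close> to the empty set
      is 0 by convention, so that the approximants below would vanish.\<close>
    proof (cases "A = UNIV")
      case True then show ?thesis using 1 by simp
    next
      case False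
      define g where "g n z = min 1 (real n * infdist z (- A))" for n z
      have g01: "0 \<le> g n z" "g n z \<le> 1" for n z by (auto simp: g_def infdist_nonneg)
      show ?thesis
      proof (rule tdense_sequence[where w = "\<lambda>x. 1" and f = "\<lambda>n x. of_real (g n (torus_embed x))"])
        show "(\<lambda>x. complex_of_real (indicator A (torus_embed x))) \<in> torus_L2" using op by (intro iL) auto
        show "tdense (\<lambda>x. of_real (g n (torus_embed x)))" for n
          by (rule tdense_continuous[of _ 1])
             (use g01 in \<open>auto simp: g_def abs_le_iff intro!: continuous_intros continuous_on_min infdist_nonneg\<close>)
        show "AE x in torus_measure. (norm (complex_of_real (indicator A (torus_embed x)) - of_real (g n (torus_embed x))))\<^sup>2 \<le> 1" for n
        proof (rule AE_I2)
          fix x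
          have "\<bar>indicator A (torus_embed x) - g n (torus_embed x)\<bar> \<le> 1"
            using g01[of n "torus_embed x"] by (auto simp: indicator_def)
          then show "(norm (complex_of_real (indicator A (torus_embed x)) - of_real (g n (torus_embed x))))\<^sup>2 \<le> 1"
            by (simp add: abs_square_le_1 flip: of_real_diff)
        qed
        have "(\<lambda>n. g n z) \<longlonglongrightarrow> indicator A z" for z
        proof (cases "z \<in> A")
          case True
          have "infdist z (- A) \<noteq> 0" using True False op in_closed_iff_infdist_zero[of "- A" z] by auto
          then have d: "infdist z (- A) > 0" using infdist_nonneg[of z "- A"] by linarith
          then obtain N :: nat where N: "1 < real N * infdist z (- A)" using reals_Archimedean3 by blast
          have "eventually (\<lambda>n. g n z = 1) sequentially"
          proof (rule eventually_sequentiallyI[of N])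
            fix n assume "n \<ge> N"
            then have "real N * infdist z (- A) \<le> real n * infdist z (- A)" using d by (intro mult_right_mono) auto
            then show "g n z = 1" using N by (simp add: g_def)
          qed
          then show ?thesis using True by (simp add: tendsto_eventually)
        next
          case False
          then have "g n z = 0" for n by (simp add: g_def)
          then show ?thesis using False by simp
        qed
        then show "AE x in torus_measure. (\<lambda>n. complex_of_real (g n (torus_embed x))) \<longlonglongrightarrow> of_real (indicator A (torus_embed x))"
          by (intro AE_I2 tendsto_of_real)
      qed simp
    qed
  qed
qed

text \<open>The argument jumps across the half-line of nonnegative reals, but it is continuous off
  this closed set and equal to 0 on it.\<close>

lemma Arg2pi_measurable [measurable]: "Arg2pi \<in> borel_measurable borel"
proof -
  have "(\<lambda>z. indicator (- \<real>\<^sub>\<ge>\<^sub>0) z *\<^sub>R Arg2pi z) \<in> borel_measurable borel"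
  proof (rule borel_measurable_continuous_on_indicator)
    show "- \<real>\<^sub>\<ge>\<^sub>0 \<in> sets (borel :: complex measure)"
      by (intro borel_open open_Compl closed_nonneg_Reals_complex)
    show "continuous_on (- \<real>\<^sub>\<ge>\<^sub>0) Arg2pi"
      by (intro continuous_at_imp_continuous_on ballI continuous_at_Arg2pi) auto
  qed
  moreover have "(\<lambda>z. indicator (- \<real>\<^sub>\<ge>\<^sub>0) z *\<^sub>R Arg2pi z) = Arg2pi"
    by (auto simp: indicator_def Arg2pi_eq_0 complex_nonneg_Reals_iff complex_is_Real_iff)
  ultimately show ?thesis by simp
qed

lemma torus_embed_inverse: "x \<in> torus_cell \<Longrightarrow> (\<chi> i. Arg2pi (torus_embed x $ i)) = x"
proof -
  assume "x \<in> torus_cell"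
  then have "Arg2pi (cis (x $ i)) = x $ i" for i
    using Arg2pi_unique[of 1 "x $ i" "cis (x $ i)"] by (auto simp: torus_cell_def cis_conv_exp)
  then show ?thesis by (simp add: vec_eq_iff torus_embed_def)
qed

text \<open>Since \<open>Arg2pi\<close> inverts the embedding on the cell, u agrees almost
  everywhere with \<open>G (torus_embed x)\<close> for a Borel function \<open>G\<close>. Simple
  functions approximating \<open>G\<close> are combinations of the indicators of
  \<open>tdense_indicator\<close>.\<close>

theorem tdense_L2:
  fixes u :: "real ^ 'd::finite \<Rightarrow> complex"
  assumes u: "u \<in> torus_L2"
  shows "tdense u"
proof -
  have um: "u \<in> borel_measurable lebesgue" using torus_L2_measurable_lebesgue[OF u] .
  obtain a b where a: "a \<in> borel_measurable borel" "AE x in lborel. Re (u x) = a x"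
    and b: "b \<in> borel_measurable borel" "AE x in lborel. Im (u x) = b x"
    using completion_ex_borel_measurable_real[of "\<lambda>x. Re (u x)" lborel] completion_ex_borel_measurable_real[of "\<lambda>x. Im (u x)" lborel] um
    by auto
  define G where "G z = Complex (a (\<chi> i. Arg2pi (z $ i))) (b (\<chi> i. Arg2pi (z $ i)))" for z :: "complex ^ 'd"
  have arg: "(\<lambda>z :: complex ^ 'd. (\<chi> i. Arg2pi (z $ i))) \<in> borel \<rightarrow>\<^sub>M (borel :: (real ^ 'd) measure)"
  proof -
    have "(\<lambda>z :: complex ^ 'd. (\<chi> i. Arg2pi (z $ i)) \<bullet> c) \<in> borel_measurable borel" if cB: "c \<in> Basis" for c :: "real ^ 'd"
    proof -
      obtain i where i: "c = axis i 1" using cB by (auto simp: Basis_vec_def)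
      have "(\<lambda>z :: complex ^ 'd. z $ i) \<in> borel_measurable borel"
        by (intro borel_measurable_continuous_onI continuous_intros)
      then have "(\<lambda>z :: complex ^ 'd. Arg2pi (z $ i)) \<in> borel_measurable borel" by measurable
      then show ?thesis by (simp add: i inner_axis)
    qed
    then show ?thesis by (subst borel_measurable_euclidean_space) auto
  qed
  have Gm: "G \<in> borel_measurable borel"
    unfolding G_def Complex_eq using measurable_compose[OF arg a(1)] measurable_compose[OF arg b(1)] by measurable
  have "AE x in lborel. u x = Complex (a x) (b x)"
    using a(2) b(2) by eventually_elim (simp add: complex_eq_iff)
  then have "AE x in lebesgue. u x = Complex (a x) (b x)" by (rule AE_completion)
  then have eq: "AE x in torus_measure. u x = G (torus_embed x)"
    by (subst AE_restrict_space_iff) (auto simp: G_def torus_embed_inverse elim: eventually_mono)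
  obtain s where s: "\<And>i. simple_function borel (s i)" "\<And>z. (\<lambda>i. s i z) \<longlonglongrightarrow> G z" "\<And>i z. dist (s i z) 0 \<le> 2 * dist (G z) 0"
    using borel_measurable_implies_sequence_metric[OF Gm, of 0] by auto
  show ?thesis
  \<comment> \<open>The factor 9 is 3^2: the simple functions satisfy |s| <= 2 |G|, hence |u - s| <=
    3 |u|.\<close>
  proof (rule tdense_sequence[OF u, where w = "\<lambda>x. 9 * (norm (u x))\<^sup>2" and f = "\<lambda>n x. s n (torus_embed x)"])
    fix n
    have fin: "finite (range (s n))" using s(1)[of n] by (simp add: simple_function_def)
    have "s n z = (\<Sum>y\<in>range (s n). y * of_real (indicator (s n -` {y}) z))" for z
    proof -
      have "(\<Sum>y\<in>range (s n). y * of_real (indicator (s n -` {y}) z)) = (\<Sum>y\<in>range (s n). if y = s n z then y else 0)"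
        by (intro sum.cong) (auto simp: indicator_def)
      then show ?thesis using fin by (simp add: sum.delta)
    qed
    then have eqs: "(\<lambda>x. s n (torus_embed x)) = (\<lambda>x. \<Sum>y\<in>range (s n). y * of_real (indicator (s n -` {y}) (torus_embed x)))"
      by (rule ext)
    have "tdense (\<lambda>x. \<Sum>y\<in>range (s n). y * of_real (indicator (s n -` {y}) (torus_embed x)))"
    proof (rule tdense_sum[OF fin])
      fix y
      have "s n -` {y} \<in> sets borel" using simple_functionD(2)[OF s(1)[of n], of "{y}"] by simp
      then show "tdense (\<lambda>x. y * of_real (indicator (s n -` {y}) (torus_embed x)))"
        by (rule tdense_scale[OF tdense_indicator])
    qed
    then show "tdense (\<lambda>x. s n (torus_embed x))" by (subst eqs)
    show "AE x in torus_measure. (norm (u x - s n (torus_embed x)))\<^sup>2 \<le> 9 * (norm (u x))\<^sup>2"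
      using eq
    proof eventually_elim
      case (elim x)
      have "norm (u x - s n (torus_embed x)) \<le> norm (u x) + norm (s n (torus_embed x))" by (rule norm_triangle_ineq4)
      also have "\<dots> \<le> 3 * norm (u x)" using s(3)[of n "torus_embed x"] elim by simp
      finally have "(norm (u x - s n (torus_embed x)))\<^sup>2 \<le> (3 * norm (u x))\<^sup>2" by (intro power_mono) auto
      then show ?case by (simp add: power_mult_distrib)
    qed
  next
    show "AE x in torus_measure. (\<lambda>n. s n (torus_embed x)) \<longlonglongrightarrow> u x"
      using eq by eventually_elim (simp add: s(2))
    show "integrable torus_measure (\<lambda>x. 9 * (norm (u x))\<^sup>2)"
      using torus_L2_integrable[OF u] by simp
  qed
qed

subsection \<open>Parseval and Riesz-Fischer\<close>

abbreviation fourier_sum :: "(real ^ 'd::finite) set \<Rightarrow> (real ^ 'd \<Rightarrow> complex) \<Rightarrow> real ^ 'd \<Rightarrow> complex" where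
  "fourier_sum F u \<equiv> trig F (fourier_coeff u)"

lemma tnorm_fourier_sum_diff:
  fixes u :: "real ^ 'd::finite \<Rightarrow> complex"
  assumes "u \<in> torus_L2" "finite F" "F \<subseteq> int_vecs"
  shows "(tnorm (\<lambda>x. u x - fourier_sum F u x))\<^sup>2 = (tnorm u)\<^sup>2 - (2 * pi) ^ CARD('d) * (\<Sum>k\<in>F. (norm (fourier_coeff u k))\<^sup>2)"
  using tnorm_trig_diff[OF assms, of "fourier_coeff u"] by simp

lemma Bessel:
  fixes u :: "real ^ 'd::finite \<Rightarrow> complex"
  assumes "u \<in> torus_L2" "finite F" "F \<subseteq> int_vecs"
  shows "(2 * pi) ^ CARD('d) * (\<Sum>k\<in>F. (norm (fourier_coeff u k))\<^sup>2) \<le> (tnorm u)\<^sup>2"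
  using tnorm_fourier_sum_diff[OF assms] zero_le_power2[of "tnorm (\<lambda>x. u x - fourier_sum F u x)"] by linarith

text \<open>Density gives one good polynomial over \<open>F0\<close>. Replacing its coefficients by
  those of u and enlarging the frequency set can only decrease the distance, so the estimate holds
  for all larger sets.\<close>

lemma fourier_sum_approx:
  fixes u :: "real ^ 'd::finite \<Rightarrow> complex"
  assumes u: "u \<in> torus_L2" and e: "e > 0"
  obtains F0 where "finite F0" "F0 \<subseteq> int_vecs"
    "\<And>F. finite F \<Longrightarrow> F \<subseteq> int_vecs \<Longrightarrow> F0 \<subseteq> F \<Longrightarrow> tnorm (\<lambda>x. u x - fourier_sum F u x) < e"
proof -
  obtain F0 c where F0: "finite F0" "F0 \<subseteq> int_vecs" "tnorm (\<lambda>x. u x - trig F0 c x) < e"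
    using tdense_L2[OF u] e unfolding tdense_def by meson
  have "tnorm (\<lambda>x. u x - fourier_sum F u x) < e" if F: "finite F" "F \<subseteq> int_vecs" "F0 \<subseteq> F" for F
  proof -
    have "(\<Sum>k\<in>F0. (norm (fourier_coeff u k))\<^sup>2) \<le> (\<Sum>k\<in>F. (norm (fourier_coeff u k))\<^sup>2)"
      using F by (intro sum_mono2) auto
    then have "(2 * pi) ^ CARD('d) * (\<Sum>k\<in>F0. (norm (fourier_coeff u k))\<^sup>2) \<le> (2 * pi) ^ CARD('d) * (\<Sum>k\<in>F. (norm (fourier_coeff u k))\<^sup>2)"
      by (intro mult_left_mono) auto
    moreover have "0 \<le> (2 * pi) ^ CARD('d) * (\<Sum>k\<in>F0. (norm (fourier_coeff u k - c k))\<^sup>2)"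
      by (intro mult_nonneg_nonneg sum_nonneg) auto
    ultimately have "(tnorm (\<lambda>x. u x - fourier_sum F u x))\<^sup>2 \<le> (tnorm (\<lambda>x. u x - trig F0 c x))\<^sup>2"
      unfolding tnorm_fourier_sum_diff[OF u F(1,2)] tnorm_trig_diff[OF u F0(1,2)] by linarith
    then have "tnorm (\<lambda>x. u x - fourier_sum F u x) \<le> tnorm (\<lambda>x. u x - trig F0 c x)"
      by (rule power2_le_imp_le) simp
    then show ?thesis using F0(3) by linarith
  qed
  then show thesis using that F0 by blast
qed

lemma tnorm_trig:
  fixes c :: "real ^ 'd::finite \<Rightarrow> complex"
  assumes "finite F" "F \<subseteq> int_vecs"
  shows "(tnorm (trig F c))\<^sup>2 = (2 * pi) ^ CARD('d) * (\<Sum>k\<in>F. (norm (c k))\<^sup>2)"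
proof -
  have "fourier_coeff (\<lambda>x. 0) k = 0" for k :: "real ^ 'd" by (simp add: fourier_coeff_def)
  moreover have "tnorm (\<lambda>x. 0 - trig F c x) = tnorm (trig F c)" "tnorm (\<lambda>x :: real ^ 'd. 0) = 0"
    by (simp_all add: tnorm_def)
  ultimately show ?thesis using tnorm_trig_diff[OF torus_L2_zero assms, of c] by simp
qed

lemma shift_int_vecs: "\<eta> \<in> int_vecs \<Longrightarrow> F \<subseteq> int_vecs \<Longrightarrow> (+) \<eta> ` F \<subseteq> int_vecs"
  by auto

text \<open>Up to a tail smaller than e, the norm of w is carried by finitely many coefficients;
  their moduli are moduli of coefficients of u, and Bessel's inequality bounds those. The shift by
  \<open>\<eta>\<close> accommodates modulation.\<close>

lemma tnorm_le_shifted_coeffs: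
  fixes u w :: "real ^ 'd::finite \<Rightarrow> complex"
  assumes u: "u \<in> torus_L2" and w: "w \<in> torus_L2" and \<eta>: "\<eta> \<in> int_vecs"
    and eq: "\<And>k. k \<in> int_vecs \<Longrightarrow> norm (fourier_coeff w (\<eta> + k)) = norm (fourier_coeff u k)"
  shows "tnorm w \<le> tnorm u"
proof (rule field_le_epsilon)
  fix e :: real assume e: "e > 0"
  obtain F where F: "finite F" "F \<subseteq> int_vecs" "tnorm (\<lambda>x. w x - fourier_sum F w x) < e"
    using fourier_sum_approx[OF w e] by (metis order_refl)
  define G where "G = (+) (- \<eta>) ` F"
  have G: "finite G" "G \<subseteq> int_vecs" using F shift_int_vecs[of "- \<eta>" F] \<eta> by (auto simp: G_def)
  have FG: "F = (+) \<eta> ` G" by (auto simp: G_def image_image)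
  have "(\<Sum>k\<in>F. (norm (fourier_coeff w k))\<^sup>2) = (\<Sum>k\<in>G. (norm (fourier_coeff u k))\<^sup>2)"
    unfolding FG using G eq by (subst sum.reindex) (auto intro!: sum.cong)
  then have "(tnorm w)\<^sup>2 - (tnorm (\<lambda>x. w x - fourier_sum F w x))\<^sup>2 \<le> (tnorm u)\<^sup>2"
    using Bessel[OF u G] tnorm_fourier_sum_diff[OF w F(1,2)] by simp
  then have "(tnorm w)\<^sup>2 \<le> (tnorm u)\<^sup>2 + (tnorm (\<lambda>x. w x - fourier_sum F w x))\<^sup>2" by simp
  also have "\<dots> \<le> (tnorm u)\<^sup>2 + e\<^sup>2" using F(3) by (intro add_left_mono power_mono) auto
  also have "\<dots> \<le> (tnorm u + e)\<^sup>2" using e by (simp add: power2_eq_square algebra_simps)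
  finally show "tnorm w \<le> tnorm u + e" by (rule power2_le_imp_le) (use e in simp)
qed

text \<open>The previous inequality in both directions. The second claim, equality of tails, is what
  moves a truncation error of \<open>\<rho>\<close> unchanged to its modulated and evolved
  versions.\<close>

lemma tnorm_eq_shifted_coeffs:
  fixes u w :: "real ^ 'd::finite \<Rightarrow> complex"
  assumes u: "u \<in> torus_L2" and w: "w \<in> torus_L2" and \<eta>: "\<eta> \<in> int_vecs"
    and eq: "\<And>k. k \<in> int_vecs \<Longrightarrow> norm (fourier_coeff w (\<eta> + k)) = norm (fourier_coeff u k)"
  shows "tnorm w = tnorm u"
    and "finite F \<Longrightarrow> F \<subseteq> int_vecs \<Longrightarrow>
      tnorm (\<lambda>x. w x - fourier_sum ((+) \<eta> ` F) w x) = tnorm (\<lambda>x. u x - fourier_sum F u x)"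
proof -
  have eq': "norm (fourier_coeff u (- \<eta> + k)) = norm (fourier_coeff w k)" if "k \<in> int_vecs" for k
    using eq[of "- \<eta> + k"] that \<eta> by simp
  show 1: "tnorm w = tnorm u"
    using tnorm_le_shifted_coeffs[OF u w \<eta> eq] tnorm_le_shifted_coeffs[OF w u _ eq'] \<eta> by (simp add: order_antisym)
  assume F: "finite F" "F \<subseteq> int_vecs"
  have "(\<Sum>k\<in>(+) \<eta> ` F. (norm (fourier_coeff w k))\<^sup>2) = (\<Sum>k\<in>F. (norm (fourier_coeff u k))\<^sup>2)"
    using F eq by (subst sum.reindex) (auto intro!: sum.cong)
  then have "(tnorm (\<lambda>x. w x - fourier_sum ((+) \<eta> ` F) w x))\<^sup>2 = (tnorm (\<lambda>x. u x - fourier_sum F u x))\<^sup>2"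
    using tnorm_fourier_sum_diff[OF u F] tnorm_fourier_sum_diff[OF w finite_imageI[OF F(1)] shift_int_vecs[OF \<eta> F(2)]] 1 by simp
  then show "tnorm (\<lambda>x. w x - fourier_sum ((+) \<eta> ` F) w x) = tnorm (\<lambda>x. u x - fourier_sum F u x)"
    by (rule power2_eq_imp_eq) auto
qed

text \<open>Fatou's lemma applied to |P m - P n|^2 with n fixed; the L^2 membership of the limit and
  the error bound come out together.\<close>

lemma torus_L2_Fatou:
  assumes P: "\<And>m :: nat. P m \<in> torus_L2" and w: "w \<in> borel_measurable lebesgue" "torus_periodic w"
    and lim: "AE x in torus_measure. (\<lambda>m. P m x) \<longlonglongrightarrow> w x"
    and bd: "\<And>m. m \<ge> n \<Longrightarrow> tnorm (\<lambda>x. P m x - P n x) \<le> K"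
  shows "w \<in> torus_L2" "tnorm (\<lambda>x. w x - P n x) \<le> K"
proof -
  have K: "K \<ge> 0" using bd[of n] by (simp add: tnorm_def)
  note [measurable] = torus_L2_measurable[OF P] torus_measurableI[OF w(1)]
  have "(\<integral>\<^sup>+x. ennreal ((norm (w x - P n x))\<^sup>2) \<partial>torus_measure) = (\<integral>\<^sup>+x. liminf (\<lambda>m. ennreal ((norm (P m x - P n x))\<^sup>2)) \<partial>torus_measure)"
    using lim
  proof (intro nn_integral_cong_AE, eventually_elim)
    case (elim x)
    have "(\<lambda>m. ennreal ((norm (P m x - P n x))\<^sup>2)) \<longlonglongrightarrow> ennreal ((norm (w x - P n x))\<^sup>2)"
      by (intro tendsto_ennrealI tendsto_intros elim)
    then show ?case by (rule lim_imp_Liminf[OF trivial_limit_sequentially, symmetric])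
  qed
  also have "\<dots> \<le> liminf (\<lambda>m. \<integral>\<^sup>+x. ennreal ((norm (P m x - P n x))\<^sup>2) \<partial>torus_measure)"
    by (rule nn_integral_liminf) measurable
  also have "\<dots> \<le> ennreal (K\<^sup>2)"
  proof (rule Liminf_le)
    show "eventually (\<lambda>m. (\<integral>\<^sup>+x. ennreal ((norm (P m x - P n x))\<^sup>2) \<partial>torus_measure) \<le> ennreal (K\<^sup>2)) sequentially"
    proof (rule eventually_sequentiallyI[of n])
      fix m assume "m \<ge> n"
      have "(\<integral>\<^sup>+x. ennreal ((norm (P m x - P n x))\<^sup>2) \<partial>torus_measure) = ennreal ((tnorm (\<lambda>x. P m x - P n x))\<^sup>2)"
        unfolding tnorm_power2 by (rule nn_integral_eq_integral) (use torus_L2_integrable[OF torus_L2_diff[OF P P]] in auto)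
      also have "\<dots> \<le> ennreal (K\<^sup>2)" using bd[OF \<open>m \<ge> n\<close>] by (intro ennreal_leI power_mono) auto
      finally show "(\<integral>\<^sup>+x. ennreal ((norm (P m x - P n x))\<^sup>2) \<partial>torus_measure) \<le> ennreal (K\<^sup>2)" .
    qed
  qed simp
  finally have le: "(\<integral>\<^sup>+x. ennreal ((norm (w x - P n x))\<^sup>2) \<partial>torus_measure) \<le> ennreal (K\<^sup>2)" .
  then have i: "integrable torus_measure (\<lambda>x. (norm (w x - P n x))\<^sup>2)"
    by (intro integrableI_nonneg) (auto simp: less_top[symmetric] top_unique intro: le_less_trans)
  have "(\<lambda>x. w x - P n x) \<in> torus_L2"
    using i w torus_L2_measurable_lebesgue[OF P[of n]] torus_periodic_comp2[OF w(2) torus_L2_periodic[OF P[of n]], of "(-)"]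
    by (simp add: torus_L2_def borel_measurable_diff)
  from torus_L2_add[OF this P[of n]] show "w \<in> torus_L2" by simp
  have "(LINT x|torus_measure. (norm (w x - P n x))\<^sup>2) \<le> K\<^sup>2"
    using le by (subst (asm) nn_integral_eq_integral[OF i]) auto
  then show "tnorm (\<lambda>x. w x - P n x) \<le> K" unfolding tnorm_def using K real_le_lsqrt by (simp add: real_sqrt_le_iff real_le_lsqrt)
qed

text \<open>The prescribed coefficients have the moduli of those of a given L^2 function, so the
  Cauchy property of the partial sums is read off from the tails of u. This is all that a unimodular
  Fourier multiplier requires.\<close>

theorem Riesz_Fischer:
  fixes u :: "real ^ 'd::finite \<Rightarrow> complex"
  assumes u: "u \<in> torus_L2" and c: "\<And>k. k \<in> int_vecs \<Longrightarrow> norm (c k) = norm (fourier_coeff u k)"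
  shows "\<exists>w\<in>torus_L2. \<forall>k\<in>int_vecs. fourier_coeff w k = c k"
proof -
  have "\<exists>F0. finite F0 \<and> F0 \<subseteq> int_vecs \<and> (\<forall>F. finite F \<longrightarrow> F \<subseteq> int_vecs \<longrightarrow> F0 \<subseteq> F \<longrightarrow> tnorm (\<lambda>x. u x - fourier_sum F u x) < (1/2) ^ n)" for n
  proof -
    have e: "(1/2 :: real) ^ n > 0" by simp
    show ?thesis by (rule fourier_sum_approx[OF u e]) blast
  qed
  then obtain F0 where F0: "\<And>n. finite (F0 n)" "\<And>n. F0 n \<subseteq> int_vecs"
    "\<And>n F. finite F \<Longrightarrow> F \<subseteq> int_vecs \<Longrightarrow> F0 n \<subseteq> F \<Longrightarrow> tnorm (\<lambda>x. u x - fourier_sum F u x) < (1/2) ^ n"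
    by metis
  \<comment> \<open>\<open>F0 i\<close> pushes the tail of u below 2^-n; the first elements of an
    enumeration of the lattice are added so that every frequency occurs eventually.\<close>
  define F where "F n = (\<Union>i\<le>n. F0 i \<union> {from_nat_into (int_vecs :: (real ^ 'd) set) i})" for n
  have ne: "(int_vecs :: (real ^ 'd) set) \<noteq> {}" using int_vecs_simps(1) by blast
  have F: "finite (F n)" "F n \<subseteq> int_vecs" for n
    using F0 from_nat_into[OF ne] by (auto simp: F_def)
  have Fmono: "F n \<subseteq> F m" if "n \<le> m" for n m using that by (fastforce simp: F_def)
  have Fs: "tnorm (\<lambda>x. u x - fourier_sum (F n) u x) < (1/2) ^ n" for n
    by (rule F0(3)[OF F]) (auto simp: F_def)
  have Fex: "\<exists>n. k \<in> F n" if k: "k \<in> int_vecs" for k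
  proof -
    obtain n where "k = from_nat_into int_vecs n" using from_nat_into_surj[OF countable_int_vecs k] by metis
    then show ?thesis by (auto simp: F_def)
  qed
  define P where "P n = trig (F n) c" for n
  have PL: "P n \<in> torus_L2" for n unfolding P_def by (rule trig_L2[OF F])
  have PP: "tnorm (\<lambda>x. P m x - P n x) \<le> (1/2) ^ n" if "n \<le> m" for n m
  proof -
    have sub: "F n \<subseteq> F m" by (rule Fmono[OF that])
    have "(\<lambda>x. P m x - P n x) = trig (F m - F n) c"
      unfolding P_def trig_def using F(1)[of m] sub by (intro ext) (simp add: sum_diff)
    then have "(tnorm (\<lambda>x. P m x - P n x))\<^sup>2 = (2 * pi) ^ CARD('d) * (\<Sum>k\<in>F m - F n. (norm (c k))\<^sup>2)"
      using tnorm_trig[of "F m - F n" c] F by auto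
    also have "(\<Sum>k\<in>F m - F n. (norm (c k))\<^sup>2) = (\<Sum>k\<in>F m - F n. (norm (fourier_coeff u k))\<^sup>2)"
      using c F by (intro sum.cong) auto
    also have "\<dots> = (\<Sum>k\<in>F m. (norm (fourier_coeff u k))\<^sup>2) - (\<Sum>k\<in>F n. (norm (fourier_coeff u k))\<^sup>2)"
      using F(1)[of m] sub by (simp add: sum_diff)
    also have "(2 * pi) ^ CARD('d) * \<dots> \<le> (tnorm (\<lambda>x. u x - fourier_sum (F n) u x))\<^sup>2"
      using Bessel[OF u F, of m] tnorm_fourier_sum_diff[OF u F, of n] by (simp add: right_diff_distrib)
    also have "\<dots> \<le> ((1/2) ^ n)\<^sup>2" using Fs[of n] by (intro power_mono) auto
    finally show ?thesis by (rule power2_le_imp_le) simp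
  qed
  \<comment> \<open>Where the partial sums diverge, \<open>lim\<close> has an arbitrary value;
    measurability and periodicity of \<open>w\<close> hold regardless, and the divergence set turns
    out to be null.\<close>
  define w where "w x = lim (\<lambda>n. P n x)" for x
  have wm: "w \<in> borel_measurable lebesgue"
    unfolding w_def[abs_def] by (rule borel_measurable_lim_metric) (rule torus_L2_measurable_lebesgue[OF PL])
  have wp: "torus_periodic w"
    unfolding torus_periodic_def
  proof (intro allI impI)
    fix x y :: "real ^ 'd" assume "torus_eq x y"
    then have "P n x = P n y" for n by (rule torus_periodicD[OF torus_L2_periodic[OF PL]])
    then show "w x = w y" by (simp add: w_def)
  qed
  define K where "K = tnorm (texp (0 :: real ^ 'd))"
  define D where "D n x = P (Suc n) x - P n x" for n x
  have DL: "D n \<in> torus_L2" for n unfolding D_def[abs_def] by (intro torus_L2_diff PL)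
  note [measurable] = torus_L2_measurable[OF DL]
  have Di: "integrable torus_measure (\<lambda>x. norm (D n x))" for n
    using torus_L2_mult_integrable(1)[OF DL texp_L2[of 0]] by simp
  have "(LINT x|torus_measure. norm (D n x)) \<le> (1/2) ^ n * K" for n
  proof -
    have "(LINT x|torus_measure. norm (D n x)) \<le> tnorm (D n) * K"
      using torus_Cauchy_Schwarz[OF DL texp_L2[of 0], of n] by (simp add: K_def)
    also have "\<dots> \<le> (1/2) ^ n * K" using PP[of n "Suc n"] unfolding D_def[abs_def] by (intro mult_right_mono) (auto simp: K_def)
    finally show ?thesis .
  qed
  then have le: "(\<integral>\<^sup>+x. ennreal (norm (D n x)) \<partial>torus_measure) \<le> ennreal ((1/2) ^ n * K)" for n
    by (subst nn_integral_eq_integral[OF Di]) (auto intro: ennreal_leI)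
  \<comment> \<open>On a space of finite measure the L^2 bounds 2^-n on the increments are L^1
    bounds up to the factor \<open>K\<close>; hence the increments are absolutely summable at almost
    every point.\<close>
  have "(\<integral>\<^sup>+x. (\<Sum>n. ennreal (norm (D n x))) \<partial>torus_measure) = (\<Sum>n. \<integral>\<^sup>+x. ennreal (norm (D n x)) \<partial>torus_measure)"
    by (rule nn_integral_suminf) measurable
  also have "\<dots> \<le> (\<Sum>n. ennreal ((1/2) ^ n * K))" by (intro suminf_le le) auto
  also have "\<dots> = ennreal (\<Sum>n. (1/2) ^ n * K)"
    by (rule suminf_ennreal2) (auto simp: K_def intro!: summable_mult2 summable_geometric)
  also have "\<dots> < \<infinity>" by simp
  finally have "AE x in torus_measure. (\<Sum>n. ennreal (norm (D n x))) \<noteq> \<infinity>"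
    by (intro nn_integral_PInf_AE) (auto simp: less_top[symmetric])
  then have lim: "AE x in torus_measure. (\<lambda>n. P n x) \<longlonglongrightarrow> w x"
  proof eventually_elim
    case (elim x)
    then have "summable (\<lambda>n. norm (D n x))" by (intro summable_suminf_not_top) (auto simp: top_unique)
    then have "summable (\<lambda>n. D n x)" by (rule summable_norm_cancel)
    then have "convergent (\<lambda>n. \<Sum>i<n. D i x)" by (simp add: summable_iff_convergent)
    moreover have "(\<Sum>i<n. D i x) = P n x - P 0 x" for n
      unfolding D_def by (rule sum_lessThan_telescope)
    ultimately have "convergent (\<lambda>n. P n x - P 0 x)" by simp
    then have "convergent (\<lambda>n. (P n x - P 0 x) + P 0 x)" by (intro convergent_add convergent_const)
    then have "convergent (\<lambda>n. P n x)" by simp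
    then show ?case unfolding w_def by (simp add: convergent_LIMSEQ_iff)
  qed
  have wL: "w \<in> torus_L2" by (rule torus_L2_Fatou(1)[OF PL wm wp lim, of 0 1]) (use PP[of 0] in simp)
  have wP: "tnorm (\<lambda>x. w x - P n x) \<le> (1/2) ^ n" for n
    by (rule torus_L2_Fatou(2)[OF PL wm wp lim]) (rule PP)
  have "fourier_coeff w k = c k" if k: "k \<in> int_vecs" for k
  proof -
    obtain N where N: "k \<in> F N" using Fex[OF k] by blast
    let ?C = "tnorm (texp k) / (2 * pi) ^ CARD('d)"
    have bd: "norm (fourier_coeff w k - c k) \<le> (1/2) ^ n * ?C" if "n \<ge> N" for n
    proof -
      have "fourier_coeff (P n) k = c k" unfolding P_def using fourier_coeff_trig[OF F k] N Fmono[OF that] by auto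
      then have "fourier_coeff w k - c k = torus_inner (\<lambda>x. w x - P n x) (texp k) / (2 * pi) ^ CARD('d)"
        by (simp add: fourier_coeff_inner torus_form_diff[OF torus_form_inner wL PL texp_L2[OF k]] diff_divide_distrib)
      then have "norm (fourier_coeff w k - c k) = norm (torus_inner (\<lambda>x. w x - P n x) (texp k)) / (2 * pi) ^ CARD('d)"
        by (simp add: norm_divide norm_mult norm_power)
      also have "\<dots> \<le> (1/2) ^ n * tnorm (texp k) / (2 * pi) ^ CARD('d)"
        using order_trans[OF torus_inner_bound[OF torus_L2_diff[OF wL PL] texp_L2[OF k]] mult_right_mono[OF wP tnorm_nonneg]]
        by (intro divide_right_mono) auto
      finally show ?thesis by simp
    qed
    have "(\<lambda>n. (1/2) ^ n * ?C) \<longlonglongrightarrow> 0 * ?C" by (intro tendsto_intros LIMSEQ_power_zero) auto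
    then have "norm (fourier_coeff w k - c k) \<le> 0 * ?C"
      by (rule LIMSEQ_le_const) (use bd in blast)
    then show ?thesis by simp
  qed
  then show ?thesis using wL by blast
qed

subsection \<open>The propagator\<close>

text \<open>The multipliers have modulus 1, so \<open>Riesz_Fischer\<close> provides a function with
  the required coefficients and the \<open>SOME\<close> in the definition is inhabited.\<close>

lemma propagator:
  assumes "u \<in> torus_L2"
  shows "propagator t u \<in> torus_L2"
    and "k \<in> int_vecs \<Longrightarrow> fourier_coeff (propagator t u) k = cis (- (t * (norm k)\<^sup>2 / 2)) * fourier_coeff u k"
proof -
  obtain w where "w \<in> torus_L2 \<and> (\<forall>k\<in>int_vecs. fourier_coeff w k = cis (- (t * (norm k)\<^sup>2 / 2)) * fourier_coeff u k)"
    using Riesz_Fischer[OF assms, of "\<lambda>k. cis (- (t * (norm k)\<^sup>2 / 2)) * fourier_coeff u k"] by (auto simp: norm_mult)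
  from someI[where P = "\<lambda>w. w \<in> torus_L2 \<and> (\<forall>k\<in>int_vecs. fourier_coeff w k = cis (- (t * (norm k)\<^sup>2 / 2)) * fourier_coeff u k)", OF this]
  show "propagator t u \<in> torus_L2"
    "k \<in> int_vecs \<Longrightarrow> fourier_coeff (propagator t u) k = cis (- (t * (norm k)\<^sup>2 / 2)) * fourier_coeff u k"
    unfolding propagator_def by blast+
qed

abbreviation modulate :: "real ^ 'd::finite \<Rightarrow> (real ^ 'd \<Rightarrow> complex) \<Rightarrow> real ^ 'd \<Rightarrow> complex" where
  "modulate \<eta> \<rho> \<equiv> (\<lambda>x. texp \<eta> x * \<rho> x)"

lemma modulate_L2: "\<eta> \<in> int_vecs \<Longrightarrow> \<rho> \<in> torus_L2 \<Longrightarrow> modulate \<eta> \<rho> \<in> torus_L2"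
  by (rule torus_L2_mult_bounded[of _ _ 1]) (auto simp: texp_periodic)

lemma fourier_coeff_modulate: "fourier_coeff (modulate \<eta> \<rho>) (\<eta> + k) = fourier_coeff \<rho> k"
proof -
  have eq: "texp \<eta> x * \<rho> x * cnj (texp (\<eta> + k) x) = \<rho> x * cnj (texp k x)" for x
    using complex_norm_square[of "texp \<eta> x"] by (simp add: texp_add algebra_simps)
  show ?thesis unfolding fourier_coeff_inner torus_inner_def by (simp only: eq)
qed

lemma torus_form_quadratic_diff:
  assumes B: "torus_form C B" and w: "w \<in> torus_L2" and s: "s \<in> torus_L2"
  shows "norm (B w w - B s s) \<le> C * tnorm (\<lambda>x. w x - s x) * (tnorm w + tnorm s)"
proof -
  note d = torus_L2_diff[OF w s]
  have "B w w - B s s = B (\<lambda>x. w x - s x) w + B s (\<lambda>x. w x - s x)"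
    by (simp add: torus_form_diff[OF B w s w] torus_form_diff[OF B w s s])
  also have "norm \<dots> \<le> norm (B (\<lambda>x. w x - s x) w) + norm (B s (\<lambda>x. w x - s x))" by (rule norm_triangle_ineq)
  also have "\<dots> \<le> C * tnorm (\<lambda>x. w x - s x) * tnorm w + C * tnorm s * tnorm (\<lambda>x. w x - s x)"
    by (intro add_mono torus_form_bound(1)[OF B] d w s)
  finally show ?thesis by (simp add: algebra_simps)
qed

text \<open>The phase that the evolution gives to the coefficient at frequency
  \<open>\<eta> + k\<close> times the conjugate of the one at \<open>\<eta> + l\<close>.\<close>

definition evolved_phase :: "real \<Rightarrow> real ^ 'd::finite \<Rightarrow> real ^ 'd \<Rightarrow> real ^ 'd \<Rightarrow> complex" where
  "evolved_phase t \<eta> k l = cis (- (t * ((norm (\<eta> + k))\<^sup>2 - (norm (\<eta> + l))\<^sup>2) / 2))"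

text \<open>Modulation shifts the coefficients and evolution rotates them, so the part beyond
  \<open>F\<close> keeps the norm it has for \<open>\<rho>\<close>. Hence the truncation error
  depends neither on \<open>t\<close> nor on \<open>\<eta>\<close>, and on the form only through
  \<open>C\<close>.\<close>

lemma propagator_modulate:
  assumes \<rho>: "\<rho> \<in> torus_L2" and \<eta>: "\<eta> \<in> int_vecs"
  shows "tnorm (propagator t (modulate \<eta> \<rho>)) = tnorm \<rho>"
    and "\<lbrakk>torus_form C B; finite F; F \<subseteq> int_vecs\<rbrakk> \<Longrightarrow>
      norm (B (propagator t (modulate \<eta> \<rho>)) (propagator t (modulate \<eta> \<rho>))
        - (\<Sum>k\<in>F. \<Sum>l\<in>F. fourier_coeff \<rho> k * cnj (fourier_coeff \<rho> l) * evolved_phase t \<eta> k l * B (texp (\<eta> + k)) (texp (\<eta> + l))))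
      \<le> 2 * C * tnorm \<rho> * tnorm (\<lambda>x. \<rho> x - fourier_sum F \<rho> x)"
proof -
  define w where "w = propagator t (modulate \<eta> \<rho>)"
  note m = modulate_L2[OF \<eta> \<rho>]
  have w: "w \<in> torus_L2" unfolding w_def by (rule propagator(1)[OF m])
  have co: "fourier_coeff w (\<eta> + k) = cis (- (t * (norm (\<eta> + k))\<^sup>2 / 2)) * fourier_coeff \<rho> k" if "k \<in> int_vecs" for k
    unfolding w_def using propagator(2)[OF m, of "\<eta> + k"] that \<eta> by (simp add: fourier_coeff_modulate)
  have eq: "norm (fourier_coeff w (\<eta> + k)) = norm (fourier_coeff \<rho> k)" if "k \<in> int_vecs" for k
    using co[OF that] by (simp add: norm_mult)
  show n: "tnorm (propagator t (modulate \<eta> \<rho>)) = tnorm \<rho>"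
    using tnorm_eq_shifted_coeffs(1)[OF \<rho> w \<eta> eq] by (simp add: w_def)
  assume B: "torus_form C B" and F: "finite F" "F \<subseteq> int_vecs"
  have F': "finite ((+) \<eta> ` F)" "(+) \<eta> ` F \<subseteq> int_vecs" using F shift_int_vecs[OF \<eta>] by auto
  let ?s = "fourier_sum ((+) \<eta> ` F) w"
  have s: "?s \<in> torus_L2" by (rule trig_L2[OF F'])
  have "(tnorm ?s)\<^sup>2 \<le> (tnorm w)\<^sup>2" unfolding tnorm_trig[OF F'] by (rule Bessel[OF w F'])
  then have sw: "tnorm ?s \<le> tnorm w" by (rule power2_le_imp_le) simp
  have "B ?s ?s = (\<Sum>k\<in>F. \<Sum>l\<in>F. fourier_coeff w (\<eta> + k) * cnj (fourier_coeff w (\<eta> + l)) * B (texp (\<eta> + k)) (texp (\<eta> + l)))"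
    unfolding torus_form_trig2[OF B F'] by (simp add: sum.reindex)
  also have "\<dots> = (\<Sum>k\<in>F. \<Sum>l\<in>F. fourier_coeff \<rho> k * cnj (fourier_coeff \<rho> l) * evolved_phase t \<eta> k l * B (texp (\<eta> + k)) (texp (\<eta> + l)))"
  proof (intro sum.cong refl)
    fix k l assume "k \<in> F" "l \<in> F"
    then have kl: "k \<in> int_vecs" "l \<in> int_vecs" using F by auto
    have E: "cis (- (t * (norm (\<eta> + k))\<^sup>2 / 2)) * cnj (cis (- (t * (norm (\<eta> + l))\<^sup>2 / 2))) = evolved_phase t \<eta> k l"
      unfolding evolved_phase_def cis_cnj cis_mult by (rule arg_cong[of _ _ cis]) (simp add: field_simps)
    show "fourier_coeff w (\<eta> + k) * cnj (fourier_coeff w (\<eta> + l)) * B (texp (\<eta> + k)) (texp (\<eta> + l))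
      = fourier_coeff \<rho> k * cnj (fourier_coeff \<rho> l) * evolved_phase t \<eta> k l * B (texp (\<eta> + k)) (texp (\<eta> + l))"
      unfolding co[OF kl(1)] co[OF kl(2)] E[symmetric] by (simp only: complex_cnj_mult mult_ac)
  qed
  finally have Bs: "B ?s ?s = \<dots>" .
  have "norm (B w w - B ?s ?s) \<le> C * tnorm (\<lambda>x. w x - ?s x) * (tnorm w + tnorm ?s)"
    by (rule torus_form_quadratic_diff[OF B w s])
  also have "\<dots> \<le> C * tnorm (\<lambda>x. w x - ?s x) * (tnorm w + tnorm w)"
    using sw torus_form_bound(2)[OF B w w] by (intro mult_left_mono mult_nonneg_nonneg) auto
  also have "\<dots> = 2 * C * tnorm \<rho> * tnorm (\<lambda>x. \<rho> x - fourier_sum F \<rho> x)"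
    using tnorm_eq_shifted_coeffs(2)[OF \<rho> w \<eta> eq F] n by (simp add: w_def)
  finally show "norm (B (propagator t (modulate \<eta> \<rho>)) (propagator t (modulate \<eta> \<rho>))
        - (\<Sum>k\<in>F. \<Sum>l\<in>F. fourier_coeff \<rho> k * cnj (fourier_coeff \<rho> l) * evolved_phase t \<eta> k l * B (texp (\<eta> + k)) (texp (\<eta> + l))))
      \<le> 2 * C * tnorm \<rho> * tnorm (\<lambda>x. \<rho> x - fourier_sum F \<rho> x)"
    unfolding Bs by (simp add: w_def)
qed

subsection \<open>Fourier transforms of compactly supported functions\<close>

lemma (in pair_sigma_finite) integrable_pair_mult:
  fixes f :: "'a \<Rightarrow> 'c::{real_normed_field, banach, second_countable_topology}"
  assumes f: "integrable M1 f" and g: "integrable M2 g"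
  shows "integrable (M1 \<Otimes>\<^sub>M M2) (\<lambda>(x, y). f x * g y)"
proof (rule Fubini_integrable)
  note [measurable] = borel_measurable_integrable[OF f] borel_measurable_integrable[OF g]
  show "(\<lambda>(x, y). f x * g y) \<in> borel_measurable (M1 \<Otimes>\<^sub>M M2)" by measurable
  have "(\<lambda>x. LINT y|M2. norm (case (x, y) of (x, y) \<Rightarrow> f x * g y)) = (\<lambda>x. norm (f x) * (LINT y|M2. norm (g y)))"
    by (simp add: norm_mult)
  then show "integrable M1 (\<lambda>x. LINT y|M2. norm (case (x, y) of (x, y) \<Rightarrow> f x * g y))"
    using f by (simp only:) (intro integrable_mult_left integrable_norm)
  show "AE x in M1. integrable M2 (\<lambda>y. case (x, y) of (x, y) \<Rightarrow> f x * g y)"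
    using g by (intro AE_I2) (simp add: integrable_mult_right)
qed

lemma integral_prod_lborel:
  fixes h :: "'a::euclidean_space \<Rightarrow> real \<Rightarrow> complex"
  assumes h: "\<And>b. b \<in> Basis \<Longrightarrow> integrable lborel (h b)"
  shows "integrable lborel (\<lambda>z :: 'a. \<Prod>b\<in>Basis. h b (z \<bullet> b))"
    and "(LINT z|lborel. (\<Prod>b\<in>Basis. h b ((z :: 'a) \<bullet> b))) = (\<Prod>b\<in>Basis. (LINT t|lborel. h b t))"
proof -
  interpret product_sigma_finite "\<lambda>_ :: 'a. lborel :: real measure" by standard
  let ?T = "\<lambda>f. \<Sum>b\<in>(Basis :: 'a set). f b *\<^sub>R b" and ?M = "\<Pi>\<^sub>M b\<in>(Basis :: 'a set). (lborel :: real measure)"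
  have [measurable]: "h b \<in> borel_measurable borel" if "b \<in> Basis" for b using h[OF that] by auto
  have T: "?T \<in> ?M \<rightarrow>\<^sub>M borel" by measurable
  have m: "(\<lambda>z :: 'a. \<Prod>b\<in>Basis. h b (z \<bullet> b)) \<in> borel_measurable borel"
    by (intro borel_measurable_prod) measurable
  have eq: "(\<Prod>b\<in>Basis. h b (?T f \<bullet> b)) = (\<Prod>b\<in>Basis. h b (f b))" for f
    by (intro prod.cong refl) simp
  have "integrable ?M (\<lambda>f. \<Prod>b\<in>Basis. h b (f b))" by (rule product_integrable_prod) (auto intro: h)
  then show "integrable lborel (\<lambda>z :: 'a. \<Prod>b\<in>Basis. h b (z \<bullet> b))"
    by (subst lborel_eq) (simp add: integrable_distr_eq[OF T m] eq)
  have "(LINT z|lborel. (\<Prod>b\<in>Basis. h b ((z :: 'a) \<bullet> b))) = (LINT f|?M. (\<Prod>b\<in>Basis. h b (f b)))"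
    by (subst lborel_eq) (simp add: integral_distr[OF T m] eq)
  also have "\<dots> = (\<Prod>b\<in>Basis. (LINT t|lborel. h b t))"
    by (rule product_integral_prod) (auto intro: h)
  finally show "(LINT z|lborel. (\<Prod>b\<in>Basis. h b ((z :: 'a) \<bullet> b))) = (\<Prod>b\<in>Basis. (LINT t|lborel. h b t))" .
qed

lemma lborel_integral_affine:
  fixes f :: "'a::euclidean_space \<Rightarrow> 'b::{banach, second_countable_topology}"
  assumes c: "c \<noteq> 0" and f: "f \<in> borel_measurable borel"
  shows "integrable lborel f \<longleftrightarrow> integrable lborel (\<lambda>x. f (t + c *\<^sub>R x))"
    and "(LINT x|lborel. f x) = \<bar>c\<bar> ^ DIM('a) *\<^sub>R (LINT x|lborel. f (t + c *\<^sub>R x))"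
proof -
  have [measurable]: "(\<lambda>x. t + c *\<^sub>R x) \<in> borel \<rightarrow>\<^sub>M borel" by measurable
  have e: "lborel = density (distr lborel borel (\<lambda>x. t + c *\<^sub>R x)) (\<lambda>_. ennreal (\<bar>c\<bar> ^ DIM('a)))"
    using lborel_affine[OF c, of t] by (simp add: ennreal_power)
  have "integrable lborel f \<longleftrightarrow> integrable (distr lborel borel (\<lambda>x. t + c *\<^sub>R x)) (\<lambda>x. \<bar>c\<bar> ^ DIM('a) *\<^sub>R f x)"
    by (subst e, subst integrable_density) (use f in auto)
  also have "\<dots> \<longleftrightarrow> integrable lborel (\<lambda>x. \<bar>c\<bar> ^ DIM('a) *\<^sub>R f (t + c *\<^sub>R x))"
    by (subst integrable_distr_eq) (use f in auto)
  also have "\<dots> \<longleftrightarrow> integrable lborel (\<lambda>x. f (t + c *\<^sub>R x))"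
  proof
    assume "integrable lborel (\<lambda>x. \<bar>c\<bar> ^ DIM('a) *\<^sub>R f (t + c *\<^sub>R x))"
    from integrable_scaleR_right[OF this, of "1 / \<bar>c\<bar> ^ DIM('a)"]
    show "integrable lborel (\<lambda>x. f (t + c *\<^sub>R x))" using c by simp
  qed (rule integrable_scaleR_right)
  finally show "integrable lborel f \<longleftrightarrow> integrable lborel (\<lambda>x. f (t + c *\<^sub>R x))" .
  have "(LINT x|lborel. f x) = (LINT x|distr lborel borel (\<lambda>x. t + c *\<^sub>R x). \<bar>c\<bar> ^ DIM('a) *\<^sub>R f x)"
    by (subst e, subst integral_density) (use f in auto)
  also have "\<dots> = (LINT x|lborel. \<bar>c\<bar> ^ DIM('a) *\<^sub>R f (t + c *\<^sub>R x))"
    by (subst integral_distr) (use f in auto)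
  finally show "(LINT x|lborel. f x) = \<bar>c\<bar> ^ DIM('a) *\<^sub>R (LINT x|lborel. f (t + c *\<^sub>R x))" by simp
qed

section \<open>Gaussians and Fourier inversion\<close>

definition gauss :: "'a::euclidean_space \<Rightarrow> real" where
  "gauss z = exp (- (norm z)\<^sup>2 / 2)"

lemma gauss_bounds: "0 \<le> gauss z" "gauss z \<le> 1" by (simp_all add: gauss_def)

lemma continuous_gauss: "continuous_on S f \<Longrightarrow> continuous_on S (\<lambda>x. gauss (f x))"
  unfolding gauss_def by (auto intro!: continuous_intros)

lemma gauss_measurable [measurable]: "gauss \<in> borel_measurable borel"
  by (intro borel_measurable_continuous_onI continuous_gauss continuous_intros)

text \<open>The characteristic function of the standard normal law, freed from its normalising
  factor.\<close>

lemma gauss_fourier_real: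
  "integrable lborel (\<lambda>s :: real. of_real (exp (- s\<^sup>2 / 2)) * cis (s * y))"
  "(LINT s|lborel. of_real (exp (- s\<^sup>2 / 2)) * cis (s * y)) = complex_of_real (sqrt (2 * pi) * exp (- y\<^sup>2 / 2))"
proof -
  have i: "integrable lborel std_normal_density" by simp
  have i': "integrable lborel (\<lambda>s :: real. exp (- s\<^sup>2 / 2))"
    using integrable_mult_right[OF i, of "sqrt (2 * pi)"] by (simp add: std_normal_density_def)
  show "integrable lborel (\<lambda>s :: real. of_real (exp (- s\<^sup>2 / 2)) * cis (s * y))"
    by (rule Bochner_Integration.integrable_bound[OF i']) (auto simp: norm_mult cis_conv_exp)
  have "(LINT s|lborel. of_real (exp (- s\<^sup>2 / 2)) * cis (s * y)) = (LINT s|lborel. of_real (sqrt (2 * pi)) * (std_normal_density s *\<^sub>R iexp (y * s)))"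
    by (rule Bochner_Integration.integral_cong) (auto simp: std_normal_density_def cis_conv_exp scaleR_conv_of_real mult_ac)
  also have "\<dots> = of_real (sqrt (2 * pi)) * (LINT s|lborel. std_normal_density s *\<^sub>R iexp (y * s))"
    by (rule integral_mult_right_zero)
  also have "(LINT s|lborel. std_normal_density s *\<^sub>R iexp (y * s)) = char std_normal_distribution y"
    unfolding char_def by (subst integral_density) (auto intro!: measurable_If)
  also have "\<dots> = complex_of_real (exp (- (y^2) / 2))" by (simp add: char_std_normal_distribution)
  finally show "(LINT s|lborel. of_real (exp (- s\<^sup>2 / 2)) * cis (s * y)) = complex_of_real (sqrt (2 * pi) * exp (- y\<^sup>2 / 2))" by simp
qed

lemma gauss_fourier:
  fixes y :: "'a::euclidean_space"
  shows "integrable lborel (\<lambda>z :: 'a. of_real (gauss z) * cis (z \<bullet> y))"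
    and "(LINT z|lborel. of_real (gauss z) * cis (z \<bullet> y)) = complex_of_real (sqrt (2 * pi) ^ DIM('a) * gauss y)"
proof -
  have n: "(norm z)\<^sup>2 = (\<Sum>b\<in>Basis. (z \<bullet> b)\<^sup>2)" for z :: 'a
    unfolding power2_norm_eq_inner by (subst euclidean_inner) (simp add: power2_eq_square)
  have g: "gauss z = (\<Prod>b\<in>Basis. exp (- (z \<bullet> b)\<^sup>2 / 2))" for z :: 'a
    by (simp add: gauss_def n exp_sum[symmetric] sum_negf[symmetric] sum_divide_distrib)
  have c: "cis (z \<bullet> y) = (\<Prod>b\<in>Basis. cis ((z \<bullet> b) * (y \<bullet> b)))" for z
    by (subst euclidean_inner) (simp add: cis_conv_exp sum_distrib_left exp_sum[symmetric])
  have e: "of_real (gauss z) * cis (z \<bullet> y) = (\<Prod>b\<in>Basis. of_real (exp (- (z \<bullet> b)\<^sup>2 / 2)) * cis ((z \<bullet> b) * (y \<bullet> b)))" for z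
    by (simp only: g c of_real_prod prod.distrib)
  show "integrable lborel (\<lambda>z :: 'a. of_real (gauss z) * cis (z \<bullet> y))"
    unfolding e by (rule integral_prod_lborel(1)) (rule gauss_fourier_real)
  have "(LINT z|lborel. of_real (gauss z) * cis (z \<bullet> y)) = (\<Prod>b\<in>Basis. complex_of_real (sqrt (2 * pi) * exp (- (y \<bullet> b)\<^sup>2 / 2)))"
    unfolding e by (subst integral_prod_lborel(2)) (simp_all only: gauss_fourier_real)
  also have "\<dots> = complex_of_real (sqrt (2 * pi) ^ DIM('a) * gauss y)"
    by (simp only: of_real_prod[symmetric] prod.distrib prod_constant g)
  finally show "(LINT z|lborel. of_real (gauss z) * cis (z \<bullet> y)) = complex_of_real (sqrt (2 * pi) ^ DIM('a) * gauss y)" .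
qed

lemma integrable_compact_support:
  fixes f :: "'a::euclidean_space \<Rightarrow> 'b::{banach, second_countable_topology}"
  assumes "f \<in> borel_measurable borel" "\<And>x. norm (f x) \<le> K" "\<And>x. norm x > R \<Longrightarrow> f x = 0"
  shows "integrable lborel f"
proof -
  have "integrable lborel (\<lambda>x. K *\<^sub>R indicator (cball (0 :: 'a) R) x :: real)"
    using emeasure_bounded_finite[of "cball (0 :: 'a) R"] by (intro integrable_scaleR_right integrable_real_indicator) auto
  then show ?thesis
  proof (rule Bochner_Integration.integrable_bound)
    have K: "K \<ge> 0" using assms(2)[of 0] norm_ge_zero order_trans by blast
    show "AE x in lborel. norm (f x) \<le> norm (K *\<^sub>R indicator (cball (0 :: 'a) R) x :: real)"
    proof (rule AE_I2)
      fix x show "norm (f x) \<le> norm (K *\<^sub>R indicator (cball (0 :: 'a) R) x :: real)"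
        using assms(2,3)[of x] K by (cases "norm x \<le> R") (auto simp: indicator_def)
    qed
  qed (use assms(1) in simp)
qed

lemma integral_compact_support_bound:
  fixes f :: "'a::euclidean_space \<Rightarrow> 'b::{banach, second_countable_topology}"
  assumes "f \<in> borel_measurable borel" "\<And>x. norm (f x) \<le> K" "\<And>x. norm x > R \<Longrightarrow> f x = 0"
  shows "norm (LINT x|lborel. f x) \<le> K * measure lborel (cball (0 :: 'a) R)"
proof -
  have i: "integrable lborel (\<lambda>x. K *\<^sub>R indicator (cball (0 :: 'a) R) x :: real)"
    using emeasure_bounded_finite[of "cball (0 :: 'a) R"] by (intro integrable_scaleR_right integrable_real_indicator) auto
  have K: "K \<ge> 0" using assms(2)[of 0] norm_ge_zero order_trans by blast
  have "norm (LINT x|lborel. f x) \<le> (LINT x|lborel. norm (f x))" by (rule integral_norm_bound)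
  also have "\<dots> \<le> (LINT x|lborel. K *\<^sub>R indicator (cball (0 :: 'a) R) x)"
  proof (rule integral_mono)
    fix x show "norm (f x) \<le> K *\<^sub>R indicator (cball (0 :: 'a) R) x"
      using assms(2,3)[of x] K by (cases "norm x \<le> R") (auto simp: indicator_def)
  qed (use i integrable_compact_support[OF assms] in auto)
  also have "\<dots> = K * measure lborel (cball (0 :: 'a) R)" by simp
  finally show ?thesis .
qed

text \<open>With the exponent \<open>DIM('a) + 2\<close> a crude covering by balls of radius n + 1
  already gives integrability: volume O((n + 1)^DIM('a)) against height (n + 1)^-(DIM('a) + 2)
  leaves a convergent sum of inverse squares.\<close>

definition decay :: "'a::euclidean_space \<Rightarrow> real" where
  "decay z = 1 / (1 + norm z) ^ (DIM('a) + 2)"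

lemma decay_nonneg [simp]: "0 \<le> decay z" by (simp add: decay_def)

lemma decay_measurable [measurable]: "decay \<in> borel_measurable borel"
  unfolding decay_def[abs_def] by measurable

lemma decay_integrable: "integrable lborel (decay :: 'a::euclidean_space \<Rightarrow> real)"
proof -
  let ?d = "DIM('a)" and ?v = "unit_ball_vol (real DIM('a))"
  have p: "ennreal (decay z) \<le> (\<Sum>n. ennreal (1 / (1 + real n) ^ (?d + 2)) * indicator (ball 0 (real n + 1)) z)" for z :: 'a
  proof -
    define n where "n = nat \<lfloor>norm z\<rfloor>"
    have n: "real n \<le> norm z" "norm z < real n + 1" using norm_ge_zero[of z] unfolding n_def by linarith+
    have pw: "(1 + real n) ^ (?d + 2) \<le> (1 + norm z) ^ (?d + 2)" using n by (intro power_mono) auto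
    have "0 < (1 + norm z) ^ (?d + 2)" by (intro zero_less_power add_pos_nonneg) auto
    then have dz: "decay z \<le> 1 / (1 + real n) ^ (?d + 2)"
      unfolding decay_def using pw by (intro divide_left_mono mult_pos_pos) auto
    define F where "F m = ennreal (1 / (1 + real m) ^ (?d + 2)) * indicator (ball 0 (real m + 1)) z" for m
    have "z \<in> ball 0 (real n + 1)" using n by simp
    then have "F n = ennreal (1 / (1 + real n) ^ (?d + 2))" unfolding F_def by (simp only: indicator_simps mult_1_right)
    then have "ennreal (decay z) \<le> F n" using ennreal_leI[OF dz] by (simp only:)
    also have "\<dots> \<le> (\<Sum>m. F m)" using sum_le_suminf[OF summableI, of "{n}" F] by simp
    finally show ?thesis unfolding F_def .
  qed
  have "(\<integral>\<^sup>+z. ennreal (decay (z :: 'a)) \<partial>lborel) \<le> (\<integral>\<^sup>+z. (\<Sum>n. ennreal (1 / (1 + real n) ^ (?d + 2)) * indicator (ball 0 (real n + 1)) (z :: 'a)) \<partial>lborel)"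
    by (intro nn_integral_mono p)
  also have "\<dots> = (\<Sum>n. \<integral>\<^sup>+z. ennreal (1 / (1 + real n) ^ (?d + 2)) * indicator (ball 0 (real n + 1)) (z :: 'a) \<partial>lborel)"
  proof (rule nn_integral_suminf)
    fix n :: nat
    have [measurable]: "ball (0 :: 'a) (real n + 1) \<in> sets borel" by simp
    show "(\<lambda>z. ennreal (1 / (1 + real n) ^ (?d + 2)) * indicator (ball (0 :: 'a) (real n + 1)) z) \<in> borel_measurable lborel"
      by measurable
  qed
  also have "\<dots> = (\<Sum>n. ennreal (?v * (1 / (1 + real n) ^ 2)))"
  proof (rule suminf_cong)
    fix n
    have v: "?v \<ge> 0" by simp
    have "(\<integral>\<^sup>+z. ennreal (1 / (1 + real n) ^ (?d + 2)) * indicator (ball 0 (real n + 1)) (z :: 'a) \<partial>lborel) = ennreal (1 / (1 + real n) ^ (?d + 2)) * ennreal (?v * (real n + 1) ^ ?d)"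
      by (subst nn_integral_cmult_indicator) (simp_all add: emeasure_ball)
    also have "\<dots> = ennreal (1 / (1 + real n) ^ (?d + 2) * (?v * (real n + 1) ^ ?d))"
      using v by (intro ennreal_mult[symmetric]) auto
    also have "1 / (1 + real n) ^ (?d + 2) * (?v * (real n + 1) ^ ?d) = ?v * (1 / (1 + real n) ^ 2)"
    proof -
      have "1 / t ^ (?d + 2) * (v * t ^ ?d) = v * (1 / t\<^sup>2)" if "t > 0" for t v :: real
        using that by (simp add: power_add power2_eq_square field_simps)
      from this[of "1 + real n" ?v] show ?thesis by (simp only: add.commute[of "real n" 1])
    qed
    finally show "(\<integral>\<^sup>+z. ennreal (1 / (1 + real n) ^ (?d + 2)) * indicator (ball 0 (real n + 1)) (z :: 'a) \<partial>lborel) = ennreal (?v * (1 / (1 + real n) ^ 2))" .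
  qed
  also have "\<dots> = ennreal (\<Sum>n. ?v * (1 / (1 + real n) ^ 2))"
  proof (rule suminf_ennreal2)
    have "summable (\<lambda>n. inverse (real n ^ 2))" by (rule inverse_power_summable) simp
    then have "summable (\<lambda>n. inverse (real (Suc n) ^ 2))" by (subst summable_Suc_iff)
    then show "summable (\<lambda>n. ?v * (1 / (1 + real n) ^ 2))" by (intro summable_mult) (simp add: inverse_eq_divide)
  qed auto
  also have "\<dots> < \<infinity>" by simp
  finally show ?thesis by (intro integrableI_nonneg) auto
qed

text \<open>A Gaussian of growing width is inserted into the inverse integral. By dominated
  convergence with the majorant \<open>C * decay z\<close> this tends to the inverse integral
  itself; by Fubini it is also the mean of f against a Gaussian concentrating at y.\<close>

theorem Fourier_inversion:
  fixes f :: "'a::euclidean_space \<Rightarrow> complex"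
  assumes f: "continuous_on UNIV f" and K: "\<And>x. norm (f x) \<le> K" and R: "\<And>x. norm x > R \<Longrightarrow> f x = 0"
    and C: "\<And>z. norm (LINT x|lborel. f x * cis (z \<bullet> x)) \<le> C * decay z"
  shows "(LINT z|lborel. (LINT x|lborel. f x * cis (z \<bullet> x)) * cis (- (z \<bullet> y))) = (2 * pi) ^ DIM('a) * f y"
proof -
  let ?F = "\<lambda>z. LINT x|lborel. f x * cis (z \<bullet> x)"
  have fm [measurable]: "f \<in> borel_measurable borel" by (rule borel_measurable_continuous_onI[OF f])
  have cism [measurable]: "cis \<in> borel_measurable borel" by (intro borel_measurable_continuous_onI continuous_intros)
  have fi: "integrable lborel f" by (rule integrable_compact_support[OF fm K R])
  have Fm [measurable]: "?F \<in> borel_measurable borel" by measurable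
  have C0: "C \<ge> 0" using order_trans[OF norm_ge_zero C[of 0]] by (simp add: decay_def)
  define I where "I n = (LINT z|lborel. ?F z * cis (- (z \<bullet> y)) * of_real (gauss ((1 / real (Suc n)) *\<^sub>R z)))" for n
  have e0: "(\<lambda>n. 1 / real (Suc n)) \<longlonglongrightarrow> 0" using LIMSEQ_Suc[OF lim_1_over_n] by simp
  have lim1: "I \<longlonglongrightarrow> (LINT z|lborel. ?F z * cis (- (z \<bullet> y)))"
    unfolding I_def
  proof (rule integral_dominated_convergence[where w = "\<lambda>z. C * decay z"])
    show "integrable lborel (\<lambda>z :: 'a. C * decay z)" by (intro integrable_mult_right decay_integrable)
    show "AE z in lborel. (\<lambda>n. ?F z * cis (- (z \<bullet> y)) * of_real (gauss ((1 / real (Suc n)) *\<^sub>R z))) \<longlonglongrightarrow> ?F z * cis (- (z \<bullet> y))"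
    proof (rule AE_I2)
      fix z :: 'a
      have "(\<lambda>n. ?F z * cis (- (z \<bullet> y)) * of_real (exp (- (norm ((1 / real (Suc n)) *\<^sub>R z))\<^sup>2 / 2))) \<longlonglongrightarrow> ?F z * cis (- (z \<bullet> y)) * of_real (exp (- (norm (0 *\<^sub>R z))\<^sup>2 / 2))"
        by (intro tendsto_intros e0) simp
      then show "(\<lambda>n. ?F z * cis (- (z \<bullet> y)) * of_real (gauss ((1 / real (Suc n)) *\<^sub>R z))) \<longlonglongrightarrow> ?F z * cis (- (z \<bullet> y))"
        by (simp add: gauss_def)
    qed
    show "AE z in lborel. norm (?F z * cis (- (z \<bullet> y)) * of_real (gauss ((1 / real (Suc n)) *\<^sub>R z))) \<le> C * decay z" for n
    proof (rule AE_I2)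
      fix z :: 'a
      have "norm (?F z) * gauss ((1 / real (Suc n)) *\<^sub>R z) \<le> (C * decay z) * 1"
        using C[of z] gauss_bounds C0 by (intro mult_mono) auto
      then show "norm (?F z * cis (- (z \<bullet> y)) * of_real (gauss ((1 / real (Suc n)) *\<^sub>R z))) \<le> C * decay z"
        using gauss_bounds(1)[of "(1 / real (Suc n)) *\<^sub>R z"] by (simp add: norm_mult)
    qed
  qed measurable
  have I: "I n = of_real (sqrt (2 * pi) ^ DIM('a)) * (LINT w|lborel. f (y + (1 / real (Suc n)) *\<^sub>R w) * of_real (gauss w))" for n
  proof -
    define e where "e = 1 / real (Suc n)"
    have e: "e > 0" by (simp add: e_def)
    have gi: "integrable lborel (\<lambda>z :: 'a. of_real (gauss (e *\<^sub>R z)) :: complex)"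
      using lborel_integral_affine(1)[of e "\<lambda>z :: 'a. of_real (gauss z) :: complex" 0] gauss_fourier(1)[of "0 :: 'a"] e by simp
    have "I n = (LINT z|lborel. LINT x|lborel. f x * (cis (z \<bullet> (x - y)) * of_real (gauss (e *\<^sub>R z))))"
      unfolding I_def e_def[symmetric]
    proof (rule Bochner_Integration.integral_cong[OF refl])
      fix z :: 'a
      have "?F z * cis (- (z \<bullet> y)) * of_real (gauss (e *\<^sub>R z)) = (LINT x|lborel. f x * cis (z \<bullet> x) * (cis (- (z \<bullet> y)) * of_real (gauss (e *\<^sub>R z))))"
        unfolding mult.assoc[of "?F z"] by (rule integral_mult_left_zero[symmetric])
      also have "\<dots> = (LINT x|lborel. f x * (cis (z \<bullet> (x - y)) * of_real (gauss (e *\<^sub>R z))))"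
      proof (rule Bochner_Integration.integral_cong[OF refl])
        fix x
        have "cis (z \<bullet> x) * cis (- (z \<bullet> y)) = cis (z \<bullet> (x - y))" by (simp add: cis_mult inner_diff_right)
        then show "f x * cis (z \<bullet> x) * (cis (- (z \<bullet> y)) * of_real (gauss (e *\<^sub>R z))) = f x * (cis (z \<bullet> (x - y)) * of_real (gauss (e *\<^sub>R z)))"
          by (metis mult.assoc)
      qed
      finally show "?F z * cis (- (z \<bullet> y)) * of_real (gauss (e *\<^sub>R z)) = (LINT x|lborel. f x * (cis (z \<bullet> (x - y)) * of_real (gauss (e *\<^sub>R z))))" .
    qed
    \<comment> \<open>The Gaussian factor makes the double integral absolutely convergent. After the
      exchange the inner integral is the Fourier transform of a dilated Gaussian.\<close>
    also have "\<dots> = (LINT x|lborel. LINT z|lborel. f x * (cis (z \<bullet> (x - y)) * of_real (gauss (e *\<^sub>R z))))"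
    proof (rule lborel_pair.Fubini_integral)
      have "integrable (lborel \<Otimes>\<^sub>M lborel) (\<lambda>(x, z :: 'a). f x * of_real (gauss (e *\<^sub>R z)))"
        by (rule lborel_pair.integrable_pair_mult[OF fi gi])
      then show "integrable (lborel \<Otimes>\<^sub>M lborel) (\<lambda>(x, z). f x * (cis (z \<bullet> (x - y)) * of_real (gauss (e *\<^sub>R z))))"
        by (rule Bochner_Integration.integrable_bound) (auto simp: norm_mult split_beta')
    qed
    also have "\<dots> = (LINT x|lborel. f x * of_real (sqrt (2 * pi) ^ DIM('a) * gauss ((1 / e) *\<^sub>R (x - y)) / e ^ DIM('a)))"
    proof (rule Bochner_Integration.integral_cong[OF refl])
      fix x
      have "of_real (sqrt (2 * pi) ^ DIM('a) * gauss ((1 / e) *\<^sub>R (x - y))) = (LINT z|lborel. of_real (gauss z) * cis (z \<bullet> ((1 / e) *\<^sub>R (x - y))))"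
        by (rule gauss_fourier(2)[symmetric])
      also have "\<dots> = \<bar>e\<bar> ^ DIM('a) *\<^sub>R (LINT z|lborel. of_real (gauss (0 + e *\<^sub>R z)) * cis ((0 + e *\<^sub>R z) \<bullet> ((1 / e) *\<^sub>R (x - y))))"
        using e by (intro lborel_integral_affine(2)) (auto intro!: borel_measurable_continuous_onI continuous_intros continuous_gauss)
      also have "\<dots> = of_real (e ^ DIM('a)) * (LINT z|lborel. of_real (gauss (e *\<^sub>R z)) * cis (z \<bullet> (x - y)))"
        using e by (simp add: scaleR_conv_of_real)
      finally have "(LINT z|lborel. of_real (gauss (e *\<^sub>R z)) * cis (z \<bullet> (x - y))) = of_real (sqrt (2 * pi) ^ DIM('a) * gauss ((1 / e) *\<^sub>R (x - y)) / e ^ DIM('a))"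
        using e by (simp add: field_simps)
      then show "(LINT z|lborel. f x * (cis (z \<bullet> (x - y)) * of_real (gauss (e *\<^sub>R z)))) = f x * of_real (sqrt (2 * pi) ^ DIM('a) * gauss ((1 / e) *\<^sub>R (x - y)) / e ^ DIM('a))"
        by (simp add: mult.commute)
    qed
    also have "\<dots> = \<bar>e\<bar> ^ DIM('a) *\<^sub>R (LINT w|lborel. f (y + e *\<^sub>R w) * of_real (sqrt (2 * pi) ^ DIM('a) * gauss ((1 / e) *\<^sub>R (y + e *\<^sub>R w - y)) / e ^ DIM('a)))"
      using e by (intro lborel_integral_affine(2)) measurable
    also have "\<dots> = (LINT w|lborel. \<bar>e\<bar> ^ DIM('a) *\<^sub>R (f (y + e *\<^sub>R w) * of_real (sqrt (2 * pi) ^ DIM('a) * gauss ((1 / e) *\<^sub>R (y + e *\<^sub>R w - y)) / e ^ DIM('a))))"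
      by (rule integral_scaleR_right[symmetric]) 
    also have "\<dots> = (LINT w|lborel. of_real (sqrt (2 * pi) ^ DIM('a)) * (f (y + e *\<^sub>R w) * of_real (gauss w)))"
      using e by (intro Bochner_Integration.integral_cong) (auto simp: scaleR_conv_of_real)
    also have "\<dots> = of_real (sqrt (2 * pi) ^ DIM('a)) * (LINT w|lborel. f (y + e *\<^sub>R w) * of_real (gauss w))"
      by (rule integral_mult_right_zero)
    finally show ?thesis unfolding e_def .
  qed
  have gi: "integrable lborel (gauss :: 'a \<Rightarrow> real)" and gv: "(LINT w|lborel. gauss (w :: 'a)) = sqrt (2 * pi) ^ DIM('a)"
  proof -
    have 1: "integrable lborel (\<lambda>z :: 'a. complex_of_real (gauss z))" "(LINT z|lborel. complex_of_real (gauss (z :: 'a))) = of_real (sqrt (2 * pi) ^ DIM('a))"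
      using gauss_fourier[of "0 :: 'a"] by (simp_all add: gauss_def)
    from integrable_Re[OF 1(1)] show "integrable lborel (gauss :: 'a \<Rightarrow> real)" by simp
    from 1(2) show "(LINT w|lborel. gauss (w :: 'a)) = sqrt (2 * pi) ^ DIM('a)"
      by (simp only: integral_complex_of_real of_real_eq_iff)
  qed
  have "(\<lambda>n. LINT w|lborel. f (y + (1 / real (Suc n)) *\<^sub>R w) * of_real (gauss w)) \<longlonglongrightarrow> (LINT w|lborel. f y * of_real (gauss (w :: 'a)))"
  proof (rule integral_dominated_convergence[where w = "\<lambda>w :: 'a. K * gauss w"])
    show "integrable lborel (\<lambda>w :: 'a. K * gauss w)" using gi by simp
    show "AE w in lborel. (\<lambda>n. f (y + (1 / real (Suc n)) *\<^sub>R w) * of_real (gauss w)) \<longlonglongrightarrow> f y * of_real (gauss w)"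
    proof (rule AE_I2)
      fix w :: 'a
      have "(\<lambda>n. y + (1 / real (Suc n)) *\<^sub>R w) \<longlonglongrightarrow> y + 0 *\<^sub>R w" by (intro tendsto_intros e0)
      then have "(\<lambda>n. f (y + (1 / real (Suc n)) *\<^sub>R w)) \<longlonglongrightarrow> f y"
        using f by (intro continuous_on_tendsto_compose[of UNIV f]) auto
      then show "(\<lambda>n. f (y + (1 / real (Suc n)) *\<^sub>R w) * of_real (gauss w)) \<longlonglongrightarrow> f y * of_real (gauss w)"
        by (intro tendsto_intros)
    qed
    show "AE w in lborel. norm (f (y + (1 / real (Suc n)) *\<^sub>R w) * of_real (gauss w)) \<le> K * gauss w" for n
      using K gauss_bounds(1) by (intro AE_I2) (auto simp: norm_mult abs_of_nonneg[OF gauss_bounds(1)] intro!: mult_right_mono)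
  qed measurable
  then have "I \<longlonglongrightarrow> of_real (sqrt (2 * pi) ^ DIM('a)) * (LINT w|lborel. f y * of_real (gauss (w :: 'a)))"
    unfolding I by (intro tendsto_intros)
  \<comment> \<open>The factor (2 pi)^(d/2) occurs twice, once from the transform of the Gaussian
    and once from its total mass.\<close>
  from LIMSEQ_unique[OF lim1 this] have "(LINT z|lborel. ?F z * cis (- (z \<bullet> y))) = of_real (sqrt (2 * pi) ^ DIM('a)) * (f y * of_real (sqrt (2 * pi) ^ DIM('a)))"
    by (simp only: integral_mult_right_zero integral_complex_of_real gv)
  also have "\<dots> = (of_real (sqrt (2 * pi)) * of_real (sqrt (2 * pi))) ^ DIM('a) * f y"
    by (simp add: power_mult_distrib)
  also have "of_real (sqrt (2 * pi)) * of_real (sqrt (2 * pi)) = (2 * pi :: complex)"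
    by (simp flip: of_real_mult)
  finally show ?thesis by simp
qed

subsection \<open>Symbols\<close>

lemma symbol_continuous: "a \<in> torus_symbols \<Longrightarrow> continuous_on UNIV a"
proof -
  assume "a \<in> torus_symbols"
  then have "Ck_on 0 UNIV a" unfolding torus_symbols_def smooth_on_def by blast
  then show ?thesis by simp
qed

lemma symbol_periodic: "a \<in> torus_symbols \<Longrightarrow> torus_periodic (\<lambda>x. a (x, \<xi>))"
  unfolding torus_symbols_def by blast

lemma symbol_support: "a \<in> torus_symbols \<Longrightarrow> \<exists>R. \<forall>x \<xi>. norm \<xi> > R \<longrightarrow> a (x, \<xi>) = 0"
  unfolding torus_symbols_def by (auto simp: not_less[symmetric])

lemma symbol_has_derivative:
  assumes "a \<in> torus_symbols" shows "(a has_derivative frechet_derivative a (at p)) (at p)"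
proof -
  have "Ck_on (Suc 0) UNIV a" using assms unfolding torus_symbols_def smooth_on_def by blast
  then have "a differentiable (at p)" unfolding Ck_on.simps by blast
  then show ?thesis by (simp only: frechet_derivative_works)
qed

lemma torus_cell_subset_cbox: "torus_cell \<subseteq> cbox 0 (\<chi> i. 2 * pi)"
  by (auto simp: torus_cell_def mem_box_cart less_imp_le)

lemma symbol_bounded:
  assumes a: "a \<in> torus_symbols" shows "\<exists>K. \<forall>p. norm (a p) \<le> K"
proof -
  obtain R where R: "\<And>x \<xi>. norm \<xi> > R \<Longrightarrow> a (x, \<xi>) = 0" using symbol_support[OF a] by blast
  let ?S = "cbox 0 (\<chi> i. 2 * pi) \<times> cball 0 R"
  have "compact (a ` ?S)"
    by (intro compact_continuous_image continuous_on_subset[OF symbol_continuous[OF a]] compact_Times) auto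
  then obtain K where K: "\<And>p. p \<in> ?S \<Longrightarrow> norm (a p) \<le> K"
    using compact_imp_bounded bounded_iff by (metis imageI)
  have "norm (a (x, \<xi>)) \<le> max K 0" for x \<xi>
  proof (cases "norm \<xi> \<le> R")
    case True
    then have "(torus_red x, \<xi>) \<in> ?S" using torus_red_in_cell torus_cell_subset_cbox by auto
    then show ?thesis using K[of "(torus_red x, \<xi>)"] torus_periodic_red[of "\<lambda>x. a (x, \<xi>)" x, OF symbol_periodic[OF a]]
      by (simp add: le_max_iff_disj)
  qed (use R in simp)
  then show ?thesis by (metis surj_pair)
qed

text \<open>Stability under differentiation permits repeated integration by parts. Periodicity is
  inherited by uniqueness of derivatives, and the support condition because the symbol vanishes on
  an open set.\<close>

lemma symbol_deriv:
  fixes a :: "(real ^ 'd::finite) \<times> (real ^ 'd) \<Rightarrow> complex"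
  assumes a: "a \<in> torus_symbols" shows "(\<lambda>p. frechet_derivative a (at p) w) \<in> torus_symbols"
  unfolding torus_symbols_def
proof (intro CollectI conjI allI)
  have "Ck_on (Suc n) UNIV a" for n using a unfolding torus_symbols_def smooth_on_def by blast
  then show "smooth_on UNIV (\<lambda>p. frechet_derivative a (at p) w)" unfolding smooth_on_def Ck_on.simps by blast
  show "torus_periodic (\<lambda>x. frechet_derivative a (at (x, \<xi>)) w)" for \<xi>
    unfolding torus_periodic_def
  proof (intro allI impI)
    fix x y :: "real ^ 'd" assume "torus_eq x y"
    then obtain k where k: "k \<in> int_vecs" "y = x + (2 * pi) *\<^sub>R k" unfolding torus_eq_def by blast
    let ?c = "((2 * pi) *\<^sub>R k, 0 :: real ^ 'd)"
    have per: "a (p + ?c) = a p" for p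
    proof (cases p)
      case (Pair u v)
      have "torus_eq u (u + (2 * pi) *\<^sub>R k)" unfolding torus_eq_def using k by blast
      then show ?thesis using torus_periodicD[OF symbol_periodic[OF a, of v]] Pair by simp
    qed
    have yc: "(y, \<xi>) = (x, \<xi>) + ?c" using k by simp
    have "(a has_derivative frechet_derivative a (at (y, \<xi>))) (at ((x, \<xi>) + ?c))"
      using symbol_has_derivative[OF a, of "(y, \<xi>)"] yc by simp
    then have "((\<lambda>p. a (p + ?c)) has_derivative (\<lambda>h. frechet_derivative a (at (y, \<xi>)) h)) (at (x, \<xi>))"
      by (rule has_derivative_compose[rotated]) (auto intro!: derivative_eq_intros)
    then have "(a has_derivative (\<lambda>h. frechet_derivative a (at (y, \<xi>)) h)) (at (x, \<xi>))"
      by (simp only: per)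
    then have "(\<lambda>h. frechet_derivative a (at (y, \<xi>)) h) = frechet_derivative a (at (x, \<xi>))"
      by (rule frechet_derivative_at)
    then show "frechet_derivative a (at (x, \<xi>)) w = frechet_derivative a (at (y, \<xi>)) w" by metis
  qed
  obtain R where R: "\<And>x \<xi>. norm \<xi> > R \<Longrightarrow> a (x, \<xi>) = 0" using symbol_support[OF a] by blast
  have "frechet_derivative a (at (x, \<xi>)) w = 0" if "norm \<xi> > R" for x \<xi>
  proof -
    let ?W = "{p :: (real ^ 'd) \<times> (real ^ 'd). norm (snd p) > R}"
    have "open ?W" by (intro open_Collect_less continuous_intros)
    moreover have "((\<lambda>p. 0) has_derivative (\<lambda>h. 0)) (at (x, \<xi>))" by simp
    ultimately have "(a has_derivative (\<lambda>h. 0)) (at (x, \<xi>))"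
      using has_derivative_transform_within_open[of "\<lambda>p. 0" "\<lambda>h. 0" "(x, \<xi>)" UNIV ?W a] that R by auto
    then show ?thesis using frechet_derivative_at by metis
  qed
  then show "\<exists>R. \<forall>x \<xi>. frechet_derivative a (at (x, \<xi>)) w \<noteq> 0 \<longrightarrow> norm \<xi> \<le> R"
    by (metis not_less)
qed

text \<open>Difference quotients have integral 0 by translation invariance. They converge to the
  derivative, and the mean value inequality dominates them by a constant on a fixed ball.\<close>

lemma integral_directional_derivative:
  fixes f :: "'a::euclidean_space \<Rightarrow> complex"
  assumes der: "\<And>x. (f has_derivative f' x) (at x)" and cont: "continuous_on UNIV (\<lambda>x. f' x v)"
    and R: "\<And>x. norm x > R \<Longrightarrow> f x = 0"
  shows "(LINT x|lborel. f' x v) = 0"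
proof -
  have fc: "continuous_on UNIV f"
    by (rule continuous_at_imp_continuous_on) (rule ballI, rule has_derivative_continuous[OF der])
  have f'0: "f' x v = 0" if "norm x > R" for x
  proof -
    let ?W = "{x :: 'a. norm x > R}"
    have "open ?W" by (intro open_Collect_less continuous_intros)
    then have "(f has_derivative (\<lambda>h. 0)) (at x)"
      using has_derivative_transform_within_open[of "\<lambda>p. 0" "\<lambda>h. 0" x UNIV ?W f] that R by auto
    then show ?thesis using has_derivative_unique[OF der[of x]] by metis
  qed
  have bounded: "\<exists>K. \<forall>x. norm (g x) \<le> K" if "continuous_on UNIV g" "\<And>x. norm x > R \<Longrightarrow> g x = 0" for g :: "'a \<Rightarrow> complex"
  proof -
    have "compact (g ` cball 0 R)" by (intro compact_continuous_image continuous_on_subset[OF that(1)]) auto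
    then obtain K where K: "\<And>x. x \<in> cball 0 R \<Longrightarrow> norm (g x) \<le> K"
      using compact_imp_bounded bounded_iff by (metis imageI)
    have "norm (g x) \<le> max K 0" for x
      using K[of x] that(2)[of x] by (cases "norm x \<le> R") (auto simp: le_max_iff_disj)
    then show ?thesis by blast
  qed
  obtain K where K: "\<And>x. norm (f' x v) \<le> K" using bounded[OF cont f'0] by blast
  obtain Kf where Kf: "\<And>x. norm (f x) \<le> Kf" using bounded[OF fc R] by blast
  have fm [measurable]: "f \<in> borel_measurable borel" by (rule borel_measurable_continuous_onI[OF fc])
  have fi: "integrable lborel f" by (rule integrable_compact_support[OF fm Kf R])
  define q where "q n x = of_real (real (Suc n)) * (f (x + (1 / real (Suc n)) *\<^sub>R v) - f x)" for n x
  have q0: "(LINT x|lborel. q n x) = 0" for n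
  proof -
    let ?t = "(1 / real (Suc n)) *\<^sub>R v"
    have 1: "(\<lambda>x. f (?t + 1 *\<^sub>R x)) = (\<lambda>x. f (x + ?t))" by (simp add: add.commute)
    have "integrable lborel (\<lambda>x. f (x + ?t))" "(LINT x|lborel. f x) = (LINT x|lborel. f (x + ?t))"
      using lborel_integral_affine[of 1 f ?t, OF _ fm] fi unfolding 1 by simp_all
    then show ?thesis unfolding q_def using fi by simp
  qed
  have seg: "norm (f (x + s *\<^sub>R v) - f x) \<le> K * s" if "s \<ge> 0" for x s
  proof -
    have "norm ((\<lambda>r. f (x + r *\<^sub>R v)) s - (\<lambda>r. f (x + r *\<^sub>R v)) 0) \<le> K * norm (s - 0)"
    proof (rule differentiable_bound[of "{0..s}" _ "\<lambda>r h. h *\<^sub>R f' (x + r *\<^sub>R v) v"])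
      fix r assume "r \<in> {0..s}"
      have "((\<lambda>r. f (x + r *\<^sub>R v)) has_derivative (\<lambda>h. f' (x + r *\<^sub>R v) (h *\<^sub>R v))) (at r within {0..s})"
        by (rule has_derivative_compose[OF _ der]) (auto intro!: derivative_eq_intros)
      moreover have "f' (x + r *\<^sub>R v) (h *\<^sub>R v) = h *\<^sub>R f' (x + r *\<^sub>R v) v" for h
        using has_derivative_linear[OF der] by (rule linear_scale)
      ultimately show "((\<lambda>r. f (x + r *\<^sub>R v)) has_derivative (\<lambda>h. h *\<^sub>R f' (x + r *\<^sub>R v) v)) (at r within {0..s})" by simp
      show "onorm (\<lambda>h. h *\<^sub>R f' (x + r *\<^sub>R v) v) \<le> K"
        by (rule onorm_le) (simp add: mult.commute[of K] mult_left_mono K)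
    qed (use that in auto)
    then show ?thesis using that by simp
  qed
  have "(\<lambda>n. LINT x|lborel. q n x) \<longlonglongrightarrow> (LINT x|lborel. f' x v)"
  \<comment> \<open>The increments are at most \<open>v\<close> in length, so the quotients live in
    the ball of radius \<open>R + norm v\<close>.\<close>
  proof (rule integral_dominated_convergence[where w = "\<lambda>x. K *\<^sub>R indicator (cball (0 :: 'a) (R + norm v)) x"])
    show "(\<lambda>x. f' x v) \<in> borel_measurable lborel"
      using borel_measurable_continuous_onI[OF cont] by simp
    show "q n \<in> borel_measurable lborel" for n unfolding q_def[abs_def] by measurable
    show "integrable lborel (\<lambda>x. K *\<^sub>R indicator (cball (0 :: 'a) (R + norm v)) x :: real)"
      using emeasure_bounded_finite[of "cball (0 :: 'a) (R + norm v)"] by (intro integrable_scaleR_right integrable_real_indicator) auto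
    show "AE x in lborel. (\<lambda>n. q n x) \<longlonglongrightarrow> f' x v"
    proof (rule AE_I2)
      fix x
      let ?g = "\<lambda>r. f (x + r *\<^sub>R v)"
      have "(?g has_derivative (\<lambda>h. f' (x + 0 *\<^sub>R v) (h *\<^sub>R v))) (at 0)"
        by (rule has_derivative_compose[OF _ der]) (auto intro!: derivative_eq_intros)
      moreover have "f' x (h *\<^sub>R v) = h *\<^sub>R f' x v" for h
        using has_derivative_linear[OF der] by (rule linear_scale)
      ultimately have "(?g has_derivative (\<lambda>h. h *\<^sub>R f' x v)) (at 0)" by simp
      then have "((\<lambda>h. norm (?g (0 + h) - ?g 0 - h *\<^sub>R f' x v) / norm h) \<longlongrightarrow> 0) (at 0)"
        unfolding has_derivative_at by blast
      moreover have "filterlim (\<lambda>n. 1 / real (Suc n)) (at 0) sequentially"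
        unfolding filterlim_at using LIMSEQ_Suc[OF lim_1_over_n] by (auto intro!: always_eventually)
      ultimately have l: "(\<lambda>n. norm (?g (0 + 1 / real (Suc n)) - ?g 0 - (1 / real (Suc n)) *\<^sub>R f' x v) / norm (1 / real (Suc n))) \<longlonglongrightarrow> 0"
        by (rule filterlim_compose)
      have "norm (?g (0 + 1 / real (Suc n)) - ?g 0 - (1 / real (Suc n)) *\<^sub>R f' x v) / norm (1 / real (Suc n)) = norm (q n x - f' x v)" for n
      proof -
        have "q n x - f' x v = real (Suc n) *\<^sub>R (?g (0 + 1 / real (Suc n)) - ?g 0 - (1 / real (Suc n)) *\<^sub>R f' x v)"
        proof -
          have "real (Suc n) *\<^sub>R ((1 / real (Suc n)) *\<^sub>R f' x v) = f' x v" by simp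
          then show ?thesis unfolding q_def scaleR_diff_right
            by (simp only:) (simp add: scaleR_conv_of_real right_diff_distrib)
        qed
        then show ?thesis by (simp only: norm_scaleR) simp
      qed
      then have "(\<lambda>n. q n x - f' x v) \<longlonglongrightarrow> 0" using l by (simp only: tendsto_norm_zero_iff)
      then show "(\<lambda>n. q n x) \<longlonglongrightarrow> f' x v" by (rule LIM_zero_cancel)
    qed
    show "AE x in lborel. norm (q n x) \<le> K *\<^sub>R indicator (cball (0 :: 'a) (R + norm v)) x" for n
    proof (rule AE_I2)
      fix x :: 'a
      show "norm (q n x) \<le> K *\<^sub>R indicator (cball (0 :: 'a) (R + norm v)) x"
      proof (cases "norm x \<le> R + norm v")
        case True
        have "norm (q n x) = real (Suc n) * norm (f (x + (1 / real (Suc n)) *\<^sub>R v) - f x)"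
          unfolding q_def norm_mult norm_of_real by simp
        also have "\<dots> \<le> real (Suc n) * (K * (1 / real (Suc n)))" by (intro mult_left_mono seg) auto
        also have "\<dots> = K" by simp
        finally show ?thesis using True by simp
      next
        case False
        have "norm x \<le> norm (x + (1 / real (Suc n)) *\<^sub>R v) + norm ((1 / real (Suc n)) *\<^sub>R v)"
          using norm_triangle_ineq4[of "x + (1 / real (Suc n)) *\<^sub>R v" "(1 / real (Suc n)) *\<^sub>R v"] by simp
        also have "norm ((1 / real (Suc n)) *\<^sub>R v) \<le> norm v" by (simp add: field_simps)
        finally have "norm (x + (1 / real (Suc n)) *\<^sub>R v) > R" using False by simp
        moreover have "norm x > R" using False norm_ge_zero[of v] by linarith
        ultimately have "q n x = 0" using R by (simp add: q_def)
        then show ?thesis using order_trans[OF norm_ge_zero K[of 0]] by simp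
      qed
    qed
  qed
  then show ?thesis unfolding q0 by (simp add: LIMSEQ_const_iff)
qed

section \<open>Decay of the fibrewise Fourier transform, uniformly over linear changes of the
  fibre\<close>

definition symbol_ft :: "((real ^ 'd::finite) \<times> (real ^ 'd) \<Rightarrow> complex) \<Rightarrow> real ^ 'd \<Rightarrow> (real ^ 'd \<Rightarrow> real ^ 'd) \<Rightarrow> real ^ 'd \<Rightarrow> complex" where
  "symbol_ft a x M z = (LINT \<xi>|lborel. a (x, M \<xi>) * cis (z \<bullet> \<xi>))"

text \<open>\<open>N\<close> is the inverse of \<open>M\<close> and \<open>L\<close> the adjoint of
  \<open>N\<close>; in a patch \<open>M\<close> is the inverse transpose of the differential and
  \<open>L\<close> the differential. The bound \<open>c\<close> on \<open>N\<close> confines the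
  support of a(x, M .) to a ball, so that constants depend on the patch only through
  \<open>c\<close>.\<close>

definition fiber_map :: "real \<Rightarrow> (real ^ 'd::finite \<Rightarrow> real ^ 'd) \<Rightarrow> (real ^ 'd \<Rightarrow> real ^ 'd) \<Rightarrow> (real ^ 'd \<Rightarrow> real ^ 'd) \<Rightarrow> bool" where
  "fiber_map c M N L \<longleftrightarrow> linear M \<and> (\<forall>\<zeta>. M (N \<zeta>) = \<zeta>) \<and> (\<forall>\<xi>. N (M \<xi>) = \<xi>) \<and>
     (\<forall>\<zeta>. norm (N \<zeta>) \<le> c * norm \<zeta>) \<and> (\<forall>z \<zeta>. z \<bullet> N \<zeta> = L z \<bullet> \<zeta>)"

lemma symbol_fiber_support:
  assumes F: "fiber_map c M N L" and c: "c > 0" and R: "\<forall>x \<xi>. norm \<xi> > R \<longrightarrow> a (x, \<xi>) = 0"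
    and x: "norm \<xi> > c * R"
  shows "a (x, M \<xi>) = (0 :: complex)"
proof -
  have "norm \<xi> \<le> c * norm (M \<xi>)" using F unfolding fiber_map_def by metis
  then have "c * R < c * norm (M \<xi>)" using x by linarith
  then have "norm (M \<xi>) > R" using c by simp
  then show ?thesis using R by blast
qed

lemma continuous_linear_fiber: "linear (M :: real ^ 'd::finite \<Rightarrow> real ^ 'd) \<Longrightarrow> continuous_on S M"
  by (simp add: linear_continuous_on linear_conv_bounded_linear)

text \<open>Integration by parts in direction \<open>N w\<close>: as M (N w) = w, the chain rule
  produces precisely the derivative of the symbol in the fibre direction \<open>w\<close>.\<close>

lemma symbol_ft_deriv:
  assumes a: "a \<in> torus_symbols" and F: "fiber_map c M N L" and c: "c > 0"
  shows "symbol_ft (\<lambda>p. frechet_derivative a (at p) (0, w)) x M z = - (\<i> * of_real (z \<bullet> N w)) * symbol_ft a x M z"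
proof -
  obtain R where R: "\<forall>x \<xi>. norm \<xi> > R \<longrightarrow> a (x, \<xi>) = 0" using symbol_support[OF a] by blast
  obtain K where K: "\<And>p. norm (a p) \<le> K" using symbol_bounded[OF a] by blast
  have M: "linear M" "M (N w) = w" using F unfolding fiber_map_def by auto
  let ?D = "\<lambda>p. frechet_derivative a (at p)"
  have D: "(\<lambda>p. ?D p (0, w)) \<in> torus_symbols" by (rule symbol_deriv[OF a])
  obtain R' where R': "\<forall>x \<xi>. norm \<xi> > R' \<longrightarrow> ?D (x, \<xi>) (0, w) = 0" using symbol_support[OF D] by blast
  obtain K' where K': "\<And>p. norm (?D p (0, w)) \<le> K'" using symbol_bounded[OF D] by blast
  let ?e = "\<lambda>\<xi>. exp (\<i> * of_real (z \<bullet> \<xi>))"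
  have e: "(?e has_derivative (\<lambda>h. (\<i> * of_real (z \<bullet> h)) * ?e \<xi>)) (at \<xi>)" for \<xi>
  proof -
    have "((\<lambda>\<xi>. \<i> * complex_of_real (z \<bullet> \<xi>)) has_derivative (\<lambda>h. \<i> * of_real (z \<bullet> h))) (at \<xi>)"
      by (intro has_derivative_mult_right has_derivative_of_real has_derivative_inner_right has_derivative_ident)
    from has_derivative_compose[OF this DERIV_exp[THEN has_field_derivative_imp_has_derivative]]
    show ?thesis by (simp add: mult.commute)
  qed
  have m: "((\<lambda>\<xi>. a (x, M \<xi>)) has_derivative (\<lambda>h. ?D (x, M \<xi>) (0, M h))) (at \<xi>)" for \<xi>
  proof -
    have "((\<lambda>\<xi>. (x, M \<xi>)) has_derivative (\<lambda>h. (0, M h))) (at \<xi>)"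
      by (intro has_derivative_Pair has_derivative_const bounded_linear.has_derivative[OF _ has_derivative_ident])
        (use M in \<open>simp add: linear_conv_bounded_linear\<close>)
    from has_derivative_compose[OF this symbol_has_derivative[OF a]] show ?thesis .
  qed
  define f' where "f' \<xi> h = a (x, M \<xi>) * ((\<i> * of_real (z \<bullet> h)) * ?e \<xi>) + ?D (x, M \<xi>) (0, M h) * ?e \<xi>" for \<xi> h
  have ca: "continuous_on UNIV (\<lambda>\<xi>. b (x, M \<xi>))" if "b \<in> torus_symbols" for b
    by (rule continuous_on_compose2[OF symbol_continuous[OF that]])
      (use M in \<open>auto intro!: continuous_intros continuous_linear_fiber\<close>)
  have "(LINT \<xi>|lborel. f' \<xi> (N w)) = 0"
  proof (rule integral_directional_derivative[where f = "\<lambda>\<xi>. a (x, M \<xi>) * ?e \<xi>" and R = "c * R"])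
    show "((\<lambda>\<xi>. a (x, M \<xi>) * ?e \<xi>) has_derivative f' \<xi>) (at \<xi>)" for \<xi>
      unfolding f'_def[abs_def] by (rule has_derivative_mult[OF m e])
    show "continuous_on UNIV (\<lambda>\<xi>. f' \<xi> (N w))"
      unfolding f'_def M(2) by (intro continuous_intros ca a D)
    show "a (x, M \<xi>) * ?e \<xi> = 0" if "norm \<xi> > c * R" for \<xi>
      using symbol_fiber_support[OF F c R that] by simp
  qed
  moreover have "f' \<xi> (N w) = (\<i> * of_real (z \<bullet> N w)) * (a (x, M \<xi>) * cis (z \<bullet> \<xi>)) + ?D (x, M \<xi>) (0, w) * cis (z \<bullet> \<xi>)" for \<xi>
    unfolding f'_def M(2) cis_conv_exp by simp
  moreover have "integrable lborel (\<lambda>\<xi>. a (x, M \<xi>) * cis (z \<bullet> \<xi>))"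
  proof (rule integrable_compact_support[where K = K and R = "c * R"])
    show "(\<lambda>\<xi>. a (x, M \<xi>) * cis (z \<bullet> \<xi>)) \<in> borel_measurable borel"
      by (intro borel_measurable_continuous_onI continuous_intros ca a)
    show "a (x, M \<xi>) * cis (z \<bullet> \<xi>) = 0" if "norm \<xi> > c * R" for \<xi>
      using symbol_fiber_support[OF F c R that] by simp
  qed (use K in \<open>simp add: norm_mult\<close>)
  moreover have "integrable lborel (\<lambda>\<xi>. ?D (x, M \<xi>) (0, w) * cis (z \<bullet> \<xi>))"
  proof (rule integrable_compact_support[where K = K' and R = "c * R'"])
    show "(\<lambda>\<xi>. ?D (x, M \<xi>) (0, w) * cis (z \<bullet> \<xi>)) \<in> borel_measurable borel"
      by (intro borel_measurable_continuous_onI continuous_intros ca D)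
    show "?D (x, M \<xi>) (0, w) * cis (z \<bullet> \<xi>) = 0" if "norm \<xi> > c * R'" for \<xi>
      using symbol_fiber_support[where a = "\<lambda>p. ?D p (0, w)", OF F c R' that] by simp
  qed (use K' in \<open>simp add: norm_mult\<close>)
  ultimately show ?thesis unfolding symbol_ft_def by (simp add: add_eq_0_iff)
qed

text \<open>Each integration by parts trades one factor L z . w for one derivative of the symbol.
  The base case is bounded by the supremum of the symbol times the volume of a ball containing the
  support.\<close>

lemma symbol_ft_power_bound:
  assumes a: "a \<in> torus_symbols" and c: "c > 0"
  shows "\<exists>C. \<forall>x z M N L. fiber_map c M N L \<longrightarrow> \<bar>L z \<bullet> w\<bar> ^ m * norm (symbol_ft a x M z) \<le> C"
  using a
proof (induction m arbitrary: a)
  case 0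
  obtain R where R: "\<forall>x \<xi>. norm \<xi> > R \<longrightarrow> a (x, \<xi>) = 0" using symbol_support[OF 0] by blast
  obtain K where K: "\<And>p. norm (a p) \<le> K" using symbol_bounded[OF 0] by blast
  have "norm (symbol_ft a x M z) \<le> K * measure lborel (cball (0 :: real ^ 'a) (c * R))" if F: "fiber_map c M N L" for x z M N L
    unfolding symbol_ft_def
  proof (rule integral_compact_support_bound)
    have M: "linear M" using F unfolding fiber_map_def by auto
    have "continuous_on UNIV (\<lambda>\<xi>. a (x, M \<xi>))"
      by (rule continuous_on_compose2[OF symbol_continuous[OF 0]])
        (use M in \<open>auto intro!: continuous_intros continuous_linear_fiber\<close>)
    then show "(\<lambda>\<xi>. a (x, M \<xi>) * cis (z \<bullet> \<xi>)) \<in> borel_measurable borel"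
      by (intro borel_measurable_continuous_onI continuous_intros)
    show "a (x, M \<xi>) * cis (z \<bullet> \<xi>) = 0" if "norm \<xi> > c * R" for \<xi>
      using symbol_fiber_support[OF F c R that] by simp
  qed (use K in \<open>simp add: norm_mult\<close>)
  then show ?case unfolding power_0 mult_1 by blast
next
  case (Suc m)
  obtain C where C: "\<And>x z M N L. fiber_map c M N L \<Longrightarrow> \<bar>L z \<bullet> w\<bar> ^ m * norm (symbol_ft (\<lambda>p. frechet_derivative a (at p) (0, w)) x M z) \<le> C"
    using Suc.IH[OF symbol_deriv[OF Suc.prems]] by blast
  have "\<bar>L z \<bullet> w\<bar> ^ Suc m * norm (symbol_ft a x M z) \<le> C" if F: "fiber_map c M N L" for x z M N L
  proof -
    have "z \<bullet> N w = L z \<bullet> w" using F unfolding fiber_map_def by auto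
    then show ?thesis using C[OF F, of z x] unfolding symbol_ft_deriv[OF Suc.prems F c]
      by (simp add: norm_mult mult_ac)
  qed
  then show ?case by blast
qed

text \<open>The norm is at most the sum of the coordinates, hence at most the dimension times the
  largest one. The 1 inserted into the maximum makes \<open>s\<close> >= 1, which absorbs the
  summand 1 on the left.\<close>

lemma power_norm_bound:
  fixes y :: "'a::euclidean_space"
  shows "(1 + norm y) ^ m \<le> (1 + real DIM('a)) ^ m * (1 + (\<Sum>b\<in>Basis. \<bar>y \<bullet> b\<bar> ^ m))"
proof -
  define s where "s = Max (insert 1 ((\<lambda>b. \<bar>y \<bullet> b\<bar>) ` Basis))"
  have s: "1 \<le> s" "\<And>b. b \<in> Basis \<Longrightarrow> \<bar>y \<bullet> b\<bar> \<le> s"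
    unfolding s_def by (rule Max_ge; simp)+
  have "s \<in> insert 1 ((\<lambda>b. \<bar>y \<bullet> b\<bar>) ` Basis)" unfolding s_def by (rule Max_in) auto
  then have sm: "s ^ m \<le> 1 + (\<Sum>b\<in>Basis. \<bar>y \<bullet> b\<bar> ^ m)"
  proof
    assume "s = 1" then show ?thesis by (simp add: sum_nonneg)
  next
    assume "s \<in> (\<lambda>b. \<bar>y \<bullet> b\<bar>) ` Basis"
    then obtain b where b: "b \<in> Basis" "s = \<bar>y \<bullet> b\<bar>" by blast
    have "\<bar>y \<bullet> b\<bar> ^ m \<le> (\<Sum>b\<in>Basis. \<bar>y \<bullet> b\<bar> ^ m)" by (rule member_le_sum) (use b in auto)
    then show ?thesis using b by simp
  qed
  have "1 + norm y \<le> 1 + (\<Sum>b\<in>Basis. \<bar>y \<bullet> b\<bar>)" using norm_le_l1[of y] by simp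
  also have "\<dots> \<le> s + real DIM('a) * s" using s sum_bounded_above[of Basis "\<lambda>b. \<bar>y \<bullet> b\<bar>" s] by (simp add: add_mono)
  also have "\<dots> = (1 + real DIM('a)) * s" by (simp add: algebra_simps)
  finally have "(1 + norm y) ^ m \<le> ((1 + real DIM('a)) * s) ^ m" by (intro power_mono) auto
  also have "\<dots> \<le> (1 + real DIM('a)) ^ m * (1 + (\<Sum>b\<in>Basis. \<bar>y \<bullet> b\<bar> ^ m))"
    unfolding power_mult_distrib using sm by (intro mult_left_mono) auto
  finally show ?thesis .
qed

lemma symbol_ft_decay:
  fixes a :: "(real ^ 'd::finite) \<times> (real ^ 'd) \<Rightarrow> complex"
  assumes a: "a \<in> torus_symbols" and c: "c > 0" and c': "c' > 0"
  shows "\<exists>C. \<forall>x z M N L. fiber_map c M N L \<longrightarrow> c' * norm z \<le> norm (L z) \<longrightarrow> norm (symbol_ft a x M z) \<le> C * decay z"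
proof -
  define m where "m = DIM(real ^ 'd) + 2"
  have "\<forall>b. \<exists>C. \<forall>x z M N L. fiber_map c M N L \<longrightarrow> \<bar>L z \<bullet> b\<bar> ^ m * norm (symbol_ft a x M z) \<le> C"
    using symbol_ft_power_bound[OF a c] by blast
  then obtain C where C: "\<And>b x z M N L. fiber_map c M N L \<Longrightarrow> \<bar>L z \<bullet> b\<bar> ^ m * norm (symbol_ft a x M z) \<le> C b" by metis
  obtain C0 where C0: "\<And>x z M N L. fiber_map c M N L \<Longrightarrow> norm (symbol_ft a x M z) \<le> C0"
    using symbol_ft_power_bound[OF a c, of 0 0] unfolding power_0 mult_1 by blast
  define B where "B = (1 + real DIM(real ^ 'd)) ^ m * (C0 + (\<Sum>b\<in>Basis. C b))"
  \<comment> \<open>Chosen so that e (1 + |z|) <= 1 + |L z|; this turns decay in \<open>L z\<close>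
    into decay in \<open>z\<close>.\<close>
  define e where "e = min 1 c'"
  have e: "e > 0" "e \<le> 1" "e \<le> c'" using c' by (auto simp: e_def)
  have "norm (symbol_ft a x M z) \<le> (B / e ^ m) * decay z" if F: "fiber_map c M N L" and L: "c' * norm z \<le> norm (L z)" for x z M N L
  proof -
    let ?t = "norm (symbol_ft a x M z)"
    have "e * norm z \<le> c' * norm z" using e by (intro mult_right_mono) auto
    then have "e * (1 + norm z) \<le> 1 + norm (L z)" using e L by (simp add: algebra_simps)
    then have "(e * (1 + norm z)) ^ m * ?t \<le> (1 + norm (L z)) ^ m * ?t" using e by (intro mult_right_mono power_mono) auto
    also have "\<dots> \<le> ((1 + real DIM(real ^ 'd)) ^ m * (1 + (\<Sum>b\<in>Basis. \<bar>L z \<bullet> b\<bar> ^ m))) * ?t"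
      by (intro mult_right_mono power_norm_bound) auto
    also have "\<dots> = (1 + real DIM(real ^ 'd)) ^ m * (?t + (\<Sum>b\<in>Basis. \<bar>L z \<bullet> b\<bar> ^ m * ?t))"
      by (simp add: distrib_left distrib_right sum_distrib_right mult.assoc)
    also have "\<dots> \<le> B" unfolding B_def by (intro mult_left_mono add_mono sum_mono C[OF F] C0[OF F]) auto
    finally have "(e ^ m * (1 + norm z) ^ m) * ?t \<le> B" by (simp add: power_mult_distrib)
    moreover have "e ^ m * (1 + norm z) ^ m > 0" using e norm_ge_zero[of z] by (intro mult_pos_pos zero_less_power) linarith+
    ultimately show ?thesis unfolding decay_def m_def[symmetric] by (simp add: field_simps)
  qed
  then show ?thesis by blast
qed

subsection \<open>Coordinate patches\<close>

lemma int_vec_small: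
  assumes "k \<in> int_vecs" "norm ((2 * pi) *\<^sub>R k) < 2 * pi" shows "k = (0 :: real ^ 'd::finite)"
proof -
  have n: "norm k < 1" using assms(2) by simp
  have "k $ i = 0" for i
  proof -
    obtain m :: int where m: "k $ i = of_int m" using assms(1) by (auto simp: int_vecs_def elim: Ints_cases)
    have "\<bar>of_int m :: real\<bar> < 1" using component_le_norm_cart[of k i] n m by simp
    then show ?thesis using m by simp
  qed
  then show ?thesis by (simp add: vec_eq_iff)
qed

text \<open>The difference of two lifts takes values in 2 pi times the integer vectors and is
  continuous at X. Distinct values differ by at least 2 pi, so it is constant near X and its
  derivative vanishes.\<close>

lemma lift_derivative_unique:
  fixes \<kappa> :: "real ^ 'd::finite \<Rightarrow> real ^ 'd"
  assumes W: "open W1" "X \<in> W1" "open W2" "X \<in> W2"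
    and t: "\<And>Y. Y \<in> W1 \<Longrightarrow> torus_eq (\<kappa> Y) (l1 Y)" "\<And>Y. Y \<in> W2 \<Longrightarrow> torus_eq (\<kappa> Y) (l2 Y)"
    and l: "(l1 has_derivative L1) (at X)" "(l2 has_derivative L2) (at X)"
  shows "L1 = L2"
proof -
  define d where "d Y = l1 Y - l2 Y" for Y
  have dd: "(d has_derivative (\<lambda>h. L1 h - L2 h)) (at X)"
    unfolding d_def[abs_def] by (rule has_derivative_diff[OF l])
  have "(d \<longlongrightarrow> d X) (at X)" using has_derivative_continuous[OF dd] by (simp add: continuous_within)
  then have "eventually (\<lambda>Y. dist (d Y) (d X) < 2 * pi) (at X)" by (rule tendstoD) simp
  moreover have "eventually (\<lambda>Y. Y \<in> W1 \<inter> W2) (at X)"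
    using W by (intro eventually_at_in_open') auto
  ultimately have ev: "eventually (\<lambda>Y. d Y = d X) (at X)"
  proof eventually_elim
    case (elim Y)
    have int: "\<exists>k\<in>int_vecs. d Z = (2 * pi) *\<^sub>R k" if "Z \<in> W1 \<inter> W2" for Z
    proof -
      have "torus_eq (l2 Z) (l1 Z)" using that t torus_eq_trans[OF torus_eq_sym[OF t(2)[of Z]] t(1)[of Z]] by simp
      then obtain k where "k \<in> int_vecs" "l1 Z = l2 Z + (2 * pi) *\<^sub>R k" unfolding torus_eq_def by blast
      then show ?thesis unfolding d_def by auto
    qed
    obtain k where k: "k \<in> int_vecs" "d Y = (2 * pi) *\<^sub>R k" using int elim by blast
    obtain j where j: "j \<in> int_vecs" "d X = (2 * pi) *\<^sub>R j" using int W by blast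
    have "norm ((2 * pi) *\<^sub>R (k - j)) < 2 * pi" using elim(1) unfolding k j dist_norm scaleR_diff_right .
    then have "k - j = 0" using k j by (intro int_vec_small) auto
    then show ?case using k j by simp
  qed
  have "(d has_derivative (\<lambda>h. 0)) (at X)"
    by (rule has_derivative_transform_eventually[of "\<lambda>_. d X"])
      (use ev in \<open>auto elim: eventually_mono\<close>)
  from has_derivative_unique[OF dd this] show ?thesis by (metis eq_iff_diff_eq_0 ext)
qed

text \<open>Uniqueness of the derivative of lifts makes the \<open>THE\<close> in
  \<open>chart_jacobian\<close> well defined.\<close>

lemma chart_jacobian_eq:
  fixes \<kappa> :: "real ^ 'd::finite \<Rightarrow> real ^ 'd"
  assumes W: "open W" "X \<in> W" and t: "\<And>Y. Y \<in> W \<Longrightarrow> torus_eq (\<kappa> Y) (l Y)" and l: "(l has_derivative L) (at X)"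
  shows "L = (\<lambda>v. chart_jacobian \<kappa> X *v v)"
proof -
  have L: "(\<lambda>v. matrix L *v v) = L" using has_derivative_linear[OF l] by (rule matrix_vector_mul(2))
  have "chart_jacobian \<kappa> X = matrix L"
    unfolding chart_jacobian_def
  proof (rule the_equality)
    show "\<exists>W l. open W \<and> X \<in> W \<and> (\<forall>Y\<in>W. torus_eq (\<kappa> Y) (l Y)) \<and> (l has_derivative (*v) (matrix L)) (at X)"
      using W t l L by (intro exI[of _ W] exI[of _ l]) auto
    fix A assume "\<exists>W l. open W \<and> X \<in> W \<and> (\<forall>Y\<in>W. torus_eq (\<kappa> Y) (l Y)) \<and> (l has_derivative (*v) A) (at X)"
    then obtain W' l' where W': "open W'" "X \<in> W'" "\<And>Y. Y \<in> W' \<Longrightarrow> torus_eq (\<kappa> Y) (l' Y)" "(l' has_derivative (*v) A) (at X)" by blast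
    have "(*v) A = L" by (rule lift_derivative_unique[OF W'(1,2) W W'(3) t W'(4) l])
    then show "A = matrix L" using L by (metis matrix_eq)
  qed
  then show ?thesis using L by simp
qed

locale patch =
  fixes U :: "(real ^ 'd::finite) set" and \<kappa> :: "real ^ 'd \<Rightarrow> real ^ 'd"
  assumes chart: "torus_chart U \<kappa>"
begin

abbreviation J where "J X \<equiv> chart_jacobian \<kappa> X"

abbreviation V where "V \<equiv> chart_image U \<kappa>"

definition jac :: "real ^ 'd \<Rightarrow> real" where "jac X = abs_jac (\<lambda>v. J X *v v)"

lemma openU: "open U" using chart by (simp add: torus_chart_def)

lemma inj: "X \<in> U \<Longrightarrow> Y \<in> U \<Longrightarrow> torus_eq (\<kappa> X) (\<kappa> Y) \<Longrightarrow> X = Y"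
  using chart unfolding torus_chart_def by blast

lemma invertible: "X \<in> U \<Longrightarrow> invertible (J X)"
  using chart unfolding torus_chart_def by blast

lemma lift:
  assumes "X \<in> U"
  obtains W l where "open W" "X \<in> W" "W \<subseteq> U" "\<And>Y. Y \<in> W \<Longrightarrow> torus_eq (\<kappa> Y) (l Y)"
    "\<And>Y. Y \<in> W \<Longrightarrow> (l has_derivative (\<lambda>v. J Y *v v)) (at Y)"
    "\<And>v. continuous_on W (\<lambda>Y. J Y *v v)" "continuous_on W l"
proof -
  have "\<forall>X\<in>U. \<exists>W l. open W \<and> X \<in> W \<and> W \<subseteq> U \<and> smooth_on W l \<and> (\<forall>Y\<in>W. torus_eq (\<kappa> Y) (l Y))"
    using chart unfolding torus_chart_def by (elim conjE)
  from bspec[OF this assms] obtain W l where Wl: "open W \<and> X \<in> W \<and> W \<subseteq> U \<and> smooth_on W l \<and> (\<forall>Y\<in>W. torus_eq (\<kappa> Y) (l Y))"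
    by (elim exE)
  then have W: "open W" "X \<in> W" "W \<subseteq> U" "smooth_on W l" "\<And>Y. Y \<in> W \<Longrightarrow> torus_eq (\<kappa> Y) (l Y)" by simp_all
  have "Ck_on (Suc 0) W l" using W(4) unfolding smooth_on_def by blast
  then have d: "\<And>Y. Y \<in> W \<Longrightarrow> (l has_derivative frechet_derivative l (at Y)) (at Y)"
    and c: "\<And>v. continuous_on W (\<lambda>Y. frechet_derivative l (at Y) v)"
    by (simp_all add: frechet_derivative_works[symmetric])
  have e: "frechet_derivative l (at Y) = (\<lambda>v. J Y *v v)" if "Y \<in> W" for Y
    by (rule chart_jacobian_eq[OF W(1) that W(5) d[OF that]])
  show thesis
  proof (rule that[OF W(1,2,3,5)])
    show "(l has_derivative (\<lambda>v. J Y *v v)) (at Y)" if "Y \<in> W" for Y using d[OF that] e[OF that] by simp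
    show "continuous_on W (\<lambda>Y. J Y *v v)" for v
      using c[of v] by (rule continuous_on_cong[THEN iffD1, rotated 2]) (simp_all add: e)
    show "continuous_on W l"
      by (rule continuous_at_imp_continuous_on) (rule ballI, rule has_derivative_continuous[OF d])
  qed
qed

lemma continuous_J: "continuous_on U (\<lambda>X. J X *v v)"
proof (rule continuous_at_imp_continuous_on, rule ballI)
  fix X assume "X \<in> U"
  then obtain W l where "open W" "X \<in> W" "continuous_on W (\<lambda>Y. J Y *v v)" using lift by metis
  then show "isCont (\<lambda>X. J X *v v) X" by (simp add: continuous_on_eq_continuous_at)
qed

lemma continuous_J_entry: "continuous_on U (\<lambda>X. J X $ i $ j)"
proof -
  have "J X $ i $ j = (J X *v axis j 1) $ i" for X by (simp add: matrix_vector_mult_basis column_def)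
  then show ?thesis using continuous_on_component[OF continuous_J[of "axis j 1"], of i] by (simp only:)
qed

lemma continuous_jac: "continuous_on U jac"
proof -
  have "continuous_on U (\<lambda>X. \<bar>det (\<chi> i j. to_wo (J X *v of_wo (axis j 1)) $ i)\<bar>)"
    unfolding det_def
    by (intro continuous_intros continuous_on_component continuous_on_wo continuous_J)
  then show ?thesis by (simp add: jac_def[abs_def] abs_jac_def matrix_def)
qed

lemma jac_pos: assumes "X \<in> U" shows "jac X > 0"
proof -
  let ?L = "\<lambda>x. to_wo (J X *v of_wo x)"
  have lin: "linear ?L"
    using linear_compose[OF linear_compose[OF linear_of_wo matrix_vector_mul_linear[of "J X"]] linear_to_wo] by (simp add: o_def)
  obtain B where B: "B ** J X = mat 1" using invertible[OF assms] by (auto simp: invertible_def)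
  have "of_wo x = B *v (of_wo (?L x))" for x by (simp add: matrix_vector_mul_assoc B)
  then have "inj ?L" by (intro injI) (metis to_of_wo)
  then have "det (matrix ?L) \<noteq> 0" using det_nz_iff_inj[OF lin] by blast
  then show ?thesis by (simp add: jac_def abs_jac_def)
qed

text \<open>Lindelof's theorem leaves countably many domains of lifts. Making them disjoint costs
  openness but keeps Borel measurability, which is why the area formula was set up with derivatives
  within a set.\<close>

lemma param: "torus_param U \<kappa> jac V"
proof -
  have "\<exists>W l. open W \<and> X \<in> W \<and> W \<subseteq> U \<and> (\<forall>Y\<in>W. torus_eq (\<kappa> Y) (l Y)) \<and> (\<forall>Y\<in>W. (l has_derivative (\<lambda>v. J Y *v v)) (at Y))"
    if "X \<in> U" for X using lift[OF that] by metis
  then obtain Wf lf where Wf: "\<And>X. X \<in> U \<Longrightarrow> open (Wf X) \<and> X \<in> Wf X \<and> Wf X \<subseteq> U \<and> (\<forall>Y\<in>Wf X. torus_eq (\<kappa> Y) (lf X Y)) \<and> (\<forall>Y\<in>Wf X. (lf X has_derivative (\<lambda>v. J Y *v v)) (at Y))"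
    by metis
  obtain \<F> where \<F>: "\<F> \<subseteq> Wf ` U" "countable \<F>" "\<Union>\<F> = \<Union>(Wf ` U)"
    using Lindelof[of "Wf ` U"] Wf by blast
  have UF: "\<Union>\<F> = U" using \<F>(3) Wf by blast
  \<comment> \<open>\<open>from_nat_into\<close> is informative only for a nonempty family; an empty
    patch is covered by empty pieces.\<close>
  define A where "A i = (if \<F> = {} then {} else from_nat_into \<F> i)" for i :: nat
  have AU: "(\<Union>i. A i) = U"
  proof (cases "\<F> = {}")
    case False
    then have "range (from_nat_into \<F>) = \<F>" using \<F>(2) by (rule range_from_nat_into)
    then show ?thesis using UF False by (simp add: A_def)
  qed (use UF in \<open>simp add: A_def\<close>)
  have Ap: "\<exists>l. \<forall>Y\<in>A i. torus_eq (\<kappa> Y) (l Y) \<and> (l has_derivative (\<lambda>v. J Y *v v)) (at Y)" for i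
  proof (cases "\<F> = {}")
    case False
    then have "A i \<in> Wf ` U" using \<F>(1) from_nat_into[of \<F> i] by (auto simp: A_def)
    then obtain X where X: "X \<in> U" "A i = Wf X" by blast
    show ?thesis unfolding X(2) using Wf[OF X(1)] by (intro exI[of _ "lf X"]) simp
  qed (simp add: A_def)
  have Ao: "open (A i)" for i
  proof (cases "\<F> = {}")
    case False
    then have "A i \<in> Wf ` U" using \<F>(1) from_nat_into[of \<F> i] by (auto simp: A_def)
    then obtain X where X: "X \<in> U" "A i = Wf X" by blast
    show ?thesis unfolding X(2) using Wf[OF X(1)] by simp
  qed (simp add: A_def)
  obtain g where g: "\<And>i Y. Y \<in> A i \<Longrightarrow> torus_eq (\<kappa> Y) (g i Y)" "\<And>i Y. Y \<in> A i \<Longrightarrow> (g i has_derivative (\<lambda>v. J Y *v v)) (at Y)"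
    using Ap by metis
  have sub: "disjointed A i \<subseteq> A i" for i by (rule disjointed_subset)
  have "torus_param U \<kappa> (\<lambda>X. abs_jac (\<lambda>v. J X *v v)) {x. \<exists>X\<in>U. torus_eq (\<kappa> X) x}"
  proof (rule torus_paramI[where E = "disjointed A" and g = g])
    have "range A \<subseteq> sets borel" using Ao by auto
    from sets.range_disjointed_sets[OF this] show "disjointed A i \<in> sets borel" for i by blast
    show "disjoint_family (disjointed A)" by (rule disjoint_family_disjointed)
    show "U = (\<Union>i. disjointed A i)" by (simp add: UN_disjointed_eq AU)
    show "(g i has_derivative (\<lambda>v. J x *v v)) (at x within disjointed A i)" if "x \<in> disjointed A i" for i x
      using g(2)[of x i] that sub has_derivative_at_withinI by blast
    show "torus_eq (\<kappa> x) (g i x)" if "x \<in> disjointed A i" for i x using g(1)[of x i] that sub by blast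
    show "abs_jac (\<lambda>v. J x *v v) > 0" if "x \<in> U" for x using jac_pos[OF that] by (simp add: jac_def)
  qed (rule inj)
  then show ?thesis by (simp add: jac_def[abs_def] chart_image_def)
qed

lemma chart_inv_eq: "X \<in> U \<Longrightarrow> torus_eq (\<kappa> X) x \<Longrightarrow> chart_inv U \<kappa> x = X"
  unfolding chart_inv_def
  by (rule the_equality) (auto intro: inj torus_eq_trans torus_eq_sym)

lemma chart_inv_V: assumes "x \<in> V" shows "chart_inv U \<kappa> x \<in> U" "torus_eq (\<kappa> (chart_inv U \<kappa> x)) x"
  using assms chart_inv_eq unfolding chart_image_def by auto

lemma V_periodic: "torus_eq x y \<Longrightarrow> x \<in> V \<longleftrightarrow> y \<in> V"
  unfolding chart_image_def using torus_eq_trans torus_eq_sym by blast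

lemma chart_inv_periodic: "torus_eq x y \<Longrightarrow> x \<in> V \<Longrightarrow> chart_inv U \<kappa> x = chart_inv U \<kappa> y"
  using chart_inv_V[of x] chart_inv_eq torus_eq_trans by metis

text \<open>A lift is continuous and, by injectivity of the chart modulo the lattice, injective;
  invariance of domain makes its image open, and a lattice translation brings it to the given
  point.\<close>

lemma open_chart_image: assumes "open S" "S \<subseteq> U" shows "open (chart_image S \<kappa>)"
proof (subst open_subopen, rule ballI)
  fix x assume "x \<in> chart_image S \<kappa>"
  then obtain X where X: "X \<in> S" "torus_eq (\<kappa> X) x" unfolding chart_image_def by blast
  obtain W l where W: "open W" "X \<in> W" "W \<subseteq> U" "\<And>Y. Y \<in> W \<Longrightarrow> torus_eq (\<kappa> Y) (l Y)" "continuous_on W l"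
    using lift X assms by (metis subsetD)
  have inj_l: "inj_on l (W \<inter> S)"
  proof (rule inj_onI)
    fix Y Z assume YZ: "Y \<in> W \<inter> S" "Z \<in> W \<inter> S" "l Y = l Z"
    have "torus_eq (\<kappa> Y) (\<kappa> Z)" using W(4)[of Y] torus_eq_sym[OF W(4)[of Z]] YZ torus_eq_trans by auto
    then show "Y = Z" using inj YZ W by blast
  qed
  have "open (l ` (W \<inter> S))"
    using W assms by (intro invariance_of_domain inj_l open_Int continuous_on_subset[OF W(5)]) auto
  have "torus_eq (l X) x" using torus_eq_trans[OF torus_eq_sym[OF W(4)[OF W(2)]] X(2)] .
  then obtain k where k: "k \<in> int_vecs" "x = l X + (2 * pi) *\<^sub>R k" unfolding torus_eq_def by blast
  let ?O = "(+) ((2 * pi) *\<^sub>R k) ` (l ` (W \<inter> S))"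
  have "open ?O" using \<open>open (l ` (W \<inter> S))\<close> by (rule open_translation)
  moreover have "x \<in> ?O" using k X W by (auto simp: add.commute)
  moreover have "?O \<subseteq> chart_image S \<kappa>"
  proof
    fix y assume "y \<in> ?O"
    then obtain Y where Y: "Y \<in> W" "Y \<in> S" "y = l Y + (2 * pi) *\<^sub>R k" by (auto simp: add.commute)
    then have "torus_eq (l Y) y" unfolding torus_eq_def using k by blast
    then show "y \<in> chart_image S \<kappa>" using W(4)[OF Y(1)] Y torus_eq_trans unfolding chart_image_def by blast
  qed
  ultimately show "\<exists>T. open T \<and> x \<in> T \<and> T \<subseteq> chart_image S \<kappa>" by blast
qed

lemma open_V: "open V" by (rule open_chart_image[OF openU]) simp

lemma continuous_chart_inv: "continuous_on V (chart_inv U \<kappa>)"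
proof (subst continuous_on_open_vimage[OF open_V], intro allI impI)
  fix S :: "(real ^ 'd) set" assume "open S"
  have "chart_inv U \<kappa> -` S \<inter> V = chart_image (S \<inter> U) \<kappa>"
  proof (intro equalityI subsetI)
    fix x assume "x \<in> chart_inv U \<kappa> -` S \<inter> V"
    then show "x \<in> chart_image (S \<inter> U) \<kappa>" using chart_inv_V[of x] unfolding chart_image_def by blast
  next
    fix x assume "x \<in> chart_image (S \<inter> U) \<kappa>"
    then obtain X where "X \<in> S" "X \<in> U" "torus_eq (\<kappa> X) x" unfolding chart_image_def by blast
    then show "x \<in> chart_inv U \<kappa> -` S \<inter> V" using chart_inv_eq unfolding chart_image_def by auto
  qed
  then show "open (chart_inv U \<kappa> -` S \<inter> V)" using open_chart_image[of "S \<inter> U"] \<open>open S\<close> openU by auto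
qed

text \<open>Periodicity makes the part of \<open>C\<close> inside one closed box representative of
  all of \<open>C\<close>. That part is compact, and the preimage is its image under the continuous
  inverse chart.\<close>

lemma compact_preimage:
  assumes C: "closed C" "C \<subseteq> V" and per: "\<And>x y. torus_eq x y \<Longrightarrow> x \<in> C \<Longrightarrow> y \<in> C"
  shows "compact {X \<in> U. \<kappa> X \<in> C}"
proof -
  let ?B = "cbox 0 (\<chi> i. 2 * pi) :: (real ^ 'd) set"
  have "{X \<in> U. \<kappa> X \<in> C} = chart_inv U \<kappa> ` (C \<inter> ?B)"
  proof (intro equalityI subsetI)
    fix X assume X: "X \<in> {X \<in> U. \<kappa> X \<in> C}"
    then have "torus_red (\<kappa> X) \<in> C \<inter> ?B" using per torus_eq_red torus_red_in_cell torus_cell_subset_cbox by blast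
    moreover have "chart_inv U \<kappa> (torus_red (\<kappa> X)) = X" using X torus_eq_red by (intro chart_inv_eq) auto
    ultimately show "X \<in> chart_inv U \<kappa> ` (C \<inter> ?B)" by (metis imageI)
  next
    fix X assume "X \<in> chart_inv U \<kappa> ` (C \<inter> ?B)"
    then obtain x where x: "x \<in> C" "X = chart_inv U \<kappa> x" by blast
    then have "X \<in> U" "torus_eq (\<kappa> X) x" using chart_inv_V C(2) by auto
    then show "X \<in> {X \<in> U. \<kappa> X \<in> C}" using per[OF torus_eq_sym x(1)] by blast
  qed
  moreover have "compact (C \<inter> ?B)" using C(1) by (intro closed_Int_compact) auto
  ultimately show ?thesis
    using C(2) by (simp only:) (intro compact_continuous_image continuous_on_subset[OF continuous_chart_inv], auto)
qed

lemma continuous_pullback: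
  fixes f :: "real ^ 'd \<Rightarrow> 'b::topological_space"
  assumes f: "continuous_on UNIV f" "torus_periodic f"
  shows "continuous_on U (\<lambda>X. f (\<kappa> X))"
proof (rule continuous_at_imp_continuous_on, rule ballI)
  fix X assume "X \<in> U"
  then obtain W l where W: "open W" "X \<in> W" "\<And>Y. Y \<in> W \<Longrightarrow> torus_eq (\<kappa> Y) (l Y)" "continuous_on W l" using lift by metis
  have "continuous_on W (\<lambda>X. f (l X))" using continuous_on_compose2[OF f(1) W(4)] by simp
  then have "continuous_on W (\<lambda>X. f (\<kappa> X))"
    by (rule continuous_on_cong[THEN iffD2, rotated 2]) (use torus_periodicD[OF f(2) W(3)] in auto)
  then show "isCont (\<lambda>X. f (\<kappa> X)) X" using W by (simp add: continuous_on_eq_continuous_at)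
qed

text \<open>The fibre part of \<open>cotangent_lift\<close> and, in \<open>Nf\<close>, its inverse
  over points of \<open>U\<close>.\<close>

definition Mf :: "real ^ 'd \<Rightarrow> real ^ 'd \<Rightarrow> real ^ 'd" where "Mf X \<Xi> = matrix_inv (transpose (J X)) *v \<Xi>"
definition Nf :: "real ^ 'd \<Rightarrow> real ^ 'd \<Rightarrow> real ^ 'd" where "Nf X \<zeta> = transpose (J X) *v \<zeta>"

lemma MN: assumes "X \<in> U" shows "Mf X (Nf X \<zeta>) = \<zeta>" "Nf X (Mf X \<Xi>) = \<Xi>"
proof -
  let ?A = "transpose (J X)"
  have "\<exists>B. ?A ** B = mat 1 \<and> B ** ?A = mat 1"
    using transpose_invertible[OF invertible[OF assms]] unfolding invertible_def .
  from someI_ex[OF this] have e: "?A ** matrix_inv ?A = mat 1" "matrix_inv ?A ** ?A = mat 1"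
    unfolding matrix_inv_def by blast+
  then show "Mf X (Nf X \<zeta>) = \<zeta>" "Nf X (Mf X \<Xi>) = \<Xi>" by (simp_all only: Mf_def Nf_def matrix_vector_mul_assoc e matrix_vector_mul_lid)
qed

lemma inner_Nf: "z \<bullet> Nf X \<zeta> = (J X *v z) \<bullet> \<zeta>"
  by (metis Nf_def dot_lmul_matrix inner_commute transpose_matrix_vector)

lemma continuous_Nf: "continuous_on U (\<lambda>X. Nf X \<zeta>)"
  unfolding Nf_def matrix_vector_mult_def transpose_def vec_lambda_beta
  by (intro continuous_on_vec_lambda continuous_on_sum continuous_on_mult continuous_on_const continuous_J_entry)

text \<open>Cramer's rule writes the inverse matrix as a quotient of polynomials in the entries of
  the Jacobian with nonvanishing denominator.\<close>

lemma continuous_Mf: "continuous_on (U \<times> UNIV) (\<lambda>p. Mf (fst p) (snd p))"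
proof -
  have e: "Mf X \<Xi> = (\<chi> k. det (\<chi> i j. if j = k then \<Xi> $ i else transpose (J X) $ i $ j) / det (transpose (J X)))" if "X \<in> U" for X \<Xi>
  proof -
    have "det (transpose (J X)) \<noteq> 0" using transpose_invertible[OF invertible[OF that]] unfolding invertible_det_nz .
    from cramer[OF this, of "Mf X \<Xi>" \<Xi>] show ?thesis using MN(2)[OF that] unfolding Nf_def by blast
  qed
  have n: "det (transpose (J (fst p))) \<noteq> 0" if "p \<in> U \<times> UNIV" for p :: "(real ^ 'd) \<times> (real ^ 'd)"
  proof -
    have "fst p \<in> U" using that by auto
    from transpose_invertible[OF invertible[OF this]] show ?thesis unfolding invertible_det_nz .
  qed
  have ent: "continuous_on (U \<times> UNIV) (\<lambda>p :: (real ^ 'd) \<times> (real ^ 'd). transpose (J (fst p)) $ i $ j)" for i j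
    unfolding transpose_def vec_lambda_beta
    by (rule continuous_on_compose2[OF continuous_J_entry]) (auto intro!: continuous_intros)
  have ent2: "continuous_on (U \<times> UNIV) (\<lambda>p :: (real ^ 'd) \<times> (real ^ 'd). if j = k then snd p $ i else transpose (J (fst p)) $ i $ j)" for i j k
    by (cases "j = k") (simp_all only: if_True if_False ent continuous_on_component[OF continuous_on_snd[OF continuous_on_id]] simp_thms)
  have d1: "continuous_on (U \<times> UNIV) (\<lambda>p :: (real ^ 'd) \<times> (real ^ 'd). det (\<chi> i j. if j = k then snd p $ i else transpose (J (fst p)) $ i $ j))" for k
    unfolding det_def vec_lambda_beta by (intro continuous_on_sum continuous_on_mult continuous_on_const continuous_on_prod ent2)
  have d2: "continuous_on (U \<times> UNIV) (\<lambda>p :: (real ^ 'd) \<times> (real ^ 'd). det (transpose (J (fst p))))"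
    unfolding det_def by (intro continuous_on_sum continuous_on_mult continuous_on_const continuous_on_prod ent)
  have "continuous_on (U \<times> UNIV) (\<lambda>p. \<chi> k. det (\<chi> i j. if j = k then snd p $ i else transpose (J (fst p)) $ i $ j) / det (transpose (J (fst p))))"
    by (intro continuous_on_vec_lambda continuous_on_divide d1 d2 ballI n)
  then show ?thesis by (rule continuous_on_eq) (rule e[symmetric], simp add: mem_Times_iff)
qed

text \<open>Homogeneity reduces both estimates to the unit sphere, where compactness of K times the
  sphere gives a maximum and, for injective maps, a positive minimum.\<close>

lemma linear_family_bounds:
  fixes T :: "real ^ 'd \<Rightarrow> real ^ 'd \<Rightarrow> real ^ 'd"
  assumes K: "compact K" and lin: "\<And>X. X \<in> K \<Longrightarrow> linear (T X)"
    and cont: "continuous_on (K \<times> UNIV) (\<lambda>p. T (fst p) (snd p))"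
  shows "\<exists>c>0. \<forall>X\<in>K. \<forall>z. norm (T X z) \<le> c * norm z"
    and "(\<And>X z. X \<in> K \<Longrightarrow> T X z = 0 \<Longrightarrow> z = 0) \<Longrightarrow> \<exists>c>0. \<forall>X\<in>K. \<forall>z. c * norm z \<le> norm (T X z)"
proof -
  let ?S = "K \<times> sphere (0 :: real ^ 'd) 1"
  let ?f = "\<lambda>p. norm (T (fst p) (snd p))"
  have S: "compact ?S" using K by (intro compact_Times) auto
  have c: "continuous_on ?S ?f" by (intro continuous_on_norm continuous_on_subset[OF cont]) auto
  have sc: "norm (T X z) = norm z * norm (T X (z /\<^sub>R norm z))" if "X \<in> K" for X z
    using lin[OF that] by (cases "z = 0") (simp_all add: linear_scale linear_0)
  have mem: "(X, z /\<^sub>R norm z) \<in> ?S" if "X \<in> K" "z \<noteq> 0" for X z using that by auto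
  have "bounded (?f ` ?S)" by (intro compact_imp_bounded compact_continuous_image c S)
  then obtain B where B: "\<And>p. p \<in> ?S \<Longrightarrow> ?f p \<le> B" unfolding bounded_iff by fastforce
  have "norm (T X z) \<le> max B 1 * norm z" if "X \<in> K" for X z
  proof (cases "z = 0")
    case True then show ?thesis using lin[OF that] by (simp add: linear_0)
  next
    case False
    have "norm (T X (z /\<^sub>R norm z)) \<le> max B 1" using B[OF mem[OF that False]] by simp
    then have "norm z * norm (T X (z /\<^sub>R norm z)) \<le> norm z * max B 1" by (rule mult_left_mono) simp
    then show ?thesis using sc[OF that, of z] by (simp add: mult.commute)
  qed
  then show "\<exists>c>0. \<forall>X\<in>K. \<forall>z. norm (T X z) \<le> c * norm z" by (intro exI[of _ "max B 1"]) auto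
  assume inj: "\<And>X z. X \<in> K \<Longrightarrow> T X z = 0 \<Longrightarrow> z = 0"
  show "\<exists>c>0. \<forall>X\<in>K. \<forall>z. c * norm z \<le> norm (T X z)"
  proof (cases "?S = {}")
    case True
    have "K = {}"
    proof (rule ccontr)
      assume "K \<noteq> {}"
      then have "sphere (0 :: real ^ 'd) 1 = {}" using True by blast
      then show False using vector_choose_size[of 1, where 'a = "real ^ 'd"] by auto
    qed
    then show ?thesis by (intro exI[of _ 1]) auto
  next
    case False
    obtain p where p: "p \<in> ?S" "\<And>q. q \<in> ?S \<Longrightarrow> ?f p \<le> ?f q" using continuous_attains_inf[OF S False c] by blast
    have "?f p > 0" using inj[of "fst p" "snd p"] p(1) by (cases p) auto
    moreover have "?f p * norm z \<le> norm (T X z)" if "X \<in> K" for X z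
    proof (cases "z = 0")
      case False
      have "?f p \<le> norm (T X (z /\<^sub>R norm z))" using p(2)[OF mem[OF that False]] by simp
      then have "?f p * norm z \<le> norm (T X (z /\<^sub>R norm z)) * norm z" by (rule mult_right_mono) simp
      then show ?thesis using sc[OF that, of z] by (simp add: mult.commute)
    qed simp
    ultimately show ?thesis by blast
  qed
qed

lemma continuous_bilinear_family:
  fixes T :: "real ^ 'd \<Rightarrow> real ^ 'd \<Rightarrow> real ^ 'd"
  assumes "\<And>X. linear (T X)" "\<And>z. continuous_on S (\<lambda>X. T X z)"
  shows "continuous_on (S \<times> UNIV) (\<lambda>p. T (fst p) (snd p))"
proof -
  have e: "T X z = (\<Sum>b\<in>Basis. (z \<bullet> b) *\<^sub>R T X b)" for X z
  proof -
    have "T X z = T X (\<Sum>b\<in>Basis. (z \<bullet> b) *\<^sub>R b)" by (simp add: euclidean_representation)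
    then show ?thesis by (simp only: linear_sum[OF assms(1)] linear_scale[OF assms(1)])
  qed
  have "continuous_on (S \<times> UNIV) (\<lambda>p. \<Sum>b\<in>Basis. (snd p \<bullet> b) *\<^sub>R T (fst p) b)"
    by (intro continuous_on_sum continuous_on_scaleR continuous_intros continuous_on_compose2[OF assms(2)]) auto
  then show ?thesis by (simp only: e[symmetric])
qed

text \<open>One pair of constants for the whole compact set, ready for
  \<open>symbol_ft_decay\<close>: \<open>c\<close> controls the transposed differential from above
  and \<open>c'\<close> the differential from below.\<close>

lemma fiber_map_bounds:
  assumes K: "compact K" "K \<subseteq> U"
  obtains c c' where "c > 0" "c' > 0" "\<And>X. X \<in> K \<Longrightarrow> fiber_map c (Mf X) (Nf X) (\<lambda>z. J X *v z)"
    "\<And>X z. X \<in> K \<Longrightarrow> c' * norm z \<le> norm (J X *v z)"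
proof -
  have lN: "linear (Nf X)" for X unfolding Nf_def[abs_def] by (rule matrix_vector_mul_linear)
  have lM: "linear (Mf X)" for X unfolding Mf_def[abs_def] by (rule matrix_vector_mul_linear)
  obtain c where c: "c > 0" "\<And>X z. X \<in> K \<Longrightarrow> norm (Nf X z) \<le> c * norm z"
    using linear_family_bounds(1)[OF K(1) lN continuous_bilinear_family[OF lN continuous_on_subset[OF continuous_Nf K(2)]]] by blast
  have lJ: "linear (\<lambda>z. J X *v z)" for X by (rule matrix_vector_mul_linear)
  have z: "z = 0" if XK: "X \<in> K" and Jz: "J X *v z = 0" for X z
  proof -
    have "invertible (J X)" using invertible K(2) XK by blast
    then obtain B where "B ** J X = mat 1" unfolding invertible_def by blast
    then have "z = B *v (J X *v z)" by (simp add: matrix_vector_mul_assoc)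
    then show ?thesis using Jz by simp
  qed
  have "\<exists>c>0. \<forall>X\<in>K. \<forall>z. c * norm z \<le> norm (J X *v z)"
    by (rule linear_family_bounds(2)[where T = "\<lambda>X z. J X *v z", OF K(1) lJ continuous_bilinear_family[OF lJ continuous_on_subset[OF continuous_J K(2)]]]) (rule z)
  then obtain c' where c': "c' > 0" "\<And>X z. X \<in> K \<Longrightarrow> c' * norm z \<le> norm (J X *v z)" by blast
  have "fiber_map c (Mf X) (Nf X) (\<lambda>z. J X *v z)" if "X \<in> K" for X
    unfolding fiber_map_def using that K lM MN[of X] c(2) inner_Nf by (simp add: subset_iff)
  then show thesis using that c c' by blast
qed

end

subsection \<open>Weyl operators with compactly supported symbols\<close>

lemma sigma_finite_lebesgue: "sigma_finite_measure (lebesgue :: 'a::euclidean_space measure)"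
proof
  show "\<exists>A. countable A \<and> A \<subseteq> sets (lebesgue :: 'a measure) \<and> \<Union>A = space lebesgue \<and> (\<forall>a\<in>A. emeasure lebesgue a \<noteq> \<infinity>)"
  proof (intro exI[of _ "range (\<lambda>n :: nat. cball 0 (real n))"] conjI ballI)
    show "\<Union>(range (\<lambda>n. cball 0 (real n))) = space (lebesgue :: 'a measure)"
    proof (intro equalityI subsetI)
      fix x :: 'a obtain n :: nat where "norm x \<le> real n" using real_arch_simple by blast
      then show "x \<in> \<Union>(range (\<lambda>n. cball 0 (real n)))" by auto
    qed simp
    fix a :: "'a set" assume "a \<in> range (\<lambda>n :: nat. cball 0 (real n))"
    then show "emeasure lebesgue a \<noteq> \<infinity>" using emeasure_bounded_finite[of a] by (auto simp: less_top)
  qed auto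
qed

interpretation lebesgue: sigma_finite_measure "lebesgue :: 'a::euclidean_space measure"
  by (rule sigma_finite_lebesgue)

interpretation lebesgue_pair: pair_sigma_finite "lebesgue :: 'a::euclidean_space measure" "lebesgue :: 'b::euclidean_space measure" ..

lemma measurable_pair_lebesgue [measurable]:
  "fst \<in> lebesgue \<Otimes>\<^sub>M lebesgue \<rightarrow>\<^sub>M (borel :: 'a::euclidean_space measure)"
  "snd \<in> lebesgue \<Otimes>\<^sub>M lebesgue \<rightarrow>\<^sub>M (borel :: 'b::euclidean_space measure)"
proof -
  have 1: "(\<lambda>x. x) \<in> lebesgue \<rightarrow>\<^sub>M (borel :: 'a measure)" "(\<lambda>x. x) \<in> lebesgue \<rightarrow>\<^sub>M (borel :: 'b measure)"
    by (auto intro!: measurable_completion)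
  show "fst \<in> lebesgue \<Otimes>\<^sub>M lebesgue \<rightarrow>\<^sub>M (borel :: 'a measure)"
    using measurable_compose[OF measurable_fst 1(1)] .
  show "snd \<in> lebesgue \<Otimes>\<^sub>M lebesgue \<rightarrow>\<^sub>M (borel :: 'b measure)"
    using measurable_compose[OF measurable_snd 1(2)] .
qed

lemma lebesgue_integral_lborel:
  "f \<in> borel_measurable borel \<Longrightarrow> (LINT x|lebesgue. f x) = (LINT x|lborel. (f x :: 'b::{banach, second_countable_topology}))"
  "f \<in> borel_measurable borel \<Longrightarrow> integrable lebesgue f \<longleftrightarrow> integrable lborel f"
  by (simp_all add: integral_completion integrable_completion)

lemma decay_le_1: "decay (z :: 'a::euclidean_space) \<le> 1"
proof -
  have "1 \<le> (1 + norm z) ^ (DIM('a) + 2)" by (rule one_le_power) simp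
  then show ?thesis unfolding decay_def inverse_eq_divide[symmetric] inverse_le_1_iff by blast
qed

text \<open>The decay of the fibrewise Fourier transform is all the regularity that enters: it makes the
  kernel of the operator an approximate identity at scale \<open>h\<close>, so that Schur's test gives a bound
  uniform in \<open>h\<close>.\<close>

locale tame_symbol =
  fixes \<sigma> :: "(real ^ 'd::finite) \<times> (real ^ 'd) \<Rightarrow> complex" and R K C :: real
  assumes cont: "continuous_on UNIV \<sigma>"
    and supp: "\<And>m \<xi>. norm \<xi> > R \<Longrightarrow> \<sigma> (m, \<xi>) = 0"
    and bound: "\<And>p. norm (\<sigma> p) \<le> K"
    and ft_decay: "\<And>m z. norm (LINT \<xi>|lborel. \<sigma> (m, \<xi>) * cis (z \<bullet> \<xi>)) \<le> C * decay z"
begin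

definition S where "S m z = (LINT \<xi>|lborel. \<sigma> (m, \<xi>) * cis (z \<bullet> \<xi>))"

text \<open>The Schwartz kernel of \<open>weyl_op h \<sigma>\<close>; rescaling the covector by h
  creates the factor h^-d and the argument (X - y)/h.\<close>

definition kernel where
  "kernel h X y = S ((1 / 2) *\<^sub>R (X + y)) ((1 / h) *\<^sub>R (X - y)) / of_real ((2 * pi) ^ CARD('d) * h ^ CARD('d))"

definition mass :: real where "mass = (LINT z|lborel. decay (z :: real ^ 'd))"

text \<open>A bound, independent of h, for the integral of the modulus of the kernel in either
  variable.\<close>

definition schur :: real where "schur = C * mass / (2 * pi) ^ CARD('d)"

lemma C_nonneg: "C \<ge> 0"
  using order_trans[OF norm_ge_zero ft_decay[of 0 0]] by (simp add: decay_def)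

lemma mass_nonneg: "mass \<ge> 0"
  unfolding mass_def by (rule integral_nonneg_AE) simp

lemma schur_nonneg: "schur \<ge> 0"
  unfolding schur_def using C_nonneg mass_nonneg by simp

lemma sigma_measurable [measurable]: "\<sigma> \<in> borel_measurable borel"
  by (rule borel_measurable_continuous_onI[OF cont])

lemma cis_measurable [measurable]: "cis \<in> borel_measurable borel"
  by (intro borel_measurable_continuous_onI continuous_intros)

lemma S_bound: "norm (S m z) \<le> C * decay z"
  unfolding S_def by (rule ft_decay)

lemma S_tendsto:
  assumes "m \<longlonglongrightarrow> m0" "z \<longlonglongrightarrow> z0" shows "(\<lambda>n. S (m n) (z n)) \<longlonglongrightarrow> S m0 z0"
  unfolding S_def
proof (rule integral_dominated_convergence[where w = "\<lambda>\<xi>. K *\<^sub>R indicator (cball (0 :: real ^ 'd) R) \<xi>"])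
  show "integrable lborel (\<lambda>\<xi>. K *\<^sub>R indicator (cball (0 :: real ^ 'd) R) \<xi> :: real)"
    using emeasure_bounded_finite[of "cball (0 :: real ^ 'd) R"] by (intro integrable_scaleR_right integrable_real_indicator) auto
  show "AE \<xi> in lborel. (\<lambda>n. \<sigma> (m n, \<xi>) * cis (z n \<bullet> \<xi>)) \<longlonglongrightarrow> \<sigma> (m0, \<xi>) * cis (z0 \<bullet> \<xi>)"
  proof (intro AE_I2 tendsto_mult)
    fix \<xi> :: "real ^ 'd"
    have "(\<lambda>n. (m n, \<xi>)) \<longlonglongrightarrow> (m0, \<xi>)" using assms by (intro tendsto_intros)
    then show "(\<lambda>n. \<sigma> (m n, \<xi>)) \<longlonglongrightarrow> \<sigma> (m0, \<xi>)"
      using cont by (intro continuous_on_tendsto_compose[of UNIV \<sigma>]) auto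
    have "(\<lambda>n. z n \<bullet> \<xi>) \<longlonglongrightarrow> z0 \<bullet> \<xi>" using assms by (intro tendsto_intros)
    then show "(\<lambda>n. cis (z n \<bullet> \<xi>)) \<longlonglongrightarrow> cis (z0 \<bullet> \<xi>)"
      by (intro continuous_on_tendsto_compose[of UNIV cis]) (auto intro!: continuous_intros)
  qed
  have K: "K \<ge> 0" using order_trans[OF norm_ge_zero bound[of 0]] .
  show "AE \<xi> in lborel. norm (\<sigma> (m n, \<xi>) * cis (z n \<bullet> \<xi>)) \<le> K *\<^sub>R indicator (cball (0 :: real ^ 'd) R) \<xi>" for n
  proof (rule AE_I2)
    fix \<xi> :: "real ^ 'd"
    show "norm (\<sigma> (m n, \<xi>) * cis (z n \<bullet> \<xi>)) \<le> K *\<^sub>R indicator (cball (0 :: real ^ 'd) R) \<xi>"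
      using supp[of \<xi> "m n"] bound[of "(m n, \<xi>)"] K by (cases "norm \<xi> \<le> R") (auto simp: norm_mult indicator_def)
  qed
qed measurable

lemma S_measurable: "(\<lambda>p. S (fst p) (snd p)) \<in> borel_measurable borel"
proof (rule borel_measurable_continuous_onI)
  show "continuous_on UNIV (\<lambda>p. S (fst p) (snd p))"
    unfolding continuous_on_sequentially o_def
    by (auto intro!: S_tendsto) (metis fst_conv tendsto_fst, metis snd_conv tendsto_snd)
qed

lemma S_measurable_comp:
  assumes "f \<in> M \<rightarrow>\<^sub>M borel" "g \<in> M \<rightarrow>\<^sub>M borel"
  shows "(\<lambda>x. S (f x) (g x)) \<in> borel_measurable M"
proof -
  have "(\<lambda>x. (f x, g x)) \<in> M \<rightarrow>\<^sub>M borel" using assms by (rule borel_measurable_Pair)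
  from measurable_compose[OF this S_measurable] show ?thesis by simp
qed

lemma kernel_measurable [measurable]:
  "(\<lambda>p. kernel h (fst p) (snd p)) \<in> borel_measurable (lebesgue \<Otimes>\<^sub>M lebesgue)"
  unfolding kernel_def by (intro borel_measurable_divide S_measurable_comp) measurable

lemma kernel_borel: "(\<lambda>y. kernel h X y) \<in> borel_measurable borel"
  unfolding kernel_def by (intro borel_measurable_divide S_measurable_comp) measurable

text \<open>The definition integrates first over y and then over covectors. The compact support in
  the covector makes the double integral absolutely convergent, so the order may be reversed to
  reveal the kernel.\<close>

lemma weyl_op_kernel:
  assumes h: "h > 0" and f: "integrable lebesgue f"
  shows "weyl_op h \<sigma> f X = (LINT y|lebesgue. kernel h X y * f y)"
proof -
  let ?g = "\<lambda>\<xi> y. \<sigma> ((1 / 2) *\<^sub>R (X + y), h *\<^sub>R \<xi>) * f y * cis ((X - y) \<bullet> \<xi>)"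
  have K: "K \<ge> 0" using order_trans[OF norm_ge_zero bound[of 0]] .
  have fm [measurable]: "f \<in> borel_measurable lebesgue" using f by (rule borel_measurable_integrable)
  have "weyl_op h \<sigma> f X = (LINT \<xi>|lebesgue. LINT y|lebesgue. ?g \<xi> y) / (2 * pi) ^ CARD('d)"
    by (simp add: weyl_op_def)
  also have "(LINT \<xi>|lebesgue. LINT y|lebesgue. ?g \<xi> y) = (LINT y|lebesgue. LINT \<xi>|lebesgue. ?g \<xi> y)"
  proof (rule lebesgue_pair.Fubini_integral[symmetric])
    have i: "integrable lebesgue (\<lambda>\<xi> :: real ^ 'd. complex_of_real (K * indicator (cball 0 (R / h)) \<xi>))"
      using emeasure_bounded_finite[of "cball (0 :: real ^ 'd) (R / h)"]
      by (intro integrable_of_real integrable_mult_right integrable_real_indicator) auto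
    from lebesgue_pair.integrable_pair_mult[OF i f]
    show "integrable (lebesgue \<Otimes>\<^sub>M lebesgue) (\<lambda>(\<xi>, y). ?g \<xi> y)"
    proof (rule Bochner_Integration.integrable_bound)
      show "(\<lambda>(\<xi>, y). ?g \<xi> y) \<in> borel_measurable (lebesgue \<Otimes>\<^sub>M lebesgue)"
        unfolding split_beta' by measurable
      show "AE p in lebesgue \<Otimes>\<^sub>M lebesgue. norm (case p of (\<xi>, y) \<Rightarrow> ?g \<xi> y) \<le> norm (case p of (\<xi>, y) \<Rightarrow> complex_of_real (K * indicator (cball 0 (R / h)) \<xi>) * f y)"
      proof (rule AE_I2, safe)
        fix \<xi> y :: "real ^ 'd"
        show "norm (?g \<xi> y) \<le> norm (complex_of_real (K * indicator (cball 0 (R / h)) \<xi>) * f y)"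
        proof (cases "norm \<xi> \<le> R / h")
          case True
          then show ?thesis using bound K by (auto simp: norm_mult intro!: mult_right_mono)
        next
          case False
          then have "norm (h *\<^sub>R \<xi>) > R" using h by (simp add: field_simps)
          then show ?thesis using supp by (simp add: norm_mult)
        qed
      qed
    qed
  qed
  also have "\<dots> = (LINT y|lebesgue. of_real ((2 * pi) ^ CARD('d)) * (kernel h X y * f y))"
  proof (rule Bochner_Integration.integral_cong[OF refl])
    fix y
    let ?m = "(1 / 2) *\<^sub>R (X + y)"
    have "(LINT \<xi>|lebesgue. ?g \<xi> y) = (LINT \<xi>|lebesgue. f y * (\<sigma> (?m, h *\<^sub>R \<xi>) * cis ((X - y) \<bullet> \<xi>)))"
      by (rule Bochner_Integration.integral_cong) (auto simp: mult_ac)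
    also have "\<dots> = f y * (LINT \<xi>|lebesgue. \<sigma> (?m, h *\<^sub>R \<xi>) * cis ((X - y) \<bullet> \<xi>))"
      by (rule integral_mult_right_zero)
    also have "(LINT \<xi>|lebesgue. \<sigma> (?m, h *\<^sub>R \<xi>) * cis ((X - y) \<bullet> \<xi>)) = (LINT \<xi>|lborel. \<sigma> (?m, h *\<^sub>R \<xi>) * cis ((X - y) \<bullet> \<xi>))"
      by (rule lebesgue_integral_lborel) measurable
    also have "\<dots> = S ?m ((1 / h) *\<^sub>R (X - y)) / of_real (h ^ CARD('d))"
    proof -
      have "S ?m ((1 / h) *\<^sub>R (X - y)) = \<bar>h\<bar> ^ DIM(real ^ 'd) *\<^sub>R (LINT \<xi>|lborel. \<sigma> (?m, 0 + h *\<^sub>R \<xi>) * cis ((1 / h) *\<^sub>R (X - y) \<bullet> (0 + h *\<^sub>R \<xi>)))"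
        unfolding S_def using h by (intro lborel_integral_affine(2)) measurable
      also have "\<dots> = of_real (h ^ CARD('d)) * (LINT \<xi>|lborel. \<sigma> (?m, h *\<^sub>R \<xi>) * cis ((X - y) \<bullet> \<xi>))"
      proof -
        have "(1 / h) *\<^sub>R (X - y) \<bullet> (0 + h *\<^sub>R \<xi>) = (X - y) \<bullet> \<xi>" for \<xi> using h by simp
        then show ?thesis using h by (simp only: add_0 scaleR_conv_of_real[where 'a = complex] abs_of_pos DIM_cart DIM_real mult_1_right)
      qed
      finally show ?thesis using h by simp
    qed
    finally show "(LINT \<xi>|lebesgue. ?g \<xi> y) = of_real ((2 * pi) ^ CARD('d)) * (kernel h X y * f y)"
      using h by (simp add: kernel_def field_simps)
  qed
  also have "\<dots> = of_real ((2 * pi) ^ CARD('d)) * (LINT y|lebesgue. kernel h X y * f y)"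
    by (rule integral_mult_right_zero)
  finally show ?thesis by simp
qed

lemma norm_kernel_le: "h > 0 \<Longrightarrow> norm (kernel h X y) \<le> C / ((2 * pi) ^ CARD('d) * h ^ CARD('d))"
proof -
  assume h: "h > 0"
  have "norm (S m z) \<le> C" for m z
    using order_trans[OF S_bound[of m z] mult_left_mono[OF decay_le_1]] C_nonneg by simp
  then show ?thesis using h unfolding kernel_def norm_divide norm_of_real by (simp add: divide_right_mono)
qed

text \<open>Continuity makes the composition with the inverse chart Borel measurable on the patch
  image, where the torus inner product is formed.\<close>

lemma weyl_op_continuous:
  assumes h: "h > 0" and q: "integrable lebesgue q"
  shows "continuous_on UNIV (weyl_op h \<sigma> q)"
proof -
  let ?P = "(2 * pi) ^ CARD('d) * h ^ CARD('d)"
  have qm [measurable]: "q \<in> borel_measurable lebesgue" using q by (rule borel_measurable_integrable)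
  have km: "(\<lambda>y. kernel h X y) \<in> borel_measurable lebesgue" for X using kernel_borel by (intro measurable_completion) simp
  have "(\<lambda>n. weyl_op h \<sigma> q (X n)) \<longlonglongrightarrow> weyl_op h \<sigma> q X0" if X: "X \<longlonglongrightarrow> X0" for X X0
    unfolding weyl_op_kernel[OF h q]
  proof (rule integral_dominated_convergence[where w = "\<lambda>y. (C / ?P) * norm (q y)"])
    show "integrable lebesgue (\<lambda>y. (C / ?P) * norm (q y))" using q by (intro integrable_mult_right integrable_norm)
    show "(\<lambda>y. kernel h X0 y * q y) \<in> borel_measurable lebesgue" "(\<lambda>y. kernel h (X n) y * q y) \<in> borel_measurable lebesgue" for n
      by (intro borel_measurable_times km qm)+
    show "AE y in lebesgue. (\<lambda>n. kernel h (X n) y * q y) \<longlonglongrightarrow> kernel h X0 y * q y"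
      unfolding kernel_def using h by (intro AE_I2 tendsto_mult tendsto_divide S_tendsto tendsto_intros X) auto
    show "AE y in lebesgue. norm (kernel h (X n) y * q y) \<le> (C / ?P) * norm (q y)" for n
    proof (rule AE_I2)
      fix y
      show "norm (kernel h (X n) y * q y) \<le> (C / ?P) * norm (q y)"
        unfolding norm_mult by (rule mult_right_mono[OF norm_kernel_le[OF h] norm_ge_zero])
    qed
  qed
  then show ?thesis unfolding continuous_on_sequentially o_def by blast
qed

lemma weyl_op_linear:
  assumes h: "h > 0" and f: "integrable lebesgue f" and g: "integrable lebesgue g"
  shows "weyl_op h \<sigma> (\<lambda>y. f y + g y) X = weyl_op h \<sigma> f X + weyl_op h \<sigma> g X"
    and "weyl_op h \<sigma> (\<lambda>y. c * f y) X = c * weyl_op h \<sigma> f X"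
proof -
  let ?P = "(2 * pi) ^ CARD('d) * h ^ CARD('d)"
  have i: "integrable lebesgue (\<lambda>y. kernel h X y * u y)" if u: "integrable lebesgue u" for u
  proof -
    have "integrable lebesgue (\<lambda>y. (C / ?P) * norm (u y))" using u by (intro integrable_mult_right integrable_norm)
    then show ?thesis
    proof (rule Bochner_Integration.integrable_bound)
      have "(\<lambda>y. kernel h X y) \<in> borel_measurable lebesgue" using kernel_borel by (intro measurable_completion) simp
      then show "(\<lambda>y. kernel h X y * u y) \<in> borel_measurable lebesgue"
        by (intro borel_measurable_times borel_measurable_integrable[OF u])
      show "AE y in lebesgue. norm (kernel h X y * u y) \<le> norm ((C / ?P) * norm (u y))"
      proof (rule AE_I2)
        fix y
        have "norm (kernel h X y * u y) \<le> (C / ?P) * norm (u y)"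
          unfolding norm_mult by (rule mult_right_mono[OF norm_kernel_le[OF h] norm_ge_zero])
        then show "norm (kernel h X y * u y) \<le> norm ((C / ?P) * norm (u y))" unfolding real_norm_def by (rule order_trans[OF _ abs_ge_self])
      qed
    qed
  qed
  show "weyl_op h \<sigma> (\<lambda>y. f y + g y) X = weyl_op h \<sigma> f X + weyl_op h \<sigma> g X"
    unfolding weyl_op_kernel[OF h f] weyl_op_kernel[OF h g] weyl_op_kernel[OF h Bochner_Integration.integrable_add[OF f g]] distrib_left
    by (rule Bochner_Integration.integral_add[OF i[OF f] i[OF g]])
  have e: "kernel h X y * (c * f y) = c * (kernel h X y * f y)" for y by simp
  show "weyl_op h \<sigma> (\<lambda>y. c * f y) X = c * weyl_op h \<sigma> f X"
    unfolding weyl_op_kernel[OF h f] weyl_op_kernel[OF h integrable_mult_right[OF f]] e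
    by (rule integral_mult_right_zero)
qed

section \<open>Bounds uniform in h by Schur's test, and the limit of the forms\<close>

text \<open>The L^1-normalised dilation of \<open>decay\<close>: its integral is \<open>mass\<close>
  for every h, which is the source of uniformity in h.\<close>

definition majorant :: "real \<Rightarrow> real ^ 'd \<Rightarrow> real" where
  "majorant h z = decay ((1 / h) *\<^sub>R z) / h ^ CARD('d)"

lemma majorant_measurable [measurable]: "majorant h \<in> borel_measurable borel"
  unfolding majorant_def[abs_def] by measurable

lemma majorant_nonneg: "h > 0 \<Longrightarrow> majorant h z \<ge> 0"
  by (simp add: majorant_def)

lemma kernel_bound: "h > 0 \<Longrightarrow> norm (kernel h X y) \<le> C / (2 * pi) ^ CARD('d) * majorant h (X - y)"
proof -
  assume h: "h > 0"
  have "norm (kernel h X y) = norm (S ((1 / 2) *\<^sub>R (X + y)) ((1 / h) *\<^sub>R (X - y))) / ((2 * pi) ^ CARD('d) * h ^ CARD('d))"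
    using h unfolding kernel_def norm_divide norm_of_real by simp
  also have "\<dots> \<le> C * decay ((1 / h) *\<^sub>R (X - y)) / ((2 * pi) ^ CARD('d) * h ^ CARD('d))"
    using h by (intro divide_right_mono S_bound) auto
  finally show ?thesis by (simp add: majorant_def)
qed

text \<open>The two signs serve the two integrations of Schur's test, over the first and over the
  second argument of the kernel.\<close>

lemma nn_integral_majorant:
  assumes h: "h > 0" and s: "s = 1 \<or> s = -1"
  shows "(\<integral>\<^sup>+y. ennreal (majorant h (t + s *\<^sub>R y)) \<partial>lebesgue) = ennreal mass"
proof -
  let ?T = "(1 / h) *\<^sub>R t" and ?c = "s / h"
  have c: "?c \<noteq> 0" using h s by auto
  have arg: "?T + ?c *\<^sub>R y = (1 / h) *\<^sub>R (t + s *\<^sub>R y)" for y by (simp add: algebra_simps)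
  have m: "(decay :: real ^ 'd \<Rightarrow> real) \<in> borel_measurable borel" by measurable
  have abs: "\<bar>?c\<bar> ^ DIM(real ^ 'd) = 1 / h ^ CARD('d)" using h s by (auto simp: power_divide)
  have 1: "integrable lborel (\<lambda>y :: real ^ 'd. decay ((1 / h) *\<^sub>R (t + s *\<^sub>R y)))"
    using lborel_integral_affine(1)[OF c m, of ?T] decay_integrable unfolding arg by blast
  have 2: "mass = (LINT y|lborel. majorant h (t + s *\<^sub>R y))"
    unfolding mass_def lborel_integral_affine(2)[OF c m, of ?T] abs arg majorant_def by simp
  have 3: "integrable lborel (\<lambda>y. majorant h (t + s *\<^sub>R y))"
    unfolding majorant_def using 1 by (intro integrable_divide_zero) 
  show ?thesis unfolding nn_integral_completion 2
    by (rule nn_integral_eq_integral[OF 3]) (simp add: majorant_nonneg[OF h])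
qed

text \<open>By |p q| <= (|p|^2 + |q|^2)/2 each half contains only one function, and the kernel is
  integrated out in the other variable. The bound is additive; a product bound is recovered later by
  rescaling the two arguments against each other.\<close>

lemma schur_test:
  fixes p q :: "real ^ 'd \<Rightarrow> complex"
  assumes h: "h > 0" and p: "p \<in> borel_measurable lebesgue" "integrable lebesgue (\<lambda>x. (norm (p x))\<^sup>2)"
    and q: "q \<in> borel_measurable lebesgue" "integrable lebesgue (\<lambda>x. (norm (q x))\<^sup>2)"
  shows "integrable (lebesgue \<Otimes>\<^sub>M lebesgue) (\<lambda>z. p (fst z) * (kernel h (fst z) (snd z) * q (snd z)))"
    and "norm (LINT z|(lebesgue \<Otimes>\<^sub>M lebesgue). p (fst z) * (kernel h (fst z) (snd z) * q (snd z)))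
      \<le> schur * ((LINT x|lebesgue. (norm (p x))\<^sup>2) + (LINT x|lebesgue. (norm (q x))\<^sup>2)) / 2"
proof -
  let ?f = "\<lambda>z. p (fst z) * (kernel h (fst z) (snd z) * q (snd z))"
  let ?P = "LINT x|lebesgue. (norm (p x))\<^sup>2" and ?Q = "LINT x|lebesgue. (norm (q x))\<^sup>2"
  note [measurable] = p(1) q(1)
  define A where "A = C / (2 * pi) ^ CARD('d) / 2"
  have A: "A \<ge> 0" using C_nonneg by (simp add: A_def)
  have fm [measurable]: "?f \<in> borel_measurable (lebesgue \<Otimes>\<^sub>M lebesgue)" by measurable
  have le: "norm (?f z) \<le> A * ((norm (p (fst z)))\<^sup>2 * majorant h (fst z - snd z)) + A * ((norm (q (snd z)))\<^sup>2 * majorant h (fst z - snd z))" for z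
  proof -
    let ?a = "norm (p (fst z))" and ?b = "norm (q (snd z))" and ?m = "majorant h (fst z - snd z)"
    have m: "?m \<ge> 0" by (rule majorant_nonneg[OF h])
    have ab: "?a * ?b \<le> (?a\<^sup>2 + ?b\<^sup>2) / 2"
      using zero_le_power2[of "?a - ?b"] by (simp add: power2_eq_square algebra_simps)
    have "norm (?f z) = (?a * ?b) * norm (kernel h (fst z) (snd z))" by (simp add: norm_mult)
    also have "\<dots> \<le> ((?a\<^sup>2 + ?b\<^sup>2) / 2) * (C / (2 * pi) ^ CARD('d) * ?m)"
      using ab kernel_bound[OF h] m C_nonneg by (intro mult_mono) auto
    also have "\<dots> = A * (?a\<^sup>2 * ?m) + A * (?b\<^sup>2 * ?m)" by (simp add: A_def field_simps)
    finally show ?thesis .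
  qed
  have mm [measurable]: "(\<lambda>z. majorant h (fst z - snd z)) \<in> borel_measurable (lebesgue \<Otimes>\<^sub>M lebesgue)"
    by measurable
  have nP: "(\<integral>\<^sup>+z. ennreal ((norm (p (fst z)))\<^sup>2 * majorant h (fst z - snd z)) \<partial>(lebesgue \<Otimes>\<^sub>M lebesgue)) = ennreal (?P * mass)"
  proof -
    have "(\<integral>\<^sup>+z. ennreal ((norm (p (fst z)))\<^sup>2 * majorant h (fst z - snd z)) \<partial>(lebesgue \<Otimes>\<^sub>M lebesgue))
      = (\<integral>\<^sup>+x. \<integral>\<^sup>+y. ennreal ((norm (p x))\<^sup>2 * majorant h (x - y)) \<partial>lebesgue \<partial>lebesgue)"
      by (subst lebesgue.nn_integral_fst[symmetric]) simp_all
    also have "\<dots> = (\<integral>\<^sup>+x. ennreal ((norm (p x))\<^sup>2) * ennreal mass \<partial>lebesgue)"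
    proof (rule nn_integral_cong)
      fix x
      have "(\<integral>\<^sup>+y. ennreal ((norm (p x))\<^sup>2 * majorant h (x - y)) \<partial>lebesgue) = (\<integral>\<^sup>+y. ennreal ((norm (p x))\<^sup>2) * ennreal (majorant h (x + (-1) *\<^sub>R y)) \<partial>lebesgue)"
        by (simp add: ennreal_mult' )
      also have "\<dots> = ennreal ((norm (p x))\<^sup>2) * (\<integral>\<^sup>+y. ennreal (majorant h (x + (-1) *\<^sub>R y)) \<partial>lebesgue)"
        by (rule nn_integral_cmult) (auto intro!: measurable_completion)
      also have "(\<integral>\<^sup>+y. ennreal (majorant h (x + (-1) *\<^sub>R y)) \<partial>lebesgue) = ennreal mass"
        by (rule nn_integral_majorant[OF h]) simp
      finally show "(\<integral>\<^sup>+y. ennreal ((norm (p x))\<^sup>2 * majorant h (x - y)) \<partial>lebesgue) = ennreal ((norm (p x))\<^sup>2) * ennreal mass" .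
    qed
    also have "\<dots> = (\<integral>\<^sup>+x. ennreal ((norm (p x))\<^sup>2) \<partial>lebesgue) * ennreal mass"
      by (rule nn_integral_multc) measurable
    also have "(\<integral>\<^sup>+x. ennreal ((norm (p x))\<^sup>2) \<partial>lebesgue) = ennreal ?P"
      by (rule nn_integral_eq_integral[OF p(2)]) simp
    finally show ?thesis using mass_nonneg by (simp add: ennreal_mult')
  qed
  have nQ: "(\<integral>\<^sup>+z. ennreal ((norm (q (snd z)))\<^sup>2 * majorant h (fst z - snd z)) \<partial>(lebesgue \<Otimes>\<^sub>M lebesgue)) = ennreal (?Q * mass)"
  proof -
    have "(\<integral>\<^sup>+z. ennreal ((norm (q (snd z)))\<^sup>2 * majorant h (fst z - snd z)) \<partial>(lebesgue \<Otimes>\<^sub>M lebesgue))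
      = (\<integral>\<^sup>+y. \<integral>\<^sup>+x. ennreal ((norm (q y))\<^sup>2 * majorant h (x - y)) \<partial>lebesgue \<partial>lebesgue)"
      by (subst lebesgue_pair.nn_integral_snd[symmetric]) simp_all
    also have "\<dots> = (\<integral>\<^sup>+y. ennreal ((norm (q y))\<^sup>2) * ennreal mass \<partial>lebesgue)"
    proof (rule nn_integral_cong)
      fix y
      have "(\<integral>\<^sup>+x. ennreal ((norm (q y))\<^sup>2 * majorant h (x - y)) \<partial>lebesgue) = (\<integral>\<^sup>+x. ennreal ((norm (q y))\<^sup>2) * ennreal (majorant h (- y + 1 *\<^sub>R x)) \<partial>lebesgue)"
        by (simp add: ennreal_mult')
      also have "\<dots> = ennreal ((norm (q y))\<^sup>2) * (\<integral>\<^sup>+x. ennreal (majorant h (- y + 1 *\<^sub>R x)) \<partial>lebesgue)"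
        by (rule nn_integral_cmult) (auto intro!: measurable_completion)
      also have "(\<integral>\<^sup>+x. ennreal (majorant h (- y + 1 *\<^sub>R x)) \<partial>lebesgue) = ennreal mass"
        by (rule nn_integral_majorant[OF h]) simp
      finally show "(\<integral>\<^sup>+x. ennreal ((norm (q y))\<^sup>2 * majorant h (x - y)) \<partial>lebesgue) = ennreal ((norm (q y))\<^sup>2) * ennreal mass" .
    qed
    also have "\<dots> = (\<integral>\<^sup>+x. ennreal ((norm (q x))\<^sup>2) \<partial>lebesgue) * ennreal mass"
      by (rule nn_integral_multc) measurable
    also have "(\<integral>\<^sup>+x. ennreal ((norm (q x))\<^sup>2) \<partial>lebesgue) = ennreal ?Q"
      by (rule nn_integral_eq_integral[OF q(2)]) simp
    finally show ?thesis using mass_nonneg by (simp add: ennreal_mult')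
  qed
  have PQ: "?P \<ge> 0" "?Q \<ge> 0" by (auto intro!: integral_nonneg_AE)
  have "(\<integral>\<^sup>+z. ennreal (norm (?f z)) \<partial>(lebesgue \<Otimes>\<^sub>M lebesgue))
    \<le> (\<integral>\<^sup>+z. ennreal A * ennreal ((norm (p (fst z)))\<^sup>2 * majorant h (fst z - snd z)) + ennreal A * ennreal ((norm (q (snd z)))\<^sup>2 * majorant h (fst z - snd z)) \<partial>(lebesgue \<Otimes>\<^sub>M lebesgue))"
  proof (rule nn_integral_mono)
    fix z :: "(real ^ 'd) \<times> (real ^ 'd)"
    have "ennreal (norm (?f z)) \<le> ennreal (A * ((norm (p (fst z)))\<^sup>2 * majorant h (fst z - snd z)) + A * ((norm (q (snd z)))\<^sup>2 * majorant h (fst z - snd z)))"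
      by (rule ennreal_leI[OF le])
    also have "\<dots> = ennreal A * ennreal ((norm (p (fst z)))\<^sup>2 * majorant h (fst z - snd z)) + ennreal A * ennreal ((norm (q (snd z)))\<^sup>2 * majorant h (fst z - snd z))"
      using A majorant_nonneg[OF h] by (simp add: ennreal_plus ennreal_mult)
    finally show "ennreal (norm (?f z)) \<le> ennreal A * ennreal ((norm (p (fst z)))\<^sup>2 * majorant h (fst z - snd z)) + ennreal A * ennreal ((norm (q (snd z)))\<^sup>2 * majorant h (fst z - snd z))" .
  qed
  also have "\<dots> = ennreal A * ennreal (?P * mass) + ennreal A * ennreal (?Q * mass)"
    by (subst nn_integral_add, measurable) (simp add: nn_integral_cmult nP nQ)
  also have "\<dots> = ennreal (schur * (?P + ?Q) / 2)"
  proof -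
    have "ennreal A * ennreal (?P * mass) + ennreal A * ennreal (?Q * mass) = ennreal (A * (?P * mass) + A * (?Q * mass))"
      using A PQ mass_nonneg by (simp add: ennreal_plus ennreal_mult)
    also have "A * (?P * mass) + A * (?Q * mass) = schur * (?P + ?Q) / 2"
      by (simp add: A_def schur_def field_simps)
    finally show ?thesis .
  qed
  finally have fin: "(\<integral>\<^sup>+z. ennreal (norm (?f z)) \<partial>(lebesgue \<Otimes>\<^sub>M lebesgue)) \<le> ennreal (schur * (?P + ?Q) / 2)" .
  then show i: "integrable (lebesgue \<Otimes>\<^sub>M lebesgue) ?f"
    by (intro integrableI_bounded fm le_less_trans[OF fin]) simp
  have "ennreal (norm (LINT z|(lebesgue \<Otimes>\<^sub>M lebesgue). ?f z)) \<le> ennreal (schur * (?P + ?Q) / 2)"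
    using order_trans[OF integral_norm_bound_ennreal[OF i] fin] .
  then show "norm (LINT z|(lebesgue \<Otimes>\<^sub>M lebesgue). ?f z) \<le> schur * (?P + ?Q) / 2"
    using schur_nonneg PQ by (simp add: ennreal_le_iff)
qed

lemma weyl_form:
  fixes p q :: "real ^ 'd \<Rightarrow> complex"
  assumes h: "h > 0" and p: "p \<in> borel_measurable lebesgue" "integrable lebesgue (\<lambda>x. (norm (p x))\<^sup>2)"
    and q: "integrable lebesgue q" "integrable lebesgue (\<lambda>x. (norm (q x))\<^sup>2)"
  shows "integrable lebesgue (\<lambda>X. p X * weyl_op h \<sigma> q X)"
    and "norm (LINT X|lebesgue. p X * weyl_op h \<sigma> q X)
      \<le> schur * ((LINT x|lebesgue. (norm (p x))\<^sup>2) + (LINT x|lebesgue. (norm (q x))\<^sup>2)) / 2"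
proof -
  note s = schur_test[OF h p borel_measurable_integrable[OF q(1)] q(2)]
  have e: "(LINT y|lebesgue. p (fst (X, y)) * (kernel h (fst (X, y)) (snd (X, y)) * q (snd (X, y)))) = p X * weyl_op h \<sigma> q X" for X
    unfolding weyl_op_kernel[OF h q(1)] fst_conv snd_conv by (rule integral_mult_right_zero)
  show "integrable lebesgue (\<lambda>X. p X * weyl_op h \<sigma> q X)"
    using lebesgue_pair.integrable_fst'[OF s(1)] unfolding e .
  show "norm (LINT X|lebesgue. p X * weyl_op h \<sigma> q X)
      \<le> schur * ((LINT x|lebesgue. (norm (p x))\<^sup>2) + (LINT x|lebesgue. (norm (q x))\<^sup>2)) / 2"
    using s(2) lebesgue_pair.integral_fst'[OF s(1)] unfolding e by simp
qed

text \<open>The substitution y = X - h z cancels h^-d and moves the dependence on h into the base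
  point X - h z/2 and the argument of q, where a limit can be taken under the integral.\<close>

lemma weyl_op_substitution:
  assumes h: "h > 0" and q: "q \<in> borel_measurable borel" "integrable lebesgue q"
  shows "weyl_op h \<sigma> q X = (LINT z|lborel. S (X - (h / 2) *\<^sub>R z) z * q (X - h *\<^sub>R z)) / of_real ((2 * pi) ^ CARD('d))"
proof -
  note [measurable] = q(1) kernel_borel
  have "weyl_op h \<sigma> q X = (LINT y|lborel. kernel h X y * q y)"
    unfolding weyl_op_kernel[OF h q(2)] by (rule lebesgue_integral_lborel) measurable
  also have "\<dots> = \<bar>- h\<bar> ^ DIM(real ^ 'd) *\<^sub>R (LINT z|lborel. kernel h X (X + (- h) *\<^sub>R z) * q (X + (- h) *\<^sub>R z))"
    using h by (intro lborel_integral_affine(2)) measurable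
  also have "\<dots> = of_real (h ^ CARD('d)) * (LINT z|lborel. (S (X - (h / 2) *\<^sub>R z) z * q (X - h *\<^sub>R z)) / of_real ((2 * pi) ^ CARD('d) * h ^ CARD('d)))"
  proof -
    have "kernel h X (X + (- h) *\<^sub>R z) = S (X - (h / 2) *\<^sub>R z) z / of_real ((2 * pi) ^ CARD('d) * h ^ CARD('d))" for z
    proof -
      have "(1 / 2) *\<^sub>R (X + (X + (- h) *\<^sub>R z)) = X - (h / 2) *\<^sub>R z"
        by (simp add: vec_eq_iff field_simps)
      moreover have "(1 / h) *\<^sub>R (X - (X + (- h) *\<^sub>R z)) = z" using h by simp
      ultimately show ?thesis unfolding kernel_def by (simp only:)
    qed
    then show ?thesis using h by (simp add: scaleR_conv_of_real)
  qed
  also have "\<dots> = (LINT z|lborel. S (X - (h / 2) *\<^sub>R z) z * q (X - h *\<^sub>R z)) / of_real ((2 * pi) ^ CARD('d))"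
    using h by (simp only: integral_divide_zero) simp
  finally show ?thesis .
qed

text \<open>\<open>\<zeta> X\<close> is the frequency with which the product of p and q oscillates
  at scale h around X. For fixed X the z-integral becomes an inverse Fourier integral of S X, and
  inversion returns the symbol at that frequency.\<close>

lemma weyl_form_limit:
  fixes p q :: "nat \<Rightarrow> real ^ 'd \<Rightarrow> complex"
  assumes h: "\<And>n. h n > 0" "h \<longlonglongrightarrow> 0"
    and p: "\<And>n. p n \<in> borel_measurable borel" "\<And>n X. norm (p n X) \<le> B" "\<And>n X. norm X > r \<Longrightarrow> p n X = 0"
    and q: "\<And>n. q n \<in> borel_measurable borel" "\<And>n X. norm (q n X) \<le> B" "\<And>n X. norm X > r \<Longrightarrow> q n X = 0"
    and lim: "\<And>X z. (\<lambda>n. p n X * q n (X - h n *\<^sub>R z)) \<longlonglongrightarrow> g X * cis (- (z \<bullet> \<zeta> X))"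
  shows "(\<lambda>n. LINT X|lebesgue. p n X * weyl_op (h n) \<sigma> (q n) X) \<longlonglongrightarrow> (LINT X|lebesgue. g X * \<sigma> (X, \<zeta> X))"
proof -
  let ?P = "(2 * pi) ^ CARD('d)"
  have B: "B \<ge> 0" using order_trans[OF norm_ge_zero p(2)[of 0 0]] .
  note [measurable] = p(1) q(1)
  have sq: "integrable lebesgue (\<lambda>x. (norm (f x))\<^sup>2)" "integrable lebesgue f"
    if "f \<in> borel_measurable borel" "\<And>X. norm (f X) \<le> B" "\<And>X. norm X > r \<Longrightarrow> f X = 0" for f :: "real ^ 'd \<Rightarrow> complex"
  proof -
    note [measurable] = that(1)
    have "integrable lborel (\<lambda>x. (norm (f x))\<^sup>2)"
      by (rule integrable_compact_support[where K = "B\<^sup>2" and R = r]) (use that(2,3) in \<open>auto intro!: power_mono\<close>)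
    then show "integrable lebesgue (\<lambda>x. (norm (f x))\<^sup>2)" by (subst lebesgue_integral_lborel(2)) measurable
    have "integrable lborel f" by (rule integrable_compact_support[OF that])
    then show "integrable lebesgue f" using that(1) by (subst lebesgue_integral_lborel(2)) 
  qed
  have qi: "integrable lebesgue (q n)" for n by (rule sq(2)[OF q])
  have form: "integrable lebesgue (\<lambda>X. p n X * weyl_op (h n) \<sigma> (q n) X)" for n
    by (rule weyl_form(1)[OF h(1) _ sq(1)[OF p] qi sq(1)[OF q]]) (auto intro!: measurable_completion)
  have sub: "weyl_op (h n) \<sigma> (q n) X = (LINT z|lborel. S (X - (h n / 2) *\<^sub>R z) z * q n (X - h n *\<^sub>R z)) / of_real ?P" for n X
    by (rule weyl_op_substitution[OF h(1) q(1) qi])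
  have ib: "norm (S m z * q n y) \<le> C * B * decay z" for m z n y
  proof -
    have "norm (S m z * q n y) \<le> (C * decay z) * B"
      unfolding norm_mult using S_bound[of m z] q(2)[of n y] C_nonneg by (intro mult_mono) auto
    then show ?thesis by (simp add: mult_ac)
  qed
  have di: "integrable lborel (\<lambda>z :: real ^ 'd. a * decay z)" for a by (intro integrable_mult_right decay_integrable)
  have Sm [measurable]: "(\<lambda>z. S (X - (h n / 2) *\<^sub>R z) z) \<in> borel_measurable borel" for X n
    by (rule S_measurable_comp) measurable
  have Sm' [measurable]: "(\<lambda>z. S X z) \<in> borel_measurable borel" for X
    by (rule S_measurable_comp) measurable
  have inner: "(\<lambda>n. p n X * weyl_op (h n) \<sigma> (q n) X) \<longlonglongrightarrow> g X * \<sigma> (X, \<zeta> X)" for X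
  proof -
    have "(\<lambda>n. LINT z|lborel. S (X - (h n / 2) *\<^sub>R z) z * (p n X * q n (X - h n *\<^sub>R z))) \<longlonglongrightarrow> (LINT z|lborel. S X z * (g X * cis (- (z \<bullet> \<zeta> X))))"
    proof (rule integral_dominated_convergence[where w = "\<lambda>z. (C * B * B) * decay z"])
      show "AE z in lborel. (\<lambda>n. S (X - (h n / 2) *\<^sub>R z) z * (p n X * q n (X - h n *\<^sub>R z))) \<longlonglongrightarrow> S X z * (g X * cis (- (z \<bullet> \<zeta> X)))"
      proof (intro AE_I2 tendsto_mult[OF S_tendsto[OF _ tendsto_const] lim])
        fix z
        have "(\<lambda>n. X - (h n / 2) *\<^sub>R z) \<longlonglongrightarrow> X - (0 / 2) *\<^sub>R z" by (intro tendsto_intros h(2)) simp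
        then show "(\<lambda>n. X - (h n / 2) *\<^sub>R z) \<longlonglongrightarrow> X" by simp
      qed
      show "AE z in lborel. norm (S (X - (h n / 2) *\<^sub>R z) z * (p n X * q n (X - h n *\<^sub>R z))) \<le> (C * B * B) * decay z" for n
      proof (rule AE_I2)
        fix z
        have "norm (p n X) * norm (S (X - (h n / 2) *\<^sub>R z) z * q n (X - h n *\<^sub>R z)) \<le> B * (C * B * decay z)"
          using p(2)[of n X] ib[of "X - (h n / 2) *\<^sub>R z" z n "X - h n *\<^sub>R z"] B by (intro mult_mono) auto
        then show "norm (S (X - (h n / 2) *\<^sub>R z) z * (p n X * q n (X - h n *\<^sub>R z))) \<le> (C * B * B) * decay z"
          by (simp add: norm_mult mult_ac)
      qed
    qed (use di in measurable)
    moreover have "(LINT z|lborel. S (X - (h n / 2) *\<^sub>R z) z * (p n X * q n (X - h n *\<^sub>R z))) = of_real ?P * (p n X * weyl_op (h n) \<sigma> (q n) X)" for n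
    proof -
      have "(LINT z|lborel. S (X - (h n / 2) *\<^sub>R z) z * (p n X * q n (X - h n *\<^sub>R z))) = (LINT z|lborel. p n X * (S (X - (h n / 2) *\<^sub>R z) z * q n (X - h n *\<^sub>R z)))"
        by (rule Bochner_Integration.integral_cong) (auto simp: mult_ac)
      also have "\<dots> = p n X * (LINT z|lborel. S (X - (h n / 2) *\<^sub>R z) z * q n (X - h n *\<^sub>R z))" by (rule integral_mult_right_zero)
      finally show ?thesis unfolding sub by simp
    qed
    moreover have "(LINT z|lborel. S X z * (g X * cis (- (z \<bullet> \<zeta> X)))) = of_real ?P * (g X * \<sigma> (X, \<zeta> X))"
    proof -
      have "(LINT z|lborel. S X z * (g X * cis (- (z \<bullet> \<zeta> X)))) = (LINT z|lborel. g X * (S X z * cis (- (z \<bullet> \<zeta> X))))"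
        by (rule Bochner_Integration.integral_cong) (auto simp: mult_ac)
      also have "\<dots> = g X * (LINT z|lborel. S X z * cis (- (z \<bullet> \<zeta> X)))" by (rule integral_mult_right_zero)
      also have "(LINT z|lborel. S X z * cis (- (z \<bullet> \<zeta> X))) = (2 * pi) ^ DIM(real ^ 'd) * \<sigma> (X, \<zeta> X)"
        unfolding S_def
      proof (rule Fourier_inversion[where f = "\<lambda>\<xi>. \<sigma> (X, \<xi>)"])
        show "continuous_on UNIV (\<lambda>\<xi>. \<sigma> (X, \<xi>))"
          by (rule continuous_on_compose2[OF cont]) (auto intro!: continuous_intros)
      qed (use bound supp ft_decay in auto)
      finally show ?thesis by simp
    qed
    ultimately have "(\<lambda>n. of_real ?P * (p n X * weyl_op (h n) \<sigma> (q n) X)) \<longlonglongrightarrow> of_real ?P * (g X * \<sigma> (X, \<zeta> X))" by (simp only:)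
    then have "(\<lambda>n. (of_real ?P * (p n X * weyl_op (h n) \<sigma> (q n) X)) / of_real ?P) \<longlonglongrightarrow> (of_real ?P * (g X * \<sigma> (X, \<zeta> X))) / of_real ?P"
      by (intro tendsto_divide tendsto_const) auto
    then show ?thesis by simp
  qed
  \<comment> \<open>Together with the common compact support of the p n this uniform bound dominates
    the outer integral.\<close>
  have Wb: "norm (weyl_op (h n) \<sigma> (q n) X) \<le> C * B * mass / ?P" for n X
  proof -
    have "norm (LINT z|lborel. S (X - (h n / 2) *\<^sub>R z) z * q n (X - h n *\<^sub>R z)) \<le> (LINT z|lborel. norm (S (X - (h n / 2) *\<^sub>R z) z * q n (X - h n *\<^sub>R z)))"
      by (rule integral_norm_bound)
    also have "\<dots> \<le> (LINT z|lborel. C * B * decay (z :: real ^ 'd))"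
    proof (rule integral_mono)
      show "integrable lborel (\<lambda>z. norm (S (X - (h n / 2) *\<^sub>R z) z * q n (X - h n *\<^sub>R z)))"
        by (rule Bochner_Integration.integrable_bound[OF di[of "C * B"]]) (auto intro!: AE_I2 order_trans[OF ib abs_ge_self])
    qed (use ib di in auto)
    also have "\<dots> = C * B * mass" by (simp add: mass_def)
    finally show ?thesis unfolding sub norm_divide norm_of_real by (simp add: divide_right_mono)
  qed
  define M where "M = C * B * mass / ?P"
  have M: "M \<ge> 0" using C_nonneg B mass_nonneg by (simp add: M_def)
  show ?thesis
  proof (rule integral_dominated_convergence[where w = "\<lambda>X. (B * M) *\<^sub>R indicator (cball (0 :: real ^ 'd) r) X"])
    show pm: "(\<lambda>X. p n X * weyl_op (h n) \<sigma> (q n) X) \<in> borel_measurable lebesgue" for n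
      by (rule borel_measurable_integrable[OF form])
    \<comment> \<open>Here \<open>g\<close> and \<open>\<zeta>\<close> are arbitrary functions, so
      measurability of the limit integrand is inherited from the approximants.\<close>
    show "(\<lambda>X. g X * \<sigma> (X, \<zeta> X)) \<in> borel_measurable lebesgue"
      by (rule borel_measurable_LIMSEQ_metric[OF pm inner])
    show "integrable lebesgue (\<lambda>X. (B * M) *\<^sub>R indicator (cball (0 :: real ^ 'd) r) X :: real)"
      using emeasure_bounded_finite[of "cball (0 :: real ^ 'd) r"] by (intro integrable_scaleR_right integrable_real_indicator) auto
    show "AE X in lebesgue. (\<lambda>n. p n X * weyl_op (h n) \<sigma> (q n) X) \<longlonglongrightarrow> g X * \<sigma> (X, \<zeta> X)"
      by (intro AE_I2 inner)
    show "AE X in lebesgue. norm (p n X * weyl_op (h n) \<sigma> (q n) X) \<le> (B * M) *\<^sub>R indicator (cball (0 :: real ^ 'd) r) X" for n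
    proof (rule AE_I2)
      fix X :: "real ^ 'd"
      show "norm (p n X * weyl_op (h n) \<sigma> (q n) X) \<le> (B * M) *\<^sub>R indicator (cball (0 :: real ^ 'd) r) X"
      proof (cases "norm X \<le> r")
        case True
        have "norm (p n X) * norm (weyl_op (h n) \<sigma> (q n) X) \<le> B * M"
          using p(2) Wb B unfolding M_def by (intro mult_mono) auto
        then show ?thesis using True by (simp add: norm_mult)
      next
        case False
        then show ?thesis using p(3)[of X n] by simp
      qed
    qed
  qed
qed

end

subsection \<open>The quantization in one patch\<close>

lemma closure_periodic:
  fixes f :: "real ^ 'd::finite \<Rightarrow> 'b::zero"
  assumes f: "torus_periodic f" and xy: "torus_eq x y" and x: "x \<in> closure {x. f x \<noteq> 0}"
  shows "y \<in> closure {x. f x \<noteq> 0}"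
proof -
  obtain k where k: "k \<in> int_vecs" "y = x + (2 * pi) *\<^sub>R k" using xy unfolding torus_eq_def by blast
  let ?c = "(2 * pi) *\<^sub>R k"
  have s: "(+) ?c ` {x. f x \<noteq> 0} \<subseteq> {x. f x \<noteq> 0}"
  proof
    fix z assume "z \<in> (+) ?c ` {x. f x \<noteq> 0}"
    then obtain w where w: "z = ?c + w" "f w \<noteq> 0" by blast
    have "torus_eq w z" unfolding torus_eq_def w(1) using k(1) by (intro bexI[of _ k]) (auto simp: add.commute)
    then show "z \<in> {x. f x \<noteq> 0}" using torus_periodicD[OF f] w(2) by simp
  qed
  have "y \<in> (+) ?c ` closure {x. f x \<noteq> 0}" using x k by (auto simp: add.commute)
  also have "\<dots> = closure ((+) ?c ` {x. f x \<noteq> 0})" by (rule closure_translation[symmetric])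
  also have "\<dots> \<subseteq> closure {x. f x \<noteq> 0}" by (rule closure_mono[OF s])
  finally show ?thesis .
qed

lemma periodic_bounded:
  fixes f :: "real ^ 'd::finite \<Rightarrow> 'b::real_normed_vector"
  assumes f: "continuous_on UNIV f" "torus_periodic f"
  obtains B where "B > 0" "\<And>x. norm (f x) \<le> B"
proof -
  have "bounded (f ` cbox 0 (\<chi> i. 2 * pi))"
    by (intro compact_imp_bounded compact_continuous_image continuous_on_subset[OF f(1)]) auto
  then obtain B where B: "\<And>x. x \<in> cbox 0 (\<chi> i. 2 * pi) \<Longrightarrow> norm (f x) \<le> B" unfolding bounded_iff by blast
  have "norm (f x) \<le> max B 1" for x
  proof -
    have "torus_red x \<in> cbox 0 (\<chi> i. 2 * pi)" using torus_red_in_cell torus_cell_subset_cbox by blast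
    from B[OF this] show ?thesis unfolding torus_periodic_red[OF f(2)] by simp
  qed
  then show thesis using that[of "max B 1"] by simp
qed

locale patch_op = patch U \<kappa> for U :: "(real ^ 'd::finite) set" and \<kappa> +
  fixes \<psi> :: "real ^ 'd \<Rightarrow> real" and \<theta> :: "real ^ 'd \<Rightarrow> complex" and a :: "(real ^ 'd) \<times> (real ^ 'd) \<Rightarrow> complex"
  assumes psi: "continuous_on UNIV \<psi>" "torus_periodic \<psi>" "closure {x. \<psi> x \<noteq> 0} \<subseteq> V"
    and theta: "continuous_on UNIV \<theta>" "torus_periodic \<theta>" "closure {x. \<theta> x \<noteq> 0} \<subseteq> V"
    and theta_one: "\<And>p. \<psi> (fst p) * a p \<noteq> 0 \<Longrightarrow> \<theta> (fst p) = 1"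
    and symbol: "a \<in> torus_symbols"
begin

definition Kpsi where "Kpsi = {X \<in> U. \<kappa> X \<in> closure {x. \<psi> x \<noteq> 0}}"
definition Ktheta where "Ktheta = {X \<in> U. \<kappa> X \<in> closure {x. \<theta> x \<noteq> 0}}"

lemma K: "compact Kpsi" "Kpsi \<subseteq> U" "compact Ktheta" "Ktheta \<subseteq> U"
proof -
  show "compact Kpsi" unfolding Kpsi_def
    by (rule compact_preimage[OF closed_closure psi(3)]) (rule closure_periodic[OF psi(2)])
  show "compact Ktheta" unfolding Ktheta_def
    by (rule compact_preimage[OF closed_closure theta(3)]) (rule closure_periodic[OF theta(2)])
qed (auto simp only: Kpsi_def Ktheta_def)

lemma outside_K:
  assumes X: "X \<in> U"
  shows "X \<notin> Kpsi \<Longrightarrow> \<psi> (\<kappa> X) = 0" "X \<notin> Ktheta \<Longrightarrow> \<theta> (\<kappa> X) = 0"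
proof -
  have c: "f x \<noteq> 0 \<Longrightarrow> x \<in> closure {x. f x \<noteq> 0}" for f :: "real ^ 'd \<Rightarrow> 'z::zero" and x
    by (rule subsetD[OF closure_subset]) simp
  show "X \<notin> Kpsi \<Longrightarrow> \<psi> (\<kappa> X) = 0" "X \<notin> Ktheta \<Longrightarrow> \<theta> (\<kappa> X) = 0"
    unfolding Kpsi_def Ktheta_def using X c[of \<psi> "\<kappa> X"] c[of \<theta> "\<kappa> X"] by auto
qed

definition sym where
  "sym p = (if fst p \<in> U then \<psi> (fst (cotangent_lift \<kappa> p)) * a (cotangent_lift \<kappa> p) else 0)"

lemma sym_eq: "X \<in> U \<Longrightarrow> sym (X, \<Xi>) = \<psi> (\<kappa> X) * a (\<kappa> X, Mf X \<Xi>)"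
  by (simp add: sym_def cotangent_lift_def Mf_def)

lemma sym_zero: "X \<notin> Kpsi \<Longrightarrow> sym (X, \<Xi>) = 0"
  using sym_eq outside_K(1) by (cases "X \<in> U") (auto simp: sym_def)

text \<open>\<open>U\<close> and the complement of the compact set \<open>Kpsi\<close> are open and
  cover the space. On the first a continuous lift replaces \<open>\<kappa>\<close>, by periodicity
  of \<open>\<psi>\<close> and \<open>a\<close>; on the second the pulled back symbol is 0.\<close>

lemma sym_continuous: "continuous_on UNIV sym"
proof (rule continuous_at_imp_continuous_on, rule ballI)
  fix p :: "(real ^ 'd) \<times> (real ^ 'd)"
  obtain X \<Xi> where p: "p = (X, \<Xi>)" by (cases p)
  show "isCont sym p"
  proof (cases "X \<in> U")
    case True
    then obtain W l where W: "open W" "X \<in> W" "W \<subseteq> U" "\<And>Y. Y \<in> W \<Longrightarrow> torus_eq (\<kappa> Y) (l Y)" "continuous_on W l"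
      using lift by metis
    have cl: "continuous_on (W \<times> UNIV) (\<lambda>q :: (real ^ 'd) \<times> (real ^ 'd). l (fst q))"
      by (rule continuous_on_compose2[OF W(5)]) (auto intro!: continuous_intros)
    have "continuous_on (W \<times> UNIV) (\<lambda>q. of_real (\<psi> (l (fst q))) * a (l (fst q), Mf (fst q) (snd q)))"
      by (intro continuous_on_mult continuous_on_of_real continuous_on_compose2[OF psi(1) cl]
          continuous_on_compose2[OF symbol_continuous[OF symbol] continuous_on_Pair[OF cl continuous_on_subset[OF continuous_Mf]]])
        (use W(3) in auto)
    then have "continuous_on (W \<times> UNIV) sym"
    proof (rule continuous_on_eq)
      fix q :: "(real ^ 'd) \<times> (real ^ 'd)" assume "q \<in> W \<times> UNIV"
      then have q: "fst q \<in> W" "fst q \<in> U" using W(3) by auto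
      have "a (l (fst q), Mf (fst q) (snd q)) = a (\<kappa> (fst q), Mf (fst q) (snd q))"
        using torus_periodicD[OF symbol_periodic[OF symbol] W(4)[OF q(1)]] by simp
      moreover have "\<psi> (l (fst q)) = \<psi> (\<kappa> (fst q))" using torus_periodicD[OF psi(2) W(4)[OF q(1)]] by simp
      ultimately show "of_real (\<psi> (l (fst q))) * a (l (fst q), Mf (fst q) (snd q)) = sym q"
        using sym_eq[OF q(2), of "snd q"] by simp
    qed
    moreover have "open (W \<times> (UNIV :: (real ^ 'd) set))" using W(1) by (intro open_Times) auto
    moreover have "p \<in> W \<times> UNIV" using p W by auto
    ultimately show ?thesis by (simp only: continuous_on_eq_continuous_at)
  next
    case False
    have "open ((- Kpsi) \<times> (UNIV :: (real ^ 'd) set))" using K(1) by (intro open_Times) (auto intro: compact_imp_closed)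
    moreover have "continuous_on ((- Kpsi) \<times> (UNIV :: (real ^ 'd) set)) sym"
      by (rule continuous_on_eq[OF continuous_on_const[of _ 0]]) (auto simp: sym_zero)
    moreover have "p \<in> (- Kpsi) \<times> UNIV" using p False K(2) by auto
    ultimately show ?thesis by (simp only: continuous_on_eq_continuous_at)
  qed
qed

text \<open>Off \<open>Kpsi\<close> the symbol vanishes; on this compact set the differential and
  its inverse are uniformly bounded, so one triple of constants serves all base points.\<close>

lemma tame: "\<exists>R K C. tame_symbol sym R K C"
proof -
  obtain c c' where c: "c > 0" "c' > 0" "\<And>X. X \<in> Kpsi \<Longrightarrow> fiber_map c (Mf X) (Nf X) (\<lambda>z. J X *v z)"
    "\<And>X z. X \<in> Kpsi \<Longrightarrow> c' * norm z \<le> norm (J X *v z)" using fiber_map_bounds[OF K(1,2)] by blast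
  obtain B where B: "B > 0" "\<And>x. norm (\<psi> x) \<le> B" using periodic_bounded[OF psi(1,2)] by blast
  obtain R where R: "\<forall>x \<xi>. norm \<xi> > R \<longrightarrow> a (x, \<xi>) = 0" using symbol_support[OF symbol] by blast
  obtain K where K': "\<And>p. norm (a p) \<le> K" using symbol_bounded[OF symbol] by blast
  have K0: "K \<ge> 0" using order_trans[OF norm_ge_zero K'] .
  obtain C where C: "\<And>x z M N L. fiber_map c M N L \<Longrightarrow> c' * norm z \<le> norm (L z) \<Longrightarrow> norm (symbol_ft a x M z) \<le> C * decay z"
    using symbol_ft_decay[OF symbol c(1,2)] by blast
  have "tame_symbol sym (c * R) (B * K) (B * \<bar>C\<bar>)"
  proof
    show "continuous_on UNIV sym" by (rule sym_continuous)
    show "sym (m, \<xi>) = 0" if "norm \<xi> > c * R" for m \<xi>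
    proof (cases "m \<in> Kpsi")
      case True
      then show ?thesis using symbol_fiber_support[OF c(3)[OF True] c(1) R that, of "\<kappa> m"] sym_eq[of m \<xi>] K(2) by auto
    qed (rule sym_zero)
    show "norm (sym p) \<le> B * K" for p
    proof (cases "fst p \<in> U")
      case True
      then have "norm (sym p) = \<bar>\<psi> (\<kappa> (fst p))\<bar> * norm (a (\<kappa> (fst p), Mf (fst p) (snd p)))"
        using sym_eq[OF True, of "snd p"] by (simp add: norm_mult)
      also have "\<dots> \<le> B * K" using B K' by (intro mult_mono) auto
      finally show ?thesis .
    next
      case False then show ?thesis using B K0 by (simp add: sym_def)
    qed
    show "norm (LINT \<xi>|lborel. sym (m, \<xi>) * cis (z \<bullet> \<xi>)) \<le> B * \<bar>C\<bar> * decay z" for m z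
    proof (cases "m \<in> Kpsi")
      case True
      then have "(LINT \<xi>|lborel. sym (m, \<xi>) * cis (z \<bullet> \<xi>)) = (LINT \<xi>|lborel. of_real (\<psi> (\<kappa> m)) * (a (\<kappa> m, Mf m \<xi>) * cis (z \<bullet> \<xi>)))"
        using K(2) by (intro Bochner_Integration.integral_cong) (auto simp: sym_eq)
      also have "\<dots> = of_real (\<psi> (\<kappa> m)) * symbol_ft a (\<kappa> m) (Mf m) z"
        unfolding symbol_ft_def by (rule integral_mult_right_zero)
      finally have "norm (LINT \<xi>|lborel. sym (m, \<xi>) * cis (z \<bullet> \<xi>)) = \<bar>\<psi> (\<kappa> m)\<bar> * norm (symbol_ft a (\<kappa> m) (Mf m) z)"
        by (simp add: norm_mult)
      also have "\<dots> \<le> B * (\<bar>C\<bar> * decay z)"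
      proof (intro mult_mono)
        have "norm (symbol_ft a (\<kappa> m) (Mf m) z) \<le> C * decay z" by (rule C[OF c(3)[OF True] c(4)[OF True]])
        also have "\<dots> \<le> \<bar>C\<bar> * decay z" by (intro mult_right_mono) auto
        finally show "norm (symbol_ft a (\<kappa> m) (Mf m) z) \<le> \<bar>C\<bar> * decay z" .
      qed (use B in auto)
      finally show ?thesis by (simp add: mult.assoc)
    next
      case False
      then show ?thesis using B by (simp add: sym_zero)
    qed
  qed
  then show ?thesis by blast
qed

text \<open>The inner cutoff goes with the argument u, while the outer cutoff and the Jacobian of
  the substitution go with the test function v; the form on the torus then is a plain integral over
  the patch.\<close>

definition src where "src u = (\<lambda>Y. if Y \<in> U then \<theta> (\<kappa> Y) * u (\<kappa> Y) else 0)"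
definition tst where "tst v = (\<lambda>X. if X \<in> U then of_real (jac X) * \<theta> (\<kappa> X) * cnj (v (\<kappa> X)) else 0)"

abbreviation qop where "qop h u \<equiv> chart_op U \<kappa> \<theta> h (\<lambda>p. \<psi> (fst p) * a p) u"

lemma qop_eq: "qop h u x = (if x \<in> V then \<theta> x * weyl_op h sym (src u) (chart_inv U \<kappa> x) else 0)"
  unfolding chart_op_def sym_def[abs_def] src_def by simp

lemma Ulebesgue: "U \<in> sets lebesgue" using openU by simp

lemma theta_bound: obtains B where "B > 0" "\<And>x. norm (\<theta> x) \<le> B"
  using periodic_bounded[OF theta(1,2)] by blast

lemma jac_bounds: obtains d e where "d > 0" "e > 0" "\<And>X. X \<in> Ktheta \<Longrightarrow> d \<le> jac X" "\<And>X. X \<in> Ktheta \<Longrightarrow> jac X \<le> e"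
proof (cases "Ktheta = {}")
  case True then show ?thesis using that[of 1 1] by simp
next
  case False
  have c: "continuous_on Ktheta jac" by (rule continuous_on_subset[OF continuous_jac K(4)])
  obtain X0 where X0: "X0 \<in> Ktheta" "\<And>X. X \<in> Ktheta \<Longrightarrow> jac X0 \<le> jac X" using continuous_attains_inf[OF K(3) False c] by blast
  obtain X1 where X1: "X1 \<in> Ktheta" "\<And>X. X \<in> Ktheta \<Longrightarrow> jac X \<le> jac X1" using continuous_attains_sup[OF K(3) False c] by blast
  show ?thesis by (rule that[of "jac X0" "jac X1"]) (use X0 X1 jac_pos K(4) in auto)
qed

lemma extend_measurable:
  assumes "f \<in> borel_measurable (lebesgue_on U)"
  shows "(\<lambda>X. if X \<in> U then f X else (0 :: complex)) \<in> borel_measurable lebesgue"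
  using assms borel_measurable_if[OF Ulebesgue, of f] by blast

lemma pullback_measurable:
  assumes "u \<in> torus_L2" shows "(\<lambda>X. u (\<kappa> X)) \<in> borel_measurable (lebesgue_on U)"
  by (rule torus_param_measurable[OF param torus_L2_measurable[OF assms] torus_L2_periodic[OF assms]])

lemma continuous_lebesgue_on: "continuous_on U f \<Longrightarrow> f \<in> borel_measurable (lebesgue_on U)"
  for f :: "real ^ 'd \<Rightarrow> 'b::{second_countable_topology, topological_space}"
proof -
  assume "continuous_on U f"
  then have f: "f \<in> borel_measurable (restrict_space borel U)" by (rule borel_measurable_continuous_on_restrict)
  have "(\<lambda>x. x) \<in> lebesgue_on U \<rightarrow>\<^sub>M restrict_space borel U"
    by (intro measurable_restrict_space3 measurable_completion) auto
  from measurable_compose[OF this f] show ?thesis .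
qed

lemma src_measurable: "u \<in> torus_L2 \<Longrightarrow> src u \<in> borel_measurable lebesgue"
  unfolding src_def
  by (intro extend_measurable borel_measurable_times pullback_measurable continuous_lebesgue_on continuous_pullback theta)

lemma tst_measurable: assumes "v \<in> torus_L2" shows "tst v \<in> borel_measurable lebesgue"
proof -
  have "(\<lambda>X. cnj (v (\<kappa> X))) \<in> borel_measurable (lebesgue_on U)"
    by (rule borel_measurable_continuous_on[OF _ pullback_measurable[OF assms]]) (intro continuous_intros)
  moreover have "(\<lambda>X. complex_of_real (jac X)) \<in> borel_measurable (lebesgue_on U)"
    "(\<lambda>X. \<theta> (\<kappa> X)) \<in> borel_measurable (lebesgue_on U)"
    by (intro continuous_lebesgue_on continuous_on_of_real continuous_jac continuous_pullback theta)+
  ultimately show ?thesis unfolding tst_def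
    by (intro extend_measurable borel_measurable_times)
qed

lemma local_L2_bound:
  assumes u: "u \<in> torus_L2" and c: "c \<ge> 0"
    and f: "f \<in> borel_measurable lebesgue" "\<And>X. X \<in> U \<Longrightarrow> (norm (f X))\<^sup>2 \<le> c * (jac X * (norm (u (\<kappa> X)))\<^sup>2)" "\<And>X. X \<notin> U \<Longrightarrow> f X = (0 :: complex)"
  shows "integrable lebesgue (\<lambda>X. (norm (f X))\<^sup>2)" "(LINT X|lebesgue. (norm (f X))\<^sup>2) \<le> c * (tnorm u)\<^sup>2"
proof -
  let ?g = "\<lambda>x. ennreal ((norm (u x))\<^sup>2)"
  have gm: "?g \<in> borel_measurable torus_measure" using torus_L2_measurable[OF u] by measurable
  have gp: "torus_periodic ?g" by (rule torus_periodic_comp[OF torus_L2_periodic[OF u]])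
  have um: "(\<lambda>X. ?g (\<kappa> X)) \<in> borel_measurable (lebesgue_on U)" by (rule torus_param_measurable[OF param gm gp])
  have jm: "(\<lambda>X. ennreal (jac X)) \<in> borel_measurable (lebesgue_on U)"
    using continuous_lebesgue_on[OF continuous_jac] by measurable
  have "(\<integral>\<^sup>+X. ennreal ((norm (f X))\<^sup>2) \<partial>lebesgue) \<le> (\<integral>\<^sup>+X. (ennreal c * (ennreal (jac X) * ?g (\<kappa> X))) * indicator U X \<partial>lebesgue)"
  proof (rule nn_integral_mono)
    fix X
    show "ennreal ((norm (f X))\<^sup>2) \<le> (ennreal c * (ennreal (jac X) * ?g (\<kappa> X))) * indicator U X"
    proof (cases "X \<in> U")
      case True
      have "ennreal ((norm (f X))\<^sup>2) \<le> ennreal (c * (jac X * (norm (u (\<kappa> X)))\<^sup>2))" by (rule ennreal_leI[OF f(2)[OF True]])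
      also have "\<dots> = ennreal c * (ennreal (jac X) * ?g (\<kappa> X))"
        using c jac_pos[OF True] by (simp add: ennreal_mult)
      finally show ?thesis using True by simp
    qed (simp add: f(3))
  qed
  also have "\<dots> = (\<integral>\<^sup>+X. ennreal c * (ennreal (jac X) * ?g (\<kappa> X)) \<partial>lebesgue_on U)"
    using Ulebesgue by (subst nn_integral_restrict_space) auto
  also have "\<dots> = ennreal c * (\<integral>\<^sup>+X. ennreal (jac X) * ?g (\<kappa> X) \<partial>lebesgue_on U)"
    using um jm by (intro nn_integral_cmult borel_measurable_times_ennreal)
  also have "(\<integral>\<^sup>+X. ennreal (jac X) * ?g (\<kappa> X) \<partial>lebesgue_on U) = (\<integral>\<^sup>+x. indicator V x * ?g x \<partial>torus_measure)"
    by (rule torus_param_nn_integral[OF param gm gp, symmetric])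
  also have "ennreal c * \<dots> \<le> ennreal c * (\<integral>\<^sup>+x. ?g x \<partial>torus_measure)"
    by (intro mult_left_mono nn_integral_mono) (auto simp: indicator_def)
  also have "(\<integral>\<^sup>+x. ?g x \<partial>torus_measure) = ennreal ((tnorm u)\<^sup>2)"
    unfolding tnorm_power2 by (rule nn_integral_eq_integral[OF torus_L2_integrable[OF u]]) simp
  also have "ennreal c * ennreal ((tnorm u)\<^sup>2) = ennreal (c * (tnorm u)\<^sup>2)" using c by (simp add: ennreal_mult)
  finally have le: "(\<integral>\<^sup>+X. ennreal ((norm (f X))\<^sup>2) \<partial>lebesgue) \<le> ennreal (c * (tnorm u)\<^sup>2)" .
  have m: "(\<lambda>X. (norm (f X))\<^sup>2) \<in> borel_measurable lebesgue" using f(1) by measurable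
  show i: "integrable lebesgue (\<lambda>X. (norm (f X))\<^sup>2)"
    by (rule integrableI_nonneg[OF m]) (use le_less_trans[OF le] in auto)
  show "(LINT X|lebesgue. (norm (f X))\<^sup>2) \<le> c * (tnorm u)\<^sup>2"
    using le c by (subst (asm) nn_integral_eq_integral[OF i]) auto
qed

lemma src_tst_bounds:
  obtains c where "c > 0"
    "\<And>u. u \<in> torus_L2 \<Longrightarrow> integrable lebesgue (\<lambda>X. (norm (src u X))\<^sup>2) \<and> (LINT X|lebesgue. (norm (src u X))\<^sup>2) \<le> c * (tnorm u)\<^sup>2"
    "\<And>u. u \<in> torus_L2 \<Longrightarrow> integrable lebesgue (\<lambda>X. (norm (tst u X))\<^sup>2) \<and> (LINT X|lebesgue. (norm (tst u X))\<^sup>2) \<le> c * (tnorm u)\<^sup>2"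
proof -
  obtain B where B: "B > 0" "\<And>x. norm (\<theta> x) \<le> B" using theta_bound by blast
  obtain d e where de: "d > 0" "e > 0" "\<And>X. X \<in> Ktheta \<Longrightarrow> d \<le> jac X" "\<And>X. X \<in> Ktheta \<Longrightarrow> jac X \<le> e" using jac_bounds by blast
  \<comment> \<open>\<open>src\<close> lacks a Jacobian, so the lower bound \<open>d\<close> pays
    for the missing factor; the square of \<open>tst\<close> has one Jacobian too many, which costs
    the upper bound \<open>e\<close>.\<close>
  define c where "c = B\<^sup>2 * max (1 / d) e"
  have c: "c > 0" using B de by (auto simp: c_def less_max_iff_disj)
  have 1: "(norm (src u X))\<^sup>2 \<le> c * (jac X * (norm (u (\<kappa> X)))\<^sup>2)" if X: "X \<in> U" for u X
  proof (cases "X \<in> Ktheta")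
    case True
    have j: "1 \<le> max (1 / d) e * jac X"
    proof -
      have "1 \<le> (1 / d) * jac X" using de(1) de(3)[OF True] by (simp add: field_simps)
      also have "\<dots> \<le> max (1 / d) e * jac X" using jac_pos[OF X] by (intro mult_right_mono) auto
      finally show ?thesis .
    qed
    have "(norm (src u X))\<^sup>2 = (norm (\<theta> (\<kappa> X)))\<^sup>2 * (norm (u (\<kappa> X)))\<^sup>2 * 1" using X by (simp add: src_def norm_mult power_mult_distrib)
    also have "\<dots> \<le> B\<^sup>2 * (norm (u (\<kappa> X)))\<^sup>2 * (max (1 / d) e * jac X)"
      using j B by (intro mult_mono power_mono) auto
    finally show ?thesis by (simp add: c_def mult_ac)
  next
    case False
    then show ?thesis using outside_K(2)[OF X False] c jac_pos[OF X] by (simp add: src_def)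
  qed
  have 2: "(norm (tst u X))\<^sup>2 \<le> c * (jac X * (norm (u (\<kappa> X)))\<^sup>2)" if X: "X \<in> U" for u X
  proof (cases "X \<in> Ktheta")
    case True
    have j: "jac X * jac X \<le> max (1 / d) e * jac X"
      using jac_pos[OF X] de(4)[OF True] by (intro mult_right_mono) auto
    have "(norm (tst u X))\<^sup>2 = (norm (\<theta> (\<kappa> X)))\<^sup>2 * (norm (u (\<kappa> X)))\<^sup>2 * (jac X * jac X)"
      using X by (simp add: tst_def norm_mult power_mult_distrib power2_eq_square)
    also have "\<dots> \<le> B\<^sup>2 * (norm (u (\<kappa> X)))\<^sup>2 * (max (1 / d) e * jac X)"
      using j B jac_pos[OF X] by (intro mult_mono power_mono) auto
    finally show ?thesis by (simp add: c_def mult_ac)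
  next
    case False
    then show ?thesis using outside_K(2)[OF X False] c jac_pos[OF X] by (simp add: tst_def)
  qed
  show thesis
  proof (rule that[OF c])
    fix u :: "real ^ 'd \<Rightarrow> complex" assume u: "u \<in> torus_L2"
    have z: "\<And>X. X \<notin> U \<Longrightarrow> src u X = 0" "\<And>X. X \<notin> U \<Longrightarrow> tst u X = 0" by (auto simp: src_def tst_def)
    show "integrable lebesgue (\<lambda>X. (norm (src u X))\<^sup>2) \<and> (LINT X|lebesgue. (norm (src u X))\<^sup>2) \<le> c * (tnorm u)\<^sup>2"
      using local_L2_bound[OF u less_imp_le[OF c] src_measurable[OF u] 1 z(1)] by blast
    show "integrable lebesgue (\<lambda>X. (norm (tst u X))\<^sup>2) \<and> (LINT X|lebesgue. (norm (tst u X))\<^sup>2) \<le> c * (tnorm u)\<^sup>2"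
      using local_L2_bound[OF u less_imp_le[OF c] tst_measurable[OF u] 2 z(2)] by blast
  qed
qed

text \<open>Square integrability and a compact set \<open>Ktheta\<close> carrying the support
  suffice, by t <= 1 + t^2.\<close>

lemma src_integrable: assumes u: "u \<in> torus_L2" shows "integrable lebesgue (src u)"
proof -
  have "integrable lebesgue (\<lambda>X. (norm (src u X))\<^sup>2)" using src_tst_bounds u by metis
  moreover have "integrable lebesgue (indicator Ktheta :: _ \<Rightarrow> real)"
  proof (rule integrable_real_indicator)
    have b: "Ktheta \<in> sets borel" using K(3) by (intro borel_closed compact_imp_closed)
    then show "Ktheta \<in> sets lebesgue" by simp
    show "emeasure lebesgue Ktheta < \<infinity>"
      using emeasure_bounded_finite[OF compact_imp_bounded[OF K(3)]] b by simp
  qed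
  ultimately have "integrable lebesgue (\<lambda>X. indicator Ktheta X + (norm (src u X))\<^sup>2)" by (rule Bochner_Integration.integrable_add[rotated])
  then show ?thesis
  proof (rule Bochner_Integration.integrable_bound[OF _ src_measurable[OF u]])
    show "AE X in lebesgue. norm (src u X) \<le> norm (indicator Ktheta X + (norm (src u X))\<^sup>2)"
    proof (rule AE_I2)
      fix X
      have "t \<le> 1 + t\<^sup>2" for t :: real using zero_le_power2[of "t - 1/2"] by (simp add: power2_eq_square algebra_simps)
      then show "norm (src u X) \<le> norm (indicator Ktheta X + (norm (src u X))\<^sup>2)"
        using outside_K(2)[of X] by (cases "X \<in> Ktheta") (auto simp: src_def)
    qed
  qed
qed

text \<open>The operator vanishes outside the patch image, so \<open>torus_param_integral\<close>
  transports the whole inner product to \<open>U\<close>, where the inverse chart cancels against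
  \<open>\<kappa>\<close>.\<close>

lemma qop_form:
  assumes h: "h > 0" and u: "u \<in> torus_L2" and v: "v \<in> torus_L2"
  shows "integrable torus_measure (\<lambda>x. qop h u x * cnj (v x))"
    and "torus_inner (qop h u) v = (LINT X|lebesgue. tst v X * weyl_op h sym (src u) X)"
    and "integrable lebesgue (\<lambda>X. tst v X * weyl_op h sym (src u) X)"
proof -
  obtain R K C where "tame_symbol sym R K C" using tame by blast
  then interpret t: tame_symbol sym R K C .
  let ?W = "weyl_op h sym (src u)"
  note qi = src_integrable[OF u]
  have s: "integrable lebesgue (\<lambda>X. (norm (src u X))\<^sup>2)" "integrable lebesgue (\<lambda>X. (norm (tst v X))\<^sup>2)"
    using src_tst_bounds u v by metis+
  show i: "integrable lebesgue (\<lambda>X. tst v X * ?W X)"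
    by (rule t.weyl_form(1)[OF h tst_measurable[OF v] s(2) qi s(1)])
  have Wc: "continuous_on UNIV ?W" by (rule t.weyl_op_continuous[OF h qi])
  have Wm: "(\<lambda>x. indicator V x *\<^sub>R ?W (chart_inv U \<kappa> x)) \<in> borel_measurable borel"
    using open_V by (intro borel_measurable_continuous_on_indicator continuous_on_compose2[OF Wc continuous_chart_inv]) auto
  let ?f = "\<lambda>x. qop h u x * cnj (v x)"
  have fe: "?f = (\<lambda>x. \<theta> x * (indicator V x *\<^sub>R ?W (chart_inv U \<kappa> x)) * cnj (v x))"
    by (auto simp: qop_eq indicator_def)
  have vm: "(\<lambda>x. cnj (v x)) \<in> borel_measurable torus_measure"
    by (rule borel_measurable_continuous_on[OF _ torus_L2_measurable[OF v]]) (intro continuous_intros)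
  have bm: "g \<in> borel_measurable torus_measure" if "g \<in> borel_measurable borel" for g :: "real ^ 'd \<Rightarrow> complex"
    using that by (intro torus_measurableI measurable_completion) simp
  have fm: "?f \<in> borel_measurable torus_measure"
    unfolding fe by (intro borel_measurable_times vm bm Wm borel_measurable_continuous_onI theta(1))
  have fp: "torus_periodic ?f"
    unfolding torus_periodic_def
  proof (intro allI impI)
    fix x y :: "real ^ 'd" assume xy: "torus_eq x y"
    show "?f x = ?f y"
      using V_periodic[OF xy] chart_inv_periodic[OF xy] torus_periodicD[OF theta(2) xy] torus_periodicD[OF torus_L2_periodic[OF v] xy]
      by (simp add: qop_eq)
  qed
  have iV: "indicator V x *\<^sub>R ?f x = ?f x" for x by (auto simp: qop_eq indicator_def)
  have e: "indicator U X *\<^sub>R (jac X *\<^sub>R ?f (\<kappa> X)) = tst v X * ?W X" for X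
  proof (cases "X \<in> U")
    case True
    then have "\<kappa> X \<in> V" "chart_inv U \<kappa> (\<kappa> X) = X" 
      unfolding chart_image_def using chart_inv_eq[OF True torus_eq_refl] True torus_eq_refl[of "\<kappa> X"] by blast+
    then show ?thesis using True by (simp add: qop_eq tst_def scaleR_conv_of_real)
  qed (simp add: tst_def)
  have "integrable (lebesgue_on U) (\<lambda>X. jac X *\<^sub>R ?f (\<kappa> X)) \<longleftrightarrow> integrable lebesgue (\<lambda>X. tst v X * ?W X)"
    using Ulebesgue by (subst integrable_restrict_space) (simp_all only: e, simp)
  then show "integrable torus_measure ?f"
    using torus_param_integral(1)[OF param fm fp] i unfolding iV by blast
  have "(LINT X|lebesgue_on U. jac X *\<^sub>R ?f (\<kappa> X)) = (LINT X|lebesgue. tst v X * ?W X)"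
    using Ulebesgue by (subst integral_restrict_space) (simp_all only: e, simp)
  then show "torus_inner (qop h u) v = (LINT X|lebesgue. tst v X * ?W X)"
    using torus_param_integral(2)[OF param fm fp] unfolding iV torus_inner_def by simp
qed

text \<open>Sesquilinearity is inherited from the Weyl operator. The bound from Schur's test is
  additive in the squared norms and is optimised over opposite scalings of u and v by
  \<open>le_sqrt_mult\<close>.\<close>

lemma qop_bounded: "\<exists>D. \<forall>h>0. torus_form D (\<lambda>u v. torus_inner (qop h u) v)"
proof -
  obtain R K C where "tame_symbol sym R K C" using tame by blast
  then interpret t: tame_symbol sym R K C .
  obtain c where c: "c > 0"
    "\<And>u. u \<in> torus_L2 \<Longrightarrow> integrable lebesgue (\<lambda>X. (norm (src u X))\<^sup>2) \<and> (LINT X|lebesgue. (norm (src u X))\<^sup>2) \<le> c * (tnorm u)\<^sup>2"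
    "\<And>u. u \<in> torus_L2 \<Longrightarrow> integrable lebesgue (\<lambda>X. (norm (tst u X))\<^sup>2) \<and> (LINT X|lebesgue. (norm (tst u X))\<^sup>2) \<le> c * (tnorm u)\<^sup>2"
    using src_tst_bounds by blast
  define D where "D = t.schur * c"
  have D: "D \<ge> 0" using t.schur_nonneg c(1) by (simp add: D_def)
  have "torus_form D (\<lambda>u v. torus_inner (qop h u) v)" if h: "h > 0" for h
  proof -
    let ?B = "\<lambda>u v. LINT X|lebesgue. tst v X * weyl_op h sym (src u) X"
    have B: "torus_inner (qop h u) v = ?B u v" if "u \<in> torus_L2" "v \<in> torus_L2" for u v
      by (rule qop_form(2)[OF h that])
    have add1: "?B (\<lambda>x. u x + v x) w = ?B u w + ?B v w" if L: "u \<in> torus_L2" "v \<in> torus_L2" "w \<in> torus_L2" for u v w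
    proof -
      have "src (\<lambda>x. u x + v x) = (\<lambda>y. src u y + src v y)" by (auto simp: src_def distrib_left)
      then have "tst w X * weyl_op h sym (src (\<lambda>x. u x + v x)) X = tst w X * weyl_op h sym (src u) X + tst w X * weyl_op h sym (src v) X" for X
        using t.weyl_op_linear(1)[OF h src_integrable[OF L(1)] src_integrable[OF L(2)], of X] by (simp add: distrib_left)
      then show ?thesis using Bochner_Integration.integral_add[OF qop_form(3)[OF h L(1,3)] qop_form(3)[OF h L(2,3)]] by (simp only:)
    qed
    have add2: "?B w (\<lambda>x. u x + v x) = ?B w u + ?B w v" if L: "u \<in> torus_L2" "v \<in> torus_L2" "w \<in> torus_L2" for u v w
    proof -
      have "tst (\<lambda>x. u x + v x) X * weyl_op h sym (src w) X = tst u X * weyl_op h sym (src w) X + tst v X * weyl_op h sym (src w) X" for X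
        by (auto simp: tst_def algebra_simps)
      then show ?thesis using Bochner_Integration.integral_add[OF qop_form(3)[OF h L(3,1)] qop_form(3)[OF h L(3,2)]] by (simp only:)
    qed
    have sc1: "?B (\<lambda>x. s * u x) v = s * ?B u v" if L: "u \<in> torus_L2" "v \<in> torus_L2" for u v s
    proof -
      have "src (\<lambda>x. s * u x) = (\<lambda>y. s * src u y)" by (auto simp: src_def)
      then have "tst v X * weyl_op h sym (src (\<lambda>x. s * u x)) X = s * (tst v X * weyl_op h sym (src u) X)" for X
        using t.weyl_op_linear(2)[OF h src_integrable[OF L(1)] src_integrable[OF L(1)], of s X] by simp
      then show ?thesis using integral_mult_right_zero[of lebesgue s "\<lambda>X. tst v X * weyl_op h sym (src u) X"] by (simp only:)
    qed
    have sc2: "?B u (\<lambda>x. s * v x) = cnj s * ?B u v" for u v s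
    proof -
      have "tst (\<lambda>x. s * v x) X * weyl_op h sym (src u) X = cnj s * (tst v X * weyl_op h sym (src u) X)" for X
        by (auto simp: tst_def)
      then show ?thesis using integral_mult_right_zero[of lebesgue "cnj s" "\<lambda>X. tst v X * weyl_op h sym (src u) X"] by (simp only:)
    qed
    have b0: "norm (?B u v) \<le> D * ((tnorm u)\<^sup>2 + (tnorm v)\<^sup>2) / 2" if L: "u \<in> torus_L2" "v \<in> torus_L2" for u v
    proof -
      have "norm (?B u v) \<le> t.schur * ((LINT x|lebesgue. (norm (tst v x))\<^sup>2) + (LINT x|lebesgue. (norm (src u x))\<^sup>2)) / 2"
        using c(2)[OF L(1)] c(3)[OF L(2)] by (intro t.weyl_form(2)[OF h tst_measurable[OF L(2)] _ src_integrable[OF L(1)]]) auto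
      also have "\<dots> \<le> t.schur * (c * (tnorm v)\<^sup>2 + c * (tnorm u)\<^sup>2) / 2"
        using c(2)[OF L(1)] c(3)[OF L(2)] t.schur_nonneg by (intro divide_right_mono mult_left_mono add_mono) auto
      also have "\<dots> = D * ((tnorm u)\<^sup>2 + (tnorm v)\<^sup>2) / 2" by (simp add: D_def algebra_simps)
      finally show ?thesis .
    qed
    have bd: "norm (?B u v) \<le> D * tnorm u * tnorm v" if L: "u \<in> torus_L2" "v \<in> torus_L2" for u v
    proof -
      have "norm (?B u v) \<le> sqrt (D * (tnorm u)\<^sup>2) * sqrt (D * (tnorm v)\<^sup>2)"
      proof (rule le_sqrt_mult)
        fix s :: real assume s: "s > 0"
        let ?r = "sqrt s"
        have r: "?r > 0" "?r\<^sup>2 = s" using s by auto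
        \<comment> \<open>Scaling u by sqrt s and v by 1 / sqrt s leaves the form unchanged but
          weights the two squared norms by s and 1/s.\<close>
        have "?B u v = ?B (\<lambda>x. of_real ?r * u x) (\<lambda>x. of_real (1 / ?r) * v x)"
          using sc1[OF L(1) torus_L2_scale[OF L(2), of "of_real (1 / ?r)"], where s = "of_real ?r"] sc2[where u = u and s = "of_real (1 / ?r)" and v = v] r(1)
          by (simp flip: of_real_mult)
        also have "norm \<dots> \<le> D * ((tnorm (\<lambda>x. of_real ?r * u x))\<^sup>2 + (tnorm (\<lambda>x. of_real (1 / ?r) * v x))\<^sup>2) / 2"
          by (intro b0 torus_L2_scale L)
        also have "\<dots> = (s * (D * (tnorm u)\<^sup>2) + D * (tnorm v)\<^sup>2 / s) / 2"
          unfolding tnorm_scale power_mult_distrib norm_of_real power2_abs power_divide r(2) by (simp add: algebra_simps)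
        finally show "norm (?B u v) \<le> (s * (D * (tnorm u)\<^sup>2) + D * (tnorm v)\<^sup>2 / s) / 2" .
      qed (use D in auto)
      also have "\<dots> = D * tnorm u * tnorm v"
        using D by (simp add: real_sqrt_mult mult_ac flip: power2_eq_square) 
      finally show ?thesis .
    qed
    show ?thesis unfolding torus_form_def
      by (intro conjI ballI allI D) (simp_all add: B torus_L2_add torus_L2_scale add1 add2 sc1 sc2 bd)
  qed
  then show ?thesis by blast
qed

end

section \<open>Action on modulated exponentials\<close>

lemma difference_quotient_sequence:
  fixes f :: "'a::real_normed_vector \<Rightarrow> 'b::real_normed_vector"
  assumes f: "(f has_derivative f') (at x)" and h: "\<And>n. h n \<noteq> 0" "h \<longlonglongrightarrow> 0"
  shows "(\<lambda>n. (1 / h n) *\<^sub>R (f (x + h n *\<^sub>R v) - f x)) \<longlonglongrightarrow> f' v"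
proof -
  interpret f': bounded_linear f' by (rule has_derivative_bounded_linear[OF f])
  have "((\<lambda>s. x + s *\<^sub>R v) has_derivative (\<lambda>s. s *\<^sub>R v)) (at 0)"
    by (auto intro!: derivative_eq_intros)
  from has_derivative_compose[OF this] have "((\<lambda>s. f (x + s *\<^sub>R v)) has_derivative (\<lambda>s. f' (s *\<^sub>R v))) (at 0)"
    using f by simp
  then have d: "((\<lambda>s. norm (f (x + (0 + s) *\<^sub>R v) - f (x + 0 *\<^sub>R v) - f' (s *\<^sub>R v)) / norm s) \<longlongrightarrow> 0) (at 0)"
    unfolding has_derivative_at by blast
  have "filterlim h (at 0) sequentially" using h by (intro filterlim_atI) auto
  from filterlim_compose[OF d this]
  have "(\<lambda>n. norm (f (x + (0 + h n) *\<^sub>R v) - f (x + 0 *\<^sub>R v) - f' (h n *\<^sub>R v)) / norm (h n)) \<longlonglongrightarrow> 0" .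
  moreover have "norm (f (x + (0 + h n) *\<^sub>R v) - f (x + 0 *\<^sub>R v) - f' (h n *\<^sub>R v)) / norm (h n)
    = norm ((1 / h n) *\<^sub>R (f (x + h n *\<^sub>R v) - f x) - f' v)" for n
  proof -
    have "(1 / h n) *\<^sub>R (f (x + h n *\<^sub>R v) - f x) - f' v = (1 / h n) *\<^sub>R (f (x + h n *\<^sub>R v) - f x - f' (h n *\<^sub>R v))"
      using h(1)[of n] by (simp add: f'.scaleR scaleR_diff_right)
    then show ?thesis by (simp add: divide_inverse abs_inverse mult.commute)
  qed
  ultimately have "(\<lambda>n. norm ((1 / h n) *\<^sub>R (f (x + h n *\<^sub>R v) - f x) - f' v)) \<longlonglongrightarrow> 0" by (simp only:)
  then show ?thesis by (simp only: tendsto_norm_zero_iff Lim_null[symmetric])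
qed

lemma symbol_fiber_continuous: "a \<in> torus_symbols \<Longrightarrow> continuous_on UNIV (\<lambda>x. a (x, \<xi>))"
  by (rule continuous_on_compose2[OF symbol_continuous]) (auto intro!: continuous_intros)

context patch_op
begin

text \<open>The lattice-dependent choice of \<open>\<kappa>\<close> disappears because all
  frequencies are integral, so a lift f may be used. The two modulations combine to cis (\<eta> .
  (f(X - h z) - f(X))), a difference quotient of f paired with h \<eta>; its limit contains \<xi> .
  (J z) = z . (J^T \<xi>), which is the pairing with \<open>Nf X \<xi>\<close>.\<close>

lemma product_limit:
  assumes h: "\<And>n. h n > 0" "h \<longlonglongrightarrow> 0" and \<eta>: "\<And>n. \<eta> n \<in> int_vecs" "(\<lambda>n. h n *\<^sub>R \<eta> n) \<longlonglongrightarrow> \<xi>"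
    and k: "k \<in> int_vecs" and m: "m \<in> int_vecs"
  shows "(\<lambda>n. tst (texp (\<eta> n + m)) X * src (texp (\<eta> n + k)) (X - h n *\<^sub>R z))
    \<longlonglongrightarrow> (if X \<in> U then of_real (jac X) * (\<theta> (\<kappa> X))\<^sup>2 * texp (k - m) (\<kappa> X) else 0) * cis (- (z \<bullet> Nf X \<xi>))"
proof (cases "X \<in> U")
  case True
  then obtain W f where W: "open W" "X \<in> W" "W \<subseteq> U" "\<And>Y. Y \<in> W \<Longrightarrow> torus_eq (\<kappa> Y) (f Y)"
    "(f has_derivative (\<lambda>v. J X *v v)) (at X)" "continuous_on W f" using lift by metis
  let ?Y = "\<lambda>n. X - h n *\<^sub>R z"
  have Y: "?Y \<longlonglongrightarrow> X"
  proof -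
    have "?Y \<longlonglongrightarrow> X - 0 *\<^sub>R z" by (intro tendsto_intros h(2))
    then show ?thesis by simp
  qed
  have ev: "eventually (\<lambda>n. ?Y n \<in> W) sequentially" by (rule topological_tendstoD[OF Y W(1,2)])
  have fY: "(\<lambda>n. f (?Y n)) \<longlonglongrightarrow> f X"
    using W(6) ev by (intro continuous_on_tendsto_compose[OF W(6) Y W(2)])
  have th: "(\<lambda>n. \<theta> (f (?Y n))) \<longlonglongrightarrow> \<theta> (f X)"
    by (rule continuous_on_tendsto_compose[OF theta(1) fY]) auto
  have q: "(\<lambda>n. (1 / h n) *\<^sub>R (f (?Y n) - f X)) \<longlonglongrightarrow> - (J X *v z)"
  proof -
    have "(\<lambda>n. (1 / h n) *\<^sub>R (f (X + h n *\<^sub>R (- z)) - f X)) \<longlonglongrightarrow> J X *v (- z)"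
      by (rule difference_quotient_sequence[OF W(5)]) (use h in \<open>auto simp: less_imp_neq[symmetric]\<close>)
    moreover have "J X *v (- z) = - (J X *v z)" using matrix_vector_mult_scaleR[of "J X" "-1" z] by simp
    ultimately show ?thesis by simp
  qed
  \<comment> \<open>The factors h and 1/h are inserted so that both entries of the inner product
    converge separately; the bounded frequencies k and m only contribute continuous terms.\<close>
  have ph: "(\<lambda>n. cis ((h n *\<^sub>R \<eta> n) \<bullet> ((1 / h n) *\<^sub>R (f (?Y n) - f X)) + (k \<bullet> f (?Y n) - m \<bullet> f X)))
    \<longlonglongrightarrow> cis (\<xi> \<bullet> (- (J X *v z)) + (k \<bullet> f X - m \<bullet> f X))"
  proof (rule continuous_on_tendsto_compose[of UNIV cis])
    show "(\<lambda>n. (h n *\<^sub>R \<eta> n) \<bullet> ((1 / h n) *\<^sub>R (f (?Y n) - f X)) + (k \<bullet> f (?Y n) - m \<bullet> f X))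
      \<longlonglongrightarrow> \<xi> \<bullet> (- (J X *v z)) + (k \<bullet> f X - m \<bullet> f X)"
      by (intro tendsto_add tendsto_diff tendsto_inner \<eta>(2) q fY tendsto_const)
  qed (auto intro!: continuous_intros)
  have tn: "texp (\<eta> n + j) (\<kappa> Y) = texp (\<eta> n + j) (f Y)" if "Y \<in> W" "j \<in> int_vecs" for n j Y
    by (rule torus_periodicD[OF texp_periodic W(4)[OF that(1)]]) (use \<eta>(1) that(2) in simp)
  have tX: "texp (k - m) (\<kappa> X) = texp (k - m) (f X)"
    by (rule torus_periodicD[OF texp_periodic W(4)[OF W(2)]]) (use k m in simp)
  have thY: "\<theta> (\<kappa> Y) = \<theta> (f Y)" if "Y \<in> W" for Y by (rule torus_periodicD[OF theta(2) W(4)[OF that]])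
  have eq: "of_real (jac X) * \<theta> (f X) * \<theta> (f (?Y n))
      * cis ((h n *\<^sub>R \<eta> n) \<bullet> ((1 / h n) *\<^sub>R (f (?Y n) - f X)) + (k \<bullet> f (?Y n) - m \<bullet> f X))
    = tst (texp (\<eta> n + m)) X * src (texp (\<eta> n + k)) (?Y n)" if n: "?Y n \<in> W" for n
  proof -
    have hn: "h n \<noteq> 0" using h(1)[of n] by simp
    have "(h n *\<^sub>R \<eta> n) \<bullet> ((1 / h n) *\<^sub>R (f (?Y n) - f X)) + (k \<bullet> f (?Y n) - m \<bullet> f X)
      = (\<eta> n + k) \<bullet> f (?Y n) + - ((\<eta> n + m) \<bullet> f X)"
    proof -
      have s: "(h n *\<^sub>R \<eta> n) \<bullet> ((1 / h n) *\<^sub>R w) = \<eta> n \<bullet> w" for w using hn by simp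
      show ?thesis unfolding s by (simp add: inner_diff_right inner_add_left)
    qed
    then have "cis ((h n *\<^sub>R \<eta> n) \<bullet> ((1 / h n) *\<^sub>R (f (?Y n) - f X)) + (k \<bullet> f (?Y n) - m \<bullet> f X))
      = texp (\<eta> n + k) (f (?Y n)) * cnj (texp (\<eta> n + m) (f X))"
      by (simp only: texp_def cis_mult[symmetric] cis_cnj)
    moreover have "tst (texp (\<eta> n + m)) X = of_real (jac X) * \<theta> (f X) * cnj (texp (\<eta> n + m) (f X))"
      using True tn[OF W(2) m] thY[OF W(2)] by (simp add: tst_def)
    moreover have "src (texp (\<eta> n + k)) (?Y n) = \<theta> (f (?Y n)) * texp (\<eta> n + k) (f (?Y n))"
    proof -
      have "?Y n \<in> U" using n W(3) by blast
      then show ?thesis using tn[OF n k] thY[OF n] by (simp add: src_def)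
    qed
    ultimately show ?thesis by simp
  qed
  have "(\<lambda>n. of_real (jac X) * \<theta> (f X) * \<theta> (f (?Y n))
      * cis ((h n *\<^sub>R \<eta> n) \<bullet> ((1 / h n) *\<^sub>R (f (?Y n) - f X)) + (k \<bullet> f (?Y n) - m \<bullet> f X)))
    \<longlonglongrightarrow> of_real (jac X) * \<theta> (f X) * \<theta> (f X) * cis (\<xi> \<bullet> (- (J X *v z)) + (k \<bullet> f X - m \<bullet> f X))"
    by (intro tendsto_mult tendsto_const th ph)
  then have "(\<lambda>n. tst (texp (\<eta> n + m)) X * src (texp (\<eta> n + k)) (?Y n))
    \<longlonglongrightarrow> of_real (jac X) * \<theta> (f X) * \<theta> (f X) * cis (\<xi> \<bullet> (- (J X *v z)) + (k \<bullet> f X - m \<bullet> f X))"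
    by (rule Lim_transform_eventually) (rule eventually_mono[OF ev eq])
  moreover have "cis (\<xi> \<bullet> (- (J X *v z)) + (k \<bullet> f X - m \<bullet> f X)) = texp (k - m) (f X) * cis (- (z \<bullet> Nf X \<xi>))"
    unfolding texp_def cis_mult inner_Nf by (simp add: inner_commute[of \<xi>] inner_diff_left)
  ultimately show ?thesis using True thY[OF W(2)] tX by (simp add: power2_eq_square mult.assoc)
qed (simp add: tst_def)

text \<open>The limit evaluates the pulled back symbol at \<open>(X, Nf X \<xi>)\<close>, and
  \<open>Mf\<close> undoes \<open>Nf\<close>, leaving the original symbol at \<open>\<xi>\<close>.
  Transport back to the torus removes the Jacobian, and the square of the cutoff, one factor from
  each side, is 1 wherever the symbol is nonzero.\<close>

lemma qop_limit:
  assumes h: "\<And>n. h n > 0" "h \<longlonglongrightarrow> 0" and \<eta>: "\<And>n. \<eta> n \<in> int_vecs" "(\<lambda>n. h n *\<^sub>R \<eta> n) \<longlonglongrightarrow> \<xi>"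
    and k: "k \<in> int_vecs" and m: "m \<in> int_vecs"
  shows "(\<lambda>n. torus_inner (qop (h n) (texp (\<eta> n + k))) (texp (\<eta> n + m)))
    \<longlonglongrightarrow> (LINT x|torus_measure. of_real (\<psi> x) * a (x, \<xi>) * texp (k - m) x)"
proof -
  obtain R K C where "tame_symbol sym R K C" using tame by blast
  then interpret t: tame_symbol sym R K C .
  obtain B where B: "B > 0" "\<And>x. norm (\<theta> x) \<le> B" using theta_bound by blast
  obtain d e where de: "d > 0" "e > 0" "\<And>X. X \<in> Ktheta \<Longrightarrow> d \<le> jac X" "\<And>X. X \<in> Ktheta \<Longrightarrow> jac X \<le> e" using jac_bounds by blast
  obtain r where r: "\<And>X. X \<in> Ktheta \<Longrightarrow> norm X \<le> r" using compact_imp_bounded[OF K(3)] unfolding bounded_iff by blast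
  let ?g = "\<lambda>X. if X \<in> U then of_real (jac X) * (\<theta> (\<kappa> X))\<^sup>2 * texp (k - m) (\<kappa> X) else 0"
  have ep: "torus_periodic (texp (\<eta> n + j))" if "j \<in> int_vecs" for n j using \<eta>(1) that by (intro texp_periodic) simp
  have ec: "continuous_on U (\<lambda>X. texp (\<eta> n + j) (\<kappa> X))" if "j \<in> int_vecs" for n j
    by (rule continuous_pullback[OF _ ep[OF that]]) (intro continuous_intros)
  have tc: "continuous_on U (\<lambda>X. \<theta> (\<kappa> X))" by (rule continuous_pullback[OF theta(1,2)])
  have out: "src u X = 0" "tst u X = 0" if "X \<notin> Ktheta" for u X
    using outside_K(2)[of X] that by (auto simp: src_def tst_def)
  have L: "(\<lambda>n. LINT X|lebesgue. tst (texp (\<eta> n + m)) X * weyl_op (h n) sym (src (texp (\<eta> n + k))) X)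
    \<longlonglongrightarrow> (LINT X|lebesgue. ?g X * sym (X, Nf X \<xi>))"
  proof (rule t.weyl_form_limit[OF h])
    show "tst (texp (\<eta> n + m)) \<in> borel_measurable borel" for n
      unfolding tst_def using openU
      by (intro borel_measurable_continuous_on_if continuous_on_mult continuous_on_of_real continuous_jac tc continuous_on_cnj ec m continuous_on_const) simp
    show "src (texp (\<eta> n + k)) \<in> borel_measurable borel" for n
      unfolding src_def using openU
      by (intro borel_measurable_continuous_on_if continuous_on_mult tc ec k continuous_on_const) simp
    \<comment> \<open>A single bound for both factors: \<open>tst\<close> is at most e B and
      \<open>src\<close> at most B.\<close>
    show "norm (tst (texp (\<eta> n + m)) X) \<le> (1 + e) * B" for n X
    proof (cases "X \<in> Ktheta")
      case True
      then have X: "X \<in> U" using K(4) by blast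
      have "norm (tst (texp (\<eta> n + m)) X) = jac X * norm (\<theta> (\<kappa> X))" using X jac_pos[OF X] by (simp add: tst_def norm_mult)
      also have "\<dots> \<le> (1 + e) * B" using de(4)[OF True] de(2) B by (intro mult_mono) auto
      finally show ?thesis .
    qed (use out de B in simp)
    show "norm (src (texp (\<eta> n + k)) X) \<le> (1 + e) * B" for n X
    proof -
      have "norm (src (texp (\<eta> n + k)) X) \<le> B" using B(1) B(2)[of "\<kappa> X"] by (simp add: src_def norm_mult)
      also have "\<dots> \<le> (1 + e) * B" using de(2) B(1) by simp
      finally show ?thesis .
    qed
    show "tst (texp (\<eta> n + m)) X = 0" "src (texp (\<eta> n + k)) X = 0" if "norm X > r" for n X
      using out r[of X] that by force+
    show "(\<lambda>n. tst (texp (\<eta> n + m)) X * src (texp (\<eta> n + k)) (X - h n *\<^sub>R z)) \<longlonglongrightarrow> ?g X * cis (- (z \<bullet> Nf X \<xi>))" for X z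
      by (rule product_limit[OF h \<eta> k m])
  qed
  let ?f = "\<lambda>x. (\<theta> x)\<^sup>2 * texp (k - m) x * (of_real (\<psi> x) * a (x, \<xi>))"
  note ac = symbol_fiber_continuous[OF symbol, of \<xi>]
  have "continuous_on UNIV ?f" by (intro continuous_intros theta psi ac)
  then have "?f \<in> borel_measurable borel" by (rule borel_measurable_continuous_onI)
  then have fm: "?f \<in> borel_measurable torus_measure" by (intro torus_measurableI measurable_completion) simp
  have fp: "torus_periodic ?f"
    unfolding torus_periodic_def
  proof (intro allI impI)
    fix x y :: "real ^ 'd" assume xy: "torus_eq x y"
    have "torus_periodic (texp (k - m))" using k m by (intro texp_periodic) simp
    from torus_periodicD[OF this xy] torus_periodicD[OF theta(2) xy] torus_periodicD[OF psi(2) xy]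
      torus_periodicD[OF symbol_periodic[OF symbol] xy, of \<xi>] show "?f x = ?f y" by simp
  qed
  have 1: "indicator U X *\<^sub>R (jac X *\<^sub>R ?f (\<kappa> X)) = ?g X * sym (X, Nf X \<xi>)" for X
    using sym_eq[of X "Nf X \<xi>"] MN(1)[of X \<xi>] by (simp add: scaleR_conv_of_real mult_ac)
  have "(LINT X|lebesgue. ?g X * sym (X, Nf X \<xi>)) = (LINT X|lebesgue_on U. jac X *\<^sub>R ?f (\<kappa> X))"
    using Ulebesgue by (subst integral_restrict_space) (simp, simp only: 1)
  also have "\<dots> = (LINT x|torus_measure. indicator V x *\<^sub>R ?f x)"
    by (rule torus_param_integral(2)[OF param fm fp, symmetric])
  also have "\<dots> = (LINT x|torus_measure. of_real (\<psi> x) * a (x, \<xi>) * texp (k - m) x)"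
  proof (rule Bochner_Integration.integral_cong[OF refl])
    fix x
    show "indicator V x *\<^sub>R ?f x = of_real (\<psi> x) * a (x, \<xi>) * texp (k - m) x"
    proof (cases "of_real (\<psi> x) * a (x, \<xi>) = 0")
      case False
      then have "\<psi> x \<noteq> 0" by auto
      then have "x \<in> {x. \<psi> x \<noteq> 0}" by simp
      then have "x \<in> V" by (rule subsetD[OF psi(3) subsetD[OF closure_subset]])
      moreover have "\<theta> x = 1" using theta_one[of "(x, \<xi>)"] False by simp
      ultimately show ?thesis by simp
    next
      case True
      then have "?f x = 0" "of_real (\<psi> x) * a (x, \<xi>) * texp (k - m) x = 0" by (simp_all only: mult_zero_left mult_zero_right)
      then show ?thesis by (simp only: scaleR_zero_right)
    qed
  qed
  finally have I: "(LINT X|lebesgue. ?g X * sym (X, Nf X \<xi>)) = (LINT x|torus_measure. of_real (\<psi> x) * a (x, \<xi>) * texp (k - m) x)" .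
  have "torus_inner (qop (h n) (texp (\<eta> n + k))) (texp (\<eta> n + m))
    = (LINT X|lebesgue. tst (texp (\<eta> n + m)) X * weyl_op (h n) sym (src (texp (\<eta> n + k))) X)" for n
    using \<eta>(1) k m by (intro qop_form(2) h texp_L2) auto
  with L show ?thesis unfolding I by (simp only:)
qed

end

subsection \<open>Quantizations as bounded forms\<close>

lemma torus_form_cong:
  assumes "torus_form C B" "\<And>u v. u \<in> torus_L2 \<Longrightarrow> v \<in> torus_L2 \<Longrightarrow> B' u v = B u v"
  shows "torus_form C B'"
  using assms(1) unfolding torus_form_def
  by (simp add: assms(2) torus_L2_add torus_L2_scale)

lemma torus_form_sum_forms:
  fixes B :: "'i \<Rightarrow> (real ^ 'd::finite \<Rightarrow> complex) \<Rightarrow> (real ^ 'd \<Rightarrow> complex) \<Rightarrow> complex"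
  assumes B: "\<And>j. j \<in> I \<Longrightarrow> torus_form (D j) (B j)"
  shows "torus_form (\<Sum>j\<in>I. D j) (\<lambda>u v. \<Sum>j\<in>I. B j u v)"
  unfolding torus_form_def
proof (intro conjI ballI allI)
  show "0 \<le> (\<Sum>j\<in>I. D j)" using B unfolding torus_form_def by (intro sum_nonneg) blast
  fix u v :: "real ^ 'd \<Rightarrow> complex" assume u: "u \<in> torus_L2" and v: "v \<in> torus_L2"
  show "(\<Sum>j\<in>I. B j (\<lambda>x. c * u x) v) = c * (\<Sum>j\<in>I. B j u v)" "(\<Sum>j\<in>I. B j u (\<lambda>x. c * v x)) = cnj c * (\<Sum>j\<in>I. B j u v)" for c
    unfolding sum_distrib_left by (intro sum.cong refl torus_form_scale[OF B u v]; assumption)+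
  show "norm (\<Sum>j\<in>I. B j u v) \<le> (\<Sum>j\<in>I. D j) * tnorm u * tnorm v"
    unfolding sum_distrib_right by (rule order_trans[OF norm_sum sum_mono]) (rule torus_form_bound(1)[OF B u v])
  fix w :: "real ^ 'd \<Rightarrow> complex" assume w: "w \<in> torus_L2"
  show "(\<Sum>j\<in>I. B j (\<lambda>x. u x + v x) w) = (\<Sum>j\<in>I. B j u w) + (\<Sum>j\<in>I. B j v w)"
    "(\<Sum>j\<in>I. B j w (\<lambda>x. u x + v x)) = (\<Sum>j\<in>I. B j w u) + (\<Sum>j\<in>I. B j w v)"
    unfolding sum.distrib[symmetric] by (intro sum.cong refl torus_form_add[OF B u v w]; assumption)+
qed

lemma smooth_continuous: "smooth_on S f \<Longrightarrow> continuous_on S f"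
proof -
  assume "smooth_on S f"
  then have "Ck_on 0 S f" unfolding smooth_on_def by blast
  then show "continuous_on S f" unfolding Ck_on.simps .
qed

lemma symbol_fiber_measurable: "a \<in> torus_symbols \<Longrightarrow> (\<lambda>x. a (x, \<xi>)) \<in> borel_measurable lebesgue"
  using borel_measurable_continuous_onI[OF symbol_fiber_continuous] by (intro measurable_completion) simp

text \<open>Finitely many patch operators add up. Their bounds are summed into one constant for all
  h, and in the limit the partition of unity sums to 1, so that no trace of charts or cutoffs
  remains.\<close>

lemma quantization_forms:
  fixes a :: "(real ^ 'd::finite) \<times> (real ^ 'd) \<Rightarrow> complex"
  assumes a: "a \<in> torus_symbols" and Op: "torus_quantization a Op"
  obtains D where "\<And>h. h > 0 \<Longrightarrow> torus_form D (\<lambda>u v. torus_inner (Op h u) v)"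
    and "\<And>h \<eta> \<xi> k m. \<lbrakk>\<And>n. h n > 0; h \<longlonglongrightarrow> 0; \<And>n. \<eta> n \<in> int_vecs; (\<lambda>n. h n *\<^sub>R \<eta> n) \<longlonglongrightarrow> \<xi>; k \<in> int_vecs; m \<in> int_vecs\<rbrakk>
      \<Longrightarrow> (\<lambda>n. torus_inner (Op (h n) (texp (\<eta> n + k))) (texp (\<eta> n + m))) \<longlonglongrightarrow> (LINT x|torus_measure. a (x, \<xi>) * texp (k - m) x)"
proof -
  obtain N :: nat and U \<kappa> and \<psi> :: "nat \<Rightarrow> real ^ 'd \<Rightarrow> real" and \<theta> :: "nat \<Rightarrow> real ^ 'd \<Rightarrow> complex"
    where *: "\<forall>j<N. torus_chart (U j) (\<kappa> j) \<and>
           smooth_on UNIV (\<lambda>x. complex_of_real (\<psi> j x)) \<and> torus_periodic (\<lambda>x. complex_of_real (\<psi> j x)) \<and>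
           (\<forall>x. 0 \<le> complex_of_real (\<psi> j x)) \<and>
           closure {x. complex_of_real (\<psi> j x) \<noteq> 0} \<subseteq> chart_image (U j) (\<kappa> j) \<and>
           smooth_on UNIV (\<theta> j) \<and> torus_periodic (\<theta> j) \<and>
           closure {x. \<theta> j x \<noteq> 0} \<subseteq> chart_image (U j) (\<kappa> j) \<and>
           (\<forall>x \<in> fst ` closure {p. complex_of_real (\<psi> j (fst p)) * a p \<noteq> 0}. \<theta> j x = 1)"
      and one: "\<forall>x. (\<Sum>j<N. complex_of_real (\<psi> j x)) = 1"
      and OpE: "Op = (\<lambda>h u x. \<Sum>j<N. chart_op (U j) (\<kappa> j) (\<theta> j) h (\<lambda>p. complex_of_real (\<psi> j (fst p)) * a p) u x)"
    using Op unfolding torus_quantization_def by (elim exE conjE) (rule that, assumption+)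
  define Q where "Q j h u = chart_op (U j) (\<kappa> j) (\<theta> j) h (\<lambda>p. \<psi> j (fst p) * a p) u" for j h u
  have P: "patch_op (U j) (\<kappa> j) (\<psi> j) (\<theta> j) a" if j: "j < N" for j
  proof -
    note X = *[rule_format, OF j]
    note A1 = X[THEN conjunct1] and X = X[THEN conjunct2]
    note A2 = X[THEN conjunct1] and X = X[THEN conjunct2]
    note A3 = X[THEN conjunct1] and X = X[THEN conjunct2, THEN conjunct2]
    note A4 = X[THEN conjunct1] and X = X[THEN conjunct2]
    note A5 = X[THEN conjunct1] and X = X[THEN conjunct2]
    note A6 = X[THEN conjunct1] and X = X[THEN conjunct2]
    note A7 = X[THEN conjunct1] and A8 = X[THEN conjunct2]
    \<comment> \<open>In the unfolded definition the functions \<open>\<psi> j\<close> occur coerced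
      to complex values; taking real parts returns the statements about the real functions.\<close>
    have c: "continuous_on UNIV (\<psi> j)" using continuous_on_Re[OF smooth_continuous[OF A2]] by simp
    have p: "torus_periodic (\<psi> j)" using torus_periodic_comp[OF A3, of Re] by simp
    have d: "closure {x. \<psi> j x \<noteq> 0} \<subseteq> chart_image (U j) (\<kappa> j)" using A4 by simp
    show ?thesis
    proof (unfold_locales)
      show "\<theta> j (fst p) = 1" if "\<psi> j (fst p) * a p \<noteq> 0" for p
      proof -
        have "p \<in> closure {p. \<psi> j (fst p) * a p \<noteq> 0}" by (rule subsetD[OF closure_subset]) (use that in simp)
        then show ?thesis using A8 by blast
      qed
    qed (fact A1 c p d smooth_continuous[OF A5] A6 A7 a)+
  qed
  have ex: "\<forall>j. \<exists>D. j < N \<longrightarrow> (\<forall>h>0. torus_form D (\<lambda>u v. torus_inner (Q j h u) v))"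
    unfolding Q_def using patch_op.qop_bounded[OF P] by blast
  then obtain D where D: "\<And>j h. j < N \<Longrightarrow> h > 0 \<Longrightarrow> torus_form (D j) (\<lambda>u v. torus_inner (Q j h u) v)" by metis
  have inner: "torus_inner (Op h u) v = (\<Sum>j<N. torus_inner (Q j h u) v)" if "h > 0" "u \<in> torus_L2" "v \<in> torus_L2" for h u v
  proof -
    have "torus_inner (Op h u) v = (LINT x|torus_measure. (\<Sum>j<N. Q j h u x * cnj (v x)))"
      by (simp only: torus_inner_def OpE Q_def sum_distrib_right)
    also have "\<dots> = (\<Sum>j<N. torus_inner (Q j h u) v)"
      unfolding torus_inner_def Q_def by (rule Bochner_Integration.integral_sum) (use patch_op.qop_form(1)[OF P that] in simp)
    finally show ?thesis .
  qed
  show thesis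
  proof (rule that)
    show "torus_form (\<Sum>j<N. D j) (\<lambda>u v. torus_inner (Op h u) v)" if h: "h > 0" for h
      by (rule torus_form_cong[OF torus_form_sum_forms[of "{..<N}" D] inner[OF h]]) (use D[OF _ h] in auto)
  next
    fix h :: "nat \<Rightarrow> real" and \<eta> :: "nat \<Rightarrow> real ^ 'd" and \<xi> k m :: "real ^ 'd"
    assume h: "\<And>n. h n > 0" "h \<longlonglongrightarrow> 0" and \<eta>: "\<And>n. \<eta> n \<in> int_vecs" "(\<lambda>n. h n *\<^sub>R \<eta> n) \<longlonglongrightarrow> \<xi>" and k: "k \<in> int_vecs" "m \<in> int_vecs"
    have e: "torus_inner (Op (h n) (texp (\<eta> n + k))) (texp (\<eta> n + m)) = (\<Sum>j<N. torus_inner (Q j (h n) (texp (\<eta> n + k))) (texp (\<eta> n + m)))" for n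
      by (rule inner[OF h(1)]) (use \<eta>(1) k in \<open>auto intro!: texp_L2\<close>)
    have "(\<lambda>n. \<Sum>j<N. torus_inner (Q j (h n) (texp (\<eta> n + k))) (texp (\<eta> n + m)))
      \<longlonglongrightarrow> (\<Sum>j<N. (LINT x|torus_measure. of_real (\<psi> j x) * a (x, \<xi>) * texp (k - m) x))"
      unfolding Q_def by (rule tendsto_sum) (use patch_op.qop_limit[OF P h \<eta> k] in simp)
    also have "(\<Sum>j<N. (LINT x|torus_measure. of_real (\<psi> j x) * a (x, \<xi>) * texp (k - m) x))
      = (LINT x|torus_measure. (\<Sum>j<N. of_real (\<psi> j x) * a (x, \<xi>) * texp (k - m) x))"
    proof (rule Bochner_Integration.integral_sum[symmetric])
      fix j assume "j \<in> {..<N}"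
      then interpret patch_op "U j" "\<kappa> j" "\<psi> j" "\<theta> j" a using P by simp
      obtain B where B: "B > 0" "\<And>x. norm (\<psi> j x) \<le> B" using periodic_bounded[OF psi(1,2)] by blast
      obtain K where K': "\<And>p. norm (a p) \<le> K" using symbol_bounded[OF a] by blast
      have "continuous_on UNIV (\<lambda>x. of_real (\<psi> j x) * a (x, \<xi>) * texp (k - m) x)"
        by (intro continuous_intros psi symbol_fiber_continuous a)
      from borel_measurable_continuous_onI[OF this]
      have m: "(\<lambda>x. of_real (\<psi> j x) * a (x, \<xi>) * texp (k - m) x) \<in> borel_measurable torus_measure"
        by (intro torus_measurableI measurable_completion) simp
      have "norm (of_real (\<psi> j x) * a (x, \<xi>) * texp (k - m) x) \<le> B * K" for x
        using B K' unfolding norm_mult norm_texp norm_of_real by (simp add: mult_mono)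
      then show "integrable torus_measure (\<lambda>x. of_real (\<psi> j x) * a (x, \<xi>) * texp (k - m) x)"
        by (rule torus_integrable_bounded[OF m])
    qed
    also have "\<dots> = (LINT x|torus_measure. a (x, \<xi>) * texp (k - m) x)"
    proof (rule Bochner_Integration.integral_cong[OF refl])
      fix x :: "real ^ 'd"
      have "(\<Sum>j<N. complex_of_real (\<psi> j x) * a (x, \<xi>) * texp (k - m) x) = (\<Sum>j<N. complex_of_real (\<psi> j x)) * (a (x, \<xi>) * texp (k - m) x)"
        by (simp add: sum_distrib_right mult.assoc)
      then show "(\<Sum>j<N. complex_of_real (\<psi> j x) * a (x, \<xi>) * texp (k - m) x) = a (x, \<xi>) * texp (k - m) x"
        using one by simp
    qed
    finally show "(\<lambda>n. torus_inner (Op (h n) (texp (\<eta> n + k))) (texp (\<eta> n + m))) \<longlonglongrightarrow> (LINT x|torus_measure. a (x, \<xi>) * texp (k - m) x)"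
      unfolding e .
  qed
qed

subsection \<open>The Riemann-Lebesgue lemma\<close>

text \<open>Integrability is included so that linear combinations and dominated limits stay within
  the class, as the inductions over sets and over integrable functions require.\<close>

definition oscillates_away :: "(nat \<Rightarrow> real) \<Rightarrow> (real \<Rightarrow> complex) \<Rightarrow> bool" where
  "oscillates_away \<omega> f \<longleftrightarrow> integrable lebesgue f \<and> (\<lambda>n. LINT t|lebesgue. f t * cis (\<omega> n * t)) \<longlonglongrightarrow> 0"

lemma cis_lebesgue_measurable [measurable]: "(\<lambda>t. cis (c * t)) \<in> borel_measurable lebesgue"
  by (intro measurable_completion) (auto intro!: borel_measurable_continuous_onI continuous_intros)

lemma integrable_mult_unimodular:
  fixes f :: "'a \<Rightarrow> complex"
  assumes "integrable M f" "g \<in> borel_measurable M" "\<And>t. norm (g t) \<le> 1"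
  shows "integrable M (\<lambda>t. f t * g t)"
proof (rule Bochner_Integration.integrable_bound[OF assms(1)])
  show "(\<lambda>t. f t * g t) \<in> borel_measurable M" using assms(1,2) by (intro borel_measurable_times) auto
  show "AE t in M. norm (f t * g t) \<le> norm (f t)"
    using assms(3) by (intro AE_I2) (simp add: norm_mult mult_left_le)
qed

lemma oscillates_awayD:
  assumes "oscillates_away \<omega> f"
  shows "integrable lebesgue f" "(\<lambda>n. LINT t|lebesgue. f t * cis (\<omega> n * t)) \<longlonglongrightarrow> 0"
    "integrable lebesgue (\<lambda>t. f t * cis (\<omega> n * t))"
  using assms unfolding oscillates_away_def by (auto intro!: integrable_mult_unimodular)

text \<open>An interchange of limits: the error against the auxiliary sequence is uniform in n. It
  carries finite truncations of \<open>\<rho>\<close> and simple approximations of test functions to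
  the limit.\<close>

lemma approx_limit:
  fixes x :: "nat \<Rightarrow> 'a::real_normed_vector"
  assumes "\<And>e. e > 0 \<Longrightarrow> \<exists>X Y. X \<longlonglongrightarrow> Y \<and> (\<forall>n. norm (x n - X n) \<le> e) \<and> norm (y - Y) \<le> e"
  shows "x \<longlonglongrightarrow> y"
proof (rule LIMSEQ_I)
  fix r :: real assume "r > 0"
  then obtain X Y where X: "X \<longlonglongrightarrow> Y" "\<And>n. norm (x n - X n) \<le> r / 4" "norm (y - Y) \<le> r / 4"
    using assms[of "r / 4"] by auto
  obtain N where N: "\<And>n. n \<ge> N \<Longrightarrow> norm (X n - Y) < r / 4" using LIMSEQ_D[OF X(1), of "r / 4"] \<open>r > 0\<close> by auto
  have "norm (x n - y) < r" if "n \<ge> N" for n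
  proof -
    have "x n - y = (x n - X n) + (X n - Y) + (Y - y)" by simp
    also have "norm \<dots> \<le> norm (x n - X n) + norm (X n - Y) + norm (Y - y)"
      by (intro order_trans[OF norm_triangle_ineq] add_right_mono norm_triangle_ineq)
    also have "\<dots> < r" using X(2)[of n] X(3) N[OF that] \<open>r > 0\<close> by (simp add: norm_minus_commute)
    finally show ?thesis .
  qed
  then show "\<exists>no. \<forall>n\<ge>no. norm (x n - y) < r" by blast
qed

text \<open>Dominated convergence gives convergence in L^1, and the L^1 distance bounds the
  difference of the oscillatory integrals for all n at once.\<close>

lemma oscillates_away_limit:
  assumes f: "\<And>p :: nat. oscillates_away \<omega> (f p)" and lim: "AE t in lebesgue. (\<lambda>p. f p t) \<longlonglongrightarrow> g t"
    and w: "integrable lebesgue w" "\<And>p. AE t in lebesgue. norm (f p t) \<le> w t" and g: "g \<in> borel_measurable lebesgue"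
  shows "oscillates_away \<omega> g"
proof -
  have fi: "integrable lebesgue (f p)" for p by (rule oscillates_awayD(1)[OF f])
  have gi: "integrable lebesgue g"
    by (rule integrable_dominated_convergence[OF g _ w(1) lim w(2)]) (rule borel_measurable_integrable[OF fi])
  have "(\<lambda>p. LINT t|lebesgue. norm (f p t - g t)) \<longlonglongrightarrow> (LINT t|(lebesgue :: real measure). 0 :: real)"
  proof (rule integral_dominated_convergence[where w = "\<lambda>t. w t + norm (g t)"])
    show "integrable lebesgue (\<lambda>t. w t + norm (g t))" using w(1) gi by auto
    show "(\<lambda>t. norm (f p t - g t)) \<in> borel_measurable lebesgue" for p using fi g by auto
    show "AE t in lebesgue. (\<lambda>p. norm (f p t - g t)) \<longlonglongrightarrow> 0"
      using lim by eventually_elim (use LIM_zero tendsto_norm_zero in blast)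
    show "AE t in lebesgue. norm (norm (f p t - g t)) \<le> w t + norm (g t)" for p
      using w(2)[of p] by eventually_elim (use norm_triangle_ineq4 in \<open>fastforce intro: order_trans\<close>)
  qed auto
  then have z: "(\<lambda>p. LINT t|lebesgue. norm (f p t - g t)) \<longlonglongrightarrow> 0" by simp
  have bd: "norm ((LINT t|lebesgue. g t * cis (\<omega> n * t)) - (LINT t|lebesgue. f p t * cis (\<omega> n * t))) \<le> (LINT t|lebesgue. norm (f p t - g t))" for n p
  proof -
    have "(LINT t|lebesgue. g t * cis (\<omega> n * t)) - (LINT t|lebesgue. f p t * cis (\<omega> n * t)) = (LINT t|lebesgue. g t * cis (\<omega> n * t) - f p t * cis (\<omega> n * t))"
      by (rule Bochner_Integration.integral_diff[symmetric]) (intro integrable_mult_unimodular gi fi, auto)+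
    also have "norm \<dots> \<le> (LINT t|lebesgue. norm (g t * cis (\<omega> n * t) - f p t * cis (\<omega> n * t)))" by (rule integral_norm_bound)
    also have "\<dots> = (LINT t|lebesgue. norm (f p t - g t))"
      by (simp add: norm_mult norm_minus_commute flip: left_diff_distrib)
    finally show ?thesis .
  qed
  have "(\<lambda>n. LINT t|lebesgue. g t * cis (\<omega> n * t)) \<longlonglongrightarrow> 0"
  proof (rule approx_limit)
    fix e :: real assume "e > 0"
    then obtain p where p: "(LINT t|lebesgue. norm (f p t - g t)) < e" using LIMSEQ_D[OF z, of e] by fastforce
    show "\<exists>X Y. X \<longlonglongrightarrow> Y \<and> (\<forall>n. norm ((LINT t|lebesgue. g t * cis (\<omega> n * t)) - X n) \<le> e) \<and> norm (0 - Y) \<le> e"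
      by (rule exI[of _ "\<lambda>n. LINT t|lebesgue. f p t * cis (\<omega> n * t)"], rule exI[of _ 0])
        (use oscillates_awayD(2)[OF f] order_trans[OF bd less_imp_le[OF p]] \<open>e > 0\<close> in auto)
  qed
  then show ?thesis unfolding oscillates_away_def using gi by blast
qed

lemma oscillates_away_zero: "oscillates_away \<omega> (\<lambda>t. 0)"
  unfolding oscillates_away_def by simp

lemma oscillates_away_add:
  assumes f: "oscillates_away \<omega> f" and g: "oscillates_away \<omega> g"
  shows "oscillates_away \<omega> (\<lambda>t. f t + g t)"
proof -
  have "(LINT t|lebesgue. (f t + g t) * cis (\<omega> n * t)) = (LINT t|lebesgue. f t * cis (\<omega> n * t)) + (LINT t|lebesgue. g t * cis (\<omega> n * t))" for n
    unfolding distrib_right by (rule Bochner_Integration.integral_add[OF oscillates_awayD(3)[OF f] oscillates_awayD(3)[OF g]])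
  then show ?thesis
    using tendsto_add[OF oscillates_awayD(2)[OF f] oscillates_awayD(2)[OF g]] oscillates_awayD(1)[OF f] oscillates_awayD(1)[OF g]
    unfolding oscillates_away_def by simp
qed

lemma oscillates_away_scale:
  assumes f: "oscillates_away \<omega> f" shows "oscillates_away \<omega> (\<lambda>t. c * f t)"
proof -
  have "(LINT t|lebesgue. c * f t * cis (\<omega> n * t)) = c * (LINT t|lebesgue. f t * cis (\<omega> n * t))" for n
    by (simp only: mult.assoc integral_mult_right_zero)
  then show ?thesis
    using tendsto_mult_left[OF oscillates_awayD(2)[OF f], of c] oscillates_awayD(1)[OF f]
    unfolding oscillates_away_def by simp
qed

lemma integrable_indicator_interval: "integrable lebesgue (indicator {a..b} :: real \<Rightarrow> real)"
  by (intro integrable_real_indicator) (auto simp: emeasure_lborel_Icc_eq)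

lemma integral_cis_interval:
  assumes c: "c \<noteq> 0" and ab: "a \<le> b"
  shows "(LINT t|lebesgue. indicator {a..b} t *\<^sub>R cis (c * t)) = (cis (c * b) - cis (c * a)) / (\<i> * of_real c)"
proof -
  let ?F = "\<lambda>t. cis (c * t) / (\<i> * of_real c)"
  have d: "(?F has_vector_derivative cis (c * t)) (at t within {a..b})" for t
  proof -
    have "((\<lambda>z. exp (\<i> * of_real c * z) / (\<i> * of_real c)) has_field_derivative exp (\<i> * of_real c * of_real t)) (at (of_real t))"
      using c by (auto intro!: derivative_eq_intros)
    from has_vector_derivative_real_field[OF this] show ?thesis by (simp add: cis_conv_exp mult.assoc)
  qed
  have "(\<lambda>t. indicator {a..b} t *\<^sub>R cis (c * t)) \<in> borel_measurable borel"
    by (intro borel_measurable_scaleR borel_measurable_indicator borel_measurable_continuous_onI continuous_intros) auto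
  then have "(LINT t|lebesgue. indicator {a..b} t *\<^sub>R cis (c * t)) = (LINT t|lborel. indicator {a..b} t *\<^sub>R cis (c * t))"
    by (rule lebesgue_integral_lborel(1))
  also have "\<dots> = ?F b - ?F a"
    by (rule integral_FTC_atLeastAtMost[OF ab d]) (auto intro!: continuous_intros)
  finally show ?thesis by (simp only: diff_divide_distrib)
qed

text \<open>The explicit primitive bounds the integral by 2/|\<omega> n|, whatever the sign of the
  frequency.\<close>

lemma oscillates_away_interval:
  assumes \<omega>: "filterlim (\<lambda>n. \<bar>\<omega> n\<bar>) at_top sequentially"
  shows "oscillates_away \<omega> (indicator {a..b})"
proof -
  have i: "integrable lebesgue (indicator {a..b} :: real \<Rightarrow> complex)"
    using integrable_of_real[OF integrable_indicator_interval[of a b], where 'a = complex] by (simp add: of_real_indicator)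
  have bd: "norm (LINT t|lebesgue. indicator {a..b} t * cis (\<omega> n * t)) \<le> 2 / \<bar>\<omega> n\<bar>" if n: "\<omega> n \<noteq> 0" for n
  proof (cases "a \<le> b")
    case True
    have "(LINT t|lebesgue. indicator {a..b} t * cis (\<omega> n * t)) = (cis (\<omega> n * b) - cis (\<omega> n * a)) / (\<i> * of_real (\<omega> n))"
      using integral_cis_interval[OF n True] by (simp add: scaleR_conv_of_real of_real_indicator)
    also have "norm \<dots> \<le> (norm (cis (\<omega> n * b)) + norm (cis (\<omega> n * a))) / \<bar>\<omega> n\<bar>"
      unfolding norm_divide by (simp add: norm_mult) (intro divide_right_mono order_trans[OF norm_triangle_ineq4], auto)
    finally show ?thesis by simp
  qed simp
  have "(\<lambda>n. 2 / \<bar>\<omega> n\<bar>) \<longlonglongrightarrow> 0" by (rule tendsto_divide_0[OF tendsto_const]) (rule filterlim_at_top_imp_at_infinity[OF \<omega>])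
  moreover have "eventually (\<lambda>n. norm (LINT t|lebesgue. indicator {a..b} t * cis (\<omega> n * t)) \<le> 2 / \<bar>\<omega> n\<bar>) sequentially"
  proof -
    have "eventually (\<lambda>n. 1 \<le> \<bar>\<omega> n\<bar>) sequentially" using \<omega> unfolding filterlim_at_top by blast
    then show ?thesis by (rule eventually_mono) (rule bd, auto)
  qed
  ultimately have "(\<lambda>n. LINT t|lebesgue. indicator {a..b} t * cis (\<omega> n * t)) \<longlonglongrightarrow> 0"
    by (rule Lim_null_comparison[rotated])
  then show ?thesis unfolding oscillates_away_def using i by simp
qed

text \<open>Dynkin's induction from the half-lines, which meet the window [-m, m] in intervals.
  Inside the window complements are differences of integrable indicators, and disjoint unions are
  dominated by the indicator of the window.\<close>

lemma oscillates_away_borel: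
  assumes \<omega>: "filterlim (\<lambda>n. \<bar>\<omega> n\<bar>) at_top sequentially" and A: "A \<in> sets borel"
  shows "oscillates_away \<omega> (indicator (A \<inter> {-m..m}))"
proof -
  let ?K = "{-m..m}"
  note int = oscillates_away_interval[OF \<omega>]
  have "Int_stable (range (\<lambda>a :: real. {..a}))"
    by (auto simp: Int_stable_def Int_atMost min_def)
  moreover have "range (\<lambda>a :: real. {..a}) \<subseteq> Pow UNIV" by simp
  moreover have "A \<in> sigma_sets UNIV (range (\<lambda>a :: real. {..a}))" using A unfolding borel_eq_atMost by simp
  ultimately show ?thesis
  proof (induction rule: sigma_sets_induct_disjoint)
    case (basic A)
    then obtain a where "A = {..a}" by blast
    then have "A \<inter> ?K = {-m..min a m}" by auto
    then show ?case using int by simp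
  next
    case empty
    show ?case using oscillates_away_zero by simp
  next
    case (compl A)
    have "indicator ((UNIV - A) \<inter> ?K) t = indicator ?K t + (-1) * (indicator (A \<inter> ?K) t :: complex)" for t
      by (auto simp: indicator_def)
    then show ?case using oscillates_away_add[OF int[of "-m" m] oscillates_away_scale[OF compl(2), of "-1"]] by presburger
  next
    case (union A)
    have Ab: "A i \<in> sets borel" for i using union(2) unfolding borel_eq_atMost by auto
    note K = integrable_indicator_interval[of "-m" m]
    let ?f = "\<lambda>p t. \<Sum>i<p. indicator (A i \<inter> ?K) t :: complex"
    have fin: "oscillates_away \<omega> (?f p)" for p
    proof (induction p)
      case 0 show ?case using oscillates_away_zero by simp
    next
      case (Suc p) show ?case using oscillates_away_add[OF Suc union(3)] by simp
    qed
    have eq: "?f p t = indicator ((\<Union>i<p. A i) \<inter> ?K) t" for p t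
    proof -
      have "disjoint_family_on (\<lambda>i. A i \<inter> ?K) {..<p}" using union(1) unfolding disjoint_family_on_def by blast
      then have "indicator (\<Union>i<p. A i \<inter> ?K) t = ?f p t" by (intro indicator_UN_disjoint) auto
      then show ?thesis by (simp only: Int_UN_distrib2 UN_simps)
    qed
    show ?case
    proof (rule oscillates_away_limit[OF fin _ K])
      show "AE t in lebesgue. (\<lambda>p. ?f p t) \<longlonglongrightarrow> indicator (\<Union> (range A) \<inter> ?K) t"
      proof (rule AE_I2)
        fix t
        have "eventually (\<lambda>p. ?f p t = indicator (\<Union> (range A) \<inter> ?K) t) sequentially"
        proof (cases "t \<in> \<Union> (range A)")
          case True
          then obtain i where "t \<in> A i" by blast
          then show ?thesis unfolding eq by (intro eventually_sequentiallyI[of "Suc i"]) (force simp: indicator_def)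
        qed (auto simp: eq indicator_def)
        then show "(\<lambda>p. ?f p t) \<longlonglongrightarrow> indicator (\<Union> (range A) \<inter> ?K) t" by (rule tendsto_eventually)
      qed
      show "AE t in lebesgue. norm (?f p t) \<le> indicator ?K t" for p unfolding eq by (intro AE_I2) (auto simp: indicator_def)
      show "indicator (\<Union> (range A) \<inter> ?K) \<in> borel_measurable lebesgue" using Ab by (intro borel_measurable_indicator) auto
    qed
  qed
qed

text \<open>Induction over integrable functions: linearity and \<open>oscillates_away_limit\<close>
  take care of everything beyond indicators of sets of finite measure.\<close>

theorem Riemann_Lebesgue:
  assumes \<phi>: "integrable lebesgue \<phi>" and \<omega>: "filterlim (\<lambda>n. \<bar>\<omega> n\<bar>) at_top sequentially"
  shows "(\<lambda>n. LINT t|lebesgue. \<phi> t * cis (\<omega> n * t)) \<longlonglongrightarrow> 0"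
proof -
  from \<phi> have "oscillates_away \<omega> \<phi>"
  proof (induction rule: integrable_induct)
    case (base A c)
    \<comment> \<open>The Lebesgue set is replaced by a Borel set up to a null set and exhausted by
      the windows [-p, p] of the preceding lemma.\<close>
    obtain S N N' where S: "A = S \<union> N" "N \<subseteq> N'" "N' \<in> null_sets lborel" "S \<in> sets lborel"
      using base(1) by (rule sets_completionE)
    have ai: "AE t in lebesgue. indicator A t = (indicator S t :: complex)"
    proof (rule AE_I'[OF null_sets_completionI[OF S(3)]])
      show "{t \<in> space lebesgue. indicator A t \<noteq> (indicator S t :: complex)} \<subseteq> N'"
        using S(1,2) by (auto simp: indicator_def split: if_splits)
    qed
    have "oscillates_away \<omega> (indicator A)"
    proof (rule oscillates_away_limit)
      show "oscillates_away \<omega> (indicator (S \<inter> {- real p..real p}))" for p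
        by (rule oscillates_away_borel[OF \<omega>]) (use S(4) in simp)
      show "AE t in lebesgue. (\<lambda>p. indicator (S \<inter> {- real p..real p}) t :: complex) \<longlonglongrightarrow> indicator A t"
        using ai
      proof eventually_elim
        case (elim t)
        obtain q :: nat where q: "\<bar>t\<bar> \<le> real q" using real_arch_simple by blast
        have "eventually (\<lambda>p. indicator (S \<inter> {- real p..real p}) t = (indicator S t :: complex)) sequentially"
        proof (rule eventually_sequentiallyI[of q])
          fix p assume "q \<le> p"
          then have "\<bar>t\<bar> \<le> real p" using q by linarith
          then show "indicator (S \<inter> {- real p..real p}) t = (indicator S t :: complex)" by (auto simp: indicator_def)
        qed
        then show ?case unfolding elim by (rule tendsto_eventually)
      qed
      show "integrable lebesgue (\<lambda>t. norm (indicator A t :: complex))"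
      proof -
        have "(\<lambda>t. norm (indicator A t :: complex)) = indicator A" by (auto simp: indicator_def)
        then show ?thesis using integrable_real_indicator[OF base] by simp
      qed
      show "AE t in lebesgue. norm (indicator (S \<inter> {- real p..real p}) t :: complex) \<le> norm (indicator A t :: complex)" for p
        using S(1) by (intro AE_I2) (auto simp: indicator_def)
      show "indicator A \<in> borel_measurable lebesgue" using base(1) by simp
    qed
    from oscillates_away_scale[OF this, of c] show ?case by (simp add: scaleR_conv_of_real of_real_indicator mult.commute)
  next
    case (add f g)
    then show ?case by (intro oscillates_away_add)
  next
    case (lim f s)
    show ?case
      by (rule oscillates_away_limit[where f = s and w = "\<lambda>t. 2 * norm (f t)"]) (use lim in auto)
  qed
  then show ?thesis by (rule oscillates_awayD(2))
qed

subsection \<open>Limits of forms along modulated sequences\<close>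

lemma fourier_sum_dense:
  fixes u :: "real ^ 'd::finite \<Rightarrow> complex"
  assumes "u \<in> torus_L2" "e > 0"
  shows "\<exists>F. finite F \<and> F \<subseteq> int_vecs \<and> tnorm (\<lambda>x. u x - fourier_sum F u x) < e"
proof (rule fourier_sum_approx[OF assms])
  fix F assume F: "finite F" "F \<subseteq> int_vecs"
    and "\<And>G. finite G \<Longrightarrow> G \<subseteq> int_vecs \<Longrightarrow> F \<subseteq> G \<Longrightarrow> tnorm (\<lambda>x. u x - fourier_sum G u x) < e"
  from this(3)[OF F order_refl] F show ?thesis by blast
qed

text \<open>\<open>SOME\<close> may select another representative, so u is recovered only up to
  seminorm 0. The difference has no nonzero Fourier coefficient, and completeness forces its
  seminorm to vanish.\<close>

lemma propagator_0:
  assumes u: "u \<in> torus_L2" shows "tnorm (\<lambda>x. propagator 0 u x - u x) = 0"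
proof (rule ccontr)
  let ?d = "\<lambda>x. propagator 0 u x - u x"
  note p = propagator(1)[OF u, of 0]
  have d: "?d \<in> torus_L2" by (rule torus_L2_diff[OF p u])
  have c: "fourier_coeff ?d k = 0" if k: "k \<in> int_vecs" for k
    using propagator(2)[OF u k, of 0] torus_form_diff(1)[OF torus_form_inner p u texp_L2[OF k]]
    by (simp add: fourier_coeff_inner diff_divide_distrib)
  assume "tnorm ?d \<noteq> 0"
  then have pos: "tnorm ?d > 0" using tnorm_nonneg[of ?d] by linarith
  then obtain F where F: "F \<subseteq> int_vecs" "tnorm (\<lambda>x. ?d x - fourier_sum F ?d x) < tnorm ?d"
    using fourier_sum_dense[OF d] by blast
  have "fourier_sum F ?d x = 0" for x unfolding trig_def using F(1) c by (intro sum.neutral) auto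
  then show False using F(2) by simp
qed

text \<open>Makes the statement about initial data the case t = 0 of the estimates for evolved
  data.\<close>

lemma form_propagator_0:
  assumes B: "torus_form C B" and u: "u \<in> torus_L2" shows "B (propagator 0 u) (propagator 0 u) = B u u"
  using torus_form_quadratic_diff[OF B propagator(1)[OF u] u, of 0] by (simp add: propagator_0[OF u])

lemma evolved_phase_continuous: "continuous_on S (\<lambda>t. evolved_phase t \<eta> k l)"
  unfolding evolved_phase_def by (auto intro!: continuous_intros)

lemma evolved_phase_measurable: "(\<lambda>t. evolved_phase t \<eta> k l) \<in> borel_measurable lebesgue"
  using borel_measurable_continuous_onI[OF evolved_phase_continuous] by (intro measurable_completion) simp

lemma norm_evolved_phase [simp]: "norm (evolved_phase t \<eta> k l) = 1" by (simp add: evolved_phase_def)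

lemma evolved_phase_shift:
  "evolved_phase t \<eta> k l = evolved_phase t 0 k l * cis (- ((k - l) \<bullet> \<eta>) * t)"
  unfolding evolved_phase_def cis_mult power2_norm_eq_inner
  by (rule arg_cong[of _ _ cis]) (simp add: inner_add_left inner_add_right inner_diff_left inner_diff_right inner_commute field_simps)

text \<open>The phase \<open>cis (- t (k - l) \<bullet> \<eta>)\<close> is what distinguishes the two families: it is constant for
  resonant pairs \<open>(k, l)\<close> and is averaged out by the Riemann-Lebesgue lemma for all others.\<close>

locale rho =
  fixes \<rho> :: "real ^ 'd::finite \<Rightarrow> complex"
  assumes rho: "\<rho> \<in> torus_L2"
begin

text \<open>The quadratic form restricted to frequencies in \<open>F\<close>. The matrix elements
  \<open>G\<close> are left free, so that they can be those of the approximating forms or of the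
  limit form.\<close>

definition truncated :: "(real ^ 'd) set \<Rightarrow> real ^ 'd \<Rightarrow> (real ^ 'd \<Rightarrow> real ^ 'd \<Rightarrow> complex) \<Rightarrow> real \<Rightarrow> complex" where
  "truncated F \<eta> G t = (\<Sum>k\<in>F. \<Sum>l\<in>F. fourier_coeff \<rho> k * cnj (fourier_coeff \<rho> l) * evolved_phase t \<eta> k l * G k l)"

abbreviation quad where "quad B \<eta> t \<equiv> B (propagator t (modulate \<eta> \<rho>)) (propagator t (modulate \<eta> \<rho>))"

lemma truncation_error:
  assumes "\<eta> \<in> int_vecs" "torus_form C B" "finite F" "F \<subseteq> int_vecs"
  shows "norm (quad B \<eta> t - truncated F \<eta> (\<lambda>k l. B (texp (\<eta> + k)) (texp (\<eta> + l))) t)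
    \<le> 2 * C * tnorm \<rho> * tnorm (\<lambda>x. \<rho> x - fourier_sum F \<rho> x)"
  unfolding truncated_def by (rule propagator_modulate(2)[OF rho assms])

lemma small_error:
  assumes M: "M \<ge> 0" and e: "e > 0"
  obtains F where "finite F" "F \<subseteq> int_vecs" "M * tnorm (\<lambda>x. \<rho> x - fourier_sum F \<rho> x) \<le> e"
proof -
  have pos: "e / (M + 1) > 0" using M e by simp
  then obtain F where F: "finite F" "F \<subseteq> int_vecs" "tnorm (\<lambda>x. \<rho> x - fourier_sum F \<rho> x) < e / (M + 1)"
    using fourier_sum_dense[OF rho] by blast
  have "M * tnorm (\<lambda>x. \<rho> x - fourier_sum F \<rho> x) \<le> (M + 1) * (e / (M + 1))"
    using F(3) M by (intro mult_mono) (auto simp: tnorm_nonneg)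
  also have "\<dots> = e" using M by simp
  finally show thesis using that F by blast
qed

lemma truncated_measurable: "truncated F \<eta> G \<in> borel_measurable lebesgue"
  unfolding truncated_def[abs_def] by (intro borel_measurable_sum borel_measurable_times evolved_phase_measurable) auto

lemma truncated_bounded: "norm (truncated F \<eta> G t) \<le> (\<Sum>k\<in>F. \<Sum>l\<in>F. norm (fourier_coeff \<rho> k * cnj (fourier_coeff \<rho> l) * G k l))"
  unfolding truncated_def
  by (intro order_trans[OF norm_sum] sum_mono) (simp add: norm_mult)

text \<open>\<open>propagator t\<close> picks a representative for each t independently, so
  measurability in t cannot be read off from the definition. It holds because the form is a uniform
  limit of the truncated sums, which are continuous in t.\<close>

lemma quad_measurable:
  assumes \<eta>: "\<eta> \<in> int_vecs" and B: "torus_form C B"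
  shows "(\<lambda>t. quad B \<eta> t) \<in> borel_measurable lebesgue"
proof -
  have C: "C \<ge> 0" using torus_form_bound(2)[OF B rho rho] .
  define M where "M = 2 * C * tnorm \<rho>"
  have M: "M \<ge> 0" using C by (simp add: M_def tnorm_nonneg)
  have "\<forall>p. \<exists>F. finite F \<and> F \<subseteq> int_vecs \<and> M * tnorm (\<lambda>x. \<rho> x - fourier_sum F \<rho> x) \<le> inverse (real (Suc p))"
  proof
    fix p
    obtain F where "finite F" "F \<subseteq> int_vecs" "M * tnorm (\<lambda>x. \<rho> x - fourier_sum F \<rho> x) \<le> inverse (real (Suc p))"
      by (rule small_error[OF M, of "inverse (real (Suc p))"]) auto
    then show "\<exists>F. finite F \<and> F \<subseteq> int_vecs \<and> M * tnorm (\<lambda>x. \<rho> x - fourier_sum F \<rho> x) \<le> inverse (real (Suc p))" by blast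
  qed
  then obtain F where F: "\<And>p. finite (F p)" "\<And>p. F p \<subseteq> int_vecs" "\<And>p. M * tnorm (\<lambda>x. \<rho> x - fourier_sum (F p) \<rho> x) \<le> inverse (real (Suc p))"
    by metis
  let ?T = "\<lambda>p. truncated (F p) \<eta> (\<lambda>k l. B (texp (\<eta> + k)) (texp (\<eta> + l)))"
  show ?thesis
  proof (rule borel_measurable_LIMSEQ_metric[of ?T])
    show "?T p \<in> borel_measurable lebesgue" for p by (rule truncated_measurable)
    fix t
    have "norm (?T p t - quad B \<eta> t) \<le> inverse (real (Suc p))" for p
      using order_trans[OF truncation_error[OF \<eta> B F(1,2)] F(3)[unfolded M_def]] by (simp add: norm_minus_commute)
    then have "(\<lambda>p. ?T p t - quad B \<eta> t) \<longlonglongrightarrow> 0"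
      by (intro Lim_null_comparison[OF _ LIMSEQ_inverse_real_of_nat] always_eventually allI)
    then show "(\<lambda>p. ?T p t) \<longlonglongrightarrow> quad B \<eta> t" by (rule LIM_zero_cancel)
  qed
qed

lemma quad_bounded:
  assumes \<eta>: "\<eta> \<in> int_vecs" and B: "torus_form C B"
  shows "norm (quad B \<eta> t) \<le> C * tnorm \<rho> * tnorm \<rho>"
proof -
  have p: "propagator t (modulate \<eta> \<rho>) \<in> torus_L2" by (rule propagator(1)[OF modulate_L2[OF \<eta> rho]])
  from torus_form_bound(1)[OF B p p] show ?thesis by (simp add: propagator_modulate(1)[OF rho \<eta>])
qed

lemma integral_quad_truncated:
  assumes \<eta>: "\<eta> \<in> int_vecs" and B: "torus_form C B" and F: "finite F" "F \<subseteq> int_vecs" and \<phi>: "integrable lebesgue \<phi>"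
  shows "norm ((LINT t|lebesgue. \<phi> t * quad B \<eta> t) - (LINT t|lebesgue. \<phi> t * truncated F \<eta> (\<lambda>k l. B (texp (\<eta> + k)) (texp (\<eta> + l))) t))
    \<le> 2 * C * tnorm \<rho> * tnorm (\<lambda>x. \<rho> x - fourier_sum F \<rho> x) * (LINT t|lebesgue. norm (\<phi> t))"
proof -
  let ?G = "\<lambda>k l. B (texp (\<eta> + k)) (texp (\<eta> + l))"
  let ?e = "2 * C * tnorm \<rho> * tnorm (\<lambda>x. \<rho> x - fourier_sum F \<rho> x)"
  have bi: "integrable lebesgue (\<lambda>t. \<phi> t * g t)" if "g \<in> borel_measurable lebesgue" "\<And>t. norm (g t) \<le> K" for g :: "real \<Rightarrow> complex" and K
  proof -
    have "integrable lebesgue (\<lambda>t. norm (\<phi> t) * K)" using \<phi> by (intro integrable_mult_left integrable_norm)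
    then show ?thesis
    proof (rule Bochner_Integration.integrable_bound)
      show "(\<lambda>t. \<phi> t * g t) \<in> borel_measurable lebesgue" using \<phi> that(1) by (intro borel_measurable_times) auto
      show "AE t in lebesgue. norm (\<phi> t * g t) \<le> norm (norm (\<phi> t) * K)"
        using that(2) by (intro AE_I2) (auto simp: norm_mult abs_mult intro!: mult_left_mono order_trans[OF _ abs_ge_self])
    qed
  qed
  note i1 = bi[OF quad_measurable[OF \<eta> B] quad_bounded[OF \<eta> B]]
  note i2 = bi[OF truncated_measurable truncated_bounded, of F \<eta> ?G]
  define q r where "q = (\<lambda>t. quad B \<eta> t)" and "r = truncated F \<eta> ?G"
  have i: "integrable lebesgue (\<lambda>t. \<phi> t * q t)" "integrable lebesgue (\<lambda>t. \<phi> t * r t)"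
    using i1 i2 unfolding q_def r_def by blast+
  have le: "norm (\<phi> t * q t - \<phi> t * r t) \<le> ?e * norm (\<phi> t)" for t
  proof -
    have "norm (\<phi> t * q t - \<phi> t * r t) = norm (\<phi> t) * norm (q t - r t)"
      by (simp only: right_diff_distrib[symmetric] norm_mult)
    also have "\<dots> \<le> norm (\<phi> t) * ?e"
      unfolding q_def r_def by (rule mult_left_mono[OF truncation_error[OF \<eta> B F] norm_ge_zero])
    finally show ?thesis by (simp only: mult.commute)
  qed
  have "norm ((LINT t|lebesgue. \<phi> t * q t) - (LINT t|lebesgue. \<phi> t * r t)) = norm (LINT t|lebesgue. \<phi> t * q t - \<phi> t * r t)"
    by (simp only: Bochner_Integration.integral_diff[OF i])
  also have "\<dots> \<le> (LINT t|lebesgue. norm (\<phi> t * q t - \<phi> t * r t))" by (rule integral_norm_bound)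
  also have "\<dots> \<le> (LINT t|lebesgue. ?e * norm (\<phi> t))"
    by (rule integral_mono[OF integrable_norm[OF Bochner_Integration.integrable_diff[OF i]] integrable_mult_right[OF integrable_norm[OF \<phi>]] le])
  also have "\<dots> = ?e * (LINT t|lebesgue. norm (\<phi> t))" by (rule integral_mult_right_zero)
  finally show ?thesis unfolding q_def r_def .
qed

lemma integral_truncated:
  assumes \<phi>: "integrable lebesgue \<phi>"
  shows "(LINT t|lebesgue. \<phi> t * truncated F \<eta> G t)
    = (\<Sum>k\<in>F. \<Sum>l\<in>F. fourier_coeff \<rho> k * cnj (fourier_coeff \<rho> l) * G k l * (LINT t|lebesgue. \<phi> t * evolved_phase t \<eta> k l))"
proof -
  have i: "integrable lebesgue (\<lambda>t. fourier_coeff \<rho> k * cnj (fourier_coeff \<rho> l) * G k l * (\<phi> t * evolved_phase t \<eta> k l))" for k l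
    by (intro integrable_mult_right integrable_mult_unimodular[OF \<phi> evolved_phase_measurable]) simp
  have "\<phi> t * truncated F \<eta> G t = (\<Sum>k\<in>F. \<Sum>l\<in>F. fourier_coeff \<rho> k * cnj (fourier_coeff \<rho> l) * G k l * (\<phi> t * evolved_phase t \<eta> k l))" for t
    unfolding truncated_def by (simp add: sum_distrib_left mult_ac)
  then show ?thesis using i by (simp add: Bochner_Integration.integral_sum)
qed

end

text \<open>The common core of all four limits: one bound for all forms, and convergence of the
  matrix elements between shifted exponentials. No symbol, chart or h is visible any more.\<close>

locale form_sequence = rho \<rho> for \<rho> :: "real ^ 'd::finite \<Rightarrow> complex" +
  fixes C :: real and B :: "nat \<Rightarrow> (real ^ 'd \<Rightarrow> complex) \<Rightarrow> (real ^ 'd \<Rightarrow> complex) \<Rightarrow> complex"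
    and \<eta> :: "nat \<Rightarrow> real ^ 'd" and A :: "real ^ 'd \<Rightarrow> real ^ 'd \<Rightarrow> complex"
  assumes form: "\<And>n. torus_form C (B n)" and eta: "\<And>n. \<eta> n \<in> int_vecs"
    and lim: "\<And>k l. k \<in> int_vecs \<Longrightarrow> l \<in> int_vecs \<Longrightarrow> (\<lambda>n. B n (texp (\<eta> n + k)) (texp (\<eta> n + l))) \<longlonglongrightarrow> A k l"
begin

lemma C_nonneg: "C \<ge> 0" using torus_form_bound(2)[OF form rho rho] .

abbreviation mult_form where "mult_form b \<equiv> (\<lambda>u v. LINT x|torus_measure. b x * (u x * cnj (v x)))"

lemma mult_form_texp: "mult_form b (texp k) (texp l) = (LINT x|torus_measure. b x * texp (k - l) x)"
  by (simp add: texp_diff)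

lemma modulate_0: "modulate 0 \<rho> = \<rho>" by simp

text \<open>At time 0 no pair oscillates, so all matrix elements survive and \<open>b\<close> must
  reproduce every one of them.\<close>

lemma static_limit:
  assumes b: "b \<in> borel_measurable lebesgue" "torus_periodic b" "\<And>x. norm (b x) \<le> K"
    and bA: "\<And>k l. k \<in> int_vecs \<Longrightarrow> l \<in> int_vecs \<Longrightarrow> (LINT x|torus_measure. b x * texp (k - l) x) = A k l"
  shows "(\<lambda>n. B n (modulate (\<eta> n) \<rho>) (modulate (\<eta> n) \<rho>)) \<longlonglongrightarrow> mult_form b \<rho> \<rho>"
proof -
  let ?D = "mult_form b"
  have D: "torus_form K ?D" by (rule torus_form_inner_bounded[OF b])
  have K: "K \<ge> 0" using torus_form_bound(2)[OF D rho rho] .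
  have e1: "B n (modulate (\<eta> n) \<rho>) (modulate (\<eta> n) \<rho>) = quad (B n) (\<eta> n) 0" for n
    by (rule form_propagator_0[OF form modulate_L2[OF eta rho], symmetric])
  have e2: "?D \<rho> \<rho> = quad ?D 0 0"
    using form_propagator_0[OF D rho] unfolding modulate_0 by simp
  show ?thesis unfolding e1 e2
  proof (rule approx_limit)
    fix e :: real assume e: "e > 0"
    \<comment> \<open>One set \<open>F\<close> has to serve the approximating forms, bounded by
      \<open>C\<close>, and the limit form, bounded by \<open>K\<close>.\<close>
    define M where "M = 2 * (C + K) * tnorm \<rho>"
    have M: "M \<ge> 0" using C_nonneg K by (simp add: M_def tnorm_nonneg)
    obtain F where F: "finite F" "F \<subseteq> int_vecs" "M * tnorm (\<lambda>x. \<rho> x - fourier_sum F \<rho> x) \<le> e" by (rule small_error[OF M e])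
    have le: "2 * c * tnorm \<rho> * tnorm (\<lambda>x. \<rho> x - fourier_sum F \<rho> x) \<le> e" if "c \<le> C + K" for c
    proof -
      have "2 * c * tnorm \<rho> * tnorm (\<lambda>x. \<rho> x - fourier_sum F \<rho> x) \<le> M * tnorm (\<lambda>x. \<rho> x - fourier_sum F \<rho> x)"
        unfolding M_def using that by (intro mult_right_mono) (auto simp: tnorm_nonneg)
      then show ?thesis using F(3) by linarith
    qed
    let ?X = "\<lambda>n. truncated F (\<eta> n) (\<lambda>k l. B n (texp (\<eta> n + k)) (texp (\<eta> n + l))) 0"
    let ?Y = "truncated F 0 (\<lambda>k l. ?D (texp (0 + k)) (texp (0 + l))) 0"
    have "?X \<longlonglongrightarrow> truncated F 0 A 0"
      unfolding truncated_def using F(2) by (intro tendsto_intros lim) (auto simp: evolved_phase_def)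
    also have "truncated F 0 A 0 = ?Y"
      unfolding truncated_def add_0 mult_form_texp using F(2) by (intro sum.cong refl arg_cong2[where f = "(*)"] bA[symmetric]) auto
    finally have "?X \<longlonglongrightarrow> ?Y" .
    moreover have "norm (quad (B n) (\<eta> n) 0 - ?X n) \<le> e" for n
      by (rule order_trans[OF truncation_error[OF eta form F(1,2)] le]) (use K in simp)
    moreover have "norm (quad ?D 0 0 - ?Y) \<le> e"
      by (rule order_trans[OF truncation_error[OF _ D F(1,2)] le]) (use C_nonneg in simp_all)
    ultimately show "\<exists>X Y. X \<longlonglongrightarrow> Y \<and> (\<forall>n. norm (quad (B n) (\<eta> n) 0 - X n) \<le> e) \<and> norm (quad ?D 0 0 - Y) \<le> e" by blast
  qed
qed

text \<open>\<open>Rel\<close> is the resonance relation. On resonant pairs the phase is the one for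
  \<open>\<eta>\<close> = 0, that is, the phase of the evolution of \<open>\<rho>\<close> itself,
  which is why the limit is a form in \<open>propagator t \<rho>\<close>; on the other pairs the
  matrix elements of \<open>b\<close> vanish like the limit of the time integrals.\<close>

lemma evolved_limit:
  assumes b: "b \<in> borel_measurable lebesgue" "torus_periodic b" "\<And>x. norm (b x) \<le> K"
    and bA: "\<And>k l. k \<in> int_vecs \<Longrightarrow> l \<in> int_vecs \<Longrightarrow> (LINT x|torus_measure. b x * texp (k - l) x) = (if Rel k l then A k l else 0)"
    and res: "\<And>k l n. k \<in> int_vecs \<Longrightarrow> l \<in> int_vecs \<Longrightarrow> Rel k l \<Longrightarrow> (k - l) \<bullet> \<eta> n = 0"
    and nonres: "\<And>k l. k \<in> int_vecs \<Longrightarrow> l \<in> int_vecs \<Longrightarrow> \<not> Rel k l \<Longrightarrow> filterlim (\<lambda>n. \<bar>(k - l) \<bullet> \<eta> n\<bar>) at_top sequentially"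
    and \<phi>: "integrable lebesgue \<phi>"
  shows "(\<lambda>n. LINT t|lebesgue. \<phi> t * quad (B n) (\<eta> n) t)
    \<longlonglongrightarrow> (LINT t|lebesgue. \<phi> t * mult_form b (propagator t \<rho>) (propagator t \<rho>))"
proof -
  let ?D = "mult_form b"
  have D: "torus_form K ?D" by (rule torus_form_inner_bounded[OF b])
  have K: "K \<ge> 0" using torus_form_bound(2)[OF D rho rho] .
  have e2: "?D (propagator t \<rho>) (propagator t \<rho>) = quad ?D 0 t" for t unfolding modulate_0 ..
  let ?I = "LINT t|lebesgue. norm (\<phi> t)"
  have I: "?I \<ge> 0" by (intro integral_nonneg_AE) auto
  show ?thesis unfolding e2
  proof (rule approx_limit)
    fix e :: real assume e: "e > 0"
    define M where "M = 2 * (C + K) * tnorm \<rho> * ?I"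
    have M: "M \<ge> 0" using C_nonneg K I by (simp add: M_def tnorm_nonneg)
    obtain F where F: "finite F" "F \<subseteq> int_vecs" "M * tnorm (\<lambda>x. \<rho> x - fourier_sum F \<rho> x) \<le> e" by (rule small_error[OF M e])
    have le: "2 * c * tnorm \<rho> * tnorm (\<lambda>x. \<rho> x - fourier_sum F \<rho> x) * ?I \<le> e" if "c \<le> C + K" for c
    proof -
      have "2 * c * tnorm \<rho> * tnorm (\<lambda>x. \<rho> x - fourier_sum F \<rho> x) * ?I = 2 * c * (tnorm \<rho> * tnorm (\<lambda>x. \<rho> x - fourier_sum F \<rho> x) * ?I)"
        by (simp add: mult_ac)
      also have "\<dots> \<le> 2 * (C + K) * (tnorm \<rho> * tnorm (\<lambda>x. \<rho> x - fourier_sum F \<rho> x) * ?I)"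
        using that I by (intro mult_right_mono) (auto simp: tnorm_nonneg)
      also have "\<dots> = M * tnorm (\<lambda>x. \<rho> x - fourier_sum F \<rho> x)" by (simp add: M_def mult_ac)
      finally show ?thesis using F(3) by linarith
    qed
    let ?X = "\<lambda>n. LINT t|lebesgue. \<phi> t * truncated F (\<eta> n) (\<lambda>k l. B n (texp (\<eta> n + k)) (texp (\<eta> n + l))) t"
    let ?Y = "LINT t|lebesgue. \<phi> t * truncated F 0 (\<lambda>k l. ?D (texp (0 + k)) (texp (0 + l))) t"
    let ?P = "\<lambda>k l. LINT t|lebesgue. \<phi> t * evolved_phase t 0 k l"
    have ph: "(\<lambda>n. LINT t|lebesgue. \<phi> t * evolved_phase t (\<eta> n) k l) \<longlonglongrightarrow> (if Rel k l then ?P k l else 0)"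
      if kl: "k \<in> int_vecs" "l \<in> int_vecs" for k l
    proof (cases "Rel k l")
      case True
      have "evolved_phase t (\<eta> n) k l = evolved_phase t 0 k l" for t n
        unfolding evolved_phase_shift[of t "\<eta> n"] using res[OF kl True, of n] by simp
      then show ?thesis using True by simp
    next
      case False
      have "integrable lebesgue (\<lambda>t. \<phi> t * evolved_phase t 0 k l)"
        by (rule integrable_mult_unimodular[OF \<phi> evolved_phase_measurable]) simp
      from Riemann_Lebesgue[OF this, of "\<lambda>n. - ((k - l) \<bullet> \<eta> n)"] nonres[OF kl False]
      have "(\<lambda>n. LINT t|lebesgue. \<phi> t * evolved_phase t 0 k l * cis (- ((k - l) \<bullet> \<eta> n) * t)) \<longlonglongrightarrow> 0"
        unfolding abs_minus_cancel by blast
      then show ?thesis using False unfolding evolved_phase_shift[of _ "\<eta> _"] by (simp add: mult.assoc)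
    qed
    have "?X \<longlonglongrightarrow> (\<Sum>k\<in>F. \<Sum>l\<in>F. fourier_coeff \<rho> k * cnj (fourier_coeff \<rho> l) * A k l * (if Rel k l then ?P k l else 0))"
      unfolding integral_truncated[OF \<phi>] using F(2) by (intro tendsto_sum tendsto_mult tendsto_const lim ph) auto
    also have "(\<Sum>k\<in>F. \<Sum>l\<in>F. fourier_coeff \<rho> k * cnj (fourier_coeff \<rho> l) * A k l * (if Rel k l then ?P k l else 0)) = ?Y"
      unfolding integral_truncated[OF \<phi>] add_0 mult_form_texp
    proof (intro sum.cong refl)
      fix k l assume "k \<in> F" "l \<in> F"
      then have kl: "k \<in> int_vecs" "l \<in> int_vecs" using F(2) by auto
      show "fourier_coeff \<rho> k * cnj (fourier_coeff \<rho> l) * A k l * (if Rel k l then ?P k l else 0)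
        = fourier_coeff \<rho> k * cnj (fourier_coeff \<rho> l) * (LINT x|torus_measure. b x * texp (k - l) x) * ?P k l"
        unfolding bA[OF kl] by simp
    qed
    finally have "?X \<longlonglongrightarrow> ?Y" .
    moreover have "norm ((LINT t|lebesgue. \<phi> t * quad (B n) (\<eta> n) t) - ?X n) \<le> e" for n
      by (rule order_trans[OF integral_quad_truncated[OF eta form F(1,2) \<phi>] le]) (use K in simp)
    moreover have "norm ((LINT t|lebesgue. \<phi> t * quad ?D 0 t) - ?Y) \<le> e"
      by (rule order_trans[OF integral_quad_truncated[OF _ D F(1,2) \<phi>] le]) (use C_nonneg in simp_all)
    ultimately show "\<exists>X Y. X \<longlonglongrightarrow> Y \<and> (\<forall>n. norm ((LINT t|lebesgue. \<phi> t * quad (B n) (\<eta> n) t) - X n) \<le> e)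
      \<and> norm ((LINT t|lebesgue. \<phi> t * quad ?D 0 t) - Y) \<le> e" by blast
  qed
qed

end

subsection \<open>Averages along the geodesic flow\<close>

text \<open>For an integer vector the orbits of the flow close up after time 2 pi, so that averages
  along the flow are means over one period.\<close>

abbreviation period_measure :: "real measure" where "period_measure \<equiv> lebesgue_on {0..2 * pi}"

lemma finite_measure_lebesgue_on: "finite_measure (lebesgue_on {a..b :: real})"
  by (rule finite_measureI) (simp add: emeasure_restrict_space space_restrict_space emeasure_lborel_Icc_eq)

lemma pair_torus_period: "pair_sigma_finite (torus_measure :: (real ^ 'd::finite) measure) period_measure"
  by (intro pair_sigma_finite.intro finite_measure.sigma_finite_measure finite_measure_torus finite_measure_lebesgue_on)

lemma period_measurable:
  "f \<in> borel_measurable borel \<Longrightarrow> f \<in> borel_measurable (lebesgue_on S)"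
  by (intro measurable_restrict_space1 measurable_completion) simp

lemma measurable_pair_torus_period [measurable]:
  "fst \<in> torus_measure \<Otimes>\<^sub>M period_measure \<rightarrow>\<^sub>M (borel :: (real ^ 'd::finite) measure)"
  "snd \<in> (torus_measure :: (real ^ 'd::finite) measure) \<Otimes>\<^sub>M period_measure \<rightarrow>\<^sub>M borel"
  using measurable_compose[OF measurable_fst period_measurable[of "\<lambda>x. x"]]
    measurable_compose[OF measurable_snd period_measurable[of "\<lambda>x. x"]] by auto

lemma torus_periodic_translate: "torus_periodic f \<Longrightarrow> torus_periodic (\<lambda>x. f (x + v))"
  using torus_eq_add unfolding torus_periodic_def by blast

text \<open>Fubini and translation invariance: averaging a density along the flow is dual to
  averaging the test function along the reversed flow. Integrability along almost every orbit comes
  from the same double integral.\<close>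

lemma flow_average_adjoint:
  fixes g \<alpha> :: "real ^ 'd::finite \<Rightarrow> complex" and \<xi> :: "real ^ 'd"
  assumes g: "g \<in> borel_measurable borel" "torus_periodic g" "integrable torus_measure g"
    and \<alpha>: "\<alpha> \<in> borel_measurable borel" "torus_periodic \<alpha>" "\<And>x. norm (\<alpha> x) \<le> K"
  shows "AE x in torus_measure. integrable period_measure (\<lambda>s. g (x + s *\<^sub>R \<xi>))"
    and "integrable torus_measure (\<lambda>x. LINT s|period_measure. g (x + s *\<^sub>R \<xi>))"
    and "(LINT x|torus_measure. \<alpha> x * (LINT s|period_measure. g (x + s *\<^sub>R \<xi>)))
      = (LINT x|torus_measure. (LINT s|period_measure. \<alpha> (x - s *\<^sub>R \<xi>)) * g x)"
proof -
  interpret pair_sigma_finite "torus_measure :: (real ^ 'd) measure" period_measure by (rule pair_torus_period)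
  interpret swap: pair_sigma_finite period_measure "torus_measure :: (real ^ 'd) measure" ..
  interpret P: finite_measure period_measure by (rule finite_measure_lebesgue_on)
  note [measurable] = g(1) \<alpha>(1)
  have gt: "g \<in> borel_measurable torus_measure" by (rule period_measurable[OF g(1)])
  have tr: "integrable torus_measure (\<lambda>x. g (x + v))" for v
    using torus_param_translation_integral(2)[OF gt g(2)] g(3) by blast
  have ms: "(\<lambda>(s, x). g (x + s *\<^sub>R \<xi>)) \<in> borel_measurable (period_measure \<Otimes>\<^sub>M torus_measure)"
  proof -
    have "(\<lambda>p. g (fst p + snd p *\<^sub>R \<xi>)) \<in> borel_measurable (torus_measure \<Otimes>\<^sub>M period_measure)" by measurable
    from measurable_compose[OF measurable_pair_swap' this] show ?thesis by (simp add: case_prod_unfold)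
  qed
  \<comment> \<open>Integrating over the torus first is the useful order: the norm of a translate
    does not depend on s.\<close>
  have "integrable (period_measure \<Otimes>\<^sub>M torus_measure) (\<lambda>(s, x). g (x + s *\<^sub>R \<xi>))"
  proof (rule swap.Fubini_integrable[OF ms])
    have "(LINT x|torus_measure. norm (g (x + s *\<^sub>R \<xi>))) = (LINT x|torus_measure. norm (g x))" for s
      using torus_param_translation_integral(1)[of "\<lambda>x. norm (g x)" "s *\<^sub>R \<xi>"] gt torus_periodic_comp[OF g(2), of norm] by auto
    then show "integrable period_measure (\<lambda>s. LINT x|torus_measure. norm (case (s, x) of (s, x) \<Rightarrow> g (x + s *\<^sub>R \<xi>)))"
      by (simp add: P.integrable_const)
    show "AE s in period_measure. integrable torus_measure (\<lambda>x. case (s, x) of (s, x) \<Rightarrow> g (x + s *\<^sub>R \<xi>))"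
      using tr by simp
  qed
  from swap.integrable_product_swap[OF this]
  have i1: "integrable (torus_measure \<Otimes>\<^sub>M period_measure) (\<lambda>p. g (fst p + snd p *\<^sub>R \<xi>))" by (simp add: case_prod_unfold)
  show "AE x in torus_measure. integrable period_measure (\<lambda>s. g (x + s *\<^sub>R \<xi>))"
    using AE_integrable_fst'[OF i1] by simp
  show "integrable torus_measure (\<lambda>x. LINT s|period_measure. g (x + s *\<^sub>R \<xi>))"
    using integrable_fst'[OF i1] by simp
  have i2: "integrable (torus_measure \<Otimes>\<^sub>M period_measure) (\<lambda>(x, s). \<alpha> x * g (x + s *\<^sub>R \<xi>))"
  proof (rule Bochner_Integration.integrable_bound[OF integrable_mult_right[OF i1, of "of_real K"]])
    show "(\<lambda>(x, s). \<alpha> x * g (x + s *\<^sub>R \<xi>)) \<in> borel_measurable (torus_measure \<Otimes>\<^sub>M period_measure)"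
      unfolding case_prod_unfold by measurable
    show "AE p in torus_measure \<Otimes>\<^sub>M period_measure. norm (case p of (x, s) \<Rightarrow> \<alpha> x * g (x + s *\<^sub>R \<xi>)) \<le> norm (of_real K * g (fst p + snd p *\<^sub>R \<xi>))"
      by (intro AE_I2) (auto simp: norm_mult intro!: mult_right_mono order_trans[OF \<alpha>(3) abs_ge_self])
  qed
  have "integrable (torus_measure \<Otimes>\<^sub>M period_measure) (\<lambda>(x, s). g x * (\<lambda>_. 1) s)"
    by (rule integrable_pair_mult[OF g(3) P.integrable_const])
  then have i3: "integrable (torus_measure \<Otimes>\<^sub>M period_measure) (\<lambda>(x, s). \<alpha> (x - s *\<^sub>R \<xi>) * g x)"
  proof (rule Bochner_Integration.integrable_bound[OF integrable_mult_right[of "of_real K"]])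
    show "(\<lambda>(x, s). \<alpha> (x - s *\<^sub>R \<xi>) * g x) \<in> borel_measurable (torus_measure \<Otimes>\<^sub>M period_measure)"
      unfolding case_prod_unfold by measurable
    show "AE p in torus_measure \<Otimes>\<^sub>M period_measure. norm (case p of (x, s) \<Rightarrow> \<alpha> (x - s *\<^sub>R \<xi>) * g x) \<le> norm (of_real K * (case p of (x, s) \<Rightarrow> g x * (\<lambda>_. 1) s))"
      by (intro AE_I2) (auto simp: norm_mult intro!: mult_right_mono order_trans[OF \<alpha>(3) abs_ge_self])
  qed
  have "(LINT x|torus_measure. \<alpha> x * (LINT s|period_measure. g (x + s *\<^sub>R \<xi>)))
    = (LINT x|torus_measure. (LINT s|period_measure. \<alpha> x * g (x + s *\<^sub>R \<xi>)))" by simp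
  also have "\<dots> = (LINT s|period_measure. (LINT x|torus_measure. \<alpha> x * g (x + s *\<^sub>R \<xi>)))"
    by (rule Fubini_integral[OF i2, symmetric])
  also have "\<dots> = (LINT s|period_measure. (LINT x|torus_measure. \<alpha> (x - s *\<^sub>R \<xi>) * g x))"
  proof (rule Bochner_Integration.integral_cong[OF refl])
    fix s
    let ?G = "\<lambda>x. \<alpha> (x + - (s *\<^sub>R \<xi>)) * g x"
    have "?G \<in> borel_measurable borel" by measurable
    then have m: "?G \<in> borel_measurable torus_measure" by (rule period_measurable)
    have p: "torus_periodic ?G" by (rule torus_periodic_comp2[OF torus_periodic_translate[OF \<alpha>(2)] g(2)])
    show "(LINT x|torus_measure. \<alpha> x * g (x + s *\<^sub>R \<xi>)) = (LINT x|torus_measure. \<alpha> (x - s *\<^sub>R \<xi>) * g x)"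
      using torus_param_translation_integral(1)[OF m p, of "s *\<^sub>R \<xi>"] by simp
  qed
  also have "\<dots> = (LINT x|torus_measure. (LINT s|period_measure. \<alpha> (x - s *\<^sub>R \<xi>) * g x))"
    by (rule Fubini_integral[OF i3])
  finally show "(LINT x|torus_measure. \<alpha> x * (LINT s|period_measure. g (x + s *\<^sub>R \<xi>)))
      = (LINT x|torus_measure. (LINT s|period_measure. \<alpha> (x - s *\<^sub>R \<xi>)) * g x)" by simp
qed

text \<open>With k full periods in [0, T], monotonicity puts the integral between k and k + 1 times
  the integral over a period; dividing by T leaves an error of at most that integral over T.\<close>

lemma periodic_mean:
  fixes g :: "real \<Rightarrow> real"
  assumes g: "g \<in> borel_measurable borel" "\<And>s. g s \<ge> 0" "\<And>s. g (s + 2 * pi) = g s" and i: "integrable period_measure g"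
  shows "((\<lambda>T. (LINT s|lebesgue_on {0..T}. g s) / T) \<longlongrightarrow> (LINT s|period_measure. g s) / (2 * pi)) at_top"
proof -
  note [measurable] = g(1)
  let ?m = "LINT s|period_measure. g s"
  \<comment> \<open>Half-open intervals tile the line exactly, and extended nonnegative values defer
    integrability on [0, T] until it follows from the bound by k + 1 periods.\<close>
  define G where "G T = (\<integral>\<^sup>+s. ennreal (g s) * indicator {0..<T} s \<partial>lborel)" for T
  have m0: "?m \<ge> 0" using g(2) by (intro integral_nonneg_AE) auto
  have half_open: "(\<integral>\<^sup>+s. ennreal (g s) \<partial>lebesgue_on {0..T}) = G T" for T
  proof -
    have "(\<integral>\<^sup>+s. ennreal (g s) \<partial>lebesgue_on {0..T}) = (\<integral>\<^sup>+s. ennreal (g s) * indicator {0..T} s \<partial>lebesgue)"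
      by (rule nn_integral_restrict_space) simp
    also have "\<dots> = (\<integral>\<^sup>+s. ennreal (g s) * indicator {0..T} s \<partial>lborel)" by (rule nn_integral_completion)
    also have "\<dots> = G T"
      unfolding G_def
    proof (rule nn_integral_cong_AE)
      show "AE s in lborel. ennreal (g s) * indicator {0..T} s = ennreal (g s) * indicator {0..<T} s"
        using AE_lborel_singleton[of T] by eventually_elim (auto simp: indicator_def)
    qed
    finally show ?thesis .
  qed
  have Gm: "G (2 * pi) = ennreal ?m"
    using nn_integral_eq_integral[OF i] g(2) unfolding half_open[symmetric] by simp
  have step: "G (T + 2 * pi) = G (2 * pi) + G T" if T: "T \<ge> 0" for T
  proof -
    have "G (T + 2 * pi) = (\<integral>\<^sup>+s. ennreal (g s) * indicator {0..<2 * pi} s + ennreal (g s) * indicator {2 * pi..<T + 2 * pi} s \<partial>lborel)"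
      unfolding G_def
    proof (rule nn_integral_cong)
      fix s
      have "0 \<le> s" if "2 * pi \<le> s" using that pi_gt_zero by linarith
      then show "ennreal (g s) * indicator {0..<T + 2 * pi} s = ennreal (g s) * indicator {0..<2 * pi} s + ennreal (g s) * indicator {2 * pi..<T + 2 * pi} s"
        using T by (auto simp: indicator_def)
    qed
    also have "\<dots> = G (2 * pi) + (\<integral>\<^sup>+s. ennreal (g s) * indicator {2 * pi..<T + 2 * pi} s \<partial>lborel)"
      unfolding G_def by (rule nn_integral_add) measurable
    also have "(\<integral>\<^sup>+s. ennreal (g s) * indicator {2 * pi..<T + 2 * pi} s \<partial>lborel)
      = (\<integral>\<^sup>+s. ennreal (g (2 * pi + 1 * s)) * indicator {2 * pi..<T + 2 * pi} (2 * pi + 1 * s) \<partial>lborel)"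
      by (subst nn_integral_real_affine[where c = 1 and t = "2 * pi"]) auto
    also have "\<dots> = G T"
      unfolding G_def using g(3) by (intro nn_integral_cong) (auto simp: indicator_def add.commute[of "2 * pi"])
    finally show ?thesis .
  qed
  have Gk: "G (real k * (2 * pi)) = ennreal (real k * ?m)" for k
  proof (induction k)
    case 0 show ?case by (simp add: G_def)
  next
    case (Suc k)
    have "G (real (Suc k) * (2 * pi)) = G (real k * (2 * pi) + 2 * pi)" by (rule arg_cong[of _ _ G]) (simp add: algebra_simps)
    also have "\<dots> = ennreal ?m + ennreal (real k * ?m)" using step[of "real k * (2 * pi)"] Suc Gm by simp
    also have "\<dots> = ennreal (real (Suc k) * ?m)" using m0 by (simp add: algebra_simps flip: ennreal_plus)
    finally show ?case .
  qed
  have mono: "G S \<le> G T" if "S \<le> T" for S T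
    unfolding G_def using that by (intro nn_integral_mono mult_left_mono) (auto simp: indicator_def)
  have bounds: "\<bar>(LINT s|lebesgue_on {0..T}. g s) / T - ?m / (2 * pi)\<bar> \<le> ?m / T" if T: "T > 0" for T
  proof -
    define k where "k = nat \<lfloor>T / (2 * pi)\<rfloor>"
    have k: "real k * (2 * pi) \<le> T" "T \<le> real (Suc k) * (2 * pi)"
    proof -
      have "real k = of_int \<lfloor>T / (2 * pi)\<rfloor>" using T by (simp add: k_def)
      then have "real k \<le> T / (2 * pi)" "T / (2 * pi) \<le> real k + 1" by linarith+
      then show "real k * (2 * pi) \<le> T" "T \<le> real (Suc k) * (2 * pi)" by (simp_all add: field_simps)
    qed
    define r where "r = (LINT s|lebesgue_on {0..T}. g s)"
    have up: "G T \<le> ennreal (real (Suc k) * ?m)" using mono[OF k(2)] unfolding Gk .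
    have "integrable (lebesgue_on {0..T}) g"
    proof (rule integrableI_nonneg)
      show "g \<in> borel_measurable (lebesgue_on {0..T})" by (rule period_measurable[OF g(1)])
      show "(\<integral>\<^sup>+s. ennreal (g s) \<partial>lebesgue_on {0..T}) < \<infinity>" unfolding half_open by (rule le_less_trans[OF up]) simp
    qed (use g(2) in auto)
    from nn_integral_eq_integral[OF this] have Gr: "G T = ennreal r" unfolding half_open r_def using g(2) by simp
    have r0: "r \<ge> 0" unfolding r_def using g(2) by (intro integral_nonneg_AE) auto
    have 1: "r \<le> real (Suc k) * ?m" using up m0 r0 unfolding Gr by (subst (asm) ennreal_le_iff) auto
    have 2: "real k * ?m \<le> r" using mono[OF k(1)] r0 unfolding Gk Gr by (subst (asm) ennreal_le_iff) auto
    have 3: "real k * ?m \<le> T / (2 * pi) * ?m" "T / (2 * pi) * ?m \<le> real (Suc k) * ?m"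
      using k m0 by (intro mult_right_mono; simp add: field_simps)+
    have "\<bar>r - T / (2 * pi) * ?m\<bar> \<le> ?m" using 1 2 3 by (simp add: algebra_simps)
    then have "\<bar>r - T / (2 * pi) * ?m\<bar> / T \<le> ?m / T" using T by (intro divide_right_mono) auto
    moreover have "\<bar>r - T / (2 * pi) * ?m\<bar> / T = \<bar>r / T - ?m / (2 * pi)\<bar>"
    proof -
      have "(r - T / (2 * pi) * ?m) / T = r / T - ?m / (2 * pi)" using T by (simp add: field_simps)
      then show ?thesis using T by (metis abs_divide abs_of_pos)
    qed
    ultimately show ?thesis unfolding r_def by simp
  qed
  have "((\<lambda>T. ?m / T) \<longlongrightarrow> 0) at_top" by (rule tendsto_divide_0[OF tendsto_const filterlim_at_top_imp_at_infinity[OF filterlim_ident]])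
  then have "((\<lambda>T. (LINT s|lebesgue_on {0..T}. g s) / T - ?m / (2 * pi)) \<longlongrightarrow> 0) at_top"
    by (rule Lim_null_comparison[rotated]) (use bounds in \<open>auto intro!: eventually_mono[OF eventually_gt_at_top[of 0]]\<close>)
  then show ?thesis by (rule LIM_zero_cancel)
qed

lemma torus_cell_lebesgue: "torus_cell \<in> sets (lebesgue :: (real ^ 'd::finite) measure)"
  using sets_torus_measure[of "torus_cell :: (real ^ 'd) set"] sets.top[of "torus_measure :: (real ^ 'd) measure"] by (simp add: space_restrict_space)

lemma AE_torus_measure: "(AE x in lebesgue. P x) \<Longrightarrow> AE x in torus_measure. P x"
  by (subst AE_restrict_space_iff) (auto intro: torus_cell_lebesgue AE_mp)

text \<open>A Lebesgue measurable function need not be measurable along an individual orbit, so that the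
  averages are computed for a Borel representative.\<close>

lemma borel_representative:
  fixes f :: "real ^ 'd::finite \<Rightarrow> real"
  assumes f: "f \<in> borel_measurable lebesgue" "torus_periodic f" "\<And>x. f x \<ge> 0"
  obtains g where "g \<in> borel_measurable borel" "torus_periodic g" "\<And>x. g x \<ge> 0" "AE x in lborel. f x = g x"
proof -
  obtain g0 where g0: "g0 \<in> borel_measurable lborel" "AE x in lborel. f x = g0 x"
    using completion_ex_borel_measurable_real[OF f(1)] by blast
  then obtain N where N: "{x \<in> space lborel. f x \<noteq> g0 x} \<subseteq> N" "N \<in> null_sets lborel" by (auto elim!: AE_E simp: null_sets_def)
  \<comment> \<open>Reduction to the cell makes the Borel version periodic and the absolute value
    makes it nonnegative, without harm since f is both. The exceptional set is spread over all
    lattice translates and stays null, as there are countably many.\<close>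
  let ?g = "\<lambda>x. \<bar>g0 (torus_red x)\<bar>"
  let ?M = "\<Union>k\<in>int_vecs. (\<lambda>x. (2 * pi) *\<^sub>R k + x) ` N"
  have M: "?M \<in> null_sets lebesgue"
  proof (rule null_sets_UN'[OF countable_int_vecs])
    fix k :: "real ^ 'd"
    show "(\<lambda>x. (2 * pi) *\<^sub>R k + x) ` N \<in> null_sets lebesgue"
      using negligible_translation[of N "(2 * pi) *\<^sub>R k"] null_sets_completionI[OF N(2)] by (simp add: negligible_iff_null_sets)
  qed
  show thesis
  proof (rule that)
    show "?g \<in> borel_measurable borel" using g0(1) by measurable
    show "torus_periodic ?g" unfolding torus_periodic_def using torus_red_cong by metis
    have "AE x in lebesgue. f x = ?g x"
    proof (rule AE_I'[OF M], rule subsetI)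
      fix x assume "x \<in> {x \<in> space lebesgue. f x \<noteq> ?g x}"
      then have ne: "f x \<noteq> \<bar>g0 (torus_red x)\<bar>" by simp
      have "torus_red x \<in> N"
      proof (rule ccontr)
        assume "torus_red x \<notin> N"
        then have "f (torus_red x) = g0 (torus_red x)" using N(1) by auto
        then show False using ne torus_periodic_red[OF f(2), of x] f(3)[of x] by simp
      qed
      moreover obtain k where k: "k \<in> int_vecs" "x = torus_red x + (2 * pi) *\<^sub>R k"
        using torus_eq_sym[OF torus_eq_red[of x]] unfolding torus_eq_def by blast
      ultimately show "x \<in> ?M" by (intro UN_I[OF k(1)] image_eqI[of _ _ "torus_red x"]) (simp_all add: add.commute)
    qed
    then show "AE x in lborel. f x = ?g x" by (simp add: AE_completion_iff)
  qed simp
qed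

text \<open>For each fixed time a translate of a null set is null. Enclosing the exceptional set in
  a Borel null set allows the two almost-everywhere quantifiers to be exchanged.\<close>

lemma AE_along_flow:
  fixes P :: "real ^ 'd::finite \<Rightarrow> bool"
  assumes P: "AE x in lborel. P x"
  shows "AE x in torus_measure. AE s in lebesgue. P (x + s *\<^sub>R \<xi>)"
proof -
  obtain N where N: "{x \<in> space lborel. \<not> P x} \<subseteq> N" "N \<in> null_sets lborel" using P by (auto elim!: AE_E simp: null_sets_def)
  have Nb [measurable]: "N \<in> sets borel" using N(2) by (simp add: null_sets_def)
  have a: "AE x in lborel. x + v \<notin> N" for v :: "real ^ 'd"
  proof -
    have "AE x in distr lborel borel ((+) v). x \<notin> N" unfolding lborel_distr_plus using N(2) by (rule AE_not_in)
    then have "AE x in lborel. v + x \<notin> N" by (subst (asm) AE_distr_iff) auto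
    then show ?thesis by (simp add: add.commute)
  qed
  have "AE x in lborel. AE s in (lborel :: real measure). x + s *\<^sub>R \<xi> \<notin> N"
  proof (subst lborel_pair.AE_commute)
    show "{p \<in> space (lborel \<Otimes>\<^sub>M lborel). fst p + snd p *\<^sub>R \<xi> \<notin> N} \<in> sets (lborel \<Otimes>\<^sub>M (lborel :: real measure))" by measurable
    show "AE s in lborel. AE x in lborel. x + s *\<^sub>R \<xi> \<notin> N" using a by simp
  qed
  then have "AE x in lborel. AE s in lebesgue. P (x + s *\<^sub>R \<xi>)"
  proof eventually_elim
    case (elim x)
    then have "AE s in lborel. P (x + s *\<^sub>R \<xi>)" by eventually_elim (use N(1) in auto)
    then show ?case by (rule AE_completion)
  qed
  then show ?thesis by (intro AE_torus_measure AE_completion)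
qed

lemma integral_lebesgue_on_cong_AE:
  fixes f g :: "real \<Rightarrow> real"
  assumes g: "g \<in> borel_measurable borel" and ae: "AE s in lebesgue. f s = g s"
  shows "(LINT s|lebesgue_on {0..T}. f s) = (LINT s|lebesgue_on {0..T}. g s)"
proof (rule integral_cong_AE)
  have gl: "g \<in> borel_measurable lebesgue" using g by (intro measurable_completion) simp
  have "f \<in> borel_measurable lebesgue" by (rule borel_measurable_AE[OF gl]) (use ae in \<open>eventually_elim, simp\<close>)
  then show "f \<in> borel_measurable (lebesgue_on {0..T})" by (rule measurable_restrict_space1)
  show "g \<in> borel_measurable (lebesgue_on {0..T})" using gl by (rule measurable_restrict_space1)
  show "AE s in lebesgue_on {0..T}. f s = g s" by (subst AE_restrict_space_iff) (use ae in \<open>auto elim: AE_mp\<close>)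
qed

text \<open>For almost every x the orbit meets the exceptional set only at a null set of times, so
  all time integrals agree with those of the Borel function and \<open>periodic_mean\<close>
  identifies the \<open>Lim\<close>.\<close>

lemma flow_average_ae:
  fixes f g :: "real ^ 'd::finite \<Rightarrow> real"
  assumes \<xi>: "\<xi> \<in> int_vecs"
    and g: "g \<in> borel_measurable borel" "torus_periodic g" "\<And>x. g x \<ge> 0" "integrable torus_measure g"
    and ae: "AE x in lborel. f x = g x"
  shows "AE x in torus_measure. flow_average \<xi> f x = (LINT s|period_measure. g (x + s *\<^sub>R \<xi>)) / (2 * pi)"
proof -
  note [measurable] = g(1)
  have "AE x in torus_measure. integrable period_measure (\<lambda>s. complex_of_real (g (x + s *\<^sub>R \<xi>)))"
    by (rule flow_average_adjoint(1)[of _ "\<lambda>_. 0" 0])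
      (use g in \<open>auto intro!: integrable_of_real torus_periodic_comp simp: torus_periodic_def\<close>)
  moreover have "AE x in torus_measure. AE s in lebesgue. f (x + s *\<^sub>R \<xi>) = g (x + s *\<^sub>R \<xi>)"
    by (rule AE_along_flow[OF ae])
  ultimately show ?thesis
  proof eventually_elim
    case (elim x)
    have m: "(\<lambda>s. g (x + s *\<^sub>R \<xi>)) \<in> borel_measurable borel" by measurable
    have i: "integrable period_measure (\<lambda>s. g (x + s *\<^sub>R \<xi>))" using integrable_Re[OF elim(1)] by simp
    have p: "g (x + (s + 2 * pi) *\<^sub>R \<xi>) = g (x + s *\<^sub>R \<xi>)" for s
      by (rule torus_periodicD[OF g(2), symmetric]) (use \<xi> in \<open>auto simp: torus_eq_def algebra_simps intro!: bexI[of _ \<xi>]\<close>)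
    have "((\<lambda>T. (LINT s|lebesgue_on {0..T}. f (x + s *\<^sub>R \<xi>)) / T) \<longlongrightarrow> (LINT s|period_measure. g (x + s *\<^sub>R \<xi>)) / (2 * pi)) at_top"
      unfolding integral_lebesgue_on_cong_AE[OF m elim(2)] by (rule periodic_mean[OF m g(3) p i])
    then show ?case unfolding flow_average_def by (intro tendsto_Lim) simp_all
  qed
qed

subsection \<open>Integration against the limit measures\<close>

text \<open>Fubini against a point mass. Nonnegativity of the density is asked only almost
  everywhere because flow averages are identified only almost everywhere.\<close>

lemma integral_dx_dirac:
  fixes f :: "real ^ 'd::finite \<Rightarrow> real" and a :: "(real ^ 'd) \<times> (real ^ 'd) \<Rightarrow> complex"
  assumes a: "a \<in> torus_symbols" and f: "integrable torus_measure f" "AE x in torus_measure. f x \<ge> 0"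
  shows "(LINT p|dx_dirac f \<xi>. a p) = (LINT x|torus_measure. a (x, \<xi>) * of_real (f x))"
proof -
  let ?D = "density torus_measure (\<lambda>x. ennreal (f x))" and ?R = "return borel \<xi>"
  obtain K where K: "\<And>p. norm (a p) \<le> K" using symbol_bounded[OF a] by blast
  have fm [measurable]: "f \<in> borel_measurable torus_measure" using f(1) by (rule borel_measurable_integrable)
  have D: "finite_measure ?D"
  proof (rule finite_measureI)
    have "emeasure ?D (space ?D) = (\<integral>\<^sup>+x. ennreal (f x) \<partial>torus_measure)"
      by (subst emeasure_density) (auto intro!: nn_integral_cong simp: space_restrict_space)
    also have "\<dots> = ennreal (LINT x|torus_measure. f x)" by (rule nn_integral_eq_integral[OF f])
    finally show "emeasure ?D (space ?D) \<noteq> \<infinity>" by simp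
  qed
  have R: "prob_space ?R" by (rule prob_space_return) simp
  interpret R: prob_space ?R by (rule R)
  interpret pair_sigma_finite ?D ?R
    by (intro pair_sigma_finite.intro finite_measure.sigma_finite_measure[OF D] R.sigma_finite_measure)
  have am: "a \<in> borel_measurable borel" by (rule borel_measurable_continuous_onI[OF symbol_continuous[OF a]])
  have "(\<lambda>x. x) \<in> ?D \<rightarrow>\<^sub>M borel" using period_measurable[of "\<lambda>x. x" torus_cell] by simp
  then have "(\<lambda>p. (fst p, snd p)) \<in> ?D \<Otimes>\<^sub>M ?R \<rightarrow>\<^sub>M borel"
    by (intro borel_measurable_Pair measurable_compose[OF measurable_fst] measurable_compose[OF measurable_snd]) auto
  from measurable_compose[OF this am] have m: "a \<in> borel_measurable (?D \<Otimes>\<^sub>M ?R)" by simp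
  have i: "integrable (?D \<Otimes>\<^sub>M ?R) a"
    by (rule finite_measure.integrable_const_bound[OF finite_measure_pair_measure[OF R.finite_measure_axioms D], of _ K]) (use m K in auto)
  have s: "(\<lambda>y. a (x, y)) \<in> borel_measurable ?R" for x
    by (simp, rule borel_measurable_continuous_onI, rule continuous_on_compose2[OF symbol_continuous[OF a]]) (auto intro!: continuous_intros)
  have "(LINT p|dx_dirac f \<xi>. a p) = (LINT x|?D. (LINT y|?R. a (x, y)))"
    unfolding dx_dirac_def by (rule integral_fst'[OF i, symmetric])
  also have "\<dots> = (LINT x|?D. a (x, \<xi>))"
    by (intro Bochner_Integration.integral_cong refl integral_return) (use s in auto)
  also have "\<dots> = (LINT x|torus_measure. f x *\<^sub>R a (x, \<xi>))"
    by (rule integral_density) (use f(2) torus_measurableI[OF symbol_fiber_measurable[OF a]] in auto)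
  finally show ?thesis by (simp add: scaleR_conv_of_real mult.commute)
qed

text \<open>The mean over one period of the reversed flow, adjoint to the average in the theorem. It
  is applied to the continuous symbol, so boundedness and measurability at every point are
  preserved.\<close>

definition orbit_mean :: "real ^ 'd::finite \<Rightarrow> (real ^ 'd \<Rightarrow> complex) \<Rightarrow> real ^ 'd \<Rightarrow> complex" where
  "orbit_mean \<xi> \<alpha> x = (LINT s|period_measure. \<alpha> (x - s *\<^sub>R \<xi>)) / (2 * pi)"

lemma orbit_mean:
  fixes \<alpha> :: "real ^ 'd::finite \<Rightarrow> complex"
  assumes \<alpha>: "\<alpha> \<in> borel_measurable borel" "torus_periodic \<alpha>" "\<And>x. norm (\<alpha> x) \<le> K"
  shows "orbit_mean \<xi> \<alpha> \<in> borel_measurable lebesgue" "torus_periodic (orbit_mean \<xi> \<alpha>)" "norm (orbit_mean \<xi> \<alpha> x) \<le> K"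
proof -
  interpret P: finite_measure period_measure by (rule finite_measure_lebesgue_on)
  have "(\<lambda>p. \<alpha> (fst p - snd p *\<^sub>R \<xi>)) \<in> borel_measurable (borel \<Otimes>\<^sub>M period_measure)"
  proof -
    have "snd \<in> borel \<Otimes>\<^sub>M period_measure \<rightarrow>\<^sub>M (borel :: real measure)"
      using measurable_compose[OF measurable_snd period_measurable[of "\<lambda>x. x"]] by auto
    then have "(\<lambda>p. fst p - snd p *\<^sub>R \<xi>) \<in> borel_measurable (borel \<Otimes>\<^sub>M period_measure)"
      by (intro borel_measurable_diff borel_measurable_scaleR measurable_fst) auto
    from measurable_compose[OF this \<alpha>(1)] show ?thesis .
  qed
  then have "orbit_mean \<xi> \<alpha> \<in> borel_measurable borel"
    unfolding orbit_mean_def[abs_def]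
    by (intro borel_measurable_divide P.borel_measurable_lebesgue_integral) (auto simp: case_prod_unfold)
  then show "orbit_mean \<xi> \<alpha> \<in> borel_measurable lebesgue" by (intro measurable_completion) simp
  show "torus_periodic (orbit_mean \<xi> \<alpha>)"
    unfolding torus_periodic_def
  proof (intro allI impI)
    fix x y :: "real ^ 'd" assume xy: "torus_eq x y"
    have "\<alpha> (x - v) = \<alpha> (y - v)" for v using torus_periodicD[OF \<alpha>(2) torus_eq_add[OF xy, of "- v"]] by simp
    then show "orbit_mean \<xi> \<alpha> x = orbit_mean \<xi> \<alpha> y" by (simp add: orbit_mean_def)
  qed
  have K: "K \<ge> 0" using order_trans[OF norm_ge_zero \<alpha>(3)] .
  have "norm (LINT s|period_measure. \<alpha> (x - s *\<^sub>R \<xi>)) \<le> (LINT s|period_measure. norm (\<alpha> (x - s *\<^sub>R \<xi>)))" by (rule integral_norm_bound)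
  also have "\<dots> \<le> (LINT s|period_measure. K)"
    by (rule integral_mono_AE') (use \<alpha>(3) K P.integrable_const in auto)
  also have "\<dots> = 2 * pi * K" by (simp add: measure_restrict_space space_restrict_space)
  finally show "norm (orbit_mean \<xi> \<alpha> x) \<le> K" by (simp add: orbit_mean_def norm_divide field_simps)
qed

lemma integral_cis_period:
  assumes "j \<in> \<int>" shows "(LINT s|period_measure. cis (s * j)) = (if j = 0 then 2 * pi else 0)"
proof (cases "j = 0")
  case True
  then show ?thesis by (simp add: measure_restrict_space space_restrict_space scaleR_conv_of_real)
next
  case False
  have "(LINT s|period_measure. cis (s * j)) = (LINT t|lebesgue. indicator {0..2 * pi} t *\<^sub>R cis (j * t))"
    by (subst integral_restrict_space) (auto simp: mult.commute)
  also have "\<dots> = (cis (j * (2 * pi)) - cis (j * 0)) / (\<i> * of_real j)"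
    by (rule integral_cis_interval[OF False]) simp
  also have "cis (j * (2 * pi)) = 1" using cis_multiple_2pi[OF assms] by (simp add: mult_ac)
  finally show ?thesis using False by simp
qed

text \<open>By duality the mean passes to the exponential, which the flow multiplies by cis (s (m .
  \<xi>)). As m . \<xi> is an integer, its mean over a period is 1 or 0; thus averaging projects
  onto the frequencies orthogonal to \<xi>.\<close>

lemma orbit_mean_coeff:
  fixes \<alpha> :: "real ^ 'd::finite \<Rightarrow> complex"
  assumes \<alpha>: "\<alpha> \<in> borel_measurable borel" "torus_periodic \<alpha>" "\<And>x. norm (\<alpha> x) \<le> K" and \<xi>: "\<xi> \<in> int_vecs" and m: "m \<in> int_vecs"
  shows "(LINT x|torus_measure. orbit_mean \<xi> \<alpha> x * texp m x) = (if m \<bullet> \<xi> = 0 then (LINT x|torus_measure. \<alpha> x * texp m x) else 0)"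
proof -
  have t: "texp m \<in> borel_measurable borel" "torus_periodic (texp m)" "integrable torus_measure (texp m)"
    using m by (auto intro!: texp_periodic torus_integrable_bounded[of _ 1] torus_measurableI)
  have "(LINT x|torus_measure. orbit_mean \<xi> \<alpha> x * texp m x) = (LINT x|torus_measure. (LINT s|period_measure. \<alpha> (x - s *\<^sub>R \<xi>)) * texp m x) / (2 * pi)"
    by (simp add: orbit_mean_def)
  also have "(LINT x|torus_measure. (LINT s|period_measure. \<alpha> (x - s *\<^sub>R \<xi>)) * texp m x)
    = (LINT x|torus_measure. \<alpha> x * (LINT s|period_measure. texp m (x + s *\<^sub>R \<xi>)))"
    by (rule flow_average_adjoint(3)[OF t \<alpha>, symmetric])
  also have "\<dots> = (LINT x|torus_measure. (if m \<bullet> \<xi> = 0 then 2 * pi else 0) * (\<alpha> x * texp m x))"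
  proof (rule Bochner_Integration.integral_cong[OF refl])
    fix x
    have "(LINT s|period_measure. texp m (x + s *\<^sub>R \<xi>)) = (LINT s|period_measure. texp m x * cis (s * (m \<bullet> \<xi>)))"
      unfolding texp_translate by (simp add: texp_def)
    also have "\<dots> = texp m x * (if m \<bullet> \<xi> = 0 then 2 * pi else 0)"
      using integral_cis_period[OF inner_int_vecs[OF m \<xi>]] by simp
    finally show "\<alpha> x * (LINT s|period_measure. texp m (x + s *\<^sub>R \<xi>)) = (if m \<bullet> \<xi> = 0 then 2 * pi else 0) * (\<alpha> x * texp m x)"
      by simp
  qed
  also have "\<dots> = (if m \<bullet> \<xi> = 0 then 2 * pi else 0) * (LINT x|torus_measure. \<alpha> x * texp m x)"
    by (rule integral_mult_right_zero)
  finally show ?thesis by simp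
qed

text \<open>Duality moves the average from the density to the symbol, after the density has been
  replaced by a Borel version; this matches the target measure with the form delivered by
  \<open>evolved_limit\<close>.\<close>

lemma integral_dx_dirac_flow_average:
  fixes w :: "real ^ 'd::finite \<Rightarrow> complex"
  assumes w: "w \<in> torus_L2" and \<xi>: "\<xi> \<in> int_vecs" and a: "a \<in> torus_symbols"
  shows "(LINT p|dx_dirac (flow_average \<xi> (\<lambda>x. (norm (w x))\<^sup>2)) \<xi>. a p)
    = (LINT x|torus_measure. orbit_mean \<xi> (\<lambda>x. a (x, \<xi>)) x * (w x * cnj (w x)))"
proof -
  let ?f = "\<lambda>x. (norm (w x))\<^sup>2" and ?\<alpha> = "\<lambda>x. a (x, \<xi>)"
  obtain K where K: "\<And>p. norm (a p) \<le> K" using symbol_bounded[OF a] by blast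
  have \<alpha>: "?\<alpha> \<in> borel_measurable borel" "torus_periodic ?\<alpha>" "\<And>x. norm (?\<alpha> x) \<le> K"
    using borel_measurable_continuous_onI[OF symbol_fiber_continuous[OF a]] symbol_periodic[OF a] K by auto
  have fm: "?f \<in> borel_measurable lebesgue" using torus_L2_measurable_lebesgue[OF w] by measurable
  have fp: "torus_periodic ?f" by (rule torus_periodic_comp[OF torus_L2_periodic[OF w]])
  obtain g where g: "g \<in> borel_measurable borel" "torus_periodic g" "\<And>x. g x \<ge> 0" "AE x in lborel. ?f x = g x"
    by (rule borel_representative[OF fm fp]) auto
  have ae: "AE x in torus_measure. ?f x = g x" by (rule AE_torus_measure[OF AE_completion[OF g(4)]])
  have gt: "g \<in> borel_measurable torus_measure" by (rule period_measurable[OF g(1)])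
  have gi: "integrable torus_measure g"
    using integrable_cong_AE[OF torus_measurableI[OF fm] gt ae] torus_L2_integrable[OF w] by blast
  let ?g = "\<lambda>x. complex_of_real (g x)"
  have gc: "?g \<in> borel_measurable borel" "torus_periodic ?g" "integrable torus_measure ?g"
    using g(1) gi by (auto intro!: torus_periodic_comp[OF g(2)])
  note adj = flow_average_adjoint[OF gc \<alpha>, of \<xi>]
  define F where "F x = (LINT s|period_measure. g (x + s *\<^sub>R \<xi>)) / (2 * pi)" for x
  have Fc: "complex_of_real (F x) = (LINT s|period_measure. ?g (x + s *\<^sub>R \<xi>)) / (2 * pi)" for x
    by (simp add: F_def)
  have FA: "AE x in torus_measure. flow_average \<xi> ?f x = F x"
    unfolding F_def by (rule flow_average_ae[OF \<xi> g(1-3) gi g(4)])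
  have Fi: "integrable torus_measure F"
  proof -
    have "integrable torus_measure (\<lambda>x. complex_of_real (F x))"
      unfolding Fc by (rule integrable_divide_zero) (rule adj(2))
    from integrable_Re[OF this] show ?thesis by simp
  qed
  have F0: "F x \<ge> 0" for x unfolding F_def using g(3) by (intro divide_nonneg_nonneg integral_nonneg_AE) auto
  \<comment> \<open>As a \<open>Lim\<close> the flow average has no evident measurability. It is
    inherited from the period mean \<open>F\<close>, with which it agrees almost everywhere on the
    cell, both being extended by 0.\<close>
  have ext: "(\<lambda>x. if x \<in> torus_cell then F x else 0) \<in> borel_measurable lebesgue"
    using borel_measurable_if[OF torus_cell_lebesgue, of F] borel_measurable_integrable[OF Fi] by blast
  have "(\<lambda>x. if x \<in> torus_cell then flow_average \<xi> ?f x else 0) \<in> borel_measurable lebesgue"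
  proof (rule borel_measurable_AE[OF ext])
    show "AE x in lebesgue. (if x \<in> torus_cell then F x else 0) = (if x \<in> torus_cell then flow_average \<xi> ?f x else 0)"
      using FA torus_cell_lebesgue by (subst (asm) AE_restrict_space_iff) (auto elim!: AE_mp)
  qed
  then have fam: "flow_average \<xi> ?f \<in> borel_measurable torus_measure"
    using borel_measurable_if[OF torus_cell_lebesgue, of "flow_average \<xi> ?f"] by blast
  have fai: "integrable torus_measure (flow_average \<xi> ?f)"
    using integrable_cong_AE[OF fam borel_measurable_integrable[OF Fi] FA] Fi by blast
  have fa0: "AE x in torus_measure. flow_average \<xi> ?f x \<ge> 0" using FA by eventually_elim (simp add: F0)
  have am: "?\<alpha> \<in> borel_measurable torus_measure" by (rule period_measurable[OF \<alpha>(1)])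
  note om = orbit_mean[OF \<alpha>, of \<xi>]
  have "(LINT p|dx_dirac (flow_average \<xi> ?f) \<xi>. a p) = (LINT x|torus_measure. ?\<alpha> x * of_real (flow_average \<xi> ?f x))"
    by (rule integral_dx_dirac[OF a fai fa0])
  also have "\<dots> = (LINT x|torus_measure. ?\<alpha> x * of_real (F x))"
  proof (rule integral_cong_AE)
    show "AE x in torus_measure. ?\<alpha> x * of_real (flow_average \<xi> ?f x) = ?\<alpha> x * of_real (F x)"
      using FA by eventually_elim simp
  qed (use am fam borel_measurable_integrable[OF Fi] in measurable)
  also have "\<dots> = (LINT x|torus_measure. ?\<alpha> x * (LINT s|period_measure. ?g (x + s *\<^sub>R \<xi>))) / (2 * pi)"
    unfolding Fc by (simp add: times_divide_eq_right)
  also have "\<dots> = (LINT x|torus_measure. (LINT s|period_measure. ?\<alpha> (x - s *\<^sub>R \<xi>)) * ?g x) / (2 * pi)"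
    unfolding adj(3) ..
  also have "\<dots> = (LINT x|torus_measure. orbit_mean \<xi> ?\<alpha> x * ?g x)" by (simp add: orbit_mean_def)
  also have "\<dots> = (LINT x|torus_measure. orbit_mean \<xi> ?\<alpha> x * (w x * cnj (w x)))"
  proof (rule integral_cong_AE)
    show "AE x in torus_measure. orbit_mean \<xi> ?\<alpha> x * ?g x = orbit_mean \<xi> ?\<alpha> x * (w x * cnj (w x))"
      using ae by eventually_elim (simp flip: complex_norm_square)
    show "(\<lambda>x. orbit_mean \<xi> ?\<alpha> x * ?g x) \<in> borel_measurable torus_measure"
      using torus_measurableI[OF om(1)] gt by measurable
    show "(\<lambda>x. orbit_mean \<xi> ?\<alpha> x * (w x * cnj (w x))) \<in> borel_measurable torus_measure"
      by (intro borel_measurable_times torus_measurableI[OF om(1)] torus_L2_measurable[OF w] borel_measurable_integrable[OF torus_L2_mult_integrable(2)[OF w w]])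
  qed
  finally show ?thesis .
qed

subsection \<open>The two families\<close>

lemma real_Suc_at_top: "filterlim (\<lambda>n. real (Suc n)) at_top sequentially"
  by (rule filterlim_compose[OF filterlim_real_sequentially filterlim_Suc])

lemma real_Suc_power_at_top:
  assumes "J \<ge> 1" shows "filterlim (\<lambda>n. real (Suc n) ^ J) at_top sequentially"
  by (rule filterlim_at_top_mono[OF real_Suc_at_top]) (use assms in \<open>auto intro!: always_eventually self_le_power\<close>)

text \<open>Dividing by the highest power N^J present leaves a sum that tends to the coefficient c
  J, which is nonzero.\<close>

lemma power_sum_diverges:
  fixes c :: "nat \<Rightarrow> real"
  assumes J: "J \<ge> 1" "J \<le> m" "c J \<noteq> 0" and top: "\<And>j. J < j \<Longrightarrow> j \<le> m \<Longrightarrow> c j = 0"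
  shows "filterlim (\<lambda>n. \<bar>\<Sum>j\<le>m. c j * real (Suc n) ^ j\<bar>) at_top sequentially"
proof -
  let ?N = "\<lambda>n. real (Suc n)"
  let ?q = "\<lambda>n. \<Sum>j\<le>J. c j * inverse (?N n) ^ (J - j)"
  have e: "(\<Sum>j\<le>m. c j * ?N n ^ j) = ?q n * ?N n ^ J" for n
  proof -
    have "(\<Sum>j\<le>m. c j * ?N n ^ j) = (\<Sum>j\<le>J. c j * ?N n ^ j)"
      by (rule sum.mono_neutral_right) (use J(2) top in auto)
    also have "\<dots> = ?q n * ?N n ^ J"
      unfolding sum_distrib_right
    proof (rule sum.cong[OF refl])
      fix j assume "j \<in> {..J}"
      then have "?N n ^ J = ?N n ^ j * ?N n ^ (J - j)" by (simp flip: power_add)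
      moreover have "inverse (?N n) ^ (J - j) * ?N n ^ (J - j) = 1"
        by (simp only: power_mult_distrib[symmetric]) simp
      ultimately show "c j * ?N n ^ j = c j * inverse (?N n) ^ (J - j) * ?N n ^ J" by (simp only: mult_ac)
    qed
    finally show ?thesis .
  qed
  have "?q \<longlonglongrightarrow> (\<Sum>j\<le>J. c j * 0 ^ (J - j))"
    by (intro tendsto_sum tendsto_mult tendsto_const tendsto_power LIMSEQ_inverse_real_of_nat)
  also have "(\<Sum>j\<le>J. c j * 0 ^ (J - j)) = (\<Sum>j\<le>J. if j = J then c j else 0)"
    by (rule sum.cong) auto
  also have "\<dots> = c J" by simp
  finally have "(\<lambda>n. \<bar>?q n\<bar>) \<longlonglongrightarrow> \<bar>c J\<bar>" by (rule tendsto_rabs)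
  from filterlim_tendsto_pos_mult_at_top[OF this _ real_Suc_power_at_top[OF J(1)]]
  have "filterlim (\<lambda>n. \<bar>?q n\<bar> * ?N n ^ J) at_top sequentially" using J(3) by simp
  then show ?thesis unfolding e abs_mult by simp
qed

text \<open>With coordinates \<open>N, N^2, \<dots>, N^d\<close> for \<open>z\<close>, where \<open>N = n + 1\<close>, the inner product with \<open>k\<close> is a
  polynomial in \<open>N\<close> without constant term that vanishes identically only for \<open>k = 0\<close>.\<close>

lemma nonresonant_frequencies:
  fixes \<xi> :: "real ^ 'd::finite"
  shows "\<exists>z :: nat \<Rightarrow> real ^ 'd. (\<forall>n. z n \<in> int_vecs) \<and>
    (\<lambda>n. (1 / real (Suc n) ^ Suc CARD('d)) *\<^sub>R z n) \<longlonglongrightarrow> 0 \<and>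
    (\<forall>k. k \<noteq> 0 \<longrightarrow> filterlim (\<lambda>n. \<bar>k \<bullet> (real (Suc n) ^ Suc CARD('d) *\<^sub>R \<xi> + z n)\<bar>) at_top sequentially)"
proof -
  let ?d = "CARD('d)"
  obtain e0 :: "'d \<Rightarrow> nat" where e0: "bij_betw e0 UNIV {0..<?d}" using ex_bij_betw_finite_nat[of "UNIV :: 'd set"] by auto
  \<comment> \<open>Exponents run from 1 to d rather than from 0, so that no coordinate of the
    perturbation stays bounded.\<close>
  define e where "e i = Suc (e0 i)" for i
  have e: "bij_betw e UNIV {1..?d}"
  proof -
    have "bij_betw Suc {0..<?d} {1..?d}" by (rule bij_betwI[of _ _ _ "\<lambda>j. j - 1"]) auto
    from bij_betw_trans[OF e0 this] show ?thesis by (simp add: e_def[abs_def] o_def)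
  qed
  have e_le: "e i \<le> ?d" "1 \<le> e i" for i using bij_betwE[OF e] by auto
  define z where "z n = (\<chi> i. real (Suc n) ^ e i)" for n
  show ?thesis
  proof (intro exI[of _ z] conjI allI impI)
    show "z n \<in> int_vecs" for n by (simp add: z_def int_vecs_def)
    show "(\<lambda>n. (1 / real (Suc n) ^ Suc ?d) *\<^sub>R z n) \<longlonglongrightarrow> 0"
    proof (rule vec_tendstoI)
      fix i
      have "(\<lambda>n. inverse (real (Suc n)) ^ (Suc ?d - e i)) \<longlonglongrightarrow> 0 ^ (Suc ?d - e i)"
        by (rule tendsto_power[OF LIMSEQ_inverse_real_of_nat])
      moreover have "inverse (real (Suc n)) ^ (Suc ?d - e i) = ((1 / real (Suc n) ^ Suc ?d) *\<^sub>R z n) $ i" for n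
      proof -
        have "real (Suc n) ^ Suc ?d = real (Suc n) ^ (Suc ?d - e i) * real (Suc n) ^ e i"
          using e_le(1)[of i] by (simp only: power_add[symmetric]) simp
        then show ?thesis by (simp only: z_def vector_scaleR_component vec_lambda_beta power_inverse[symmetric] real_scaleR_def)
          (simp add: field_simps del: power_Suc of_nat_Suc)
      qed
      moreover have "(0 :: real) ^ (Suc ?d - e i) = 0 $ i" using e_le(1)[of i] by (simp add: Suc_diff_le)
      ultimately show "(\<lambda>n. ((1 / real (Suc n) ^ Suc ?d) *\<^sub>R z n) $ i) \<longlonglongrightarrow> 0 $ i" by (simp only:)
    qed
    fix k :: "real ^ 'd" assume k: "k \<noteq> 0"
    \<comment> \<open>The coefficients of k . \<eta> as a polynomial in N: the main term has degree
      d + 1, and each entry of k sits at its own degree between 1 and d, so no cancellation is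
      possible.\<close>
    define c where "c j = (if j = Suc ?d then k \<bullet> \<xi> else if j \<in> {1..?d} then k $ inv_into UNIV e j else 0)" for j
    have ce: "c (e i) = k $ i" for i
      using e_le[of i] bij_betw_inv_into_left[OF e, of i] by (simp add: c_def)
    have eq: "k \<bullet> (real (Suc n) ^ Suc ?d *\<^sub>R \<xi> + z n) = (\<Sum>j\<le>Suc ?d. c j * real (Suc n) ^ j)" for n
    proof -
      have "(\<Sum>j\<le>Suc ?d. c j * real (Suc n) ^ j) = (\<Sum>j\<le>?d. c j * real (Suc n) ^ j) + (k \<bullet> \<xi>) * real (Suc n) ^ Suc ?d"
        by (simp add: c_def)
      also have "(\<Sum>j\<le>?d. c j * real (Suc n) ^ j) = (\<Sum>j\<in>{1..?d}. c j * real (Suc n) ^ j)"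
        by (rule sum.mono_neutral_right) (auto simp: c_def)
      also have "\<dots> = (\<Sum>i\<in>UNIV. c (e i) * real (Suc n) ^ e i)"
        by (rule sum.reindex_bij_betw[OF e, symmetric])
      also have "\<dots> = k \<bullet> z n" by (simp only: ce) (simp add: z_def inner_vec_def)
      finally show ?thesis by (simp add: inner_add_right mult.commute)
    qed
    let ?S = "{j. j \<le> Suc ?d \<and> c j \<noteq> 0}"
    obtain i where i: "k $ i \<noteq> 0" using k by (auto simp: vec_eq_iff)
    have fin: "finite ?S" by simp
    have ne: "?S \<noteq> {}" using ce[of i] i e_le(1)[of i] by (auto intro!: exI[of _ "e i"])
    \<comment> \<open>The degree of the polynomial. It is at least 1 because some entry of k is
      nonzero and c 0 = 0.\<close>
    define J where "J = Max ?S"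
    have JS: "J \<in> ?S" unfolding J_def by (rule Max_in[OF fin ne])
    have "J \<ge> 1" using JS by (cases J) (auto simp: c_def)
    moreover have "c j = 0" if "J < j" "j \<le> Suc ?d" for j
    proof (rule ccontr)
      assume "c j \<noteq> 0"
      then have "j \<in> ?S" using that by simp
      then have "j \<le> J" unfolding J_def by (rule Max_ge[OF fin])
      then show False using that by simp
    qed
    ultimately show "filterlim (\<lambda>n. \<bar>k \<bullet> (real (Suc n) ^ Suc ?d *\<^sub>R \<xi> + z n)\<bar>) at_top sequentially"
      unfolding eq using JS by (intro power_sum_diverges[of J]) auto
  qed
qed

locale modulated_sequence = rho \<rho> for \<rho> :: "real ^ 'd::finite \<Rightarrow> complex" +
  fixes h :: "nat \<Rightarrow> real" and \<eta> :: "nat \<Rightarrow> real ^ 'd" and \<xi> :: "real ^ 'd"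
  assumes h: "\<And>n. h n > 0" "h \<longlonglongrightarrow> 0"
    and eta: "\<And>n. \<eta> n \<in> int_vecs" "(\<lambda>n. h n *\<^sub>R \<eta> n) \<longlonglongrightarrow> \<xi>"
begin

lemma form_sequence:
  assumes a: "a \<in> torus_symbols" and Op: "torus_quantization a Op"
  obtains D where "form_sequence \<rho> D (\<lambda>n u v. torus_inner (Op (h n) u) v) \<eta> (\<lambda>k l. LINT x|torus_measure. a (x, \<xi>) * texp (k - l) x)"
proof (rule quantization_forms[OF a Op])
  fix D
  assume form: "\<And>h. h > 0 \<Longrightarrow> torus_form D (\<lambda>u v. torus_inner (Op h u) v)"
    and lim: "\<And>h \<eta> \<xi> k m. \<lbrakk>\<And>n. h n > 0; h \<longlonglongrightarrow> 0; \<And>n. \<eta> n \<in> int_vecs; (\<lambda>n. h n *\<^sub>R \<eta> n) \<longlonglongrightarrow> \<xi>; k \<in> int_vecs; m \<in> int_vecs\<rbrakk>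
      \<Longrightarrow> (\<lambda>n. torus_inner (Op (h n) (texp (\<eta> n + k))) (texp (\<eta> n + m))) \<longlonglongrightarrow> (LINT x|torus_measure. a (x, \<xi>) * texp (k - m) x)"
  show thesis
    by (rule that[of D], unfold_locales) (fact form[OF h(1)] eta(1) lim[OF h eta])+
qed

lemma semiclassical_measure_modulate:
  "semiclassical_measure h (\<lambda>n. modulate (\<eta> n) \<rho>) (dx_dirac (\<lambda>x. (norm (\<rho> x))\<^sup>2) \<xi>)"
  unfolding semiclassical_measure_def
proof (intro ballI allI impI)
  fix a :: "(real ^ 'd) \<times> (real ^ 'd) \<Rightarrow> complex" and Op
  assume a: "a \<in> torus_symbols" and Op: "torus_quantization a Op"
  obtain D where D: "form_sequence \<rho> D (\<lambda>n u v. torus_inner (Op (h n) u) v) \<eta> (\<lambda>k l. LINT x|torus_measure. a (x, \<xi>) * texp (k - l) x)"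
    by (rule form_sequence[OF a Op])
  obtain K where K: "\<And>p. norm (a p) \<le> K" using symbol_bounded[OF a] by blast
  have "(\<lambda>n. torus_inner (Op (h n) (modulate (\<eta> n) \<rho>)) (modulate (\<eta> n) \<rho>)) \<longlonglongrightarrow> (LINT x|torus_measure. a (x, \<xi>) * (\<rho> x * cnj (\<rho> x)))"
    by (rule form_sequence.static_limit[OF D symbol_fiber_measurable[OF a] symbol_periodic[OF a] K refl])
  also have "(LINT x|torus_measure. a (x, \<xi>) * (\<rho> x * cnj (\<rho> x))) = (LINT p|dx_dirac (\<lambda>x. (norm (\<rho> x))\<^sup>2) \<xi>. a p)"
    unfolding complex_norm_square[symmetric] by (rule integral_dx_dirac[OF a torus_L2_integrable[OF rho], symmetric]) simp
  finally show "(\<lambda>n. torus_inner (Op (h n) (modulate (\<eta> n) \<rho>)) (modulate (\<eta> n) \<rho>)) \<longlonglongrightarrow> (LINT p|dx_dirac (\<lambda>x. (norm (\<rho> x))\<^sup>2) \<xi>. a p)" .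
qed

text \<open>\<open>b a\<close> stands for the averaged symbol, the orbit mean for one family and the
  torus mean for the other. Apart from the resonance relation, the evaluation of the target measure
  by \<open>\<mu>\<close> is all that differs.\<close>

lemma evolved_measure_modulate:
  assumes b: "\<And>a. a \<in> torus_symbols \<Longrightarrow> b a \<in> borel_measurable lebesgue" "\<And>a. a \<in> torus_symbols \<Longrightarrow> torus_periodic (b a)"
      "\<And>a. a \<in> torus_symbols \<Longrightarrow> \<exists>K. \<forall>x. norm (b a x) \<le> K"
    and bA: "\<And>a k l. \<lbrakk>a \<in> torus_symbols; k \<in> int_vecs; l \<in> int_vecs\<rbrakk> \<Longrightarrow>
      (LINT x|torus_measure. b a x * texp (k - l) x) = (if Rel k l then (LINT x|torus_measure. a (x, \<xi>) * texp (k - l) x) else 0)"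
    and res: "\<And>k l n. k \<in> int_vecs \<Longrightarrow> l \<in> int_vecs \<Longrightarrow> Rel k l \<Longrightarrow> (k - l) \<bullet> \<eta> n = 0"
    and nonres: "\<And>k l. k \<in> int_vecs \<Longrightarrow> l \<in> int_vecs \<Longrightarrow> \<not> Rel k l \<Longrightarrow> filterlim (\<lambda>n. \<bar>(k - l) \<bullet> \<eta> n\<bar>) at_top sequentially"
    and \<mu>: "\<And>a t. a \<in> torus_symbols \<Longrightarrow>
      (LINT p|\<mu> t. a p) = (LINT x|torus_measure. b a x * (propagator t \<rho> x * cnj (propagator t \<rho> x)))"
  shows "evolved_semiclassical_measure h (\<lambda>n. modulate (\<eta> n) \<rho>) \<mu>"
  unfolding evolved_semiclassical_measure_def
proof (intro ballI allI impI)
  fix \<phi> :: "real \<Rightarrow> complex" and a :: "(real ^ 'd) \<times> (real ^ 'd) \<Rightarrow> complex" and Op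
  assume \<phi>: "integrable lebesgue \<phi>" and a: "a \<in> torus_symbols" and Op: "torus_quantization a Op"
  obtain D where D: "form_sequence \<rho> D (\<lambda>n u v. torus_inner (Op (h n) u) v) \<eta> (\<lambda>k l. LINT x|torus_measure. a (x, \<xi>) * texp (k - l) x)"
    by (rule form_sequence[OF a Op])
  obtain K where K: "\<And>x. norm (b a x) \<le> K" using b(3)[OF a] by blast
  show "(\<lambda>n. LINT t|lebesgue. \<phi> t * torus_inner (Op (h n) (propagator t (modulate (\<eta> n) \<rho>))) (propagator t (modulate (\<eta> n) \<rho>)))
    \<longlonglongrightarrow> (LINT t|lebesgue. \<phi> t * (LINT p|\<mu> t. a p))"
    unfolding \<mu>[OF a]
    by (rule form_sequence.evolved_limit[OF D b(1)[OF a] b(2)[OF a] K bA[OF a] res nonres \<phi>])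
qed

end

theorem proposition11:
  fixes \<xi>\<^sub>0 :: "real ^ 'd::finite" and \<rho> :: "real ^ 'd \<Rightarrow> complex"
  assumes "\<xi>\<^sub>0 \<in> int_vecs" and "\<rho> \<in> torus_L2"
  shows "\<exists>h u v. (\<forall>n. h n > 0) \<and> h \<longlonglongrightarrow> 0 \<and>
    (\<forall>n. u n \<in> torus_L2 \<and> v n \<in> torus_L2) \<and>
    semiclassical_measure h u (dx_dirac (\<lambda>x. (norm (\<rho> x))\<^sup>2) \<xi>\<^sub>0) \<and>
    semiclassical_measure h v (dx_dirac (\<lambda>x. (norm (\<rho> x))\<^sup>2) \<xi>\<^sub>0) \<and>
    evolved_semiclassical_measure h u
      (\<lambda>t. dx_dirac (flow_average \<xi>\<^sub>0 (\<lambda>x. (norm (propagator t \<rho> x))\<^sup>2)) \<xi>\<^sub>0) \<and>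
    evolved_semiclassical_measure h v
      (\<lambda>t. dx_dirac (\<lambda>x. (LINT y|torus_measure. (norm (\<rho> y))\<^sup>2) / (2 * pi) ^ CARD('d)) \<xi>\<^sub>0)"
proof -
  note \<xi> = assms(1) and \<rho> = assms(2)
  \<comment> \<open>1/h is an integer, so \<open>M n *\<^sub>R \<xi>\<^sub>0\<close> is an integer
    vector and modulation by it is periodic; the exponent d + 1 beats the exponents 1, ..., d of the
    perturbation.\<close>
  define M where "M n = real (Suc n) ^ Suc CARD('d)" for n
  define h where "h n = 1 / M n" for n
  have M: "M n > 0" "M n \<in> \<int>" for n by (simp_all add: M_def)
  have Mtop: "filterlim M at_top sequentially" unfolding M_def by (rule real_Suc_power_at_top) simp
  have h: "h n > 0" "h n * M n = 1" for n using M(1)[of n] by (simp_all add: h_def)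
  have h0: "h \<longlonglongrightarrow> 0" unfolding h_def by (rule tendsto_divide_0[OF tendsto_const filterlim_at_top_imp_at_infinity[OF Mtop]])
  obtain z :: "nat \<Rightarrow> real ^ 'd" where z: "\<And>n. z n \<in> int_vecs" "(\<lambda>n. h n *\<^sub>R z n) \<longlonglongrightarrow> 0"
    "\<And>k. k \<noteq> 0 \<Longrightarrow> filterlim (\<lambda>n. \<bar>k \<bullet> (M n *\<^sub>R \<xi>\<^sub>0 + z n)\<bar>) at_top sequentially"
    using nonresonant_frequencies[of \<xi>\<^sub>0] unfolding h_def M_def by blast
  interpret u: modulated_sequence \<rho> h "\<lambda>n. M n *\<^sub>R \<xi>\<^sub>0" \<xi>\<^sub>0
    by unfold_locales (use \<rho> \<xi> h h0 M in auto)
  interpret v: modulated_sequence \<rho> h "\<lambda>n. M n *\<^sub>R \<xi>\<^sub>0 + z n" \<xi>\<^sub>0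
  proof unfold_locales
    have "(\<lambda>n. \<xi>\<^sub>0 + h n *\<^sub>R z n) \<longlonglongrightarrow> \<xi>\<^sub>0 + 0" by (intro tendsto_add tendsto_const z(2))
    then show "(\<lambda>n. h n *\<^sub>R (M n *\<^sub>R \<xi>\<^sub>0 + z n)) \<longlonglongrightarrow> \<xi>\<^sub>0" by (simp add: scaleR_add_right h(2))
  qed (use h h0 \<xi> M z(1) in auto)
  have bounded: "\<exists>K. \<forall>x. norm (a (x, \<xi>\<^sub>0)) \<le> K" if "a \<in> torus_symbols" for a :: "(real ^ 'd) \<times> (real ^ 'd) \<Rightarrow> complex"
    using symbol_bounded[OF that] by blast
  have borel: "(\<lambda>x. a (x, \<xi>\<^sub>0)) \<in> borel_measurable borel" if "a \<in> torus_symbols" for a :: "(real ^ 'd) \<times> (real ^ 'd) \<Rightarrow> complex"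
    by (rule borel_measurable_continuous_onI[OF symbol_fiber_continuous[OF that]])
  have evolved_u: "evolved_semiclassical_measure h (\<lambda>n. modulate (M n *\<^sub>R \<xi>\<^sub>0) \<rho>)
      (\<lambda>t. dx_dirac (flow_average \<xi>\<^sub>0 (\<lambda>x. (norm (propagator t \<rho> x))\<^sup>2)) \<xi>\<^sub>0)"
  proof (rule u.evolved_measure_modulate[where b = "\<lambda>a. orbit_mean \<xi>\<^sub>0 (\<lambda>x. a (x, \<xi>\<^sub>0))" and Rel = "\<lambda>k l. (k - l) \<bullet> \<xi>\<^sub>0 = 0"])
    fix a :: "(real ^ 'd) \<times> (real ^ 'd) \<Rightarrow> complex" assume a: "a \<in> torus_symbols"
    obtain K where K: "\<And>x. norm (a (x, \<xi>\<^sub>0)) \<le> K" using bounded[OF a] by blast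
    note om = orbit_mean[OF borel[OF a] symbol_periodic[OF a] K, of \<xi>\<^sub>0]
    show "orbit_mean \<xi>\<^sub>0 (\<lambda>x. a (x, \<xi>\<^sub>0)) \<in> borel_measurable lebesgue" "torus_periodic (orbit_mean \<xi>\<^sub>0 (\<lambda>x. a (x, \<xi>\<^sub>0)))"
      "\<exists>K. \<forall>x. norm (orbit_mean \<xi>\<^sub>0 (\<lambda>x. a (x, \<xi>\<^sub>0)) x) \<le> K"
      using om by blast+
    show "(LINT x|torus_measure. orbit_mean \<xi>\<^sub>0 (\<lambda>x. a (x, \<xi>\<^sub>0)) x * texp (k - l) x)
      = (if (k - l) \<bullet> \<xi>\<^sub>0 = 0 then (LINT x|torus_measure. a (x, \<xi>\<^sub>0) * texp (k - l) x) else 0)"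
      if "k \<in> int_vecs" "l \<in> int_vecs" for k l
      by (rule orbit_mean_coeff[OF borel[OF a] symbol_periodic[OF a] K \<xi>]) (use that in simp)
    show "(LINT p|dx_dirac (flow_average \<xi>\<^sub>0 (\<lambda>x. (norm (propagator t \<rho> x))\<^sup>2)) \<xi>\<^sub>0. a p)
      = (LINT x|torus_measure. orbit_mean \<xi>\<^sub>0 (\<lambda>x. a (x, \<xi>\<^sub>0)) x * (propagator t \<rho> x * cnj (propagator t \<rho> x)))" for t
      by (rule integral_dx_dirac_flow_average[OF propagator(1)[OF \<rho>] \<xi> a])
  next
    fix k l :: "real ^ 'd" assume "(k - l) \<bullet> \<xi>\<^sub>0 \<noteq> 0"
    then have "filterlim (\<lambda>n. \<bar>(k - l) \<bullet> \<xi>\<^sub>0\<bar> * M n) at_top sequentially"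
      by (intro filterlim_tendsto_pos_mult_at_top[OF tendsto_const _ Mtop]) simp
    then show "filterlim (\<lambda>n. \<bar>(k - l) \<bullet> M n *\<^sub>R \<xi>\<^sub>0\<bar>) at_top sequentially"
      using M(1) by (simp add: abs_mult mult.commute less_imp_le)
  qed simp
  have evolved_v: "evolved_semiclassical_measure h (\<lambda>n. modulate (M n *\<^sub>R \<xi>\<^sub>0 + z n) \<rho>)
      (\<lambda>t. dx_dirac (\<lambda>x. (LINT y|torus_measure. (norm (\<rho> y))\<^sup>2) / (2 * pi) ^ CARD('d)) \<xi>\<^sub>0)"
  \<comment> \<open>Only the diagonal is resonant, so \<open>b\<close> is the constant mean of the
    symbol over the torus: a constant has no Fourier coefficient besides the one at 0.\<close>
  proof (rule v.evolved_measure_modulate[where b = "\<lambda>a x. (LINT y|torus_measure. a (y, \<xi>\<^sub>0)) / of_real ((2 * pi) ^ CARD('d))" and Rel = "(=)"])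
    fix a :: "(real ^ 'd) \<times> (real ^ 'd) \<Rightarrow> complex" assume a: "a \<in> torus_symbols"
    let ?P = "(2 * pi) ^ CARD('d)" and ?A = "LINT y|torus_measure. a (y, \<xi>\<^sub>0)"
    show "(LINT x|torus_measure. ?A / of_real ?P * texp (k - l) x) = (if k = l then (LINT x|torus_measure. a (x, \<xi>\<^sub>0) * texp (k - l) x) else 0)"
      if kl: "k \<in> int_vecs" "l \<in> int_vecs" for k l
    proof (cases "k = l")
      case True
      then show ?thesis by (simp add: measure_torus space_restrict_space scaleR_conv_of_real)
    next
      case False
      have "(LINT x|torus_measure. ?A / of_real ?P * texp (k - l) x) = ?A / of_real ?P * (LINT x|torus_measure. texp (k - l) x)"
        by (rule integral_mult_right_zero)
      then show ?thesis using torus_integral_texp[of "k - l"] kl False by simp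
    qed
    fix t
    let ?r = "(LINT y|torus_measure. (norm (\<rho> y))\<^sup>2)"
    have r: "?r \<ge> 0" by (intro integral_nonneg_AE) auto
    \<comment> \<open>Conservation of the norm, seen as modulation by the zero frequency, makes the
      limit measure independent of time.\<close>
    have "(tnorm (propagator t \<rho>))\<^sup>2 = ?r"
      using propagator_modulate(1)[OF \<rho>, of 0 t] by (simp add: tnorm_power2[symmetric])
    then have "torus_inner (propagator t \<rho>) (propagator t \<rho>) = of_real ?r" by (simp only: tnorm_inner)
    then have "(LINT x|torus_measure. ?A / of_real ?P * (propagator t \<rho> x * cnj (propagator t \<rho> x))) = ?A / of_real ?P * of_real ?r"
      unfolding torus_inner_def by (simp only: integral_mult_right_zero)
    moreover have "(LINT p|dx_dirac (\<lambda>x. ?r / ?P) \<xi>\<^sub>0. a p) = (LINT x|torus_measure. a (x, \<xi>\<^sub>0) * of_real (?r / ?P))"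
      by (rule integral_dx_dirac[OF a]) (use r in auto)
    ultimately show "(LINT p|dx_dirac (\<lambda>x. ?r / ?P) \<xi>\<^sub>0. a p)
      = (LINT x|torus_measure. ?A / of_real ?P * (propagator t \<rho> x * cnj (propagator t \<rho> x)))"
      by (simp only: integral_mult_left_zero) simp
  next
    fix k l :: "real ^ 'd" assume "k \<noteq> l"
    then show "filterlim (\<lambda>n. \<bar>(k - l) \<bullet> (M n *\<^sub>R \<xi>\<^sub>0 + z n)\<bar>) at_top sequentially" by (intro z(3)) simp
  qed (auto simp: torus_periodic_def)
  have L2: "modulate (M n *\<^sub>R \<xi>\<^sub>0) \<rho> \<in> torus_L2" "modulate (M n *\<^sub>R \<xi>\<^sub>0 + z n) \<rho> \<in> torus_L2" for n
    using \<rho> \<xi> M(2)[of n] z(1)[of n] by (auto intro!: modulate_L2)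
  show ?thesis
    by (rule exI[of _ h], rule exI[of _ "\<lambda>n. modulate (M n *\<^sub>R \<xi>\<^sub>0) \<rho>"], rule exI[of _ "\<lambda>n. modulate (M n *\<^sub>R \<xi>\<^sub>0 + z n) \<rho>"])
      (intro conjI allI h(1) h0 L2 u.semiclassical_measure_modulate v.semiclassical_measure_modulate evolved_u evolved_v)
qed

end
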